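(* Let $-A$ generate a $\gamma$-bounded $C_0$-semigroup on a Banach space $X$. Then $A$ has a strong $m$-bounded $\mathrm{H}^\infty$-calculus of type $0$ for all $m\in\mathbb{N}$.
   Context: $\mathbb{N}=\{1,2,\dots\}$; $\mathcal{L}(X)$: bounded operators on $X$. For $\omega\in\mathbb{R}$, $\mathrm{R}_\omega:=\{z\in\mathbb{C}:\operatorname{Re}z>\omega\}$; $\mathrm{H}^\infty(\mathrm{R}_\omega)$ is the Banach algebra of bounded holomorphic functions on $\mathrm{R}_\omega$ with supremum norm. A collection $\mathcal{T}\subseteq\mathcal{L}(X)$ is $\gamma$-bounded if there is $C\ge0$ such that $\left(\mathbb{E}\|\sum_{S\in\mathcal{T}'}\gamma_SSx_S\|^2\right)^{1/2}\le C\left(\mathbb{E}\|\sum_{S\in\mathcal{T}'}\gamma_Sx_S\|^2\right)^{1/2}$ for all finite $\mathcal{T}'\subseteq\mathcal{T}$, all $(x_S)_{S\in\mathcal{T}'}\subseteq X$ and independent complex-valued standard Gaussian random variables $(\gamma_S)_{S\in\mathcal{T}'}$. A semigroup $(T(t))_{t\ge0}$ is $\gamma$-bounded if $\{T(t):t\ge0\}$ is. Generator convention: $-A$ generates $T$ if $(\mu+A)^{-1}x=\int_0^\infty e^{-\mu t}T(t)x\,dt$ for $\operatorname{Re}\mu$ large. Functional calculus (Hille–Phillips): for a complex Borel measure $\mu$ on $[0,\infty)$ let $\widehat\mu(z)=\int_0^\infty e^{-zs}\mu(ds)$ and $\widehat\mu(A)x:=\int_0^\infty T(t)x\,\mu(dt)$.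 For other functions $f$, $f(A):=e(A)^{-1}(ef)(A)$ whenever there is a Laplace transform $e$ of a complex Borel measure on $[0,\infty)$ with $e(A)$ injective and $ef$ (on $\mathrm{R}_0$) again such a Laplace transform; this is a closed operator independent of $e$. Every bounded holomorphic $f$ on a half-plane $\mathrm{R}_{\omega}$, $\omega<0$, is covered, using $e(z)=(z-\mu)^{-1}$ with $\operatorname{Re}\mu<\omega$. $A$ has a strong $m$-bounded $\mathrm{H}^\infty$-calculus of type $0$ if there is a constant $C\ge0$ such that for every $\omega<0$ and $f\in\mathrm{H}^\infty(\mathrm{R}_\omega)$ one has $f^{(m)}(A)\in\mathcal{L}(X)$ with $\|f^{(m)}(A)\|\le\frac{C}{|\omega|^m}\|f\|_{\mathrm{H}^\infty(\mathrm{R}_\omega)}$ ($f^{(m)}$ being the $m$-th derivative, bounded on $\mathrm{R}_{\omega'}$ for each $\omega'>\omega$). *)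

theory Defs
  imports "HOL-Probability.Probability"
begin

text \<open>The libraries provide real Banach spaces only. A complex Banach space is a real one with a
  compatible complex scalar multiplication for which the norm is homogeneous.\<close>

class scaleC =
  fixes scaleC :: "complex \<Rightarrow> 'a \<Rightarrow> 'a"  (infixr \<open>*\<^sub>C\<close> 75)

class cbanach = banach + scaleC +
  assumes scaleR_scaleC: "scaleR r x = scaleC (complex_of_real r) x"
    and scaleC_add_right: "scaleC a (x + y) = scaleC a x + scaleC a y"
    and scaleC_add_left: "scaleC (a + b) x = scaleC a x + scaleC b x"
    and scaleC_scaleC: "scaleC a (scaleC b x) = scaleC (a * b) x"
    and norm_scaleC: "norm (scaleC a x) = cmod a * norm x"

instantiation complex :: cbanach
begin

definition scaleC_complex :: "complex \<Rightarrow> complex \<Rightarrow> complex"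
  where "scaleC_complex a z = a * z"

instance
  by standard (simp_all add: scaleC_complex_def scaleR_conv_of_real algebra_simps norm_mult)

end

definition bounded_clinear :: "('a::cbanach \<Rightarrow> 'a) \<Rightarrow> bool" where
  "bounded_clinear S \<longleftrightarrow> bounded_linear S \<and> (\<forall>c x. S (c *\<^sub>C x) = c *\<^sub>C S x)"

text \<open>A possibly unbounded operator is identified with its graph.\<close>

definition clinear_operator :: "('a::cbanach \<times> 'a) set \<Rightarrow> bool" where
  "clinear_operator A \<longleftrightarrow> single_valued A \<and> (0, 0) \<in> A
     \<and> (\<forall>x y x' y'. (x, y) \<in> A \<longrightarrow> (x', y') \<in> A \<longrightarrow> (x + x', y + y') \<in> A)
     \<and> (\<forall>c x y. (x, y) \<in> A \<longrightarrow> (c *\<^sub>C x, c *\<^sub>C y) \<in> A)"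

definition graph_of :: "('a \<Rightarrow> 'b) \<Rightarrow> ('a \<times> 'b) set" where
  "graph_of S = {(x, S x) | x. True}"

text \<open>The Bochner integral. The definition is the one of \<open>has_bochner_integral\<close>, without the
  restriction to second countable spaces made there.\<close>

definition has_bochner :: "'m measure \<Rightarrow> ('m \<Rightarrow> 'a::real_normed_vector) \<Rightarrow> 'a \<Rightarrow> bool" where
  "has_bochner M F y \<longleftrightarrow> F \<in> borel_measurable M \<and>
     (\<exists>s. (\<forall>i. Bochner_Integration.simple_bochner_integrable M (s i))
        \<and> (\<lambda>i. \<integral>\<^sup>+ t. ennreal (norm (F t - s i t)) \<partial>M) \<longlonglongrightarrow> 0
        \<and> (\<lambda>i::nat. Bochner_Integration.simple_bochner_integral M (s i)) \<longlonglongrightarrow> y)"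

subsection \<open>Semigroups and generators\<close>

text \<open>Only the values of \<open>T\<close> on \<open>[0,\<infinity>)\<close> matter.\<close>

definition C0_semigroup :: "(real \<Rightarrow> 'a::cbanach \<Rightarrow> 'a) \<Rightarrow> bool" where
  "C0_semigroup T \<longleftrightarrow> (\<forall>t\<ge>0. bounded_clinear (T t)) \<and> (\<forall>x. T 0 x = x)
     \<and> (\<forall>s\<ge>0. \<forall>t\<ge>0. \<forall>x. T (s + t) x = T s (T t x))
     \<and> (\<forall>x. ((\<lambda>t. T t x) \<longlongrightarrow> x) (at_right 0))"

definition shifted :: "complex \<Rightarrow> ('a::cbanach \<times> 'a) set \<Rightarrow> ('a \<times> 'a) set" where
  "shifted \<mu> A = {(x, \<mu> *\<^sub>C x + y) | x y. (x, y) \<in> A}"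

text \<open>\<open>-A\<close> generates \<open>T\<close>: for \<open>Re \<mu>\<close> large, \<open>(\<mu> + A)\<inverse>\<close> is the
  Laplace transform of \<open>T\<close> at \<open>\<mu>\<close>.\<close>

definition minus_generates :: "('a::cbanach \<times> 'a) set \<Rightarrow> (real \<Rightarrow> 'a \<Rightarrow> 'a) \<Rightarrow> bool" where
  "minus_generates A T \<longleftrightarrow> clinear_operator A \<and> C0_semigroup T \<and>
     (\<exists>w. \<forall>\<mu>. Re \<mu> > w \<longrightarrow>
        (shifted \<mu> A)\<inverse> =
          {(x, y). has_bochner (restrict_space lborel {0..})
                     (\<lambda>t. exp (- \<mu> * complex_of_real t) *\<^sub>C T t x) y})"

subsection \<open>Gamma-boundedness\<close>

text \<open>The law of \<open>(g + i g') / \<surd>2\<close> for independent real standard normal \<open>g, g'\<close>.\<close>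

definition std_complex_gaussian :: "complex measure" where
  "std_complex_gaussian =
     distr (density lborel std_normal_density \<Otimes>\<^sub>M density lborel std_normal_density) borel
       (\<lambda>(a, b). Complex (a / sqrt 2) (b / sqrt 2))"

lemma prob_space_std_complex_gaussian: "prob_space std_complex_gaussian"
proof -
  interpret N: prob_space "density lborel std_normal_density"
    by (rule prob_space_normal_density) simp
  interpret P: pair_prob_space "density lborel std_normal_density" "density lborel std_normal_density"
    by standard
  show ?thesis
    unfolding std_complex_gaussian_def
    by (rule P.prob_space_distr) (simp add: Complex_eq split_beta')
qed

text \<open>The inequality depends only on the joint law of the Gaussian variables, so they are taken to be
  the coordinate functions on the product probability space indexed by the operators.\<close>

definition gaussian_L2_norm :: "'i set \<Rightarrow> ('i \<Rightarrow> 'a::cbanach) \<Rightarrow> real" where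
  "gaussian_L2_norm I x =
     sqrt (\<integral>g. (norm (\<Sum>i\<in>I. g i *\<^sub>C x i))\<^sup>2 \<partial>(PiM I (\<lambda>_. std_complex_gaussian)))"

definition gamma_bounded :: "('a::cbanach \<Rightarrow> 'a) set \<Rightarrow> bool" where
  "gamma_bounded \<T> \<longleftrightarrow> \<T> \<subseteq> Collect bounded_clinear \<and>
     (\<exists>C\<ge>0. \<forall>\<T>' x. finite \<T>' \<longrightarrow> \<T>' \<subseteq> \<T> \<longrightarrow>
        gaussian_L2_norm \<T>' (\<lambda>S. S (x S)) \<le> C * gaussian_L2_norm \<T>' x)"

definition gamma_bounded_semigroup :: "(real \<Rightarrow> 'a::cbanach \<Rightarrow> 'a) \<Rightarrow> bool" where
  "gamma_bounded_semigroup T \<longleftrightarrow> gamma_bounded (T ` {0..})"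

subsection \<open>Complex Borel measures on the half-line\<close>

abbreviation borel_halfline :: "real measure" where
  "borel_halfline \<equiv> restrict_space borel {0..}"

definition complex_borel_measure :: "(real set \<Rightarrow> complex) \<Rightarrow> bool" where
  "complex_borel_measure \<mu> \<longleftrightarrow>
     (\<forall>E :: nat \<Rightarrow> real set. range E \<subseteq> sets borel_halfline \<longrightarrow> disjoint_family E \<longrightarrow>
        (\<lambda>n. \<mu> (E n)) sums \<mu> (\<Union>n. E n))"

text \<open>As usual, \<open>\<integral> F d\<mu>\<close> is \<open>\<integral> F h d\<nu>\<close>, where \<open>d\<mu> = h d\<nu>\<close> with a finite positive
  measure \<open>\<nu>\<close> and \<open>h \<in> L\<^sup>1(\<nu>)\<close> (for instance the polar decomposition); the value does not depend
  on the choice of \<open>\<nu>\<close> and \<open>h\<close>.\<close>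

definition represents :: "real measure \<Rightarrow> (real \<Rightarrow> complex) \<Rightarrow> (real set \<Rightarrow> complex) \<Rightarrow> bool" where
  "represents \<nu> h \<mu> \<longleftrightarrow> finite_measure \<nu> \<and> sets \<nu> = sets borel_halfline \<and> integrable \<nu> h
     \<and> (\<forall>E\<in>sets borel_halfline. \<mu> E = (LINT t:E|\<nu>. h t))"

definition has_cm_integral :: "(real set \<Rightarrow> complex) \<Rightarrow> (real \<Rightarrow> 'a::cbanach) \<Rightarrow> 'a \<Rightarrow> bool" where
  "has_cm_integral \<mu> F y \<longleftrightarrow> (\<exists>\<nu> h. represents \<nu> h \<mu> \<and> has_bochner \<nu> (\<lambda>t. h t *\<^sub>C F t) y)"

subsection \<open>Functional calculus\<close>

definition right_half_plane :: "real \<Rightarrow> complex set" where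
  "right_half_plane \<omega> = {z. Re z > \<omega>}"

definition is_laplace_transform :: "(real set \<Rightarrow> complex) \<Rightarrow> (complex \<Rightarrow> complex) \<Rightarrow> bool" where
  "is_laplace_transform \<mu> e \<longleftrightarrow> complex_borel_measure \<mu> \<and>
     (\<forall>z\<in>right_half_plane 0. has_cm_integral \<mu> (\<lambda>s. exp (- z * complex_of_real s)) (e z))"

text \<open>The operator \<open>\<integral> T(t) \<mu>(dt)\<close>, where \<open>T\<close> is the semigroup (unique on \<open>[0,\<infinity>)\<close>)
  generated by \<open>-A\<close>.\<close>

definition hille_phillips ::
    "('a::cbanach \<times> 'a) set \<Rightarrow> (real set \<Rightarrow> complex) \<Rightarrow> ('a \<times> 'a) set" where
  "hille_phillips A \<mu> =
     {(x, y). \<exists>T. minus_generates A T \<and> has_cm_integral \<mu> (\<lambda>t. T t x) y}"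

text \<open>\<open>f(A) = e(A)\<inverse> (ef)(A)\<close>, with \<open>e\<close> the transform of \<open>\<mu>\<close> and \<open>ef\<close> that of \<open>\<nu>\<close>.
  The operator does not depend on the regularizer \<open>e\<close>, so the union below is a union of equal sets.\<close>

definition fun_calc ::
    "('a::cbanach \<times> 'a) set \<Rightarrow> (complex \<Rightarrow> complex) \<Rightarrow> ('a \<times> 'a) set" where
  "fun_calc A f =
     \<Union> {hille_phillips A \<nu> O (hille_phillips A \<mu>)\<inverse> | \<mu> \<nu>.
        \<exists>e. is_laplace_transform \<mu> e \<and> is_laplace_transform \<nu> (\<lambda>z. e z * f z)
          \<and> single_valued ((hille_phillips A \<mu>)\<inverse>)}"

definition H_infinity :: "complex set \<Rightarrow> (complex \<Rightarrow> complex) set" where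
  "H_infinity \<Omega> = {f. f holomorphic_on \<Omega> \<and> bounded (f ` \<Omega>)}"

definition H_infinity_norm :: "complex set \<Rightarrow> (complex \<Rightarrow> complex) \<Rightarrow> real" where
  "H_infinity_norm \<Omega> f = (SUP z\<in>\<Omega>. cmod (f z))"

definition strong_bounded_calculus :: "nat \<Rightarrow> ('a::cbanach \<times> 'a) set \<Rightarrow> bool" where
  "strong_bounded_calculus m A \<longleftrightarrow>
     (\<exists>C\<ge>0. \<forall>\<omega><0. \<forall>f\<in>H_infinity (right_half_plane \<omega>).
        \<exists>S. bounded_clinear S \<and> fun_calc A ((deriv ^^ m) f) = graph_of S
          \<and> onorm S \<le> C / \<bar>\<omega>\<bar> ^ m * H_infinity_norm (right_half_plane \<omega>) f)"

end

theory Submission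
  imports Defs "HOL-Complex_Analysis.Complex_Analysis" "HOL-Real_Asymp.Real_Asymp"
begin

text \<open>By Cauchy's estimates on a smaller half-plane the case \<open>m = 1\<close> suffices. Replacing \<open>z\<close> by
  \<open>(1 - e\<^sup>-\<^sup>\<tau>\<^sup>z) / \<tau>\<close> turns \<open>f\<close> into a power series \<open>\<Sum>k a\<^sub>k e\<^sup>-\<^sup>k\<^sup>\<tau>\<^sup>z\<close> with the same bound, whose
  derivative at \<open>A\<close> is \<open>-\<tau> \<Sum>k k a\<^sub>k T(k \<tau>)\<close>. The factor \<open>k\<close> counts the ways of writing \<open>T(k \<tau>)\<close> as
  \<open>T(i \<tau>) T(j \<tau>)\<close>, which displays this operator as a Hankel matrix between two sequences
  of semigroup operators: both are controlled by gamma-boundedness, and the Hankel matrix acts on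
  Gaussian sums with norm at most the supremum of \<open>f\<close>, because Gaussian sums are invariant under the
  fast Fourier transform (plane rotations and phases) and contracted by diagonal matrices. With
  weights \<open>r\<^sup>i\<close>, \<open>1 - r\<close> comparable to \<open>\<tau> \<bar>\<omega>\<bar>\<close>, the bound is of order \<open>1 / \<bar>\<omega>\<bar>\<close>, uniformly in \<open>\<tau>\<close>.

  As \<open>\<tau>\<close> tends to 0 the discretizations converge on the range of \<open>(\<lambda> + A)\<^sup>-\<^sup>2\<close>, where the operators
  are given by inverse Laplace transforms, hence everywhere. All identifications in the functional
  calculus, including the independence of the regularizer, rest on the fact that a functional on
  bounded continuous functions that is continuous under bounded pointwise convergence is determined
  by its values on the powers of \<open>e\<^sup>-\<^sup>t\<close>, by Bernstein's approximation.\<close>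

subsection \<open>The Bochner integral\<close>

text \<open>The pairing in the transference uses no dual space. The row of weights r^j acts on
  Gaussian sequences by a Cauchy-Schwarz inequality, so the whole estimate is a chain of
  inequalities between second moments in X, and no geometric property of X enters. Gamma-boundedness
  is applied once on each side of the Hankel matrix, hence the square of its constant. One
  derivative is the price of this factorization: without the factor k the entries on the k-th
  antidiagonal would need the weight 1/k, and the symbol would no longer be controlled by the
  supremum of f. Discretizing keeps every Gaussian sum finite, and finite sums are all that
  gamma-boundedness speaks about. Two features of the definitions shape the rest. X may be
  nonseparable, where sums of Borel functions can fail to be Borel; therefore integrals are built on
  limits of simple functions, and Gaussian moments are iterated integrals of lower semicontinuous
  functions. And the functional calculus fixes neither the generated semigroup nor the regularizer,
  so uniqueness theorems are part of the proof.\<close>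

lemma bounded_bilinear_scaleC: "bounded_bilinear (scaleC :: complex \<Rightarrow> 'a::cbanach \<Rightarrow> 'a)"
proof
  show "(r *\<^sub>R a) *\<^sub>C b = r *\<^sub>R a *\<^sub>C b" for r a and b :: 'a
    by (simp add: scaleR_scaleC[of r "a *\<^sub>C b"] scaleC_scaleC scaleR_conv_of_real)
  show "a *\<^sub>C r *\<^sub>R b = r *\<^sub>R a *\<^sub>C b" for r a and b :: 'a
    by (simp add: scaleR_scaleC scaleC_scaleC mult.commute)
  show "\<exists>K. \<forall>a. \<forall>b::'a. norm (a *\<^sub>C b) \<le> norm a * norm b * K"
    by (rule exI[of _ 1]) (simp add: norm_scaleC)
qed (simp_all add: scaleC_add_left scaleC_add_right)

interpretation scaleC: bounded_bilinear "scaleC :: complex \<Rightarrow> 'a::cbanach \<Rightarrow> 'a"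
  by (rule bounded_bilinear_scaleC)

lemma scaleC_one: "1 *\<^sub>C x = (x :: 'a::cbanach)"
  using scaleR_scaleC[of 1 x] by simp

lemma scaleC_of_real: "complex_of_real r *\<^sub>C x = r *\<^sub>R (x :: 'a::cbanach)"
  by (simp add: scaleR_scaleC)

text \<open>Borel measurability is not closed under sums when the values lie in a nonseparable
  space. Pointwise limits of simple functions are, and continuous or right continuous functions on
  the half-line are of this kind.\<close>

definition strongly_measurable :: "'m measure \<Rightarrow> ('m \<Rightarrow> 'a::real_normed_vector) \<Rightarrow> bool" where
  "strongly_measurable M f \<longleftrightarrow>
     (\<exists>s. (\<forall>i::nat. simple_function M (s i)) \<and> (\<forall>x\<in>space M. (\<lambda>i. s i x) \<longlonglongrightarrow> f x))"

lemma strongly_measurable_simple: "simple_function M f \<Longrightarrow> strongly_measurable M f"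
  unfolding strongly_measurable_def by (rule exI[of _ "\<lambda>_. f"]) auto

lemma strongly_measurable_const: "strongly_measurable M (\<lambda>_. c)"
  by (rule strongly_measurable_simple) simp

lemma strongly_measurable_add:
  assumes "strongly_measurable M f" "strongly_measurable M g"
  shows "strongly_measurable M (\<lambda>x. f x + g x)"
proof -
  from assms obtain s t where "\<forall>i::nat. simple_function M (s i)" "\<forall>x\<in>space M. (\<lambda>i. s i x) \<longlonglongrightarrow> f x"
    "\<forall>i::nat. simple_function M (t i)" "\<forall>x\<in>space M. (\<lambda>i. t i x) \<longlonglongrightarrow> g x"
    unfolding strongly_measurable_def by blast
  then show ?thesis unfolding strongly_measurable_def
    by (intro exI[of _ "\<lambda>i x. s i x + t i x"]) (auto intro!: tendsto_add)
qed

lemma strongly_measurable_complex: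
  assumes "c \<in> borel_measurable M"
  shows "strongly_measurable M (c :: _ \<Rightarrow> complex)"
  using borel_measurable_implies_sequence_metric[OF assms, of 0]
  unfolding strongly_measurable_def by blast

lemma strongly_measurable_scaleC:
  assumes "c \<in> borel_measurable M" "strongly_measurable M f"
  shows "strongly_measurable M (\<lambda>x. c x *\<^sub>C (f x :: 'a::cbanach))"
proof -
  from assms(2) strongly_measurable_complex[OF assms(1)]
  obtain s t where "\<forall>i::nat. simple_function M (s i)" "\<forall>x\<in>space M. (\<lambda>i. s i x) \<longlonglongrightarrow> f x"
    "\<forall>i::nat. simple_function M (t i)" "\<forall>x\<in>space M. (\<lambda>i. t i x) \<longlonglongrightarrow> c x"
    unfolding strongly_measurable_def by blast
  then show ?thesis unfolding strongly_measurable_def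
    by (intro exI[of _ "\<lambda>i x. t i x *\<^sub>C s i x"])
       (auto intro!: scaleC.tendsto simple_function_compose2[where h="scaleC"])
qed

lemma strongly_measurable_minus:
  assumes "strongly_measurable M f"
  shows "strongly_measurable M (\<lambda>x. - (f x :: 'a::cbanach))"
  using strongly_measurable_scaleC[of "\<lambda>_. -1" M f] assms
  by (simp add: scaleC.minus_left scaleC_one)

lemma strongly_measurable_diff:
  assumes "strongly_measurable M f" "strongly_measurable M g"
  shows "strongly_measurable M (\<lambda>x. f x - (g x :: 'a::cbanach))"
  using strongly_measurable_add[OF assms(1) strongly_measurable_minus[OF assms(2)]] by simp

lemma strongly_measurable_sum:
  assumes "\<And>i. i \<in> I \<Longrightarrow> strongly_measurable M (f i)"
  shows "strongly_measurable M (\<lambda>x. \<Sum>i\<in>I. f i x)"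
  using assms
  by (induction I rule: infinite_finite_induct)
     (simp_all add: strongly_measurable_const strongly_measurable_add)

lemma strongly_measurable_borel:
  assumes "strongly_measurable M f"
  shows "f \<in> borel_measurable M"
proof -
  from assms obtain s where s: "\<And>i::nat. simple_function M (s i)"
    "\<And>x. x \<in> space M \<Longrightarrow> (\<lambda>i. s i x) \<longlonglongrightarrow> f x"
    unfolding strongly_measurable_def by blast
  show ?thesis
    by (rule borel_measurable_LIMSEQ_metric[where f=s])
       (simp_all add: s borel_measurable_simple_function)
qed

lemma strongly_measurable_norm:
  assumes "strongly_measurable M f"
  shows "(\<lambda>x. norm (f x)) \<in> borel_measurable M"
  using measurable_compose[OF strongly_measurable_borel[OF assms], of norm borel]
  by (simp add: borel_measurable_continuous_onI continuous_on_norm_id)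

text \<open>On each of the finitely many level sets of \<open>s\<close> the difference is a
  translate of \<open>f\<close>, so it stays Borel even in a nonseparable space. All comparisons of
  an integrand with its simple approximations go through this.\<close>

lemma measurable_diff_simple:
  fixes f :: "'m \<Rightarrow> 'a::real_normed_vector"
  assumes [measurable]: "f \<in> borel_measurable M" and s: "simple_function M s"
  shows "(\<lambda>x. f x - s x) \<in> borel_measurable M"
proof (rule measurable_compose_countable'[where f="\<lambda>i x. f x - i" and I="s ` space M"])
  show "s \<in> measurable M (count_space (s ` space M))"
    using s by (simp add: measurable_count_space_eq2 simple_function_def vimage_def)
  show "countable (s ` space M)"
    using s by (simp add: simple_function_def countable_finite)
  show "(\<lambda>x. f x - i) \<in> borel_measurable M" for i
  proof -
    have "(\<lambda>y. y - i) \<in> borel_measurable borel"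
      by (intro borel_measurable_continuous_onI continuous_intros)
    from measurable_compose[OF assms(1) this] show ?thesis .
  qed
qed

section \<open>Bochner integrals: comparison, limits, existence\<close>

lemma ennreal_tendsto_0_le:
  fixes g h :: "nat \<Rightarrow> ennreal"
  assumes "h \<longlonglongrightarrow> 0" "\<And>n. g n \<le> h n"
  shows "g \<longlonglongrightarrow> 0"
  by (rule tendsto_sandwich[of "\<lambda>_. 0" g sequentially h]) (use assms in auto)

abbreviation (input) "sbint \<equiv> Bochner_Integration.simple_bochner_integral"
abbreviation (input) "sbable \<equiv> Bochner_Integration.simple_bochner_integrable"

lemma sbable_simple: "sbable M s \<Longrightarrow> simple_function M s"
  by (auto elim: Bochner_Integration.simple_bochner_integrable.cases)

lemma norm_sbint_diff_le:
  assumes s: "sbable M s" and t: "sbable M t"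
  shows "ennreal (norm (sbint M s - sbint M t)) \<le> (\<integral>\<^sup>+x. ennreal (norm (s x - t x)) \<partial>M)"
proof -
  have "ennreal (norm (sbint M s - sbint M t)) = norm (sbint M (\<lambda>x. s x - t x))"
    using s t by (subst simple_bochner_integral_diff) auto
  also have "\<dots> \<le> sbint M (\<lambda>x. norm (s x - t x))"
    using simple_bochner_integrable_compose2[of "(-)" M "s" "t"] s t
    by (auto intro!: simple_bochner_integral_norm_bound)
  also have "\<dots> = (\<integral>\<^sup>+x. norm (s x - t x) \<partial>M)"
    using simple_bochner_integrable_compose2[of "\<lambda>x y. norm (x - y)" M "s" "t"] s t
    by (auto intro!: simple_bochner_integral_eq_nn_integral)
  finally show ?thesis .
qed

lemma has_bochner_measurable: "has_bochner M f y \<Longrightarrow> f \<in> borel_measurable M"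
  by (simp add: has_bochner_def)

text \<open>The majorant is there because the difference of two measurable functions with values in a
  nonseparable space need not be measurable.\<close>

lemma has_bochner_diff_le:
  assumes f: "has_bochner M f y" and g: "has_bochner M g z"
    and [measurable]: "w \<in> borel_measurable M"
    and le: "\<And>x. x \<in> space M \<Longrightarrow> ennreal (norm (f x - g x)) \<le> w x"
  shows "ennreal (norm (y - z)) \<le> (\<integral>\<^sup>+x. w x \<partial>M)"
proof -
  from f obtain s where s: "\<And>i. sbable M (s i)"
    "(\<lambda>i. \<integral>\<^sup>+ t. ennreal (norm (f t - s i t)) \<partial>M) \<longlonglongrightarrow> 0" "(\<lambda>i::nat. sbint M (s i)) \<longlonglongrightarrow> y"
    unfolding has_bochner_def by blast
  from g obtain t where t: "\<And>i. sbable M (t i)"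
    "(\<lambda>i. \<integral>\<^sup>+ x. ennreal (norm (g x - t i x)) \<partial>M) \<longlonglongrightarrow> 0" "(\<lambda>i::nat. sbint M (t i)) \<longlonglongrightarrow> z"
    unfolding has_bochner_def by blast
  have [measurable]: "(\<lambda>x. f x - s i x) \<in> borel_measurable M" "(\<lambda>x. g x - t i x) \<in> borel_measurable M" for i
    using s(1) t(1) has_bochner_measurable[OF f] has_bochner_measurable[OF g]
    by (auto intro!: measurable_diff_simple sbable_simple)
  have *: "ennreal (norm (sbint M (s i) - sbint M (t i)))
      \<le> (\<integral>\<^sup>+ x. ennreal (norm (f x - s i x)) \<partial>M) + (\<integral>\<^sup>+x. w x \<partial>M) + (\<integral>\<^sup>+ x. ennreal (norm (g x - t i x)) \<partial>M)" for i
  proof -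
    have "ennreal (norm (sbint M (s i) - sbint M (t i))) \<le> (\<integral>\<^sup>+x. ennreal (norm (s i x - t i x)) \<partial>M)"
      by (rule norm_sbint_diff_le[OF s(1) t(1)])
    also have "\<dots> \<le> (\<integral>\<^sup>+x. ennreal (norm (f x - s i x)) + w x + ennreal (norm (g x - t i x)) \<partial>M)"
    proof (rule nn_integral_mono)
      fix x assume x: "x \<in> space M"
      have "norm (s i x - t i x) \<le> norm (f x - s i x) + norm (f x - g x) + norm (g x - t i x)"
        using norm_triangle_ineq[of "s i x - f x" "f x - t i x"]
          norm_triangle_ineq[of "f x - g x" "g x - t i x"] by (simp add: norm_minus_commute)
      then have "ennreal (norm (s i x - t i x))
          \<le> ennreal (norm (f x - s i x)) + ennreal (norm (f x - g x)) + ennreal (norm (g x - t i x))"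
        by (simp flip: ennreal_plus add: ennreal_leI)
      also have "\<dots> \<le> ennreal (norm (f x - s i x)) + w x + ennreal (norm (g x - t i x))"
        by (intro add_mono le x order_refl)
      finally show "ennreal (norm (s i x - t i x)) \<le> \<dots>" .
    qed
    also have "\<dots> = (\<integral>\<^sup>+ x. ennreal (norm (f x - s i x)) \<partial>M) + (\<integral>\<^sup>+x. w x \<partial>M) + (\<integral>\<^sup>+ x. ennreal (norm (g x - t i x)) \<partial>M)"
      by (simp add: nn_integral_add)
    finally show ?thesis .
  qed
  have lhs: "(\<lambda>i. ennreal (norm (sbint M (s i) - sbint M (t i)))) \<longlonglongrightarrow> ennreal (norm (y - z))"
    by (intro tendsto_ennrealI tendsto_norm tendsto_diff s t)
  have rhs: "(\<lambda>i. (\<integral>\<^sup>+ x. ennreal (norm (f x - s i x)) \<partial>M) + (\<integral>\<^sup>+x. w x \<partial>M)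
      + (\<integral>\<^sup>+ x. ennreal (norm (g x - t i x)) \<partial>M)) \<longlonglongrightarrow> 0 + (\<integral>\<^sup>+x. w x \<partial>M) + 0"
    by (intro tendsto_add s t tendsto_const)
  show ?thesis
    using LIMSEQ_le[OF lhs rhs] * by auto
qed

lemma has_bochner_unique:
  assumes "has_bochner M f y" "has_bochner M f z"
  shows "y = z"
  using has_bochner_diff_le[OF assms, of "\<lambda>_. 0"] by simp

lemma has_bochner_cong:
  assumes "\<And>x. x \<in> space M \<Longrightarrow> f x = g x"
  shows "has_bochner M f y \<longleftrightarrow> has_bochner M g y"
proof -
  have "f \<in> borel_measurable M \<longleftrightarrow> g \<in> borel_measurable M"
    by (rule measurable_cong) (rule assms)
  moreover have "(\<integral>\<^sup>+ t. ennreal (norm (f t - s t)) \<partial>M) = (\<integral>\<^sup>+ t. ennreal (norm (g t - s t)) \<partial>M)" for s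
    by (rule nn_integral_cong) (simp add: assms)
  ultimately show ?thesis
    unfolding has_bochner_def by simp
qed

text \<open>The integrals form a Cauchy sequence by the comparison lemma, and a diagonal choice of
  simple functions, one close in mean to each \<open>f n\<close>, exhibits their limit as the
  integral of \<open>g\<close>.\<close>

lemma has_bochner_limit:
  fixes g :: "'m \<Rightarrow> 'a::banach"
  assumes f: "\<And>n. has_bochner M (f n) (y n)" and g: "g \<in> borel_measurable M"
    and [measurable]: "\<And>n. (\<lambda>x. norm (f n x - g x)) \<in> borel_measurable M"
    and lim: "(\<lambda>n. \<integral>\<^sup>+x. ennreal (norm (f n x - g x)) \<partial>M) \<longlonglongrightarrow> 0"
  shows "\<exists>z. y \<longlonglongrightarrow> z \<and> has_bochner M g z"
proof -
  define D where "D n = (\<integral>\<^sup>+x. ennreal (norm (f n x - g x)) \<partial>M)" for n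
  have le: "ennreal (norm (y n - y m)) \<le> D n + D m" for n m
  proof -
    have "ennreal (norm (y n - y m)) \<le> (\<integral>\<^sup>+x. ennreal (norm (f n x - g x)) + ennreal (norm (f m x - g x)) \<partial>M)"
    proof (rule has_bochner_diff_le[OF f f])
      show "ennreal (norm (f n x - f m x)) \<le> ennreal (norm (f n x - g x)) + ennreal (norm (f m x - g x))" for x
        using norm_triangle_ineq4[of "f n x - g x" "f m x - g x"]
        by (simp flip: ennreal_plus add: ennreal_leI)
    qed measurable
    then show ?thesis by (simp add: nn_integral_add D_def)
  qed
  have "Cauchy y"
  proof (rule CauchyI)
    fix e :: real assume "e > 0"
    have "eventually (\<lambda>n. D n < ennreal (e/2)) sequentially"
      using lim \<open>e > 0\<close> by (intro order_tendstoD(2)[where y=0]) (auto simp: D_def)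
    then obtain N where N: "\<And>n. n \<ge> N \<Longrightarrow> D n < ennreal (e/2)"
      by (auto simp: eventually_sequentially)
    have "norm (y m - y n) < e" if "m \<ge> N" "n \<ge> N" for m n
    proof -
      have "ennreal (norm (y m - y n)) \<le> D m + D n" by (rule le)
      also have "\<dots> < ennreal (e/2) + ennreal (e/2)"
        using N[OF that(1)] N[OF that(2)] by (rule add_strict_mono)
      also have "\<dots> = ennreal e" using \<open>e > 0\<close> by (simp flip: ennreal_plus)
      finally show ?thesis using \<open>e > 0\<close> by (simp add: ennreal_less_iff)
    qed
    then show "\<exists>M. \<forall>m\<ge>M. \<forall>n\<ge>M. norm (y m - y n) < e" by blast
  qed
  then obtain z where z: "y \<longlonglongrightarrow> z" using Cauchy_convergent convergentD by blast
  have "\<forall>n. \<exists>s. sbable M s \<and> (\<integral>\<^sup>+x. ennreal (norm (f n x - s x)) \<partial>M) < ennreal (inverse (Suc n))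
     \<and> dist (sbint M s) (y n) < inverse (Suc n)"
  proof
    fix n
    from f[of n] obtain s where s: "\<And>i. sbable M (s i)"
      "(\<lambda>i. \<integral>\<^sup>+ t. ennreal (norm (f n t - s i t)) \<partial>M) \<longlonglongrightarrow> 0" "(\<lambda>i::nat. sbint M (s i)) \<longlonglongrightarrow> y n"
      unfolding has_bochner_def by blast
    have pos: "(0::real) < inverse (Suc n)" by simp
    have "eventually (\<lambda>i. (\<integral>\<^sup>+x. ennreal (norm (f n x - s i x)) \<partial>M) < ennreal (inverse (Suc n))
     \<and> dist (sbint M (s i)) (y n) < inverse (Suc n)) sequentially"
      by (intro eventually_conj order_tendstoD(2)[OF s(2)] tendstoD[OF s(3)] pos) simp
    then obtain i where "(\<integral>\<^sup>+x. ennreal (norm (f n x - s i x)) \<partial>M) < ennreal (inverse (Suc n))"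
      "dist (sbint M (s i)) (y n) < inverse (Suc n)"
      by (auto simp: eventually_sequentially)
    with s(1)[of i] show "\<exists>s. sbable M s \<and> (\<integral>\<^sup>+x. ennreal (norm (f n x - s x)) \<partial>M) < ennreal (inverse (Suc n))
     \<and> dist (sbint M s) (y n) < inverse (Suc n)" by blast
  qed
  from choice[OF this] obtain s where s: "\<And>n. sbable M (s n)"
    "\<And>n. (\<integral>\<^sup>+x. ennreal (norm (f n x - s n x)) \<partial>M) < ennreal (inverse (Suc n))"
    "\<And>n. dist (sbint M (s n)) (y n) < inverse (Suc n)"
    by blast
  have [measurable]: "(\<lambda>x. f n x - s n x) \<in> borel_measurable M" for n
    by (intro measurable_diff_simple sbable_simple s has_bochner_measurable[OF f])
  have le2: "(\<integral>\<^sup>+x. ennreal (norm (g x - s n x)) \<partial>M) \<le> D n + ennreal (inverse (Suc n))" for n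
  proof -
    have "(\<integral>\<^sup>+x. ennreal (norm (g x - s n x)) \<partial>M)
        \<le> (\<integral>\<^sup>+x. ennreal (norm (f n x - g x)) + ennreal (norm (f n x - s n x)) \<partial>M)"
    proof (rule nn_integral_mono)
      fix x
      show "ennreal (norm (g x - s n x)) \<le> ennreal (norm (f n x - g x)) + ennreal (norm (f n x - s n x))"
        using norm_triangle_ineq4[of "f n x - s n x" "f n x - g x"]
        by (simp flip: ennreal_plus add: ennreal_leI)
    qed
    also have "\<dots> = D n + (\<integral>\<^sup>+x. ennreal (norm (f n x - s n x)) \<partial>M)"
      by (simp add: nn_integral_add D_def)
    also have "\<dots> \<le> D n + ennreal (inverse (Suc n))"
      using s(2)[of n] by (intro add_left_mono) simp
    finally show ?thesis .
  qed
  have inv0: "(\<lambda>n. ennreal (inverse (Suc n))) \<longlonglongrightarrow> ennreal 0"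
    by (intro tendsto_ennrealI LIMSEQ_inverse_real_of_nat)
  have "(\<lambda>n. D n + ennreal (inverse (Suc n))) \<longlonglongrightarrow> 0 + ennreal 0"
    using lim inv0 by (intro tendsto_add) (simp_all add: D_def)
  then have "(\<lambda>n. D n + ennreal (inverse (Suc n))) \<longlonglongrightarrow> 0" by simp
  then have D0: "(\<lambda>n. \<integral>\<^sup>+x. ennreal (norm (g x - s n x)) \<partial>M) \<longlonglongrightarrow> 0"
    using le2 by (rule ennreal_tendsto_0_le)
  have "(\<lambda>n. sbint M (s n) - y n) \<longlonglongrightarrow> 0"
    by (rule Lim_null_comparison[OF _ LIMSEQ_inverse_real_of_nat])
       (intro always_eventually allI less_imp_le s(3)[unfolded dist_norm])
  from tendsto_add[OF this z] have "(\<lambda>n. sbint M (s n)) \<longlonglongrightarrow> z" by simp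
  then have "has_bochner M g z"
    unfolding has_bochner_def using g s(1) D0 by blast
  with z show ?thesis by blast
qed

lemma has_bochner_simple:
  "sbable M s \<Longrightarrow> has_bochner M s (sbint M s)"
  unfolding has_bochner_def
  by (intro conjI exI[of _ "\<lambda>_. s"]) (simp_all add: borel_measurable_simple_function sbable_simple)

lemma has_bochner_bounded_linear:
  assumes f: "has_bochner M f y" and F: "bounded_linear F"
  shows "has_bochner M (\<lambda>x. F (f x)) (F y)"
proof -
  obtain K where K: "K \<ge> 0" "\<And>x. norm (F x) \<le> norm x * K"
    using bounded_linear.nonneg_bounded[OF F] by blast
  from f obtain s where s: "\<And>i. sbable M (s i)"
    "(\<lambda>i. \<integral>\<^sup>+ t. ennreal (norm (f t - s i t)) \<partial>M) \<longlonglongrightarrow> 0" "(\<lambda>i::nat. sbint M (s i)) \<longlonglongrightarrow> y"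
    unfolding has_bochner_def by blast
  have lin: "linear F" using F by (rule bounded_linear.linear)
  have fm [measurable]: "(\<lambda>x. f x - s i x) \<in> borel_measurable M" for i
    by (intro measurable_diff_simple sbable_simple s has_bochner_measurable[OF f])
  have "F \<in> borel_measurable borel"
    by (intro borel_measurable_continuous_onI linear_continuous_on F)
  then have 1: "(\<lambda>x. F (f x)) \<in> borel_measurable M"
    by (rule measurable_compose[OF has_bochner_measurable[OF f]])
  have 2: "sbable M (\<lambda>x. F (s i x))" for i
    using simple_bochner_integrable_compose2[of "\<lambda>x y. F x" M "s i" "s i"] s(1) linear_0[OF lin] by simp
  have le: "(\<integral>\<^sup>+ t. ennreal (norm (F (f t) - F (s i t))) \<partial>M) \<le> ennreal K * (\<integral>\<^sup>+ t. ennreal (norm (f t - s i t)) \<partial>M)" for i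
  proof -
    have "(\<integral>\<^sup>+ t. ennreal (norm (F (f t) - F (s i t))) \<partial>M) \<le> (\<integral>\<^sup>+ t. ennreal K * ennreal (norm (f t - s i t)) \<partial>M)"
      using K by (intro nn_integral_mono) (simp flip: linear_diff[OF lin] ennreal_mult add: ennreal_leI mult.commute)
    then show ?thesis by (simp add: nn_integral_cmult)
  qed
  have "(\<lambda>i. ennreal K * (\<integral>\<^sup>+ t. ennreal (norm (f t - s i t)) \<partial>M)) \<longlonglongrightarrow> ennreal K * 0"
    by (intro ennreal_tendsto_cmult s) simp
  then have "(\<lambda>i. ennreal K * (\<integral>\<^sup>+ t. ennreal (norm (f t - s i t)) \<partial>M)) \<longlonglongrightarrow> 0" by simp
  from ennreal_tendsto_0_le[OF this le]
  have 3: "(\<lambda>i. \<integral>\<^sup>+ t. ennreal (norm (F (f t) - F (s i t))) \<partial>M) \<longlonglongrightarrow> 0" .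
  have 4: "(\<lambda>i. sbint M (\<lambda>x. F (s i x))) \<longlonglongrightarrow> F y"
    unfolding simple_bochner_integral_linear[OF lin s(1)] by (intro bounded_linear.tendsto[OF F] s)
  show ?thesis
    unfolding has_bochner_def by (intro conjI exI[of _ "\<lambda>i x. F (s i x)"] allI 1 2 3 4)
qed

lemma has_bochner_exists:
  fixes f :: "'m \<Rightarrow> 'a::cbanach"
  assumes f: "strongly_measurable M f" and fin: "(\<integral>\<^sup>+x. ennreal (norm (f x)) \<partial>M) < \<infinity>"
  shows "\<exists>y. has_bochner M f y"
proof -
  obtain s where s: "\<And>i::nat. simple_function M (s i)" "\<And>x. x \<in> space M \<Longrightarrow> (\<lambda>i. s i x) \<longlonglongrightarrow> f x"
    using f unfolding strongly_measurable_def by blast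
  have nf [measurable]: "(\<lambda>x. norm (f x)) \<in> borel_measurable M" by (rule strongly_measurable_norm[OF f])
  have ns [measurable]: "(\<lambda>x. norm (s i x)) \<in> borel_measurable M" for i
    by (rule strongly_measurable_norm[OF strongly_measurable_simple[OF s(1)]])
  \<comment> \<open>Truncation with a factor 2 of slack: where \<open>f x\<close> is nonzero it is
    eventually inactive, where \<open>f x = 0\<close> it forces the value 0, and everywhere it
    bounds the error by \<open>3 * norm (f x)\<close>.\<close>
  define B where "B i = {x \<in> space M. norm (s i x) \<le> 2 * norm (f x)}" for i
  have Bm [measurable]: "B i \<in> sets M" for i unfolding B_def by measurable
  define r where "r i x = indicator (B i) x *\<^sub>C s i x" for i x
  have rs: "simple_function M (r i)" for i
    unfolding r_def by (rule simple_function_compose2[where h=scaleC]) (simp_all add: s(1) simple_function_indicator)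
  have rb: "norm (r i x) \<le> 2 * norm (f x)" if "x \<in> space M" for i x
    using that by (auto simp: r_def B_def indicator_def scaleC_one scaleC.zero_left)
  have rlim: "(\<lambda>i. r i x) \<longlonglongrightarrow> f x" if x: "x \<in> space M" for x
  proof (cases "f x = 0")
    case True
    then have "r i x = 0" for i using rb[OF x, of i] by simp
    then show ?thesis using True by simp
  next
    case False
    have "(\<lambda>i. norm (s i x)) \<longlonglongrightarrow> norm (f x)" by (intro tendsto_norm s(2) x)
    moreover have "norm (f x) < 2 * norm (f x)" using False by simp
    ultimately have "eventually (\<lambda>i. norm (s i x) < 2 * norm (f x)) sequentially"
      by (rule order_tendstoD(2))
    then have "eventually (\<lambda>i. s i x = r i x) sequentially"
      by eventually_elim (use x in \<open>simp add: r_def B_def scaleC_one\<close>)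
    with s(2)[OF x] show ?thesis by (rule Lim_transform_eventually)
  qed
  have rint: "sbable M (r i)" for i
  proof (rule simple_bochner_integrableI_bounded[OF rs])
    have "(\<integral>\<^sup>+x. ennreal (norm (r i x)) \<partial>M) \<le> (\<integral>\<^sup>+x. 2 * ennreal (norm (f x)) \<partial>M)"
    proof (rule nn_integral_mono)
      fix x assume "x \<in> space M"
      then have "ennreal (norm (r i x)) \<le> ennreal (2 * norm (f x))" by (intro ennreal_leI rb)
      then show "ennreal (norm (r i x)) \<le> 2 * ennreal (norm (f x))" by (simp add: ennreal_mult')
    qed
    also have "\<dots> < \<infinity>" using fin by (simp add: nn_integral_cmult ennreal_mult_less_top)
    finally show "(\<integral>\<^sup>+x. ennreal (norm (r i x)) \<partial>M) < \<infinity>" .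
  qed
  have dm [measurable]: "(\<lambda>x. norm (r i x - f x)) \<in> borel_measurable M" for i
    by (intro strongly_measurable_norm strongly_measurable_diff f strongly_measurable_simple rs)
  have "(\<lambda>i. \<integral>\<^sup>+x. ennreal (norm (r i x - f x)) \<partial>M) \<longlonglongrightarrow> (\<integral>\<^sup>+x. 0 \<partial>M)"
  proof (rule nn_integral_dominated_convergence[where w="\<lambda>x. 3 * ennreal (norm (f x))"])
    show "(\<integral>\<^sup>+x. 3 * ennreal (norm (f x)) \<partial>M) < \<infinity>"
      using fin by (simp add: nn_integral_cmult ennreal_mult_less_top)
    show "AE x in M. ennreal (norm (r i x - f x)) \<le> 3 * ennreal (norm (f x))" for i
    proof (rule AE_I2)
      fix x assume "x \<in> space M"
      then have "norm (r i x - f x) \<le> 3 * norm (f x)"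
        using norm_triangle_ineq4[of "r i x" "f x"] rb[of x i] by simp
      then have "ennreal (norm (r i x - f x)) \<le> ennreal (3 * norm (f x))" by (rule ennreal_leI)
      then show "ennreal (norm (r i x - f x)) \<le> 3 * ennreal (norm (f x))" by (simp add: ennreal_mult')
    qed
    show "AE x in M. (\<lambda>i. ennreal (norm (r i x - f x))) \<longlonglongrightarrow> 0"
    proof (rule AE_I2)
      fix x assume "x \<in> space M"
      then have "(\<lambda>i. r i x - f x) \<longlonglongrightarrow> 0" using rlim by (simp add: LIM_zero)
      then have "(\<lambda>i. ennreal (norm (r i x - f x))) \<longlonglongrightarrow> ennreal (norm (0::'a))"
        by (intro tendsto_ennrealI tendsto_norm)
      then show "(\<lambda>i. ennreal (norm (r i x - f x))) \<longlonglongrightarrow> 0" by simp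
    qed
  qed measurable
  then have "(\<lambda>i. \<integral>\<^sup>+x. ennreal (norm (r i x - f x)) \<partial>M) \<longlonglongrightarrow> 0" by simp
  from has_bochner_limit[OF has_bochner_simple[OF rint] strongly_measurable_borel[OF f] dm this]
  show ?thesis by blast
qed

lemma has_bochner_finite:
  assumes "has_bochner M f y"
  shows "(\<integral>\<^sup>+x. ennreal (norm (f x)) \<partial>M) < \<infinity>"
proof -
  from assms obtain s where s: "\<And>i. sbable M (s i)"
    "(\<lambda>i. \<integral>\<^sup>+ t. ennreal (norm (f t - s i t)) \<partial>M) \<longlonglongrightarrow> 0"
    unfolding has_bochner_def by blast
  have "eventually (\<lambda>i. (\<integral>\<^sup>+ t. ennreal (norm (f t - s i t)) \<partial>M) < 1) sequentially"
    by (rule order_tendstoD(2)[OF s(2)]) simp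
  then obtain i where i: "(\<integral>\<^sup>+ t. ennreal (norm (f t - s i t)) \<partial>M) < 1"
    by (auto simp: eventually_sequentially)
  have [measurable]: "(\<lambda>t. f t - s i t) \<in> borel_measurable M"
    by (intro measurable_diff_simple sbable_simple s has_bochner_measurable[OF assms])
  have sn: "sbable M (\<lambda>t. norm (s i t))"
    using simple_bochner_integrable_compose2[of "\<lambda>x y. norm x" M "s i" "s i"] s(1) by simp
  then have [measurable]: "(\<lambda>t. norm (s i t)) \<in> borel_measurable M"
    by (intro borel_measurable_simple_function sbable_simple)
  have "(\<integral>\<^sup>+t. ennreal (norm (s i t)) \<partial>M) = ennreal (sbint M (\<lambda>t. norm (s i t)))"
    by (rule simple_bochner_integral_eq_nn_integral[OF sn, symmetric]) simp
  then have sfin: "(\<integral>\<^sup>+t. ennreal (norm (s i t)) \<partial>M) < \<infinity>" by simp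
  have "(\<integral>\<^sup>+x. ennreal (norm (f x)) \<partial>M) \<le> (\<integral>\<^sup>+x. ennreal (norm (f x - s i x)) + ennreal (norm (s i x)) \<partial>M)"
  proof (rule nn_integral_mono)
    fix x
    show "ennreal (norm (f x)) \<le> ennreal (norm (f x - s i x)) + ennreal (norm (s i x))"
      using norm_triangle_ineq[of "f x - s i x" "s i x"] by (simp flip: ennreal_plus add: ennreal_leI)
  qed
  also have "\<dots> = (\<integral>\<^sup>+x. ennreal (norm (f x - s i x)) \<partial>M) + (\<integral>\<^sup>+t. ennreal (norm (s i t)) \<partial>M)"
    by (rule nn_integral_add) measurable
  also have "\<dots> < \<infinity>" using i sfin by (simp add: order_less_trans[OF i])
  finally show ?thesis .
qed

lemma has_bochner_add:
  fixes f g :: "'m \<Rightarrow> 'a::cbanach"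
  assumes f: "has_bochner M f y" "strongly_measurable M f"
    and g: "has_bochner M g z" "strongly_measurable M g"
  shows "has_bochner M (\<lambda>x. f x + g x) (y + z)"
proof -
  from f obtain s where s: "\<And>i. sbable M (s i)"
    "(\<lambda>i. \<integral>\<^sup>+ t. ennreal (norm (f t - s i t)) \<partial>M) \<longlonglongrightarrow> 0" "(\<lambda>i::nat. sbint M (s i)) \<longlonglongrightarrow> y"
    unfolding has_bochner_def by blast
  from g obtain t where t: "\<And>i. sbable M (t i)"
    "(\<lambda>i. \<integral>\<^sup>+ x. ennreal (norm (g x - t i x)) \<partial>M) \<longlonglongrightarrow> 0" "(\<lambda>i::nat. sbint M (t i)) \<longlonglongrightarrow> z"
    unfolding has_bochner_def by blast
  have [measurable]: "(\<lambda>x. f x - s i x) \<in> borel_measurable M" "(\<lambda>x. g x - t i x) \<in> borel_measurable M" for i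
    using s(1) t(1) has_bochner_measurable[OF f(1)] has_bochner_measurable[OF g(1)]
    by (auto intro!: measurable_diff_simple sbable_simple)
  have le: "(\<integral>\<^sup>+x. ennreal (norm (f x + g x - (s i x + t i x))) \<partial>M)
      \<le> (\<integral>\<^sup>+ t. ennreal (norm (f t - s i t)) \<partial>M) + (\<integral>\<^sup>+ x. ennreal (norm (g x - t i x)) \<partial>M)" for i
  proof -
    have "(\<integral>\<^sup>+x. ennreal (norm (f x + g x - (s i x + t i x))) \<partial>M)
      \<le> (\<integral>\<^sup>+x. ennreal (norm (f x - s i x)) + ennreal (norm (g x - t i x)) \<partial>M)"
    proof (rule nn_integral_mono)
      fix x
      show "ennreal (norm (f x + g x - (s i x + t i x))) \<le> ennreal (norm (f x - s i x)) + ennreal (norm (g x - t i x))"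
        using norm_triangle_ineq[of "f x - s i x" "g x - t i x"]
        by (simp flip: ennreal_plus add: ennreal_leI add_diff_add)
    qed
    then show ?thesis by (simp add: nn_integral_add)
  qed
  have "(\<lambda>i. (\<integral>\<^sup>+ t. ennreal (norm (f t - s i t)) \<partial>M) + (\<integral>\<^sup>+ x. ennreal (norm (g x - t i x)) \<partial>M)) \<longlonglongrightarrow> 0 + 0"
    by (intro tendsto_add s t)
  then have "(\<lambda>i. (\<integral>\<^sup>+ t. ennreal (norm (f t - s i t)) \<partial>M) + (\<integral>\<^sup>+ x. ennreal (norm (g x - t i x)) \<partial>M)) \<longlonglongrightarrow> 0"
    by simp
  then have *: "(\<lambda>i. \<integral>\<^sup>+x. ennreal (norm (f x + g x - (s i x + t i x))) \<partial>M) \<longlonglongrightarrow> 0"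
    using le by (rule ennreal_tendsto_0_le)
  have "(\<lambda>i. sbint M (\<lambda>x. s i x + t i x)) \<longlonglongrightarrow> y + z"
    using tendsto_add[OF s(3) t(3)] by (simp add: simple_bochner_integral_add s t)
  moreover have "sbable M (\<lambda>x. s i x + t i x)" for i
    using simple_bochner_integrable_compose2[of "(+)" M "s i" "t i"] s(1) t(1) by simp
  moreover have "(\<lambda>x. f x + g x) \<in> borel_measurable M"
    by (intro strongly_measurable_borel strongly_measurable_add f g)
  ultimately show ?thesis
    unfolding has_bochner_def using * by (intro conjI exI[of _ "\<lambda>i x. s i x + t i x"]) auto
qed

lemma has_bochner_scaleC_left:
  fixes v :: "'a::cbanach"
  assumes "integrable M h"
  shows "has_bochner M (\<lambda>x. h x *\<^sub>C v) ((\<integral>x. h x \<partial>M) *\<^sub>C v)"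
proof -
  have "has_bochner_integral M h (\<integral>x. h x \<partial>M)"
    using assms by (rule has_bochner_integral_integrable)
  then have "has_bochner M h (\<integral>x. h x \<partial>M)"
    unfolding has_bochner_def by (elim has_bochner_integral.cases) blast
  then show ?thesis by (rule has_bochner_bounded_linear[OF _ scaleC.bounded_linear_left])
qed

lemma has_bochner_sum_scaleC:
  fixes v :: "'i \<Rightarrow> 'a::cbanach"
  assumes "finite I" "\<And>i. i \<in> I \<Longrightarrow> integrable M (h i)"
  shows "has_bochner M (\<lambda>x. \<Sum>i\<in>I. h i x *\<^sub>C v i) (\<Sum>i\<in>I. (\<integral>x. h i x \<partial>M) *\<^sub>C v i)"
  using assms
proof (induction I rule: finite_induct)
  case empty
  show ?case using has_bochner_scaleC_left[of M "\<lambda>_. 0" 0] by (simp add: scaleC.zero_left)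
next
  case (insert i I)
  have sm: "strongly_measurable M (\<lambda>x. h j x *\<^sub>C v j)" if "j \<in> insert i I" for j
    by (intro strongly_measurable_scaleC strongly_measurable_const)
       (use insert.prems that in auto)
  have "has_bochner M (\<lambda>x. h i x *\<^sub>C v i + (\<Sum>j\<in>I. h j x *\<^sub>C v j))
      ((\<integral>x. h i x \<partial>M) *\<^sub>C v i + (\<Sum>j\<in>I. (\<integral>x. h j x \<partial>M) *\<^sub>C v j))"
  proof (rule has_bochner_add)
    show "has_bochner M (\<lambda>x. h i x *\<^sub>C v i) ((\<integral>x. h i x \<partial>M) *\<^sub>C v i)"
      by (rule has_bochner_scaleC_left) (simp add: insert.prems)
    show "strongly_measurable M (\<lambda>x. \<Sum>j\<in>I. h j x *\<^sub>C v j)"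
      by (rule strongly_measurable_sum) (simp add: sm)
  qed (simp_all add: insert sm)
  then show ?case using insert by simp
qed

section \<open>Bounded continuous integrands and Stieltjes sums\<close>

definition bcont :: "(real \<Rightarrow> 'a::real_normed_vector) set" where
  "bcont = {\<phi>. continuous_on {0..} \<phi> \<and> bounded (\<phi> ` {0..})}"

text \<open>The first \<open>n * n\<close> cells of length \<open>1 / n\<close> cover
  \<open>[0, n)\<close>, so a single index drives both the refinement and the exhaustion of the
  half-line.\<close>

definition mesh :: "nat \<Rightarrow> nat \<Rightarrow> real set" where
  "mesh n k = {real k / real n ..< real (Suc k) / real n}"

definition step :: "nat \<Rightarrow> (real \<Rightarrow> 'a::cbanach) \<Rightarrow> real \<Rightarrow> 'a" where
  "step n \<phi> t = (\<Sum>k<n*n. indicator (mesh n k) t *\<^sub>C \<phi> (real k / real n))"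

lemma mesh_sets [measurable]: "mesh n k \<in> sets (restrict_space borel {0..})"
proof -
  have *: "0 \<le> real k / real n" by simp
  have "mesh n k \<subseteq> {0..}"
    unfolding mesh_def by (clarsimp simp del: of_nat_Suc) (rule order_trans[OF *])
  moreover have "mesh n k \<in> sets borel" by (simp add: mesh_def)
  ultimately show ?thesis by (simp add: sets_restrict_space_iff)
qed

lemma mem_mesh_iff:
  assumes "n > 0" "t \<ge> 0"
  shows "t \<in> mesh n k \<longleftrightarrow> k = nat \<lfloor>n * t\<rfloor>"
proof -
  have "t \<in> mesh n k \<longleftrightarrow> real k \<le> n * t \<and> n * t < real k + 1"
    using assms by (auto simp: mesh_def field_simps)
  also have "\<dots> \<longleftrightarrow> \<lfloor>n * t\<rfloor> = int k"
    by (metis floor_eq_iff of_int_of_nat_eq)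
  also have "\<dots> \<longleftrightarrow> k = nat \<lfloor>n * t\<rfloor>"
    using assms by (auto simp: nat_eq_iff2)
  finally show ?thesis .
qed

lemma step_eq:
  assumes "t \<ge> 0"
  shows "step n \<phi> t = (if t < n then \<phi> (real (nat \<lfloor>n * t\<rfloor>) / n) else 0)"
proof (cases "n = 0")
  case True
  then show ?thesis using assms by (simp add: step_def)
next
  case False
  then have "n > 0" by simp
  have "step n \<phi> t = (\<Sum>k<n*n. if k = nat \<lfloor>n * t\<rfloor> then \<phi> (real k / real n) else 0)"
    unfolding step_def by (rule sum.cong) (auto simp: mem_mesh_iff[OF \<open>n > 0\<close> assms] indicator_def scaleC_one scaleC.zero_left)
  also have "\<dots> = (if nat \<lfloor>n * t\<rfloor> < n * n then \<phi> (real (nat \<lfloor>n * t\<rfloor>) / n) else 0)"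
    by (auto simp: sum.delta')
  also have "nat \<lfloor>n * t\<rfloor> < n * n \<longleftrightarrow> t < n"
  proof -
    have "nat \<lfloor>n * t\<rfloor> < n * n \<longleftrightarrow> \<lfloor>n * t\<rfloor> < int (n * n)"
      using assms by (simp add: nat_less_iff)
    also have "\<dots> \<longleftrightarrow> n * t < n * n"
      by (simp add: floor_less_iff)
    finally show ?thesis using \<open>n > 0\<close> by simp
  qed
  finally show ?thesis .
qed

lemma step_tendsto:
  assumes "continuous_on {0..} \<phi>" "t \<ge> 0"
  shows "(\<lambda>n. step n \<phi> t) \<longlonglongrightarrow> \<phi> t"
proof -
  have "(\<lambda>n. real (nat \<lfloor>n * t\<rfloor>) / n) \<longlonglongrightarrow> t"
  proof (rule tendsto_sandwich[where f="\<lambda>n. t - 1 / real n" and h="\<lambda>n. t"])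
    have "t - 1 / real n \<le> real (nat \<lfloor>n * t\<rfloor>) / n" if "n > 0" for n :: nat
    proof -
      have "n * t - 1 \<le> real (nat \<lfloor>n * t\<rfloor>)" using assms(2) by linarith
      then have "(n * t - 1) / n \<le> real (nat \<lfloor>n * t\<rfloor>) / n"
        by (rule divide_right_mono) simp
      then show ?thesis using that by (simp add: diff_divide_distrib)
    qed
    then show "\<forall>\<^sub>F n in sequentially. t - 1 / real n \<le> real (nat \<lfloor>n * t\<rfloor>) / n"
      by (auto intro: eventually_mono[OF eventually_gt_at_top[of 0]])
    have "real (nat \<lfloor>n * t\<rfloor>) / n \<le> t" if "n > 0" for n :: nat
    proof -
      have "real (nat \<lfloor>n * t\<rfloor>) \<le> n * t" using assms(2) by simp
      then show ?thesis using that by (simp add: field_simps)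
    qed
    then show "\<forall>\<^sub>F n in sequentially. real (nat \<lfloor>n * t\<rfloor>) / n \<le> t"
      by (auto intro: eventually_mono[OF eventually_gt_at_top[of 0]])
    show "(\<lambda>n. t - 1 / real n) \<longlonglongrightarrow> t"
      using tendsto_diff[OF tendsto_const lim_1_over_n, of t] by simp
  qed auto
  then have "(\<lambda>n. \<phi> (real (nat \<lfloor>n * t\<rfloor>) / n)) \<longlonglongrightarrow> \<phi> t"
    using assms by (intro continuous_on_tendsto_compose[OF assms(1)]) auto
  moreover have "eventually (\<lambda>n. step n \<phi> t = \<phi> (real (nat \<lfloor>n * t\<rfloor>) / n)) sequentially"
  proof -
    obtain N :: nat where "t < N" using reals_Archimedean2 by blast
    then show ?thesis using assms(2)
      by (intro eventually_mono[OF eventually_ge_at_top[of N]]) (auto simp: step_eq)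
  qed
  ultimately show ?thesis by (simp add: tendsto_cong)
qed

lemma norm_step_le:
  assumes "\<And>t. t \<ge> 0 \<Longrightarrow> norm (\<phi> t) \<le> B" "t \<ge> 0"
  shows "norm (step n \<phi> t) \<le> B"
  using assms(1)[of 0] order_trans[OF norm_ge_zero assms(1)[of 0]]
  by (auto simp: step_eq assms)

lemma simple_function_step:
  assumes "sets \<nu> = sets borel_halfline"
  shows "simple_function \<nu> (step n \<phi>)"
proof -
  have "simple_function \<nu> (\<lambda>t. indicator (mesh n k) t *\<^sub>C \<phi> (real k / real n))" for k
    by (rule simple_function_compose1[where g="\<lambda>c. c *\<^sub>C \<phi> (real k / real n)"])
       (simp add: assms mesh_sets simple_function_indicator)
  then have "simple_function \<nu> (\<lambda>t. \<Sum>k<n*n. indicator (mesh n k) t *\<^sub>C \<phi> (real k / real n))"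
    by (intro simple_function_sum) auto
  then show ?thesis by (simp add: step_def[abs_def])
qed

lemma space_halfline: "sets \<nu> = sets borel_halfline \<Longrightarrow> space \<nu> = {0..}"
  by (drule sets_eq_imp_space_eq) (simp add: space_restrict_space)

lemma strongly_measurable_continuous:
  fixes \<phi> :: "real \<Rightarrow> 'a::cbanach"
  assumes "sets \<nu> = sets borel_halfline" "continuous_on {0..} \<phi>"
  shows "strongly_measurable \<nu> \<phi>"
  unfolding strongly_measurable_def
  using simple_function_step[OF assms(1)] step_tendsto[OF assms(2)] space_halfline[OF assms(1)]
  by (intro exI[of _ "\<lambda>n. step n \<phi>"]) auto

definition stieltjes_sum :: "(real set \<Rightarrow> complex) \<Rightarrow> (real \<Rightarrow> 'a::cbanach) \<Rightarrow> nat \<Rightarrow> 'a" where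
  "stieltjes_sum \<mu> \<phi> n = (\<Sum>k<n*n. \<mu> (mesh n k) *\<^sub>C \<phi> (real k / real n))"

text \<open>Computing the integral from \<open>\<mu>\<close> alone makes it independent of the representation of \<open>\<mu>\<close>
  by a density.\<close>

definition cm_integral :: "(real set \<Rightarrow> complex) \<Rightarrow> (real \<Rightarrow> 'a::cbanach) \<Rightarrow> 'a" where
  "cm_integral \<mu> \<phi> = lim (stieltjes_sum \<mu> \<phi>)"

text \<open>The reference measure may be infinite here, in contrast to \<open>represents\<close>:
  densities with respect to Lebesgue measure on the half-line are to be treated directly.\<close>

definition density_cm :: "real measure \<Rightarrow> (real \<Rightarrow> complex) \<Rightarrow> real set \<Rightarrow> complex" where
  "density_cm \<nu> h E = (LINT t:E|\<nu>. h t)"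

text \<open>The integral of \<open>step n \<phi>\<close> against \<open>h d\<nu>\<close> is exactly
  the \<open>n\<close>-th Stieltjes sum, which sees the measure only on the mesh cells. Dominated
  convergence then gives existence and value of the integral together.\<close>

theorem has_bochner_cm_integral:
  fixes \<phi> :: "real \<Rightarrow> 'a::cbanach"
  assumes \<nu>: "sets \<nu> = sets borel_halfline" and h: "integrable \<nu> h" and \<phi>: "\<phi> \<in> bcont"
  shows "has_bochner \<nu> (\<lambda>t. h t *\<^sub>C \<phi> t) (cm_integral (density_cm \<nu> h) \<phi>)"
    and "stieltjes_sum (density_cm \<nu> h) \<phi> \<longlonglongrightarrow> cm_integral (density_cm \<nu> h) \<phi>"
proof -
  have cont: "continuous_on {0..} \<phi>" using \<phi> by (simp add: bcont_def)
  obtain B where B: "\<And>t. t \<ge> 0 \<Longrightarrow> norm (\<phi> t) \<le> B"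
    using \<phi> by (auto simp: bcont_def bounded_iff)
  have [simp]: "space \<nu> = {0..}" using \<nu> by (rule space_halfline)
  have hm[measurable]: "h \<in> borel_measurable \<nu>" using h by auto
  have 1: "has_bochner \<nu> (\<lambda>t. h t *\<^sub>C step n \<phi> t) (stieltjes_sum (density_cm \<nu> h) \<phi> n)" for n
  proof -
    have int: "integrable \<nu> (\<lambda>t. indicator (mesh n k) t *\<^sub>R h t)" for k
      by (rule integrable_mult_indicator[OF _ h]) (simp add: \<nu> mesh_sets)
    have "has_bochner \<nu> (\<lambda>t. \<Sum>k<n*n. (indicator (mesh n k) t *\<^sub>R h t) *\<^sub>C \<phi> (real k / real n))
      (\<Sum>k<n*n. (\<integral>t. (indicator (mesh n k) t *\<^sub>R h t) \<partial>\<nu>) *\<^sub>C \<phi> (real k / real n))"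
      by (rule has_bochner_sum_scaleC) (auto intro: int)
    moreover have "(\<lambda>t. \<Sum>k<n*n. (indicator (mesh n k) t *\<^sub>R h t) *\<^sub>C \<phi> (real k / real n)) = (\<lambda>t. h t *\<^sub>C step n \<phi> t)"
      by (auto simp: step_def scaleC.sum_right scaleC_scaleC indicator_def scaleC_one intro!: sum.cong)
    ultimately show ?thesis by (simp add: stieltjes_sum_def density_cm_def set_lebesgue_integral_def)
  qed
  have sm: "strongly_measurable \<nu> (\<lambda>t. h t *\<^sub>C step n \<phi> t - h t *\<^sub>C \<phi> t)" for n
    by (intro strongly_measurable_diff strongly_measurable_scaleC hm strongly_measurable_continuous[OF \<nu> cont]
         strongly_measurable_simple simple_function_step[OF \<nu>])
  have 2: "\<exists>z. stieltjes_sum (density_cm \<nu> h) \<phi> \<longlonglongrightarrow> z \<and> has_bochner \<nu> (\<lambda>t. h t *\<^sub>C \<phi> t) z"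
  proof (rule has_bochner_limit[OF 1])
    show "(\<lambda>t. h t *\<^sub>C \<phi> t) \<in> borel_measurable \<nu>"
      by (intro strongly_measurable_borel strongly_measurable_scaleC hm strongly_measurable_continuous[OF \<nu> cont])
    show nm[measurable]: "(\<lambda>t. norm (h t *\<^sub>C step n \<phi> t - h t *\<^sub>C \<phi> t)) \<in> borel_measurable \<nu>" for n
      by (rule strongly_measurable_norm[OF sm])
    have "(\<lambda>n. \<integral>\<^sup>+t. ennreal (norm (h t *\<^sub>C step n \<phi> t - h t *\<^sub>C \<phi> t)) \<partial>\<nu>) \<longlonglongrightarrow> (\<integral>\<^sup>+t. 0 \<partial>\<nu>)"
    proof (rule nn_integral_dominated_convergence[where w="\<lambda>t. ennreal (cmod (h t) * (2 * B))"])
      have Bb: "norm (h t *\<^sub>C step n \<phi> t - h t *\<^sub>C \<phi> t) \<le> cmod (h t) * (2 * B)" if "t \<ge> 0" for t n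
      proof -
        have "norm (step n \<phi> t - \<phi> t) \<le> 2 * B"
          using norm_triangle_ineq4[of "step n \<phi> t" "\<phi> t"] norm_step_le[of \<phi>, OF B, of t n] B[OF that] that by simp
        then show ?thesis
          by (simp flip: scaleC.diff_right add: norm_scaleC mult_left_mono)
      qed
      show "AE t in \<nu>. ennreal (norm (h t *\<^sub>C step n \<phi> t - h t *\<^sub>C \<phi> t)) \<le> ennreal (cmod (h t) * (2 * B))" for n
        using Bb by (intro AE_I2 ennreal_leI) simp
      have "integrable \<nu> (\<lambda>t. cmod (h t) * (2 * B))" using h by auto
      moreover have "B \<ge> 0" using B[of 0] norm_ge_zero[of "\<phi> 0"] by linarith
      ultimately show "(\<integral>\<^sup>+t. ennreal (cmod (h t) * (2 * B)) \<partial>\<nu>) < \<infinity>"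
        by (subst nn_integral_eq_integral) auto
      show "AE t in \<nu>. (\<lambda>n. ennreal (norm (h t *\<^sub>C step n \<phi> t - h t *\<^sub>C \<phi> t))) \<longlonglongrightarrow> 0"
      proof (rule AE_I2)
        fix t assume "t \<in> space \<nu>"
        then have "(\<lambda>n. h t *\<^sub>C step n \<phi> t - h t *\<^sub>C \<phi> t) \<longlonglongrightarrow> h t *\<^sub>C \<phi> t - h t *\<^sub>C \<phi> t"
          by (intro tendsto_diff scaleC.tendsto tendsto_const step_tendsto[OF cont]) simp
        then have "(\<lambda>n. ennreal (norm (h t *\<^sub>C step n \<phi> t - h t *\<^sub>C \<phi> t))) \<longlonglongrightarrow> ennreal (norm (0::'a))"
          by (intro tendsto_ennrealI tendsto_norm) simp
        then show "(\<lambda>n. ennreal (norm (h t *\<^sub>C step n \<phi> t - h t *\<^sub>C \<phi> t))) \<longlonglongrightarrow> 0" by simp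
      qed
    qed measurable
    then show "(\<lambda>n. \<integral>\<^sup>+t. ennreal (norm (h t *\<^sub>C step n \<phi> t - h t *\<^sub>C \<phi> t)) \<partial>\<nu>) \<longlonglongrightarrow> 0" by simp
  qed
  then obtain z where z: "stieltjes_sum (density_cm \<nu> h) \<phi> \<longlonglongrightarrow> z" "has_bochner \<nu> (\<lambda>t. h t *\<^sub>C \<phi> t) z" by blast
  then have "cm_integral (density_cm \<nu> h) \<phi> = z" by (simp add: cm_integral_def limI)
  with z show "has_bochner \<nu> (\<lambda>t. h t *\<^sub>C \<phi> t) (cm_integral (density_cm \<nu> h) \<phi>)"
    and "stieltjes_sum (density_cm \<nu> h) \<phi> \<longlonglongrightarrow> cm_integral (density_cm \<nu> h) \<phi>" by simp_all
qed

subsection \<open>Rotation invariance of Gaussian sums\<close>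

text \<open>Along each line in its own direction a shear is a translation, under which Lebesgue
  measure is invariant.\<close>

lemma nn_integral_shear:
  fixes G :: "real \<times> real \<Rightarrow> ennreal"
  assumes [measurable]: "G \<in> borel_measurable (borel \<Otimes>\<^sub>M borel)"
  shows "(\<integral>\<^sup>+a. \<integral>\<^sup>+b. G (a + t * b, b) \<partial>lborel \<partial>lborel) = (\<integral>\<^sup>+a. \<integral>\<^sup>+b. G (a, b) \<partial>lborel \<partial>lborel)"
    and "(\<integral>\<^sup>+a. \<integral>\<^sup>+b. G (a, b + t * a) \<partial>lborel \<partial>lborel) = (\<integral>\<^sup>+a. \<integral>\<^sup>+b. G (a, b) \<partial>lborel \<partial>lborel)"
proof -
  have tr: "(\<integral>\<^sup>+a. H (a + c) \<partial>lborel) = (\<integral>\<^sup>+a. H a \<partial>lborel)"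
    if "H \<in> borel_measurable borel" for H :: "real \<Rightarrow> ennreal" and c
    using nn_integral_real_affine[OF that, of 1 c] by (simp add: add.commute)
  have "(\<integral>\<^sup>+a. \<integral>\<^sup>+b. G (a + t * b, b) \<partial>lborel \<partial>lborel) = (\<integral>\<^sup>+b. \<integral>\<^sup>+a. G (a + t * b, b) \<partial>lborel \<partial>lborel)"
    by (rule lborel_pair.Fubini') measurable
  also have "\<dots> = (\<integral>\<^sup>+b. \<integral>\<^sup>+a. G (a, b) \<partial>lborel \<partial>lborel)"
  proof (rule nn_integral_cong)
    fix b :: real
    have "(\<lambda>a. G (a, b)) \<in> borel_measurable borel" by measurable
    from tr[OF this, of "t * b"] show "(\<integral>\<^sup>+a. G (a + t * b, b) \<partial>lborel) = (\<integral>\<^sup>+a. G (a, b) \<partial>lborel)" .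
  qed
  also have "\<dots> = (\<integral>\<^sup>+a. \<integral>\<^sup>+b. G (a, b) \<partial>lborel \<partial>lborel)"
    by (rule lborel_pair.Fubini'[symmetric]) measurable
  finally show "(\<integral>\<^sup>+a. \<integral>\<^sup>+b. G (a + t * b, b) \<partial>lborel \<partial>lborel) = (\<integral>\<^sup>+a. \<integral>\<^sup>+b. G (a, b) \<partial>lborel \<partial>lborel)" .
  show "(\<integral>\<^sup>+a. \<integral>\<^sup>+b. G (a, b + t * a) \<partial>lborel \<partial>lborel) = (\<integral>\<^sup>+a. \<integral>\<^sup>+b. G (a, b) \<partial>lborel \<partial>lborel)"
  proof (rule nn_integral_cong)
    fix a :: real
    have "(\<lambda>b. G (a, b)) \<in> borel_measurable borel" by measurable
    from tr[OF this, of "t * a"] show "(\<integral>\<^sup>+b. G (a, b + t * a) \<partial>lborel) = (\<integral>\<^sup>+b. G (a, b) \<partial>lborel)" .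
  qed
qed

text \<open>A rotation is a product of three shears.\<close>

lemma nn_integral_rotation:
  fixes G :: "real \<times> real \<Rightarrow> ennreal"
  assumes [measurable]: "G \<in> borel_measurable (borel \<Otimes>\<^sub>M borel)"
    and cs: "c\<^sup>2 + s\<^sup>2 = 1" "c \<noteq> -1"
  shows "(\<integral>\<^sup>+a. \<integral>\<^sup>+b. G (c * a - s * b, s * a + c * b) \<partial>lborel \<partial>lborel) = (\<integral>\<^sup>+a. \<integral>\<^sup>+b. G (a, b) \<partial>lborel \<partial>lborel)"
proof -
  \<comment> \<open>For \<open>c = cos \<theta>\<close> and \<open>s = sin \<theta>\<close> this is
    \<open>- tan (\<theta> / 2)\<close>, which is why the half turn \<open>c = -1\<close> is left
    out. The outer shears are horizontal with slope \<open>t\<close>, the middle one is vertical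
    with slope \<open>s\<close>.\<close>
  define t where "t = - s / (1 + c)"
  have c1: "1 + c \<noteq> 0" using cs(2) by (simp add: add_eq_0_iff)
  have "s * s = (1 - c) * (1 + c)"
    using cs(1) by (simp add: power2_eq_square algebra_simps)
  then have st: "1 + s * t = c" using c1 by (simp add: t_def)
  have tc: "t * (1 + c) = - s" using c1 by (simp add: t_def)
  define H1 where "H1 = (\<lambda>(a, b). G (a + t * b, b))"
  define H2 where "H2 = (\<lambda>(a, b). H1 (a, b + s * a))"
  have [measurable]: "H1 \<in> borel_measurable (borel \<Otimes>\<^sub>M borel)" unfolding H1_def by measurable
  have [measurable]: "H2 \<in> borel_measurable (borel \<Otimes>\<^sub>M borel)" unfolding H2_def by measurable
  have "G (c * a - s * b, s * a + c * b) = H2 (a + t * b, b)" for a b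
  proof -
    have 1: "b + s * (a + t * b) = s * a + (1 + s * t) * b" by (simp add: algebra_simps)
    have "a + t * b + t * (s * a + c * b) = (1 + s * t) * a + (t * (1 + c)) * b" by (simp add: algebra_simps)
    then have 2: "a + t * b + t * (s * a + c * b) = c * a - s * b" unfolding st tc by simp
    show ?thesis
      unfolding H2_def H1_def prod.case 1 st 2 ..
  qed
  then have "(\<integral>\<^sup>+a. \<integral>\<^sup>+b. G (c * a - s * b, s * a + c * b) \<partial>lborel \<partial>lborel) = (\<integral>\<^sup>+a. \<integral>\<^sup>+b. H2 (a + t * b, b) \<partial>lborel \<partial>lborel)"
    by simp
  also have "\<dots> = (\<integral>\<^sup>+a. \<integral>\<^sup>+b. H2 (a, b) \<partial>lborel \<partial>lborel)"
    by (rule nn_integral_shear) measurable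
  also have "\<dots> = (\<integral>\<^sup>+a. \<integral>\<^sup>+b. H1 (a, b + s * a) \<partial>lborel \<partial>lborel)" by (simp add: H2_def)
  also have "\<dots> = (\<integral>\<^sup>+a. \<integral>\<^sup>+b. H1 (a, b) \<partial>lborel \<partial>lborel)"
    by (rule nn_integral_shear) measurable
  also have "\<dots> = (\<integral>\<^sup>+a. \<integral>\<^sup>+b. G (a + t * b, b) \<partial>lborel \<partial>lborel)" by (simp add: H1_def)
  also have "\<dots> = (\<integral>\<^sup>+a. \<integral>\<^sup>+b. G (a, b) \<partial>lborel \<partial>lborel)"
    by (rule nn_integral_shear) measurable
  finally show ?thesis .
qed

section \<open>Rotations of real and complex Gaussian variables\<close>

abbreviation "std_gaussian \<equiv> density lborel std_normal_density"

lemma nn_integral_std_gaussian: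
  assumes [measurable]: "f \<in> borel_measurable borel"
  shows "(\<integral>\<^sup>+a. f a \<partial>std_gaussian) = (\<integral>\<^sup>+a. ennreal (std_normal_density a) * f a \<partial>lborel)"
  by (rule nn_integral_density) (auto simp: normal_density_nonneg)

text \<open>Written jointly, the density depends on \<open>a\<^sup>2 + b\<^sup>2\<close> alone, a
  quantity that rotations preserve.\<close>

lemma nn_integral_std_gaussian2:
  assumes [measurable]: "f \<in> borel_measurable (borel \<Otimes>\<^sub>M borel)"
  shows "(\<integral>\<^sup>+a. \<integral>\<^sup>+b. f (a, b) \<partial>std_gaussian \<partial>std_gaussian)
    = (\<integral>\<^sup>+a. \<integral>\<^sup>+b. ennreal (exp (- (a\<^sup>2 + b\<^sup>2) / 2) / (2 * pi)) * f (a, b) \<partial>lborel \<partial>lborel)"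
proof -
  have m: "(\<lambda>a. \<integral>\<^sup>+b. ennreal (std_normal_density b) * f (a, b) \<partial>lborel) \<in> borel_measurable borel"
    by measurable
  have e: "std_normal_density a * std_normal_density b = exp (- (a\<^sup>2 + b\<^sup>2) / 2) / (2 * pi)" for a b
    by (simp add: std_normal_density_def add_divide_distrib diff_divide_distrib flip: exp_add)
  have "(\<integral>\<^sup>+a. \<integral>\<^sup>+b. f (a, b) \<partial>std_gaussian \<partial>std_gaussian)
      = (\<integral>\<^sup>+a. \<integral>\<^sup>+b. ennreal (std_normal_density b) * f (a, b) \<partial>lborel \<partial>std_gaussian)"
    by (intro nn_integral_cong nn_integral_std_gaussian) measurable
  also have "\<dots> = (\<integral>\<^sup>+a. ennreal (std_normal_density a) * (\<integral>\<^sup>+b. ennreal (std_normal_density b) * f (a, b) \<partial>lborel) \<partial>lborel)"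
    by (rule nn_integral_std_gaussian[OF m])
  also have "\<dots> = (\<integral>\<^sup>+a. \<integral>\<^sup>+b. ennreal (std_normal_density a) * (ennreal (std_normal_density b) * f (a, b)) \<partial>lborel \<partial>lborel)"
    by (intro nn_integral_cong nn_integral_cmult[symmetric]) measurable
  also have "\<dots> = (\<integral>\<^sup>+a. \<integral>\<^sup>+b. ennreal (exp (- (a\<^sup>2 + b\<^sup>2) / 2) / (2 * pi)) * f (a, b) \<partial>lborel \<partial>lborel)"
    by (simp add: mult.assoc[symmetric] ennreal_mult[symmetric] normal_density_nonneg e)
  finally show ?thesis .
qed

lemma std_gaussian_rotation:
  fixes f :: "real \<times> real \<Rightarrow> ennreal"
  assumes [measurable]: "f \<in> borel_measurable (borel \<Otimes>\<^sub>M borel)"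
    and cs: "c\<^sup>2 + s\<^sup>2 = 1" "c \<noteq> -1"
  shows "(\<integral>\<^sup>+a. \<integral>\<^sup>+b. f (c * a - s * b, s * a + c * b) \<partial>std_gaussian \<partial>std_gaussian)
    = (\<integral>\<^sup>+a. \<integral>\<^sup>+b. f (a, b) \<partial>std_gaussian \<partial>std_gaussian)"
proof -
  define N where "N r = ennreal (exp (- r / 2) / (2 * pi))" for r
  have [measurable]: "N \<in> borel_measurable borel" unfolding N_def by measurable
  have dens: "(\<integral>\<^sup>+a. \<integral>\<^sup>+b. h (a, b) \<partial>std_gaussian \<partial>std_gaussian) = (\<integral>\<^sup>+a. \<integral>\<^sup>+b. N (a\<^sup>2 + b\<^sup>2) * h (a, b) \<partial>lborel \<partial>lborel)"
    if "h \<in> borel_measurable (borel \<Otimes>\<^sub>M borel)" for h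
    unfolding N_def by (rule nn_integral_std_gaussian2[OF that])
  define G where "G = (\<lambda>(a, b). N (a\<^sup>2 + b\<^sup>2) * f (a, b))"
  define F where "F = (\<lambda>(a, b). f (c * a - s * b, s * a + c * b))"
  have [measurable]: "G \<in> borel_measurable (borel \<Otimes>\<^sub>M borel)" unfolding G_def by measurable
  have [measurable]: "F \<in> borel_measurable (borel \<Otimes>\<^sub>M borel)" unfolding F_def by measurable
  have sq: "(c * a - s * b)\<^sup>2 + (s * a + c * b)\<^sup>2 = a\<^sup>2 + b\<^sup>2" for a b
  proof -
    have "(c * a - s * b)\<^sup>2 + (s * a + c * b)\<^sup>2 = (c\<^sup>2 + s\<^sup>2) * (a\<^sup>2 + b\<^sup>2)"
      by (simp add: power2_eq_square algebra_simps)
    then show ?thesis using cs by simp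
  qed
  have "(\<integral>\<^sup>+a. \<integral>\<^sup>+b. F (a, b) \<partial>std_gaussian \<partial>std_gaussian)
     = (\<integral>\<^sup>+a. \<integral>\<^sup>+b. G (c * a - s * b, s * a + c * b) \<partial>lborel \<partial>lborel)"
    by (subst dens) (simp_all add: G_def F_def sq)
  also have "\<dots> = (\<integral>\<^sup>+a. \<integral>\<^sup>+b. G (a, b) \<partial>lborel \<partial>lborel)"
    by (rule nn_integral_rotation) (use cs in measurable)
  also have "\<dots> = (\<integral>\<^sup>+a. \<integral>\<^sup>+b. f (a, b) \<partial>std_gaussian \<partial>std_gaussian)"
    by (subst dens) (simp_all add: G_def)
  finally show ?thesis by (simp add: F_def)
qed

abbreviation "cgauss \<equiv> std_complex_gaussian"

interpretation cgauss: prob_space cgauss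
  by (rule prob_space_std_complex_gaussian)

interpretation cgauss2: pair_sigma_finite cgauss cgauss ..

lemma prob_space_std_gaussian: "prob_space std_gaussian"
  by (rule prob_space_normal_density) simp

interpretation std_gaussian: prob_space std_gaussian
  by (rule prob_space_std_gaussian)

interpretation std_gaussian2: pair_sigma_finite std_gaussian std_gaussian ..

lemma sets_cgauss [simp, measurable_cong]: "sets cgauss = sets borel"
  by (simp add: std_complex_gaussian_def)

lemma space_cgauss [simp]: "space cgauss = UNIV"
  by (simp add: std_complex_gaussian_def)

definition "cplx a b = Complex (a / sqrt 2) (b / sqrt 2)"

lemma measurable_cplx [measurable]:
  assumes [measurable]: "f \<in> borel_measurable M" "h \<in> borel_measurable M"
  shows "(\<lambda>x. cplx (f x) (h x)) \<in> borel_measurable M"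
  unfolding cplx_def Complex_eq by measurable

lemma nn_integral_cgauss:
  assumes [measurable]: "F \<in> borel_measurable borel"
  shows "(\<integral>\<^sup>+g. F g \<partial>cgauss) = (\<integral>\<^sup>+a. \<integral>\<^sup>+b. F (cplx a b) \<partial>std_gaussian \<partial>std_gaussian)"
proof -
  have c: "(\<lambda>(a, b). Complex (a / sqrt 2) (b / sqrt 2)) = (\<lambda>(a, b). cplx a b)"
    by (simp add: cplx_def)
  have "(\<integral>\<^sup>+g. F g \<partial>cgauss) = (\<integral>\<^sup>+x. F (case x of (a, b) \<Rightarrow> cplx a b) \<partial>(std_gaussian \<Otimes>\<^sub>M std_gaussian))"
    unfolding std_complex_gaussian_def c by (rule nn_integral_distr) measurable
  also have "\<dots> = (\<integral>\<^sup>+a. \<integral>\<^sup>+b. F (cplx a b) \<partial>std_gaussian \<partial>std_gaussian)"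
    by (subst std_gaussian.nn_integral_fst[symmetric]) auto
  finally show ?thesis .
qed

text \<open>Multiplication by \<open>u\<close> rotates the pair of real and imaginary parts by the
  angle of \<open>u\<close>. This covers all \<open>u\<close> except -1, which is a product of two
  quarter turns.\<close>

lemma cgauss_phase:
  assumes F[measurable]: "F \<in> borel_measurable borel" and u: "cmod u = 1"
  shows "(\<integral>\<^sup>+g. F (u * g) \<partial>cgauss) = (\<integral>\<^sup>+g. F g \<partial>cgauss)"
proof -
  have main: "(\<integral>\<^sup>+g. F (u * g) \<partial>cgauss) = (\<integral>\<^sup>+g. F g \<partial>cgauss)"
    if [measurable]: "F \<in> borel_measurable borel" and u: "cmod u = 1" and "u \<noteq> -1" for F and u
  proof -
    have m: "(\<lambda>(a, b). F (cplx a b)) \<in> borel_measurable (borel \<Otimes>\<^sub>M borel)"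
      by measurable
    have cs: "(Re u)\<^sup>2 + (Im u)\<^sup>2 = 1" using u by (simp add: cmod_def real_sqrt_eq_1_iff)
    have ne: "Re u \<noteq> -1"
    proof
      assume r: "Re u = -1"
      then have "Im u = 0" using cs by simp
      with r that(3) show False by (simp add: complex_eq_iff)
    qed
    have eq: "u * cplx a b = cplx (Re u * a - Im u * b) (Im u * a + Re u * b)" for a b
      by (simp add: cplx_def complex_eq_iff diff_divide_distrib add_divide_distrib)
    have "(\<integral>\<^sup>+g. F (u * g) \<partial>cgauss) = (\<integral>\<^sup>+a. \<integral>\<^sup>+b. F (u * cplx a b) \<partial>std_gaussian \<partial>std_gaussian)"
      by (rule nn_integral_cgauss) measurable
    also have "\<dots> = (\<integral>\<^sup>+a. \<integral>\<^sup>+b. F (cplx a b) \<partial>std_gaussian \<partial>std_gaussian)"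
      using std_gaussian_rotation[OF m cs ne] by (simp add: eq)
    also have "\<dots> = (\<integral>\<^sup>+g. F g \<partial>cgauss)"
      by (rule nn_integral_cgauss[symmetric]) measurable
    finally show ?thesis .
  qed
  show ?thesis
  proof (cases "u = -1")
    case True
    have m: "(\<lambda>g. F (\<i> * g)) \<in> borel_measurable borel" by measurable
    have "(\<integral>\<^sup>+g. F (\<i> * (\<i> * g)) \<partial>cgauss) = (\<integral>\<^sup>+g. F g \<partial>cgauss)"
      using main[OF m, of \<i>] main[OF F, of \<i>] by (simp add: complex_eq_iff)
    then show ?thesis by (simp add: True mult.assoc[symmetric])
  qed (use main F u in blast)
qed

text \<open>A real rotation of two complex variables rotates the two real parts and, by the same
  angle, the two imaginary parts. Interchanging the middle integrations makes the members of each
  pair adjacent, and the planar statement applies twice.\<close>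

lemma cgauss_rotation:
  fixes F :: "complex \<times> complex \<Rightarrow> ennreal"
  assumes F[measurable]: "F \<in> borel_measurable (borel \<Otimes>\<^sub>M borel)"
    and cs: "c\<^sup>2 + s\<^sup>2 = 1" "c \<noteq> -1"
  shows "(\<integral>\<^sup>+g. \<integral>\<^sup>+g'. F (of_real c * g - of_real s * g', of_real s * g + of_real c * g') \<partial>cgauss \<partial>cgauss)
    = (\<integral>\<^sup>+g. \<integral>\<^sup>+g'. F (g, g') \<partial>cgauss \<partial>cgauss)"
proof -
  have four: "(\<integral>\<^sup>+g. \<integral>\<^sup>+g'. H (g, g') \<partial>cgauss \<partial>cgauss)
    = (\<integral>\<^sup>+a. \<integral>\<^sup>+a'. \<integral>\<^sup>+b. \<integral>\<^sup>+b'. H (cplx a b, cplx a' b') \<partial>std_gaussian \<partial>std_gaussian \<partial>std_gaussian \<partial>std_gaussian)"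
    if [measurable]: "H \<in> borel_measurable (borel \<Otimes>\<^sub>M borel)" for H :: "complex \<times> complex \<Rightarrow> ennreal"
  proof -
    have m: "(\<lambda>g. \<integral>\<^sup>+g'. H (g, g') \<partial>cgauss) \<in> borel_measurable borel" by measurable
    have "(\<integral>\<^sup>+g. \<integral>\<^sup>+g'. H (g, g') \<partial>cgauss \<partial>cgauss) = (\<integral>\<^sup>+a. \<integral>\<^sup>+b. \<integral>\<^sup>+g'. H (cplx a b, g') \<partial>cgauss \<partial>std_gaussian \<partial>std_gaussian)"
      by (rule nn_integral_cgauss[OF m])
    also have "\<dots> = (\<integral>\<^sup>+a. \<integral>\<^sup>+b. \<integral>\<^sup>+a'. \<integral>\<^sup>+b'. H (cplx a b, cplx a' b') \<partial>std_gaussian \<partial>std_gaussian \<partial>std_gaussian \<partial>std_gaussian)"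
      by (intro nn_integral_cong nn_integral_cgauss) measurable
    also have "\<dots> = (\<integral>\<^sup>+a. \<integral>\<^sup>+a'. \<integral>\<^sup>+b. \<integral>\<^sup>+b'. H (cplx a b, cplx a' b') \<partial>std_gaussian \<partial>std_gaussian \<partial>std_gaussian \<partial>std_gaussian)"
      by (intro nn_integral_cong std_gaussian2.Fubini') measurable
    finally show ?thesis .
  qed
  define f where "f = (\<lambda>(a, a'). \<integral>\<^sup>+b. \<integral>\<^sup>+b'. F (cplx a b, cplx a' b') \<partial>std_gaussian \<partial>std_gaussian)"
  have fm: "f \<in> borel_measurable (borel \<Otimes>\<^sub>M borel)" unfolding f_def by measurable
  define H where "H = (\<lambda>(g, g'). F (of_real c * g - of_real s * g', of_real s * g + of_real c * g'))"
  have Hm: "H \<in> borel_measurable (borel \<Otimes>\<^sub>M borel)" unfolding H_def by measurable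
  have H: "H (cplx a b, cplx a' b') = F (cplx (c * a - s * a') (c * b - s * b'), cplx (s * a + c * a') (s * b + c * b'))"
    for a b a' b'
    by (simp add: H_def cplx_def complex_eq_iff diff_divide_distrib add_divide_distrib Complex_eq algebra_simps)
  have "(\<integral>\<^sup>+b. \<integral>\<^sup>+b'. H (cplx a b, cplx a' b') \<partial>std_gaussian \<partial>std_gaussian) = f (c * a - s * a', s * a + c * a')" for a a'
  proof -
    define h where "h = (\<lambda>(b, b'). F (cplx (c * a - s * a') b, cplx (s * a + c * a') b'))"
    have hm: "h \<in> borel_measurable (borel \<Otimes>\<^sub>M borel)" unfolding h_def by measurable
    show ?thesis using std_gaussian_rotation[OF hm cs] by (simp add: H h_def f_def)
  qed
  then have "(\<integral>\<^sup>+g. \<integral>\<^sup>+g'. H (g, g') \<partial>cgauss \<partial>cgauss)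
      = (\<integral>\<^sup>+a. \<integral>\<^sup>+a'. f (c * a - s * a', s * a + c * a') \<partial>std_gaussian \<partial>std_gaussian)"
    by (simp add: four[OF Hm])
  also have "\<dots> = (\<integral>\<^sup>+a. \<integral>\<^sup>+a'. f (a, a') \<partial>std_gaussian \<partial>std_gaussian)"
    by (rule std_gaussian_rotation[OF fm cs])
  also have "\<dots> = (\<integral>\<^sup>+g. \<integral>\<^sup>+g'. F (g, g') \<partial>cgauss \<partial>cgauss)"
    by (simp add: four[OF F] f_def)
  finally show ?thesis by (simp add: H_def)
qed

subsection \<open>Second moments of Gaussian sums\<close>

text \<open>The value of \<open>gauss_moment xs a\<close> is the second moment of \<open>norm (a + \<Sum>i g\<^sub>i x\<^sub>i)\<close> for independent
  Gaussian \<open>g\<^sub>i\<close>; a list instead of an index set admits repetitions.\<close>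

primrec gauss_moment :: "'a::cbanach list \<Rightarrow> 'a \<Rightarrow> ennreal" where
  "gauss_moment [] a = ennreal ((norm a)\<^sup>2)"
| "gauss_moment (x # xs) a = (\<integral>\<^sup>+g. gauss_moment xs (a + g *\<^sub>C x) \<partial>cgauss)"

text \<open>Lower semicontinuity provides measurability although the space may be nonseparable.\<close>

lemma gauss_moment_lsc:
  fixes xs :: "'a::cbanach list"
  shows "(\<forall>f a. f \<longlonglongrightarrow> a \<longrightarrow> gauss_moment xs a \<le> liminf (\<lambda>n. gauss_moment xs (f n)))
     \<and> gauss_moment xs \<in> borel_measurable borel"
\<comment> \<open>Both claims have to be carried along together: Fatou's lemma for one more Gaussian
  needs measurability of the inner moment, while measurability comes from closed sublevel sets, that
  is, from lower semicontinuity.\<close>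
proof (induction xs)
  case Nil
  have "gauss_moment [] a \<le> liminf (\<lambda>n. gauss_moment [] (f n))" if "f \<longlonglongrightarrow> a" for f and a :: 'a
  proof -
    have "(\<lambda>n. ennreal ((norm (f n))\<^sup>2)) \<longlonglongrightarrow> ennreal ((norm a)\<^sup>2)"
      using that by (intro tendsto_ennrealI tendsto_intros)
    then have "liminf (\<lambda>n. ennreal ((norm (f n))\<^sup>2)) = ennreal ((norm a)\<^sup>2)"
      by (intro lim_imp_Liminf) simp_all
    then show ?thesis by simp
  qed
  moreover have "(\<lambda>a::'a. (norm a)\<^sup>2) \<in> borel_measurable borel"
    by (intro borel_measurable_continuous_onI continuous_intros)
  ultimately show ?case by simp
next
  case (Cons x xs)
  have m: "(\<lambda>g. gauss_moment xs (a + g *\<^sub>C x)) \<in> borel_measurable cgauss" for a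
  proof (rule measurable_compose[where N=borel and f="\<lambda>g. a + g *\<^sub>C x"])
    have "(\<lambda>g. a + g *\<^sub>C x) \<in> borel_measurable borel"
      by (intro borel_measurable_continuous_onI continuous_intros scaleC.continuous_on)
    then show "(\<lambda>g. a + g *\<^sub>C x) \<in> borel_measurable cgauss"
      by (simp cong: measurable_cong_sets)
  qed (use Cons in simp)
  have lsc: "gauss_moment (x # xs) a \<le> liminf (\<lambda>n. gauss_moment (x # xs) (f n))" if "f \<longlonglongrightarrow> a" for f a
  proof -
    have "(\<integral>\<^sup>+g. gauss_moment xs (a + g *\<^sub>C x) \<partial>cgauss)
        \<le> (\<integral>\<^sup>+g. liminf (\<lambda>n. gauss_moment xs (f n + g *\<^sub>C x)) \<partial>cgauss)"
    proof (rule nn_integral_mono)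
      fix g
      have "(\<lambda>n. f n + g *\<^sub>C x) \<longlonglongrightarrow> a + g *\<^sub>C x" by (intro tendsto_intros that)
      then show "gauss_moment xs (a + g *\<^sub>C x) \<le> liminf (\<lambda>n. gauss_moment xs (f n + g *\<^sub>C x))"
        using Cons by blast
    qed
    also have "\<dots> \<le> liminf (\<lambda>n. \<integral>\<^sup>+g. gauss_moment xs (f n + g *\<^sub>C x) \<partial>cgauss)"
      by (rule nn_integral_liminf) (rule m)
    finally show ?thesis by simp
  qed
  moreover have "gauss_moment (x # xs) \<in> borel_measurable borel"
  proof (rule borel_measurableI_le)
    fix y
    have "closed {a. gauss_moment (x # xs) a \<le> y}"
      unfolding closed_sequential_limits
    proof (intro allI impI, elim conjE)
      fix f a assume f: "\<forall>n. f n \<in> {a. gauss_moment (x # xs) a \<le> y}" "f \<longlonglongrightarrow> a"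
      have "gauss_moment (x # xs) a \<le> liminf (\<lambda>n. gauss_moment (x # xs) (f n))" by (rule lsc[OF f(2)])
      also have "\<dots> \<le> liminf (\<lambda>n. y)" using f(1) by (intro Liminf_mono) auto
      also have "\<dots> = y" by (simp add: Liminf_const)
      finally show "a \<in> {a. gauss_moment (x # xs) a \<le> y}" by simp
    qed
    then show "{a \<in> space borel. gauss_moment (x # xs) a \<le> y} \<in> sets borel" by simp
  qed
  ultimately show ?case by blast
qed

lemma gauss_moment_comp_measurable:
  fixes f :: "'b::t2_space \<Rightarrow> 'a::cbanach"
  assumes "continuous_on UNIV f"
  shows "(\<lambda>g. gauss_moment xs (f g)) \<in> borel_measurable borel"
  by (rule measurable_compose[OF borel_measurable_continuous_onI[OF assms] conjunct2[OF gauss_moment_lsc]])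

lemma gauss_moment_measurable1 [measurable]: "(\<lambda>g. gauss_moment xs (a + g *\<^sub>C x)) \<in> borel_measurable borel"
  by (intro gauss_moment_comp_measurable continuous_intros scaleC.continuous_on)

lemma gauss_moment_measurable2:
  "(\<lambda>(g, g'). gauss_moment xs (a + g *\<^sub>C x + g' *\<^sub>C y)) \<in> borel_measurable (borel \<Otimes>\<^sub>M borel)"
  unfolding borel_prod split_beta'
  by (intro gauss_moment_comp_measurable continuous_intros scaleC.continuous_on)

lemma gauss_moment_swap: "gauss_moment (x # y # xs) = gauss_moment (y # x # xs)"
proof
  fix a
  have "(\<integral>\<^sup>+g. \<integral>\<^sup>+g'. gauss_moment xs (a + g *\<^sub>C x + g' *\<^sub>C y) \<partial>cgauss \<partial>cgauss)
      = (\<integral>\<^sup>+g'. \<integral>\<^sup>+g. gauss_moment xs (a + g *\<^sub>C x + g' *\<^sub>C y) \<partial>cgauss \<partial>cgauss)"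
    using gauss_moment_measurable2[of xs a y x]
    by (intro cgauss2.Fubini') (simp add: add.assoc add.commute add.left_commute split_beta' cong: measurable_cong_sets)
  then show "gauss_moment (x # y # xs) a = gauss_moment (y # x # xs) a"
    by (simp add: algebra_simps)
qed

lemma gauss_moment_Cons_cong: "gauss_moment xs = gauss_moment ys \<Longrightarrow> gauss_moment (x # xs) = gauss_moment (x # ys)"
  by (rule ext) simp

lemma gauss_moment_perm:
  "mset xs = mset ys \<Longrightarrow> gauss_moment xs = gauss_moment ys"
proof (induction xs arbitrary: ys)
  case Nil
  then show ?case by simp
next
  case (Cons x xs)
  have move: "gauss_moment (x # us @ vs) = gauss_moment (us @ x # vs)" for us vs
  proof (induction us)
    case (Cons u us)
    have "gauss_moment (x # (u # us) @ vs) = gauss_moment (u # x # us @ vs)"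
      using gauss_moment_swap by simp
    also have "\<dots> = gauss_moment (u # us @ x # vs)" by (rule gauss_moment_Cons_cong[OF Cons.IH])
    finally show ?case by simp
  qed simp
  have "x \<in> set ys" using Cons.prems by (metis list.set_intros(1) set_mset_mset)
  then obtain us vs where ys: "ys = us @ x # vs" by (meson split_list)
  then have "mset xs = mset (us @ vs)" using Cons.prems by simp
  then have "gauss_moment (x # xs) = gauss_moment (x # us @ vs)"
    by (intro gauss_moment_Cons_cong Cons.IH)
  then show ?case by (simp only: move ys)
qed

text \<open>Equality of moments as functions of the offset is inherited when vectors are prepended,
  so the prefix is replaced after a permutation has moved it to the end.\<close>

lemma gauss_moment_append_cong:
  assumes "gauss_moment xs = gauss_moment xs'" "gauss_moment ys = gauss_moment ys'"
  shows "gauss_moment (xs @ ys) = gauss_moment (xs' @ ys')"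
proof -
  have pre: "gauss_moment (zs @ us) = gauss_moment (zs @ vs)" if "gauss_moment us = gauss_moment vs" for zs us vs :: "'a list"
    by (induction zs) (use that in \<open>auto intro: gauss_moment_Cons_cong simp del: gauss_moment.simps\<close>)
  have "gauss_moment (xs @ ys) = gauss_moment (xs @ ys')" by (rule pre[OF assms(2)])
  also have "\<dots> = gauss_moment (ys' @ xs)" by (rule gauss_moment_perm) simp
  also have "\<dots> = gauss_moment (ys' @ xs')" by (rule pre[OF assms(1)])
  also have "\<dots> = gauss_moment (xs' @ ys')" by (rule gauss_moment_perm) simp
  finally show ?thesis .
qed

lemma gauss_moment_rotation:
  assumes cs: "c\<^sup>2 + s\<^sup>2 = 1" "c \<noteq> -1"
  shows "gauss_moment (x # y # xs) = gauss_moment ((c *\<^sub>R x + s *\<^sub>R y) # (c *\<^sub>R y - s *\<^sub>R x) # xs)"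
proof
  fix a
  let ?F = "\<lambda>(g, g'). gauss_moment xs (a + g *\<^sub>C x + g' *\<^sub>C y)"
  have eq: "a + (of_real c * g - of_real s * g') *\<^sub>C x + (of_real s * g + of_real c * g') *\<^sub>C y
      = a + g *\<^sub>C (c *\<^sub>R x + s *\<^sub>R y) + g' *\<^sub>C (c *\<^sub>R y - s *\<^sub>R x)" for g g'
    by (simp add: scaleR_scaleC scaleC_add_left scaleC_add_right scaleC.diff_left scaleC.diff_right scaleC_scaleC mult.commute)
  have "(\<integral>\<^sup>+g. \<integral>\<^sup>+g'. ?F (g, g') \<partial>cgauss \<partial>cgauss)
      = (\<integral>\<^sup>+g. \<integral>\<^sup>+g'. ?F (of_real c * g - of_real s * g', of_real s * g + of_real c * g') \<partial>cgauss \<partial>cgauss)"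
    by (rule cgauss_rotation[symmetric, OF gauss_moment_measurable2 cs])
  then show "gauss_moment (x # y # xs) a = gauss_moment ((c *\<^sub>R x + s *\<^sub>R y) # (c *\<^sub>R y - s *\<^sub>R x) # xs) a"
    by (simp add: eq)
qed

lemma gauss_moment_phase:
  assumes "cmod u = 1"
  shows "gauss_moment (u *\<^sub>C x # xs) = gauss_moment (x # xs)"
proof
  fix a
  show "gauss_moment (u *\<^sub>C x # xs) a = gauss_moment (x # xs) a"
    using cgauss_phase[OF gauss_moment_measurable1 assms, of xs a x]
    by (simp add: scaleC_scaleC mult.commute)
qed

text \<open>Rotation by 45 degrees yields the difference with the opposite sign, which the phase -1
  repairs. The resulting reflection is the elementary step of the fast Fourier transform.\<close>

lemma gauss_moment_butterfly:
  "gauss_moment (x # y # xs) = gauss_moment ((1 / sqrt 2) *\<^sub>R (x + y) # (1 / sqrt 2) *\<^sub>R (x - y) # xs)"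
proof -
  let ?r = "1 / sqrt 2"
  have r2: "?r\<^sup>2 + ?r\<^sup>2 = 1" by (simp add: power_divide)
  have "?r \<noteq> -1" by (smt (verit) divide_nonneg_nonneg real_sqrt_ge_zero)
  then have "gauss_moment (x # y # xs) = gauss_moment ((?r *\<^sub>R x + ?r *\<^sub>R y) # (?r *\<^sub>R y - ?r *\<^sub>R x) # xs)"
    by (rule gauss_moment_rotation[OF r2])
  also have "?r *\<^sub>R y - ?r *\<^sub>R x = (-1) *\<^sub>C (?r *\<^sub>R (x - y))"
    by (simp add: scaleC.minus_left scaleC_one scaleR_diff_right)
  also have "gauss_moment ((?r *\<^sub>R x + ?r *\<^sub>R y) # (-1) *\<^sub>C (?r *\<^sub>R (x - y)) # xs)
      = gauss_moment ((?r *\<^sub>R x + ?r *\<^sub>R y) # (?r *\<^sub>R (x - y)) # xs)"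
    by (intro gauss_moment_Cons_cong gauss_moment_phase) simp
  finally show ?thesis by (simp add: scaleR_add_right del: gauss_moment.simps)
qed

section \<open>Convexity, contraction by diagonal matrices, finiteness\<close>

lemma gauss_moment_convex:
  "2 * gauss_moment xs ((1/2) *\<^sub>R (p + q)) \<le> gauss_moment xs p + gauss_moment xs q"
proof (induction xs arbitrary: p q)
  case Nil
  have "norm ((1/2) *\<^sub>R (p + q)) \<le> (norm p + norm q) / 2"
    using norm_triangle_ineq[of p q] by simp
  then have "2 * (norm ((1/2) *\<^sub>R (p + q)))\<^sup>2 \<le> 2 * ((norm p + norm q) / 2)\<^sup>2"
    by (intro mult_left_mono power_mono) auto
  also have "\<dots> \<le> (norm p)\<^sup>2 + (norm q)\<^sup>2"
    using sum_squares_bound[of "norm p" "norm q"] by (simp add: power2_eq_square field_simps)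
  finally have "ennreal (2 * (norm ((1/2) *\<^sub>R (p + q)))\<^sup>2) \<le> ennreal ((norm p)\<^sup>2 + (norm q)\<^sup>2)"
    by (rule ennreal_leI)
  then show ?case by (simp add: ennreal_mult' ennreal_plus)
next
  case (Cons x xs)
  have eq: "(1/2) *\<^sub>R (p + q) + g *\<^sub>C x = (1/2) *\<^sub>R ((p + g *\<^sub>C x) + (q + g *\<^sub>C x))" for g
    by (simp add: scaleR_add_right flip: scaleR_left.add)
  have "2 * gauss_moment (x # xs) ((1/2) *\<^sub>R (p + q)) = (\<integral>\<^sup>+g. 2 * gauss_moment xs ((1/2) *\<^sub>R (p + q) + g *\<^sub>C x) \<partial>cgauss)"
    by (simp add: nn_integral_cmult)
  also have "\<dots> \<le> (\<integral>\<^sup>+g. gauss_moment xs (p + g *\<^sub>C x) + gauss_moment xs (q + g *\<^sub>C x) \<partial>cgauss)"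
    unfolding eq by (intro nn_integral_mono Cons.IH)
  also have "\<dots> = gauss_moment (x # xs) p + gauss_moment (x # xs) q"
    by (simp add: nn_integral_add)
  finally show ?case .
qed

text \<open>A point of the closed unit disc is the midpoint of two points of the unit circle.\<close>

lemma gauss_moment_contract1:
  assumes "cmod d \<le> 1"
  shows "gauss_moment (d *\<^sub>C x # xs) a \<le> gauss_moment (x # xs) a"
proof -
  \<comment> \<open>The two points of the unit circle whose chord has midpoint \<open>d\<close> lie
    at the angle \<open>arccos (cmod d)\<close> on either side of the direction of
    \<open>d\<close>.\<close>
  define \<alpha> where "\<alpha> = arccos (cmod d)"
  define u where "u = cis (Arg d + \<alpha>)"
  define v where "v = cis (Arg d - \<alpha>)"
  have "u + v = 2 * of_real (cos \<alpha>) * cis (Arg d)"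
    by (simp add: u_def v_def complex_eq_iff cos_add sin_add cos_diff sin_diff)
  also have "cos \<alpha> = cmod d" unfolding \<alpha>_def using assms norm_ge_zero[of d] by (intro cos_arccos) (linarith, simp)
  also have "2 * of_real (cmod d) * cis (Arg d) = 2 * d"
    using rcis_cmod_Arg[of d] by (simp add: rcis_def)
  finally have uv: "u + v = 2 * d" .
  have eq: "a + g *\<^sub>C d *\<^sub>C x = (1/2) *\<^sub>R ((a + g *\<^sub>C u *\<^sub>C x) + (a + g *\<^sub>C v *\<^sub>C x))" for g
  proof -
    have "(a + g *\<^sub>C u *\<^sub>C x) + (a + g *\<^sub>C v *\<^sub>C x) = 2 *\<^sub>R a + g *\<^sub>C (u + v) *\<^sub>C x"
      by (simp add: scaleC_add_left scaleC_add_right scaleR_2)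
    also have "g *\<^sub>C (u + v) *\<^sub>C x = 2 *\<^sub>R (g *\<^sub>C d *\<^sub>C x)"
      by (simp add: uv scaleR_scaleC scaleC_scaleC mult.left_commute)
    finally show ?thesis by (simp add: scaleR_add_right)
  qed
  have "2 * gauss_moment (d *\<^sub>C x # xs) a = (\<integral>\<^sup>+g. 2 * gauss_moment xs (a + g *\<^sub>C d *\<^sub>C x) \<partial>cgauss)"
    by (simp add: nn_integral_cmult)
  also have "\<dots> \<le> (\<integral>\<^sup>+g. gauss_moment xs (a + g *\<^sub>C u *\<^sub>C x) + gauss_moment xs (a + g *\<^sub>C v *\<^sub>C x) \<partial>cgauss)"
    unfolding eq by (intro nn_integral_mono gauss_moment_convex)
  also have "\<dots> = gauss_moment (u *\<^sub>C x # xs) a + gauss_moment (v *\<^sub>C x # xs) a"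
    by (simp add: nn_integral_add)
  also have "\<dots> = 2 * gauss_moment (x # xs) a"
    using gauss_moment_phase[of u x xs] gauss_moment_phase[of v x xs]
    by (simp add: u_def v_def mult_2 del: gauss_moment.simps)
  finally show ?thesis by (simp add: ennreal_mult_le_mult_iff del: gauss_moment.simps)
qed

lemma gauss_moment_contract:
  assumes "\<And>i. i \<in> set is \<Longrightarrow> cmod (d i) \<le> 1"
  shows "gauss_moment (map (\<lambda>i. d i *\<^sub>C x i) is) a \<le> gauss_moment (map x is) a"
  using assms
proof (induction "is" arbitrary: a)
  case (Cons i "is")
  have "gauss_moment (map (\<lambda>i. d i *\<^sub>C x i) (i # is)) a \<le> gauss_moment (x i # map (\<lambda>i. d i *\<^sub>C x i) is) a"
    using Cons.prems gauss_moment_contract1[of "d i" "x i"] by (simp del: gauss_moment.simps)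
  also have "\<dots> \<le> gauss_moment (x i # map x is) a"
    using Cons by (auto intro!: nn_integral_mono)
  finally show ?case by simp
qed simp

lemma gauss_moment_Cons_0: "gauss_moment (0 # xs) = gauss_moment xs"
  by (rule ext) (simp add: scaleC.zero_right cgauss.emeasure_space_1[simplified])

text \<open>Deleting a vector is the contraction with diagonal entry 0.\<close>

lemma gauss_moment_Cons_ge: "gauss_moment xs a \<le> gauss_moment (x # xs) a"
  using gauss_moment_contract1[of 0 x xs a]
  by (simp add: gauss_moment_Cons_0 scaleC.zero_left del: gauss_moment.simps)

lemma gauss_moment_append_ge: "gauss_moment ys a \<le> gauss_moment (xs @ ys) a"
  by (induction xs) (auto intro: order_trans[OF _ gauss_moment_Cons_ge] simp del: gauss_moment.simps)

lemma gauss_moment_scale: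
  "gauss_moment (map (\<lambda>x. r *\<^sub>R x) xs) (r *\<^sub>R a) = ennreal (r\<^sup>2) * gauss_moment xs a"
proof (induction xs arbitrary: a)
  case Nil
  then show ?case by (simp add: power_mult_distrib ennreal_mult')
next
  case (Cons x xs)
  have "r *\<^sub>R a + g *\<^sub>C r *\<^sub>R x = r *\<^sub>R (a + g *\<^sub>C x)" for g
    by (simp add: scaleR_add_right scaleC.scaleR_right)
  then show ?case by (simp add: Cons.IH nn_integral_cmult)
qed

lemma nn_integral_cgauss_square: "(\<integral>\<^sup>+g. ennreal ((cmod g)\<^sup>2) \<partial>cgauss) = 1"
proof -
  have sq: "(\<integral>\<^sup>+a. ennreal (a\<^sup>2) \<partial>std_gaussian) = 1"
  proof -
    have hb: "has_bochner_integral lborel (\<lambda>x. std_normal_density x * x ^ (2 * 1)) (fact (2 * 1) / (2 ^ 1 * fact 1))"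
      by (rule std_normal_moment_even)
    have "(\<integral>\<^sup>+a. ennreal (a\<^sup>2) \<partial>std_gaussian) = (\<integral>\<^sup>+a. ennreal (std_normal_density a * a\<^sup>2) \<partial>lborel)"
      by (subst nn_integral_std_gaussian) (auto simp: ennreal_mult normal_density_nonneg)
    also have "\<dots> = ennreal (\<integral>a. std_normal_density a * a\<^sup>2 \<partial>lborel)"
      using hb by (intro nn_integral_eq_integral) (auto simp: has_bochner_integral_iff normal_density_nonneg)
    also have "\<dots> = 1" using hb by (simp add: has_bochner_integral_iff)
    finally show ?thesis .
  qed
  have "(\<integral>\<^sup>+g. ennreal ((cmod g)\<^sup>2) \<partial>cgauss) = (\<integral>\<^sup>+a. \<integral>\<^sup>+b. ennreal ((cmod (cplx a b))\<^sup>2) \<partial>std_gaussian \<partial>std_gaussian)"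
    by (rule nn_integral_cgauss) measurable
  also have "\<dots> = (\<integral>\<^sup>+a. \<integral>\<^sup>+b. ennreal (1/2) * (ennreal (a\<^sup>2) + ennreal (b\<^sup>2)) \<partial>std_gaussian \<partial>std_gaussian)"
  proof -
    have "ennreal ((cmod (cplx a b))\<^sup>2) = ennreal (1/2) * (ennreal (a\<^sup>2) + ennreal (b\<^sup>2))" for a b
    proof -
      have "(cmod (cplx a b))\<^sup>2 = (1/2) * (a\<^sup>2 + b\<^sup>2)"
        by (simp add: cplx_def cmod_def power_divide add_divide_distrib[symmetric])
      also have "ennreal \<dots> = ennreal (1/2) * ennreal (a\<^sup>2 + b\<^sup>2)" by (rule ennreal_mult) auto
      finally show ?thesis by (subst (asm) ennreal_plus) auto
    qed
    then show ?thesis by simp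
  qed
  also have "\<dots> = (\<integral>\<^sup>+a. ennreal (1/2) * (ennreal (a\<^sup>2) + 1) \<partial>std_gaussian)"
    by (simp add: nn_integral_cmult nn_integral_add sq std_gaussian.emeasure_space_1[simplified])
  also have "\<dots> = ennreal (1/2) * (1 + 1)"
    by (subst nn_integral_cmult) (auto simp: nn_integral_add sq std_gaussian.emeasure_space_1[simplified])
  also have "\<dots> = 1"
  proof -
    have "ennreal (1/2) * (1 + 1) = ennreal (1/2) * ennreal 2" by simp
    also have "\<dots> = ennreal (1/2 * 2)" by (rule ennreal_mult[symmetric]) auto
    finally show ?thesis by simp
  qed
  finally show ?thesis .
qed

lemma gauss_moment_single: "gauss_moment [x] 0 = ennreal ((norm x)\<^sup>2)"
proof -
  have "gauss_moment [x] 0 = (\<integral>\<^sup>+g. ennreal ((cmod g)\<^sup>2) * ennreal ((norm x)\<^sup>2) \<partial>cgauss)"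
    by (simp add: norm_scaleC power_mult_distrib ennreal_mult')
  then show ?thesis by (simp add: nn_integral_multc nn_integral_cgauss_square)
qed

text \<open>A quadratic bound in the offset survives integration over one more Gaussian variable,
  whereas finiteness at a single offset would not be inductive.\<close>

lemma gauss_moment_finite: "gauss_moment xs a < \<infinity>"
proof -
  have "\<exists>A\<ge>0. \<exists>B\<ge>0. \<forall>a. gauss_moment xs a \<le> ennreal (A + B * (norm a)\<^sup>2)"
  proof (induction xs)
    case Nil
    show ?case by (rule exI[of _ 0], simp, rule exI[of _ 1], simp)
  next
    case (Cons x xs)
    then obtain A B where AB: "A \<ge> 0" "B \<ge> 0" "\<And>a. gauss_moment xs a \<le> ennreal (A + B * (norm a)\<^sup>2)" by blast
    have "gauss_moment (x # xs) a \<le> ennreal ((A + 2 * B * (norm x)\<^sup>2) + 2 * B * (norm a)\<^sup>2)" for a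
    proof -
      have le: "A + B * (norm (a + g *\<^sub>C x))\<^sup>2 \<le> (A + 2 * B * (norm a)\<^sup>2) + 2 * B * (norm x)\<^sup>2 * (cmod g)\<^sup>2" for g
      proof -
        have "(norm (a + g *\<^sub>C x))\<^sup>2 \<le> (norm a + cmod g * norm x)\<^sup>2"
          using norm_triangle_ineq[of a "g *\<^sub>C x"] by (intro power_mono) (auto simp: norm_scaleC)
        also have "\<dots> \<le> 2 * (norm a)\<^sup>2 + 2 * (norm x)\<^sup>2 * (cmod g)\<^sup>2"
          using sum_squares_bound[of "norm a" "cmod g * norm x"] by (simp add: power2_eq_square algebra_simps)
        finally have "B * (norm (a + g *\<^sub>C x))\<^sup>2 \<le> B * (2 * (norm a)\<^sup>2 + 2 * (norm x)\<^sup>2 * (cmod g)\<^sup>2)"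
          using AB(2) by (rule mult_left_mono)
        then show ?thesis by (simp add: algebra_simps)
      qed
      have "gauss_moment (x # xs) a \<le> (\<integral>\<^sup>+g. ennreal (A + 2 * B * (norm a)\<^sup>2) + ennreal (2 * B * (norm x)\<^sup>2) * ennreal ((cmod g)\<^sup>2) \<partial>cgauss)"
        unfolding gauss_moment.simps
        using le AB
        by (intro nn_integral_mono order_trans[OF AB(3)]) (auto simp flip: ennreal_plus ennreal_mult intro!: ennreal_leI)
      also have "\<dots> = ennreal (A + 2 * B * (norm a)\<^sup>2) + ennreal (2 * B * (norm x)\<^sup>2)"
        by (simp add: nn_integral_add nn_integral_cmult nn_integral_cgauss_square cgauss.emeasure_space_1[simplified])
      also have "\<dots> = ennreal ((A + 2 * B * (norm x)\<^sup>2) + 2 * B * (norm a)\<^sup>2)"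
        using AB by (simp flip: ennreal_plus add: algebra_simps)
      finally show ?thesis .
    qed
    then show ?case using AB by (intro exI[of _ "A + 2 * B * (norm x)\<^sup>2"] exI[of _ "2 * B"] conjI) auto
  qed
  then obtain A B where "gauss_moment xs a \<le> ennreal (A + B * (norm a)\<^sup>2)" by blast
  also have "\<dots> < \<infinity>" by simp
  finally show ?thesis .
qed

section \<open>Collecting a linear combination on one Gaussian variable\<close>

declare gauss_moment.simps [simp del]

text \<open>The rotation sends the coefficient vector \<open>(\<beta>, b)\<close> to
  \<open>(\<rho>, 0)\<close>, so that \<open>\<beta> x + b y\<close> becomes \<rho> times the first
  new vector. With \<open>\<beta> > 0\<close> the cosine is positive and the half turn cannot
  occur.\<close>

lemma gauss_moment_rotate_pair:
  fixes x y :: "'a::cbanach" and \<beta> b :: real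
  assumes "\<beta> > 0"
  defines "\<rho> \<equiv> sqrt (\<beta>\<^sup>2 + b\<^sup>2)"
  shows "gauss_moment (x # y # xs)
      = gauss_moment (((\<beta> / \<rho>) *\<^sub>R x + (b / \<rho>) *\<^sub>R y) # ((\<beta> / \<rho>) *\<^sub>R y - (b / \<rho>) *\<^sub>R x) # xs)"
    and "\<rho> > 0" "\<rho>\<^sup>2 = \<beta>\<^sup>2 + b\<^sup>2"
proof -
  have pos: "\<beta>\<^sup>2 + b\<^sup>2 > 0" using assms(1) by (simp add: add_pos_nonneg)
  then show r: "\<rho> > 0" "\<rho>\<^sup>2 = \<beta>\<^sup>2 + b\<^sup>2" by (simp_all add: \<rho>_def)
  have "(\<beta> / \<rho>)\<^sup>2 + (b / \<rho>)\<^sup>2 = (\<beta>\<^sup>2 + b\<^sup>2) / \<rho>\<^sup>2" by (simp add: power_divide add_divide_distrib)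
  then have 1: "(\<beta> / \<rho>)\<^sup>2 + (b / \<rho>)\<^sup>2 = 1" unfolding r(2) using pos by (simp only: divide_self)
  have "\<beta> / \<rho> > 0" using assms(1) r by simp
  then have 2: "\<beta> / \<rho> \<noteq> -1" by linarith
  show "gauss_moment (x # y # xs)
      = gauss_moment (((\<beta> / \<rho>) *\<^sub>R x + (b / \<rho>) *\<^sub>R y) # ((\<beta> / \<rho>) *\<^sub>R y - (b / \<rho>) *\<^sub>R x) # xs)"
    by (rule gauss_moment_rotation[OF 1 2])
qed

text \<open>This is the Cauchy-Schwarz inequality for Gaussian sums. Successive rotations move the
  whole combination onto a single vector; the orthogonal vectors produced on the way are dropped,
  which only lowers the moment. The term \<open>w0\<close> with its positive coefficient serves as
  accumulator.\<close>

lemma norm_sum_le_gauss_moment: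
  fixes w :: "'i \<Rightarrow> 'a::cbanach"
  assumes "\<beta> > 0"
  shows "ennreal ((norm (\<beta> *\<^sub>R w0 + (\<Sum>j\<leftarrow>js. b j *\<^sub>R w j)))\<^sup>2)
     \<le> ennreal (\<beta>\<^sup>2 + (\<Sum>j\<leftarrow>js. (b j)\<^sup>2)) * gauss_moment (w0 # map w js) 0"
  using assms
proof (induction js arbitrary: \<beta> w0)
  case Nil
  then show ?case by (simp add: gauss_moment_single power_mult_distrib ennreal_mult)
next
  case (Cons j js)
  define \<rho> where "\<rho> = sqrt (\<beta>\<^sup>2 + (b j)\<^sup>2)"
  note rot = gauss_moment_rotate_pair(1)[OF Cons.prems, where b="b j" and x=w0 and y="w j" and xs="map w js", folded \<rho>_def]
    gauss_moment_rotate_pair(2,3)[OF Cons.prems, where b="b j", folded \<rho>_def]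
  define v where "v = (\<beta> / \<rho>) *\<^sub>R w0 + (b j / \<rho>) *\<^sub>R w j"
  have v: "\<rho> *\<^sub>R v = \<beta> *\<^sub>R w0 + b j *\<^sub>R w j" using rot(2) by (simp add: v_def scaleR_add_right)
  have "ennreal ((norm (\<beta> *\<^sub>R w0 + (\<Sum>j\<leftarrow>j # js. b j *\<^sub>R w j)))\<^sup>2)
      = ennreal ((norm (\<rho> *\<^sub>R v + (\<Sum>j\<leftarrow>js. b j *\<^sub>R w j)))\<^sup>2)"
    by (simp add: v add.assoc)
  also have "\<dots> \<le> ennreal (\<rho>\<^sup>2 + (\<Sum>j\<leftarrow>js. (b j)\<^sup>2)) * gauss_moment (v # map w js) 0"
    by (rule Cons.IH) (rule rot(2))
  also have "gauss_moment (v # map w js) 0 \<le> gauss_moment (((\<beta> / \<rho>) *\<^sub>R w j - (b j / \<rho>) *\<^sub>R w0) # v # map w js) 0"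
    by (rule gauss_moment_Cons_ge)
  also have "\<dots> = gauss_moment (w0 # map w (j # js)) 0"
    by (simp add: rot(1) gauss_moment_swap[of "(\<beta> / \<rho>) *\<^sub>R w j - (b j / \<rho>) *\<^sub>R w0"] v_def)
  finally show ?case by (simp add: rot(3) add.assoc mult_left_mono)
qed

text \<open>For multiples of one vector the same rotations leave 0 in the orthogonal position, so
  nothing is lost and equality holds.\<close>

lemma gauss_moment_multiples:
  fixes x :: "'a::cbanach"
  assumes "\<beta> > 0"
  shows "gauss_moment (\<beta> *\<^sub>R x # map (\<lambda>j. b j *\<^sub>R x) js) 0 = ennreal ((\<beta>\<^sup>2 + (\<Sum>j\<leftarrow>js. (b j)\<^sup>2)) * (norm x)\<^sup>2)"
  using assms
proof (induction js arbitrary: \<beta>)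
  case Nil
  then show ?case by (simp add: gauss_moment_single power_mult_distrib)
next
  case (Cons j js)
  define \<rho> where "\<rho> = sqrt (\<beta>\<^sup>2 + (b j)\<^sup>2)"
  note rot = gauss_moment_rotate_pair(1)[OF Cons.prems, where b="b j" and x="\<beta> *\<^sub>R x" and y="b j *\<^sub>R x"
      and xs="map (\<lambda>j. b j *\<^sub>R x) js", folded \<rho>_def]
    gauss_moment_rotate_pair(2,3)[OF Cons.prems, where b="b j", folded \<rho>_def]
  have "(\<beta> / \<rho>) *\<^sub>R \<beta> *\<^sub>R x + (b j / \<rho>) *\<^sub>R b j *\<^sub>R x = ((\<beta>\<^sup>2 + (b j)\<^sup>2) / \<rho>) *\<^sub>R x"
    by (simp add: power2_eq_square add_divide_distrib scaleR_left_distrib)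
  also have "(\<beta>\<^sup>2 + (b j)\<^sup>2) / \<rho> = \<rho>"
    using rot(2,3) by (simp add: power2_eq_square field_simps)
  finally have 1: "(\<beta> / \<rho>) *\<^sub>R \<beta> *\<^sub>R x + (b j / \<rho>) *\<^sub>R b j *\<^sub>R x = \<rho> *\<^sub>R x" .
  have 2: "(\<beta> / \<rho>) *\<^sub>R b j *\<^sub>R x - (b j / \<rho>) *\<^sub>R \<beta> *\<^sub>R x = 0" by (simp add: mult.commute)
  have "gauss_moment (\<beta> *\<^sub>R x # map (\<lambda>j. b j *\<^sub>R x) (j # js)) 0 = gauss_moment (0 # \<rho> *\<^sub>R x # map (\<lambda>j. b j *\<^sub>R x) js) 0"
    using rot(1)[unfolded 1 2] by (simp add: gauss_moment_swap[of 0])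
  also have "\<dots> = ennreal ((\<rho>\<^sup>2 + (\<Sum>j\<leftarrow>js. (b j)\<^sup>2)) * (norm x)\<^sup>2)"
    by (simp add: gauss_moment_Cons_0 Cons.IH rot(2))
  finally show ?case by (simp add: rot(3) add.assoc)
qed

subsection \<open>Hankel matrices and the discrete Fourier transform\<close>

definition dft :: "nat \<Rightarrow> (nat \<Rightarrow> 'a::cbanach) \<Rightarrow> nat \<Rightarrow> 'a" where
  "dft q x l = (1 / sqrt (2 ^ q)) *\<^sub>R (\<Sum>i<2^q. cis (2 * pi * real (l * i) / 2 ^ q) *\<^sub>C x i)"

lemma gauss_moment_phases:
  assumes "\<And>i. cmod (u i) = 1"
  shows "gauss_moment (map (\<lambda>i. u i *\<^sub>C x i) is) = gauss_moment (map x is)"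
proof (induction "is")
  case (Cons i "is")
  show ?case
    by (simp add: gauss_moment_phase assms) (rule gauss_moment_Cons_cong[OF Cons.IH])
qed simp

lemma gauss_moment_butterflies:
  "gauss_moment (map u L @ map v L)
    = gauss_moment (map (\<lambda>l. (1 / sqrt 2) *\<^sub>R (u l + v l)) L @ map (\<lambda>l. (1 / sqrt 2) *\<^sub>R (u l - v l)) L)"
proof (induction L)
  case (Cons l L)
  let ?p = "\<lambda>l. (1 / sqrt 2) *\<^sub>R (u l + v l)" and ?m = "\<lambda>l. (1 / sqrt 2) *\<^sub>R (u l - v l)"
  have "gauss_moment (map u (l # L) @ map v (l # L)) = gauss_moment (u l # v l # (map u L @ map v L))"
    by (rule gauss_moment_perm) simp
  also have "\<dots> = gauss_moment (?p l # ?m l # (map u L @ map v L))"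
    by (rule gauss_moment_butterfly)
  also have "\<dots> = gauss_moment (?p l # ?m l # (map ?p L @ map ?m L))"
    by (intro gauss_moment_Cons_cong Cons.IH)
  also have "\<dots> = gauss_moment (map ?p (l # L) @ map ?m (l # L))"
    by (rule gauss_moment_perm) simp
  finally show ?case .
qed simp

lemma mset_even_odd:
  "mset (map x [0..<2 * n]) = mset (map (\<lambda>i. x (2 * i)) [0..<n] @ map (\<lambda>i. x (2 * i + 1)) [0..<n])"
  by (induction n) (simp_all add: algebra_simps)

lemma sum_even_odd: "(\<Sum>i<2 * n. f i) = (\<Sum>i<n. f (2 * i)) + (\<Sum>i<n. f (2 * i + 1 :: nat) :: 'a::comm_monoid_add)"
  by (induction n) (simp_all add: algebra_simps)

text \<open>Invariance under the radix-2 fast Fourier transform needs only plane rotations and phases.\<close>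

lemma gauss_moment_dft: "gauss_moment (map (dft q x) [0..<2^q]) = gauss_moment (map x [0..<2^q])"
proof (induction q arbitrary: x)
  case 0
  then show ?case by (simp add: dft_def scaleC_one)
next
  case (Suc q)
  let ?n = "2 ^ q :: nat"
  let ?e = "\<lambda>i. x (2 * i)" and ?o = "\<lambda>i. x (2 * i + 1)"
  define w where "w l = cis (2 * pi * real l / 2 ^ Suc q)" for l
  \<comment> \<open>Decimation in time: the transform of doubled length is assembled from those of
    the even and the odd entries, the latter multiplied by the unimodular factor \<open>w l\<close>.
    As \<open>w\<close> changes sign half a period later, the entries \<open>l\<close> and
    \<open>l + ?n\<close> form a butterfly.\<close>
  have split: "dft (Suc q) x l = (1 / sqrt 2) *\<^sub>R (dft q ?e l + w l *\<^sub>C dft q ?o l)" for l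
  proof -
    have 1: "cis (2 * pi * real (l * (2 * i)) / 2 ^ Suc q) = cis (2 * pi * real (l * i) / 2 ^ q)" for i
      by (simp add: mult_ac)
    have 2: "cis (2 * pi * real (l * (2 * i + 1)) / 2 ^ Suc q) = w l * cis (2 * pi * real (l * i) / 2 ^ q)" for i
    proof -
      have "2 * pi * real (l * (2 * i + 1)) / 2 ^ Suc q = 2 * pi * real l / 2 ^ Suc q + 2 * pi * real (l * i) / 2 ^ q"
        by (simp add: field_simps)
      then show ?thesis by (simp only: w_def cis_mult)
    qed
    have "dft (Suc q) x l = (1 / sqrt (2 ^ Suc q)) *\<^sub>R ((\<Sum>i<?n. cis (2 * pi * real (l * i) / 2 ^ q) *\<^sub>C ?e i)
        + (\<Sum>i<?n. w l *\<^sub>C cis (2 * pi * real (l * i) / 2 ^ q) *\<^sub>C ?o i))"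
      unfolding dft_def power_Suc[of "2::nat"] sum_even_odd 1 2 scaleC_scaleC[symmetric] ..
    also have "\<dots> = (1 / sqrt 2) *\<^sub>R (dft q ?e l + w l *\<^sub>C dft q ?o l)"
      by (simp add: dft_def real_sqrt_mult scaleC.sum_right scaleC.scaleR_right scaleR_add_right)
    finally show ?thesis .
  qed
  have per: "dft q y (l + ?n) = dft q y l" for l y
  proof -
    have "cis (2 * pi * real ((l + ?n) * i) / 2 ^ q) = cis (2 * pi * real (l * i) / 2 ^ q)" for i
    proof -
      have "2 * pi * real ((l + ?n) * i) / 2 ^ q = 2 * pi * real (l * i) / 2 ^ q + 2 * pi * real i"
        by (simp add: algebra_simps add_divide_distrib)
      then show ?thesis by (simp flip: cis_mult)
    qed
    then show ?thesis by (simp add: dft_def)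
  qed
  have wn: "w (l + ?n) = - w l" for l
  proof -
    have "2 * pi * real (l + ?n) / 2 ^ Suc q = 2 * pi * real l / 2 ^ Suc q + pi"
      by (simp add: field_simps)
    then show ?thesis by (simp add: w_def flip: cis_mult)
  qed
  have "map (dft (Suc q) x) [0..<2 ^ Suc q] = map (dft (Suc q) x) [0..<?n] @ map (\<lambda>l. dft (Suc q) x (l + ?n)) [0..<?n]"
    by (rule nth_equalityI) (auto simp: nth_append add.commute)
  also have "\<dots> = map (\<lambda>l. (1 / sqrt 2) *\<^sub>R (dft q ?e l + w l *\<^sub>C dft q ?o l)) [0..<?n]
      @ map (\<lambda>l. (1 / sqrt 2) *\<^sub>R (dft q ?e l - w l *\<^sub>C dft q ?o l)) [0..<?n]"
    by (simp add: split per wn scaleC.minus_left)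
  finally have "gauss_moment (map (dft (Suc q) x) [0..<2 ^ Suc q])
      = gauss_moment (map (dft q ?e) [0..<?n] @ map (\<lambda>l. w l *\<^sub>C dft q ?o l) [0..<?n])"
    by (simp only: gauss_moment_butterflies[of "dft q ?e" _ "\<lambda>l. w l *\<^sub>C dft q ?o l"])
  also have "\<dots> = gauss_moment (map ?e [0..<?n] @ map ?o [0..<?n])"
  proof (rule gauss_moment_append_cong)
    have "gauss_moment (map (\<lambda>l. w l *\<^sub>C dft q ?o l) [0..<?n]) = gauss_moment (map (dft q ?o) [0..<?n])"
      by (rule gauss_moment_phases) (simp add: w_def)
    then show "gauss_moment (map (\<lambda>l. w l *\<^sub>C dft q ?o l) [0..<?n]) = gauss_moment (map ?o [0..<?n])"
      by (simp only: Suc.IH)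
  qed (rule Suc.IH)
  also have "\<dots> = gauss_moment (map x [0..<2 ^ Suc q])"
    by (rule gauss_moment_perm) (simp only: power_Suc mset_even_odd)
  finally show ?case .
qed

lemma sum_roots_of_unity:
  fixes m :: int
  assumes "\<bar>m\<bar> < int M"
  shows "(\<Sum>l<M. cis (2 * pi * real l * of_int m / M)) = (if m = 0 then of_nat M else 0)"
proof (cases "m = 0")
  case False
  let ?z = "cis (2 * pi * of_int m / M)"
  have M: "M > 0" using assms by simp
  have pow: "cis (2 * pi * real l * of_int m / M) = ?z ^ l" for l
    by (simp add: Complex.DeMoivre mult_ac)
  have "?z ^ M = 1"
  proof -
    have "?z ^ M = cis (2 * pi * of_int m)" using M by (simp add: Complex.DeMoivre)
    then show ?thesis by simp
  qed
  moreover have "?z \<noteq> 1"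
  proof
    assume "?z = 1"
    then have "cos (2 * pi * of_int m / M) = 1" by (metis cis.sel(1) one_complex.sel(1))
    then obtain k :: int where "2 * pi * of_int m / M = of_int k * 2 * pi"
      by (auto simp: cos_one_2pi_int)
    then have "real_of_int m = of_int k * real M" using M by (simp add: field_simps)
    then have "m = k * int M" by (metis of_int_eq_iff of_int_mult of_int_of_nat_eq)
    then have "int M \<le> \<bar>m\<bar>" using False M by (auto simp: abs_mult)
    then show False using assms by simp
  qed
  ultimately show ?thesis
    using False by (simp add: pow sum_gp_strict)
qed simp

lemma gauss_moment_append_zeros: "gauss_moment (xs @ map (\<lambda>_. 0) is) = gauss_moment xs"
proof -
  have "gauss_moment (map (\<lambda>_. 0) is @ xs) = gauss_moment xs"
    by (induction "is") (simp_all add: gauss_moment_Cons_0)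
  moreover have "gauss_moment (xs @ map (\<lambda>_. 0) is) = gauss_moment (map (\<lambda>_. 0) is @ xs)"
    by (rule gauss_moment_perm) simp
  ultimately show ?thesis by simp
qed

text \<open>The Hankel matrix \<open>(c\<^sub>i\<^sub>+\<^sub>j)\<close> is a compression of \<open>F D F\<close> with the unitary discrete Fourier
  transform \<open>F\<close> of length \<open>M > 2 n\<close> and \<open>D\<close> the diagonal matrix of the values of the symbol at the
  roots of unity.\<close>

theorem gauss_moment_hankel:
  fixes v :: "nat \<Rightarrow> 'a::cbanach"
  assumes c: "\<And>k. k > n \<Longrightarrow> c k = 0" and K: "K > 0"
    and sup: "\<And>z. cmod z = 1 \<Longrightarrow> cmod (\<Sum>k\<le>n. c k * z ^ k) \<le> K"
  shows "gauss_moment (map (\<lambda>j. \<Sum>i\<le>n. c (i + j) *\<^sub>C v i) [0..<Suc n]) 0 \<le> ennreal (K\<^sup>2) * gauss_moment (map v [0..<Suc n]) 0"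
proof -
  \<comment> \<open>The index differences \<open>i + j - k\<close> stay between \<open>- n\<close>
    and \<open>2 * n\<close>. A length exceeding \<open>2 * n\<close> rules out aliasing: no nonzero
    difference is a multiple of it.\<close>
  obtain q :: nat where q: "2 * n < 2 ^ q" using less_exp by blast
  define M where "M = (2::nat) ^ q"
  have M0: "M > 0" and nM: "Suc n \<le> M" and M2: "2 * n < M" using q by (auto simp: M_def)
  define v' where "v' i = (if i \<le> n then v i else 0)" for i
  \<comment> \<open>The symbol is evaluated at the conjugate roots of unity because both transforms
    carry the positive sign. Orthogonality then selects \<open>k = i + j\<close>, hence a Hankel and
    not a Toeplitz matrix.\<close>
  define d where "d l = (\<Sum>k\<le>n. c k * cis (- (2 * pi * real l / M)) ^ k)" for l :: nat
  define w where "w l = (d l / of_real K) *\<^sub>C dft q v' l" for l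
  have u: "dft q w j = (1 / K) *\<^sub>R (\<Sum>i\<le>n. c (i + j) *\<^sub>C v i)" if j: "j \<le> n" for j
  proof -
    have root: "(\<Sum>l<M. cis (2 * pi * real (j * l) / M) * d l * cis (2 * pi * real (l * i) / M)) = of_nat M * c (i + j)"
      if "i \<le> n" for i
    proof -
      have "(\<Sum>l<M. cis (2 * pi * real (j * l) / M) * d l * cis (2 * pi * real (l * i) / M))
         = (\<Sum>l<M. \<Sum>k\<le>n. c k * cis (2 * pi * real l * of_int (int i + int j - int k) / M))"
      proof (rule sum.cong[OF refl])
        fix l
        have "cis (2 * pi * real (j * l) / M) * (c k * cis (- (2 * pi * real l / M)) ^ k) * cis (2 * pi * real (l * i) / M)
            = c k * cis (2 * pi * real l * of_int (int i + int j - int k) / M)" for k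
        proof -
          have "2 * pi * real (j * l) / M + real k * - (2 * pi * real l / M) + 2 * pi * real (l * i) / M
             = 2 * pi * real l * of_int (int i + int j - int k) / M"
            by (simp add: algebra_simps diff_divide_distrib add_divide_distrib)
          then have "cis (2 * pi * real (j * l) / M) * cis (- (2 * pi * real l / M)) ^ k * cis (2 * pi * real (l * i) / M)
             = cis (2 * pi * real l * of_int (int i + int j - int k) / M)"
            unfolding Complex.DeMoivre cis_mult by simp
          then show ?thesis by (metis (no_types, lifting) mult.assoc mult.left_commute)
        qed
        then have "(\<Sum>k\<le>n. cis (2 * pi * real (j * l) / M) * (c k * cis (- (2 * pi * real l / M)) ^ k) * cis (2 * pi * real (l * i) / M))
            = (\<Sum>k\<le>n. c k * cis (2 * pi * real l * of_int (int i + int j - int k) / M))"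
          by (intro sum.cong refl)
        then show "cis (2 * pi * real (j * l) / M) * d l * cis (2 * pi * real (l * i) / M)
            = (\<Sum>k\<le>n. c k * cis (2 * pi * real l * of_int (int i + int j - int k) / M))"
          unfolding d_def sum_distrib_left sum_distrib_right .
      qed
      also have "\<dots> = (\<Sum>k\<le>n. c k * (\<Sum>l<M. cis (2 * pi * real l * of_int (int i + int j - int k) / M)))"
        by (subst sum.swap) (simp add: sum_distrib_left)
      also have "\<dots> = (\<Sum>k\<le>n. c k * (if int i + int j - int k = 0 then of_nat M else 0))"
        using that j M2 by (intro sum.cong refl arg_cong2[where f="(*)"] sum_roots_of_unity) auto
      also have "\<dots> = (\<Sum>k\<le>n. if k = i + j then c k * of_nat M else 0)"
        by (intro sum.cong) auto
      also have "\<dots> = of_nat M * c (i + j)"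
        using c[of "i + j"] by (simp add: sum.delta' mult.commute not_le)
      finally show ?thesis .
    qed
    have Mr: "2 ^ q = real M" "(2::nat) ^ q = M" by (simp_all add: M_def)
    have sub: "{..n} \<subseteq> {..<M}" using nM by auto
    have dv: "dft q v' l = (1 / sqrt M) *\<^sub>R (\<Sum>i\<le>n. cis (2 * pi * real (l * i) / M) *\<^sub>C v i)" for l
      unfolding dft_def Mr
      by (intro arg_cong[where f="scaleR _"] sum.mono_neutral_cong_right)
         (use sub in \<open>auto simp: v'_def scaleC.zero_right\<close>)
    have "dft q w j = (1 / sqrt M) *\<^sub>R (\<Sum>l<M. cis (2 * pi * real (j * l) / M) *\<^sub>C (d l / of_real K) *\<^sub>C
          (1 / sqrt M) *\<^sub>R (\<Sum>i\<le>n. cis (2 * pi * real (l * i) / M) *\<^sub>C v i))"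
      unfolding dft_def[of q w] Mr w_def dv ..
    also have "\<dots> = (1 / sqrt M) *\<^sub>R (\<Sum>l<M. (1 / sqrt M * (1 / K)) *\<^sub>R (\<Sum>i\<le>n. (cis (2 * pi * real (j * l) / M) * d l * cis (2 * pi * real (l * i) / M)) *\<^sub>C v i))"
      by (simp add: scaleC.sum_right scaleR_sum_right scaleR_scaleC scaleC_scaleC field_simps)
    also have "\<dots> = (1 / M * (1 / K)) *\<^sub>R (\<Sum>l<M. \<Sum>i\<le>n. (cis (2 * pi * real (j * l) / M) * d l * cis (2 * pi * real (l * i) / M)) *\<^sub>C v i)"
      using M0 by (simp flip: scaleR_sum_right)
    also have "(\<Sum>l<M. \<Sum>i\<le>n. (cis (2 * pi * real (j * l) / M) * d l * cis (2 * pi * real (l * i) / M)) *\<^sub>C v i)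
       = (\<Sum>i\<le>n. (\<Sum>l<M. cis (2 * pi * real (j * l) / M) * d l * cis (2 * pi * real (l * i) / M)) *\<^sub>C v i)"
      by (subst sum.swap) (simp add: scaleC.sum_left)
    also have "\<dots> = (\<Sum>i\<le>n. (of_nat M * c (i + j)) *\<^sub>C v i)"
      by (intro sum.cong refl arg_cong2[where f=scaleC] root) simp
    also have "\<dots> = real M *\<^sub>R (\<Sum>i\<le>n. c (i + j) *\<^sub>C v i)"
      unfolding scaleR_sum_right by (simp add: scaleR_scaleC scaleC_scaleC)
    finally show ?thesis using M0 by simp
  qed
  let ?u = "\<lambda>j. \<Sum>i\<le>n. c (i + j) *\<^sub>C v i"
  have upt: "[0..<2^q] = [0..<Suc n] @ [Suc n..<M]"
    using upt_add_eq_append[of 0 "Suc n" "M - Suc n"] nM by (simp add: M_def del: upt_Suc)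
  \<comment> \<open>Compression: the transformed vector has \<open>M\<close> entries, of which only
    the first \<open>n + 1\<close> are wanted; adding the others can only raise the moment. The
    scaling by \<open>1 / K\<close> makes the diagonal matrix a contraction and is undone at the
    end.\<close>
  have "gauss_moment (map (\<lambda>j. (1 / K) *\<^sub>R ?u j) [0..<Suc n]) 0 \<le> gauss_moment (map (dft q w) [Suc n..<M] @ map (\<lambda>j. (1 / K) *\<^sub>R ?u j) [0..<Suc n]) 0"
    by (rule gauss_moment_append_ge)
  also have "\<dots> = gauss_moment (map (dft q w) [0..<2^q]) 0"
  proof -
    have "map (\<lambda>j. (1 / K) *\<^sub>R ?u j) [0..<Suc n] = map (dft q w) [0..<Suc n]"
      by (rule map_cong) (auto simp: u simp del: upt_Suc)
    moreover have "gauss_moment (map (dft q w) [Suc n..<M] @ map (dft q w) [0..<Suc n]) = gauss_moment (map (dft q w) [0..<2^q])"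
      unfolding upt map_append by (rule gauss_moment_perm) (simp del: upt_Suc)
    ultimately show ?thesis by (simp only:)
  qed
  also have "\<dots> = gauss_moment (map w [0..<2^q]) 0" by (simp only: gauss_moment_dft)
  also have "\<dots> \<le> gauss_moment (map (dft q v') [0..<2^q]) 0"
    unfolding w_def
  proof (rule gauss_moment_contract)
    fix l
    have "cmod (d l) \<le> K" unfolding d_def by (rule sup) simp
    then show "cmod (d l / complex_of_real K) \<le> 1" using K by (simp add: norm_divide)
  qed
  also have "\<dots> = gauss_moment (map v' [0..<2^q]) 0" by (simp only: gauss_moment_dft)
  also have "map v' [0..<2^q] = map v [0..<Suc n] @ map (\<lambda>_. 0) [Suc n..<M]"
  proof -
    have "map v' [0..<Suc n] = map v [0..<Suc n]" "map v' [Suc n..<M] = map (\<lambda>_. 0) [Suc n..<M]"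
      by (auto simp: v'_def simp del: upt_Suc)
    then show ?thesis unfolding upt map_append by (simp only:)
  qed
  also have "gauss_moment \<dots> = gauss_moment (map v [0..<Suc n])" by (rule gauss_moment_append_zeros)
  finally have le: "gauss_moment (map (\<lambda>j. (1 / K) *\<^sub>R ?u j) [0..<Suc n]) 0 \<le> gauss_moment (map v [0..<Suc n]) 0" .
  have "map ?u [0..<Suc n] = map (\<lambda>x. K *\<^sub>R x) (map (\<lambda>j. (1 / K) *\<^sub>R ?u j) [0..<Suc n])"
    using K by (simp del: upt_Suc)
  then have "gauss_moment (map ?u [0..<Suc n]) 0 = ennreal (K\<^sup>2) * gauss_moment (map (\<lambda>j. (1 / K) *\<^sub>R ?u j) [0..<Suc n]) 0"
    using gauss_moment_scale[of K "map (\<lambda>j. (1 / K) *\<^sub>R ?u j) [0..<Suc n]" 0] by (simp del: map_map upt_Suc)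
  also have "\<dots> \<le> ennreal (K\<^sup>2) * gauss_moment (map v [0..<Suc n]) 0"
    by (rule mult_left_mono[OF le]) simp
  finally show ?thesis .
qed

subsection \<open>Discrete transference\<close>

text \<open>The factor \<open>k\<close> counts the pairs \<open>i + j = k\<close> with \<open>j \<ge> 1\<close>, so the sum is the pairing of the Gaussian
  vectors \<open>(r\<^sup>j B\<^sub>j x)\<close> through the Hankel matrix of \<open>a\<^sub>k / r\<^sup>k\<close>.\<close>

theorem discrete_transference:
  fixes B :: "nat \<Rightarrow> 'a::cbanach \<Rightarrow> 'a"
  assumes B: "\<And>j. bounded_clinear (B j)" "\<And>i j x. B j (B i x) = B (i + j) x"
    and C: "C \<ge> 0" "\<And>N w. gauss_moment (map (\<lambda>j. B j (w j)) [0..<N]) 0 \<le> ennreal (C\<^sup>2) * gauss_moment (map w [0..<N]) 0"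
    and r: "0 < r" "r < 1" and K: "K > 0"
    and sup: "\<And>z. cmod z = 1 / r \<Longrightarrow> cmod (\<Sum>k\<le>n. a k * z ^ k) \<le> K"
  shows "norm (\<Sum>k\<le>n. (of_nat k * a k) *\<^sub>C B k x) \<le> C\<^sup>2 * K / (1 - r\<^sup>2) * norm x"
proof -
  \<comment> \<open>The quotient by \<open>r ^ k\<close> cancels the weights \<open>r ^ i\<close>
    and \<open>r ^ j\<close> on the two sides when \<open>k = i + j\<close>. On the unit circle the
    polynomial with these coefficients takes the values of the original one on the circle of radius
    \<open>1 / r\<close>.\<close>
  define c where "c k = (if k \<le> n then a k * of_real (1 / r ^ k) else 0)" for k
  define v where "v i = B i (r ^ i *\<^sub>R x)" for i
  define u where "u j = (\<Sum>i\<le>n. c (i + j) *\<^sub>C v i)" for j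
  \<comment> \<open>Switching off the row \<open>j = 0\<close> leaves \<open>k\<close> instead of
    \<open>k + 1\<close> pairs with sum \<open>k\<close>.\<close>
  define \<delta> where "\<delta> j = (if j = 0 then 0 else 1 :: complex)" for j :: nat
  \<comment> \<open>This sum arises twice, as the squared length of the weights in the
    Cauchy-Schwarz step and in the moment of the vectors \<open>r ^ i *\<^sub>R x\<close>; that is
    why the norm is bounded by a multiple of \<open>S\<close> and not of its root.\<close>
  define S where "S = (\<Sum>j\<leftarrow>[0..<Suc n]. (r ^ j)\<^sup>2)"
  have S: "0 \<le> S" "S \<le> 1 / (1 - r\<^sup>2)" "S = 1\<^sup>2 + (\<Sum>j\<leftarrow>[1..<Suc n]. (r ^ j)\<^sup>2)"
  proof -
    have r2: "r\<^sup>2 < 1" using r by (simp add: power_less_one_iff)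
    have "S = (\<Sum>j<Suc n. (r\<^sup>2) ^ j)"
      unfolding S_def interv_sum_list_conv_sum_set_nat by (simp add: power_mult[symmetric] mult.commute atLeast0LessThan del: upt_Suc sum.lessThan_Suc)
    also have "\<dots> = (1 - (r\<^sup>2) ^ Suc n) / (1 - r\<^sup>2)" using r2 by (simp add: sum_gp_strict del: sum.lessThan_Suc)
    also have "\<dots> \<le> 1 / (1 - r\<^sup>2)" using r2 r by (intro divide_right_mono) auto
    finally show "S \<le> 1 / (1 - r\<^sup>2)" .
    show "0 \<le> S" unfolding S_def by (rule sum_list_nonneg) auto
    show "S = 1\<^sup>2 + (\<Sum>j\<leftarrow>[1..<Suc n]. (r ^ j)\<^sup>2)" unfolding S_def by (subst upt_conv_Cons) auto
  qed
  have lin: "B j (t *\<^sub>R y) = t *\<^sub>R B j y" "B j (c *\<^sub>C y) = c *\<^sub>C B j y" "B j (\<Sum>i\<in>I. f i) = (\<Sum>i\<in>I. B j (f i))"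
    for j t y c f and I :: "nat set"
    using B(1)[of j] by (simp_all add: bounded_clinear_def linear_sum linear_scale bounded_linear.linear)
  have cons0: "gauss_moment (map f [0..<Suc n]) = gauss_moment (f 0 # map f [1..<Suc n])" for f :: "nat \<Rightarrow> 'a"
    by (subst upt_conv_Cons) auto
  have expand: "(\<Sum>k\<le>n. (of_nat k * a k) *\<^sub>C B k x) = (\<Sum>j\<le>n. r ^ j *\<^sub>R B j (\<delta> j *\<^sub>C u j))"
  proof -
    have inner: "r ^ j *\<^sub>R B j (\<delta> j *\<^sub>C u j) = (\<Sum>i\<le>n. if i + j \<le> n then (\<delta> j * a (i + j)) *\<^sub>C B (i + j) x else 0)" for j
    proof -
      have "r ^ j *\<^sub>R B j (\<delta> j *\<^sub>C u j) = (\<Sum>i\<le>n. (of_real (r ^ j) * \<delta> j * c (i + j) * of_real (r ^ i)) *\<^sub>C B (i + j) x)"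
        by (simp add: u_def v_def lin B(2) scaleC.sum_right scaleR_sum_right scaleR_scaleC scaleC_scaleC mult.assoc)
      also have "\<dots> = (\<Sum>i\<le>n. if i + j \<le> n then (\<delta> j * a (i + j)) *\<^sub>C B (i + j) x else 0)"
        using r by (intro sum.cong refl) (auto simp: c_def power_add scaleC.zero_left)
      finally show ?thesis .
    qed
    have "(\<Sum>j\<le>n. r ^ j *\<^sub>R B j (\<delta> j *\<^sub>C u j)) = (\<Sum>j\<le>n. \<Sum>k\<le>n. if j \<le> k then (\<delta> j * a k) *\<^sub>C B k x else 0)"
    proof (rule sum.cong[OF refl])
      fix j assume j: "j \<in> {..n}"
      have "r ^ j *\<^sub>R B j (\<delta> j *\<^sub>C u j) = (\<Sum>i\<in>{i. i \<le> n \<and> i + j \<le> n}. (\<delta> j * a (i + j)) *\<^sub>C B (i + j) x)"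
        unfolding inner by (rule sum.mono_neutral_cong_right) auto
      also have "\<dots> = (\<Sum>k\<in>{j..n}. (\<delta> j * a k) *\<^sub>C B k x)"
        by (rule sum.reindex_bij_witness[of _ "\<lambda>k. k - j" "\<lambda>i. i + j"]) auto
      also have "\<dots> = (\<Sum>k\<le>n. if j \<le> k then (\<delta> j * a k) *\<^sub>C B k x else 0)"
        by (rule sum.mono_neutral_cong_left) auto
      finally show "r ^ j *\<^sub>R B j (\<delta> j *\<^sub>C u j) = \<dots>" .
    qed
    also have "\<dots> = (\<Sum>k\<le>n. \<Sum>j\<le>n. if j \<le> k then (\<delta> j * a k) *\<^sub>C B k x else 0)"
      by (rule sum.swap)
    also have "\<dots> = (\<Sum>k\<le>n. (of_nat k * a k) *\<^sub>C B k x)"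
    proof (rule sum.cong[OF refl])
      fix k assume k: "k \<in> {..n}"
      have "(\<Sum>j\<le>n. if j \<le> k then (\<delta> j * a k) *\<^sub>C B k x else 0) = (\<Sum>j\<in>{1..k}. a k *\<^sub>C B k x)"
        by (rule sum.mono_neutral_cong_right) (use k in \<open>auto simp: \<delta>_def scaleC.zero_left\<close>)
      also have "\<dots> = (of_nat k * a k) *\<^sub>C B k x"
      proof -
        have "(\<Sum>j\<in>{1..k}. a k *\<^sub>C B k x) = (\<Sum>j\<in>{1..k}. a k) *\<^sub>C B k x" by (rule scaleC.sum_left[symmetric])
        then show ?thesis by simp
      qed
      finally show "(\<Sum>j\<le>n. if j \<le> k then (\<delta> j * a k) *\<^sub>C B k x else 0) = (of_nat k * a k) *\<^sub>C B k x" .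
    qed
    finally show ?thesis by simp
  qed
  have sup': "cmod (\<Sum>k\<le>n. c k * z ^ k) \<le> K" if "cmod z = 1" for z
  proof -
    have "cmod (\<Sum>k\<le>n. a k * (z / of_real r) ^ k) \<le> K"
      using r that by (intro sup) (simp add: norm_divide)
    moreover have "(\<Sum>k\<le>n. a k * (z / of_real r) ^ k) = (\<Sum>k\<le>n. c k * z ^ k)"
      by (intro sum.cong) (auto simp: c_def power_divide)
    ultimately show ?thesis by simp
  qed
  have "ennreal ((norm (\<Sum>k\<le>n. (of_nat k * a k) *\<^sub>C B k x))\<^sup>2)
      = ennreal ((norm (1 *\<^sub>R B 0 (\<delta> 0 *\<^sub>C u 0) + (\<Sum>j\<leftarrow>[1..<Suc n]. r ^ j *\<^sub>R B j (\<delta> j *\<^sub>C u j))))\<^sup>2)"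
  proof -
    have "(\<Sum>j\<le>n. r ^ j *\<^sub>R B j (\<delta> j *\<^sub>C u j)) = (\<Sum>j\<leftarrow>[0..<Suc n]. r ^ j *\<^sub>R B j (\<delta> j *\<^sub>C u j))"
      unfolding interv_sum_list_conv_sum_set_nat by (simp add: atLeast0LessThan lessThan_Suc_atMost del: upt_Suc)
    also have "\<dots> = 1 *\<^sub>R B 0 (\<delta> 0 *\<^sub>C u 0) + (\<Sum>j\<leftarrow>[1..<Suc n]. r ^ j *\<^sub>R B j (\<delta> j *\<^sub>C u j))"
      by (subst upt_conv_Cons) auto
    finally show ?thesis unfolding expand by simp
  qed
  also have "\<dots> \<le> ennreal S * gauss_moment (B 0 (\<delta> 0 *\<^sub>C u 0) # map (\<lambda>j. B j (\<delta> j *\<^sub>C u j)) [1..<Suc n]) 0"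
    unfolding S(3) by (rule norm_sum_le_gauss_moment) simp
  also have "\<dots> = ennreal S * gauss_moment (map (\<lambda>j. B j (\<delta> j *\<^sub>C u j)) [0..<Suc n]) 0"
    by (simp only: cons0)
  \<comment> \<open>Gamma-boundedness removes the outer operators \<open>B j\<close> here; a second
    application below bounds the inner vectors \<open>v i\<close>. The Hankel matrix acts in
    between.\<close>
  also have "\<dots> \<le> ennreal S * (ennreal (C\<^sup>2) * gauss_moment (map (\<lambda>j. \<delta> j *\<^sub>C u j) [0..<Suc n]) 0)"
    by (intro mult_left_mono C) simp
  also have "\<dots> \<le> ennreal S * (ennreal (C\<^sup>2) * gauss_moment (map u [0..<Suc n]) 0)"
    by (intro mult_left_mono gauss_moment_contract) (auto simp: \<delta>_def)
  also have "\<dots> \<le> ennreal S * (ennreal (C\<^sup>2) * (ennreal (K\<^sup>2) * gauss_moment (map v [0..<Suc n]) 0))"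
    unfolding u_def using sup' K by (intro mult_left_mono gauss_moment_hankel) (auto simp: c_def)
  also have "\<dots> \<le> ennreal S * (ennreal (C\<^sup>2) * (ennreal (K\<^sup>2) * (ennreal (C\<^sup>2) * gauss_moment (map (\<lambda>i. r ^ i *\<^sub>R x) [0..<Suc n]) 0)))"
    unfolding v_def by (intro mult_left_mono C) auto
  also have "gauss_moment (map (\<lambda>i. r ^ i *\<^sub>R x) [0..<Suc n]) 0 = ennreal (S * (norm x)\<^sup>2)"
    unfolding cons0 S(3) using gauss_moment_multiples[of 1 x "\<lambda>i. r ^ i" "[1..<Suc n]"] by simp
  also have "ennreal S * (ennreal (C\<^sup>2) * (ennreal (K\<^sup>2) * (ennreal (C\<^sup>2) * ennreal (S * (norm x)\<^sup>2))))
      = ennreal ((C\<^sup>2 * K * S * norm x)\<^sup>2)"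
  proof -
    have *: "(C\<^sup>2 * K * S * norm x)\<^sup>2 = S * (C\<^sup>2 * (K\<^sup>2 * (C\<^sup>2 * (S * (norm x)\<^sup>2))))"
      by (simp add: power2_eq_square mult_ac)
    show ?thesis unfolding * using S(1) by (simp add: ennreal_mult)
  qed
  finally have "(norm (\<Sum>k\<le>n. (of_nat k * a k) *\<^sub>C B k x))\<^sup>2 \<le> (C\<^sup>2 * K * S * norm x)\<^sup>2"
    by (subst (asm) ennreal_le_iff) auto
  then have "norm (\<Sum>k\<le>n. (of_nat k * a k) *\<^sub>C B k x) \<le> C\<^sup>2 * K * S * norm x"
    by (rule power2_le_imp_le) (use C(1) K S(1) in simp)
  also have "\<dots> \<le> C\<^sup>2 * K * (1 / (1 - r\<^sup>2)) * norm x"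
    by (intro mult_right_mono mult_left_mono S) (use K in auto)
  finally show ?thesis by simp
qed

subsection \<open>Gamma-bounded semigroups\<close>

interpretation cgauss_product: product_sigma_finite "\<lambda>_. cgauss" ..

text \<open>Fubini's theorem turns the integral over the product space, on which the definition of
  gamma-boundedness rests, into the iterated integral with its free offset.\<close>

lemma nn_integral_PiM_gauss:
  fixes x :: "'i \<Rightarrow> 'a::cbanach"
  assumes "distinct l"
  shows "(\<integral>\<^sup>+g. ennreal ((norm (a + (\<Sum>i\<in>set l. g i *\<^sub>C x i)))\<^sup>2) \<partial>PiM (set l) (\<lambda>_. cgauss)) = gauss_moment (map x l) a"
  using assms
proof (induction l arbitrary: a)
  case Nil
  show ?case
    by (simp add: gauss_moment.simps PiM_empty emeasure_count_space_finite)
next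
  case (Cons i l)
  have sm: "strongly_measurable (PiM (insert i (set l)) (\<lambda>_. cgauss)) (\<lambda>g. a + (\<Sum>j\<in>insert i (set l). g j *\<^sub>C x j))"
    by (intro strongly_measurable_add strongly_measurable_sum strongly_measurable_scaleC strongly_measurable_const)
       (simp add: measurable_component_singleton cong: measurable_cong_sets)
  have upd: "(a + (\<Sum>j\<in>insert i (set l). (g(i := y)) j *\<^sub>C x j)) = (a + y *\<^sub>C x i) + (\<Sum>j\<in>set l. g j *\<^sub>C x j)" for g y
  proof -
    have "(\<Sum>j\<in>set l. (g(i := y)) j *\<^sub>C x j) = (\<Sum>j\<in>set l. g j *\<^sub>C x j)"
      using Cons.prems by (intro sum.cong) auto
    then show ?thesis using Cons.prems by (simp add: add.assoc)
  qed
  have "(\<integral>\<^sup>+g. ennreal ((norm (a + (\<Sum>j\<in>insert i (set l). g j *\<^sub>C x j)))\<^sup>2) \<partial>PiM (insert i (set l)) (\<lambda>_. cgauss))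
    = (\<integral>\<^sup>+y. \<integral>\<^sup>+g. ennreal ((norm (a + (\<Sum>j\<in>insert i (set l). (g(i := y)) j *\<^sub>C x j)))\<^sup>2) \<partial>PiM (set l) (\<lambda>_. cgauss) \<partial>cgauss)"
  proof (rule cgauss_product.product_nn_integral_insert_rev)
    show "(\<lambda>g. ennreal ((norm (a + (\<Sum>j\<in>insert i (set l). g j *\<^sub>C x j)))\<^sup>2)) \<in> borel_measurable (PiM (insert i (set l)) (\<lambda>_. cgauss))"
      using strongly_measurable_norm[OF sm] by measurable
  qed (use Cons.prems in auto)
  also have "\<dots> = gauss_moment (map x (i # l)) a"
    unfolding upd using Cons by (simp add: gauss_moment.simps)
  finally show ?case by simp
qed

lemma gaussian_L2_norm_eq:
  fixes x :: "'i \<Rightarrow> 'a::cbanach"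
  assumes "distinct l"
  shows "gaussian_L2_norm (set l) x = sqrt (enn2real (gauss_moment (map x l) 0))"
proof -
  have sm: "strongly_measurable (PiM (set l) (\<lambda>_. cgauss)) (\<lambda>g. \<Sum>j\<in>set l. g j *\<^sub>C x j)"
    by (intro strongly_measurable_sum strongly_measurable_scaleC strongly_measurable_const)
       (simp add: measurable_component_singleton cong: measurable_cong_sets)
  have "(\<integral>g. (norm (\<Sum>i\<in>set l. g i *\<^sub>C x i))\<^sup>2 \<partial>PiM (set l) (\<lambda>_. cgauss))
      = enn2real (\<integral>\<^sup>+g. ennreal ((norm (\<Sum>i\<in>set l. g i *\<^sub>C x i))\<^sup>2) \<partial>PiM (set l) (\<lambda>_. cgauss))"
    using strongly_measurable_norm[OF sm] by (intro integral_eq_nn_integral) auto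
  then show ?thesis
    using nn_integral_PiM_gauss[OF assms, of 0 x] by (simp add: gaussian_L2_norm_def)
qed

text \<open>In the definition the vectors are indexed by the operators themselves; an injective
  family \<open>S\<close> carries them over to an arbitrary index type. Finiteness of the moments
  allows passing from real numbers to \<open>ennreal\<close>.\<close>

lemma gamma_bounded_gauss_moment:
  assumes "gamma_bounded (\<T> :: ('a::cbanach \<Rightarrow> 'a) set)"
  obtains C where "C \<ge> 0"
    "\<And>js S w. distinct js \<Longrightarrow> inj_on S (set js) \<Longrightarrow> S ` set js \<subseteq> \<T> \<Longrightarrow>
       gauss_moment (map (\<lambda>j::'i. S j (w j)) js) 0 \<le> ennreal (C\<^sup>2) * gauss_moment (map w js) 0"
proof -
  from assms obtain C where C: "C \<ge> 0" "\<And>\<T>' x. finite \<T>' \<Longrightarrow> \<T>' \<subseteq> \<T> \<Longrightarrow>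
        gaussian_L2_norm \<T>' (\<lambda>S. S (x S)) \<le> C * gaussian_L2_norm \<T>' x"
    unfolding gamma_bounded_def by blast
  have "gauss_moment (map (\<lambda>j::'i. S j (w j)) js) 0 \<le> ennreal (C\<^sup>2) * gauss_moment (map w js) 0"
    if js: "distinct js" "inj_on S (set js)" "S ` set js \<subseteq> \<T>" for js S w
  proof -
    define x where "x R = w (inv_into (set js) S R)" for R
    have x: "x (S j) = w j" if "j \<in> set js" for j using js(2) that by (simp add: x_def)
    have d: "distinct (map S js)" using js by (simp add: distinct_map)
    have m: "map x (map S js) = map w js" "map (\<lambda>S. S (x S)) (map S js) = map (\<lambda>j. S j (w j)) js"
      using x by auto
    let ?p = "gauss_moment (map (\<lambda>j. S j (w j)) js) 0" and ?q = "gauss_moment (map w js) 0"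
    have fin: "?p = ennreal (enn2real ?p)" "?q = ennreal (enn2real ?q)"
      using gauss_moment_finite[of "map (\<lambda>j. S j (w j)) js" 0] gauss_moment_finite[of "map w js" 0]
      by simp_all
    have "sqrt (enn2real ?p) \<le> C * sqrt (enn2real ?q)"
      using C(2)[of "set (map S js)" x] js(3) gaussian_L2_norm_eq[OF d, of x] gaussian_L2_norm_eq[OF d, of "\<lambda>S. S (x S)"]
      by (simp add: m[unfolded map_map o_def] o_def)
    then have "(sqrt (enn2real ?p))\<^sup>2 \<le> (C * sqrt (enn2real ?q))\<^sup>2"
      by (rule power_mono) simp
    then have "enn2real ?p \<le> C\<^sup>2 * enn2real ?q" by (simp add: power_mult_distrib)
    then have "ennreal (enn2real ?p) \<le> ennreal (C\<^sup>2) * ennreal (enn2real ?q)"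
      by (simp add: ennreal_mult[symmetric] ennreal_leI)
    then show ?thesis using fin by simp
  qed
  with C(1) show ?thesis using that by blast
qed

section \<open>Tools for families with repeated operators\<close>

lemma gauss_moment_filter:
  "gauss_moment (map (\<lambda>i. if P i then f i else 0) is) = gauss_moment (map f (filter P is))"
proof (induction "is")
  case (Cons i "is")
  then show ?case by (auto simp: gauss_moment_Cons_0 intro: gauss_moment_Cons_cong)
qed simp

lemma gauss_moment_filter_le: "gauss_moment (map f (filter P is)) a \<le> gauss_moment (map f is) a"
proof -
  have eq: "map (\<lambda>i. if P i then f i else 0) is = map (\<lambda>i. (if P i then 1 else 0) *\<^sub>C f i) is"
    by (auto simp: scaleC_one scaleC.zero_left)
  show ?thesis
    unfolding gauss_moment_filter[symmetric] eq by (rule gauss_moment_contract) simp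
qed

lemma gauss_moment_add_le:
  "gauss_moment (map (\<lambda>i. p i + q i) is) (a + b) \<le> 2 * gauss_moment (map p is) a + 2 * gauss_moment (map q is) b"
proof (induction "is" arbitrary: a b)
  case Nil
  have "(norm (a + b))\<^sup>2 \<le> (norm a + norm b)\<^sup>2"
    by (intro power_mono norm_triangle_ineq) simp
  also have "\<dots> \<le> 2 * (norm a)\<^sup>2 + 2 * (norm b)\<^sup>2"
    using sum_squares_bound[of "norm a" "norm b"] by (simp add: power2_eq_square algebra_simps)
  finally have "ennreal ((norm (a + b))\<^sup>2) \<le> ennreal (2 * (norm a)\<^sup>2 + 2 * (norm b)\<^sup>2)"
    by (rule ennreal_leI)
  then show ?case by (simp add: gauss_moment.simps ennreal_mult')
next
  case (Cons i "is")
  have eq: "a + b + g *\<^sub>C (p i + q i) = (a + g *\<^sub>C p i) + (b + g *\<^sub>C q i)" for g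
    by (simp add: scaleC_add_right)
  have "gauss_moment (map (\<lambda>i. p i + q i) (i # is)) (a + b)
     \<le> (\<integral>\<^sup>+g. 2 * gauss_moment (map p is) (a + g *\<^sub>C p i) + 2 * gauss_moment (map q is) (b + g *\<^sub>C q i) \<partial>cgauss)"
    unfolding list.map gauss_moment.simps eq by (intro nn_integral_mono Cons.IH)
  also have "\<dots> = 2 * gauss_moment (map p (i # is)) a + 2 * gauss_moment (map q (i # is)) b"
    by (simp add: gauss_moment.simps nn_integral_add nn_integral_cmult)
  finally show ?case .
qed

text \<open>A single operator can be pulled out of a Gaussian sum at the cost of its norm bound.
  This treats an operator that occurs at many indices, a situation about which gamma-boundedness
  with its distinct operators says nothing directly.\<close>

lemma gauss_moment_bounded_clinear:
  assumes S: "bounded_clinear S" and C: "\<And>x. norm (S x) \<le> C * norm x"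
  shows "gauss_moment (map (\<lambda>i. S (f i)) is) (S a) \<le> ennreal (C\<^sup>2) * gauss_moment (map f is) a"
proof (induction "is" arbitrary: a)
  case Nil
  have "(norm (S a))\<^sup>2 \<le> (C * norm a)\<^sup>2" by (intro power_mono C) simp
  then have "ennreal ((norm (S a))\<^sup>2) \<le> ennreal (C\<^sup>2 * (norm a)\<^sup>2)"
    by (intro ennreal_leI) (simp add: power_mult_distrib)
  then show ?case by (simp add: gauss_moment.simps ennreal_mult')
next
  case (Cons i "is")
  have eq: "S a + g *\<^sub>C S (f i) = S (a + g *\<^sub>C f i)" for g
    using S by (simp add: bounded_clinear_def linear_add[OF bounded_linear.linear])
  have "gauss_moment (map (\<lambda>i. S (f i)) (i # is)) (S a)
      \<le> (\<integral>\<^sup>+g. ennreal (C\<^sup>2) * gauss_moment (map f is) (a + g *\<^sub>C f i) \<partial>cgauss)"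
    unfolding list.map gauss_moment.simps eq by (intro nn_integral_mono Cons.IH)
  then show ?case by (simp add: gauss_moment.simps nn_integral_cmult)
qed

text \<open>Right continuity at 0 spreads to two-sided continuity because the uniform bound controls
  \<open>T b x - T a x = T a (T (b - a) x - x)\<close> independently of \<open>a\<close>.\<close>

lemma C0_semigroup_continuous:
  fixes T :: "real \<Rightarrow> 'a::cbanach \<Rightarrow> 'a"
  assumes T: "C0_semigroup T" and C: "C \<ge> 0" "\<And>t x. t \<ge> 0 \<Longrightarrow> norm (T t x) \<le> C * norm x"
  shows "continuous_on {0..} (\<lambda>t. T t x)"
proof -
  have diff: "norm (T b x - T a x) \<le> C * norm (T (b - a) x - x)" if "0 \<le> a" "a \<le> b" for a b
  proof -
    have "T b x = T a (T (b - a) x)"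
      using T that unfolding C0_semigroup_def by (metis add.commute diff_add_cancel diff_ge_0_iff_ge)
    moreover have "bounded_linear (T a)" using T that by (simp add: C0_semigroup_def bounded_clinear_def)
    ultimately have "T b x - T a x = T a (T (b - a) x - x)"
      by (simp add: linear_diff[OF bounded_linear.linear])
    then show ?thesis using C(2)[OF that(1)] by simp
  qed
  show ?thesis
    unfolding continuous_on_iff
  proof (intro ballI allI impI)
    fix t e :: real assume t: "t \<in> {0..}" and e: "e > 0"
    have "((\<lambda>t. T t x) \<longlongrightarrow> x) (at_right 0)" using T by (simp add: C0_semigroup_def)
    then have "eventually (\<lambda>h. dist (T h x) x < e / (C + 1)) (at_right 0)"
      using e C(1) by (intro tendstoD) auto
    then obtain d where d: "d > 0" "\<And>h. 0 < h \<Longrightarrow> h < d \<Longrightarrow> dist (T h x) x < e / (C + 1)"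
      unfolding eventually_at_right_field by auto
    have small: "C * norm (T h x - x) < e" if "0 < h" "h < d" for h
    proof -
      have "C * norm (T h x - x) \<le> (C + 1) * norm (T h x - x)" by (intro mult_right_mono) auto
      also have "\<dots> < (C + 1) * (e / (C + 1))"
        using d(2)[OF that] C(1) by (intro mult_strict_left_mono) (auto simp: dist_norm)
      finally show ?thesis using C(1) by simp
    qed
    have "dist (T s x) (T t x) < e" if s: "s \<in> {0..}" "dist s t < d" for s
    proof -
      consider "s = t" | "s < t" | "t < s" by linarith
      then show ?thesis
      proof cases
        case 2
        then have "norm (T t x - T s x) \<le> C * norm (T (t - s) x - x)" using s by (intro diff) auto
        also have "\<dots> < e" using 2 s by (intro small) (auto simp: dist_real_def)
        finally show ?thesis by (simp add: dist_norm norm_minus_commute)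
      next
        case 3
        then have "norm (T s x - T t x) \<le> C * norm (T (s - t) x - x)" using t by (intro diff) auto
        also have "\<dots> < e" using 3 s by (intro small) (auto simp: dist_real_def)
        finally show ?thesis by (simp add: dist_norm)
      qed (use e in simp)
    qed
    then show "\<exists>d>0. \<forall>s\<in>{0..}. dist s t < d \<longrightarrow> dist (T s x) (T t x) < e" using d(1) by blast
  qed
qed

text \<open>The definition of gamma-boundedness only admits distinct operators, so the times \<open>j \<tau>\<close> are
  chosen with \<open>T(j \<tau>)\<close> distinct. This is possible for all but countably many \<open>\<tau>\<close>, unless the
  semigroup is eventually constant.\<close>

lemma semigroup_distinct_times:
  fixes T :: "real \<Rightarrow> 'a::cbanach \<Rightarrow> 'a"
  assumes T: "C0_semigroup T" and cont: "\<And>x. continuous_on {0..} (\<lambda>t. T t x)"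
    and nonconst: "\<And>s. s \<ge> 0 \<Longrightarrow> \<exists>h\<ge>0. T (s + h) \<noteq> T s" and e: "e > 0"
  shows "\<exists>\<tau>. 0 < \<tau> \<and> \<tau> < e \<and> inj (\<lambda>j::nat. T (real j * \<tau>))"
proof -
  have add: "T (s + t) = T s \<circ> T t" if "s \<ge> 0" "t \<ge> 0" for s t
    using T that by (auto simp: C0_semigroup_def)
  have shift: "T (s + h) = T s" if "T (r + h) = T r" "0 \<le> r" "r \<le> s" "0 \<le> h" for r s h
  proof -
    have "T (s + h) = T (s - r) \<circ> T (r + h)" using that add[of "s - r" "r + h"] by simp
    also have "\<dots> = T s" using that add[of "s - r" r] by simp
    finally show ?thesis .
  qed
  have multiple: "T (s + real k * h) = T s" if "T (s + h) = T s" "0 \<le> s" "0 \<le> h" for s h k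
  proof (induction k)
    case (Suc k)
    have "T (s + real k * h + h) = T (s + real k * h)" by (rule shift[OF that(1)]) (use that in auto)
    then show ?case using Suc by (simp add: algebra_simps)
  qed simp
  \<comment> \<open>If \<open>T (s + h) = T s\<close> held for arbitrarily small \<open>h\<close>,
    the multiples of these periods would be dense in the future of \<open>s\<close>, and continuity
    would make \<open>T\<close> constant from \<open>s\<close> on.\<close>
  have gap: "\<exists>\<delta>>0. \<forall>h. 0 < h \<and> h < \<delta> \<longrightarrow> T (s + h) \<noteq> T s" if s: "s \<ge> 0" for s
  proof (rule ccontr)
    assume "\<not> (\<exists>\<delta>>0. \<forall>h. 0 < h \<and> h < \<delta> \<longrightarrow> T (s + h) \<noteq> T s)"
    then have small: "\<exists>h. 0 < h \<and> h < \<delta> \<and> T (s + h) = T s" if "\<delta> > 0" for \<delta> using that by blast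
    have "T (s + u) x = T s x" if u: "u \<ge> 0" for u x
    proof -
      have "dist (T s x) (T (s + u) x) \<le> 0 + \<epsilon>" if "\<epsilon> > 0" for \<epsilon>
      proof -
        have "s + u \<in> {0..}" using s u by simp
        then obtain d where d: "d > 0" "\<And>t. t \<in> {0..} \<Longrightarrow> dist t (s + u) < d \<Longrightarrow> dist (T t x) (T (s + u) x) < \<epsilon>"
          using cont[of x] \<open>\<epsilon> > 0\<close> unfolding continuous_on_iff by blast
        obtain h where h: "0 < h" "h < d" "T (s + h) = T s" using small[OF d(1)] by blast
        define k where "k = nat \<lfloor>u / h\<rfloor>"
        have k: "real k \<le> u / h" "u / h < real k + 1" using u h by (auto simp: k_def)
        then have "real k * h \<le> u" "u < real k * h + h" using h by (auto simp: field_simps)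
        then have "dist (s + real k * h) (s + u) < d" using h by (auto simp: dist_real_def)
        then have "dist (T (s + real k * h) x) (T (s + u) x) < \<epsilon>" using s h by (intro d(2)) auto
        then show ?thesis using multiple[OF h(3) s] h by simp
      qed
      then have "dist (T s x) (T (s + u) x) \<le> 0" by (rule field_le_epsilon)
      then show ?thesis by simp
    qed
    then show False using nonconst[OF s] by blast
  qed
  \<comment> \<open>The parameters up to \<open>m\<close> at which the operators with indices
    \<open>i\<close> and \<open>i + d\<close> coincide. Three natural numbers index these sets, so
    finiteness of each makes the exceptional set countable.\<close>
  define bad where "bad i d m = {\<tau>. 0 < \<tau> \<and> \<tau> \<le> real m \<and> T (real i * \<tau> + real d * \<tau>) = T (real i * \<tau>)}" for i d m :: nat
  have fin: "finite (bad i d m)" if d: "d > 0" for i d m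
  proof -
    \<comment> \<open>A coincidence at an earlier time persists at later ones, so those for all
      \<tau> up to \<open>m\<close> can be compared at the common time \<open>s\<close>.\<close>
    define s where "s = real i * real m"
    have s0: "s \<ge> 0" by (simp add: s_def)
    obtain \<delta> where \<delta>: "\<delta> > 0" "\<And>h. 0 < h \<Longrightarrow> h < \<delta> \<Longrightarrow> T (s + real d * real m + h) \<noteq> T (s + real d * real m)"
      using gap[of "s + real d * real m"] s0 by auto
    have bad_s: "T (s + real d * \<tau>) = T s" if "\<tau> \<in> bad i d m" for \<tau>
    proof -
      have \<tau>: "0 < \<tau>" "\<tau> \<le> real m" and eq: "T (real i * \<tau> + real d * \<tau>) = T (real i * \<tau>)"
        using that by (simp_all add: bad_def)
      have "real i * \<tau> \<le> s" unfolding s_def by (rule mult_left_mono[OF \<tau>(2)]) simp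
      with \<tau> show ?thesis by (intro shift[OF eq]) simp_all
    qed
    \<comment> \<open>Two exceptional parameters yield the period
      \<open>real d * (\<tau>' - \<tau>)\<close>, which by the choice of \<delta> cannot be shorter
      than \<delta>. So exceptional parameters are separated, and only finitely many fit below
      \<open>m\<close>.\<close>
    have sep: "\<delta> \<le> real d * (\<tau>' - \<tau>)" if "\<tau> \<in> bad i d m" "\<tau>' \<in> bad i d m" "\<tau> < \<tau>'" for \<tau> \<tau>'
    proof (rule ccontr)
      assume "\<not> \<delta> \<le> real d * (\<tau>' - \<tau>)"
      then have ne: "T (s + real d * real m + real d * (\<tau>' - \<tau>)) \<noteq> T (s + real d * real m)"
        using that d by (intro \<delta>(2)) auto
      have "s + real d * \<tau> + real d * (\<tau>' - \<tau>) = s + real d * \<tau>'" by (simp add: algebra_simps)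
      then have eq: "T (s + real d * \<tau> + real d * (\<tau>' - \<tau>)) = T (s + real d * \<tau>)"
        by (simp only: bad_s[OF that(1)] bad_s[OF that(2)])
      have \<tau>: "0 < \<tau>" "\<tau> \<le> real m" using that(1) by (simp_all add: bad_def)
      have "real d * \<tau> \<le> real d * real m" by (rule mult_left_mono[OF \<tau>(2)]) simp
      then have "T (s + real d * real m + real d * (\<tau>' - \<tau>)) = T (s + real d * real m)"
        using \<tau> s0 that(3) by (intro shift[OF eq]) simp_all
      with ne show False by blast
    qed
    have inj: "inj_on (\<lambda>\<tau>. \<lfloor>real d * \<tau> / \<delta>\<rfloor>) (bad i d m)"
    proof (rule linorder_inj_onI')
      fix \<tau> \<tau>' assume *: "\<tau> \<in> bad i d m" "\<tau>' \<in> bad i d m" "\<tau> < \<tau>'"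
      have "(real d * \<tau> + \<delta>) / \<delta> \<le> real d * \<tau>' / \<delta>"
        using sep[OF *] \<delta>(1) by (intro divide_right_mono) (auto simp: algebra_simps)
      then have "real d * \<tau> / \<delta> + 1 \<le> real d * \<tau>' / \<delta>" using \<delta>(1) by (simp add: add_divide_distrib)
      then show "\<lfloor>real d * \<tau> / \<delta>\<rfloor> \<noteq> \<lfloor>real d * \<tau>' / \<delta>\<rfloor>" by linarith
    qed
    have "(\<lambda>\<tau>. \<lfloor>real d * \<tau> / \<delta>\<rfloor>) ` bad i d m \<subseteq> {0..\<lfloor>real d * real m / \<delta>\<rfloor>}"
      using \<delta>(1) by (auto simp: bad_def intro!: floor_mono divide_right_mono mult_left_mono)
    then have "finite ((\<lambda>\<tau>. \<lfloor>real d * \<tau> / \<delta>\<rfloor>) ` bad i d m)" by (rule finite_subset) simp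
    then show ?thesis using inj by (rule finite_imageD)
  qed
  have c1: "countable (\<Union>m. bad i (Suc d) m)" for i d
    by (rule countable_UN) (simp_all add: countable_finite fin)
  have c2: "countable (\<Union>d. \<Union>m. bad i (Suc d) m)" for i
    by (rule countable_UN) (simp, rule c1)
  have "countable (\<Union>i. \<Union>d. \<Union>m. bad i (Suc d) m)"
    by (rule countable_UN) (simp, rule c2)
  moreover have "uncountable {0<..<e}" using e by (simp add: uncountable_open_interval)
  ultimately have "\<not> {0<..<e} \<subseteq> (\<Union>i. \<Union>d. \<Union>m. bad i (Suc d) m)" using countable_subset by blast
  then obtain \<tau> where "\<tau> \<in> {0<..<e}" "\<tau> \<notin> (\<Union>i. \<Union>d. \<Union>m. bad i (Suc d) m)" by blast
  then have \<tau>: "0 < \<tau>" "\<tau> < e" "\<And>i d m. \<tau> \<notin> bad i (Suc d) m" by auto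
  have "inj (\<lambda>j::nat. T (real j * \<tau>))"
  proof (rule linorder_injI)
    fix i j :: nat assume "i < j"
    then obtain d where d: "j = i + Suc d" using less_iff_Suc_add by auto
    obtain m :: nat where "\<tau> \<le> real m" using real_arch_simple by blast
    with \<tau>(1) \<tau>(3)[of i d m] show "T (real i * \<tau>) \<noteq> T (real j * \<tau>)"
      by (simp add: bad_def d algebra_simps)
  qed
  with \<tau> show ?thesis by blast
qed

text \<open>Arbitrarily small \<tau> are provided and not all \<tau>, which is enough because the
  discretizations are only taken along a sequence tending to 0.\<close>

theorem gamma_bounded_semigroup_discrete:
  fixes T :: "real \<Rightarrow> 'a::cbanach \<Rightarrow> 'a"
  assumes T: "C0_semigroup T" and gb: "gamma_bounded_semigroup T"
  obtains C where "C \<ge> 0" "\<And>t x. t \<ge> 0 \<Longrightarrow> norm (T t x) \<le> C * norm x"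
    "\<And>e. e > 0 \<Longrightarrow> \<exists>\<tau>. 0 < \<tau> \<and> \<tau> < e \<and> (\<forall>N w. gauss_moment (map (\<lambda>j. T (real j * \<tau>) (w j)) [0..<N]) 0
        \<le> ennreal (C\<^sup>2) * gauss_moment (map w [0..<N]) 0)"
proof -
  obtain C where C: "C \<ge> 0"
    "\<And>js S w. distinct js \<Longrightarrow> inj_on S (set js) \<Longrightarrow> S ` set js \<subseteq> T ` {0..} \<Longrightarrow>
       gauss_moment (map (\<lambda>j::nat. S j (w j)) js) 0 \<le> ennreal (C\<^sup>2) * gauss_moment (map w js) 0"
    using gamma_bounded_gauss_moment gb unfolding gamma_bounded_semigroup_def by blast
  have bl: "bounded_clinear (T t)" if "t \<ge> 0" for t using T that by (simp add: C0_semigroup_def)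
  have bound: "norm (T t x) \<le> C * norm x" if "t \<ge> 0" for t x
  proof -
    have "ennreal ((norm (T t x))\<^sup>2) \<le> ennreal (C\<^sup>2) * ennreal ((norm x)\<^sup>2)"
      using C(2)[of "[0]" "\<lambda>_. T t" "\<lambda>_. x"] that by (simp add: gauss_moment_single)
    then have "(norm (T t x))\<^sup>2 \<le> (C * norm x)\<^sup>2"
      by (simp flip: ennreal_mult add: power_mult_distrib)
    then show ?thesis by (rule power2_le_imp_le) (simp add: C(1))
  qed
  note cont = C0_semigroup_continuous[OF T C(1) bound]
  show ?thesis
  proof (cases "\<forall>s\<ge>0. \<exists>h\<ge>0. T (s + h) \<noteq> T s")
    case True
    show ?thesis
    proof (rule that[OF C(1) bound])
      fix e :: real assume "e > 0"
      then obtain \<tau> where \<tau>: "0 < \<tau>" "\<tau> < e" "inj (\<lambda>j::nat. T (real j * \<tau>))"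
        using semigroup_distinct_times[OF T cont] True by blast
      have "gauss_moment (map (\<lambda>j. T (real j * \<tau>) (w j)) [0..<N]) 0 \<le> ennreal (C\<^sup>2) * gauss_moment (map w [0..<N]) 0" for N w
        using \<tau> by (intro C(2)[of _ "\<lambda>j. T (real j * \<tau>)"]) (auto intro: inj_on_subset)
      with \<tau> show "\<exists>\<tau>. 0 < \<tau> \<and> \<tau> < e \<and> (\<forall>N w. gauss_moment (map (\<lambda>j. T (real j * \<tau>) (w j)) [0..<N]) 0
        \<le> ennreal (C\<^sup>2) * gauss_moment (map w [0..<N]) 0)" by blast
    qed
  next
    case False
    then obtain s where s: "s \<ge> 0" "\<And>h. h \<ge> 0 \<Longrightarrow> T (s + h) = T s" by blast
    have add: "T (a + b) = T a \<circ> T b" if "a \<ge> 0" "b \<ge> 0" for a b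
      using T that by (auto simp: C0_semigroup_def)
    \<comment> \<open>A coincidence at \<open>a\<close> recurs along the multiples of
      \<open>h\<close>, and some multiple passes \<open>s\<close>, where the semigroup is already
      constant. So every repeated operator equals \<open>T s\<close>.\<close>
    have inj: "T a = T s" if ah: "T (a + h) = T a" "a \<ge> 0" "h > 0" for a h
    proof -
      have "T (a + real k * h) = T a" for k
      proof (induction k)
        case (Suc k)
        have "T (a + real (Suc k) * h) = T (real k * h) \<circ> T (a + h)"
          using ah add[of "real k * h" "a + h"] by (simp add: algebra_simps)
        also have "\<dots> = T (a + real k * h)" using ah add[of "real k * h" a] by (simp add: add.commute)
        finally show ?case using Suc by simp
      qed simp
      then have eq: "T (a + real k * h) = T a" for k .
      obtain k :: nat where "s < real k * h" using ah(3) reals_Archimedean3 by blast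
      then have "T (s + (a + real k * h - s)) = T s" using ah(2) by (intro s(2)) simp
      then show ?thesis using eq[of k] by simp
    qed
    show ?thesis
    \<comment> \<open>The sum is split into the indices with operator \<open>T s\<close> and the
      remaining ones, whose operators are distinct. This costs
      \<open>2 * C\<^sup>2 + 2 * C\<^sup>2\<close>, the square of \<open>2 * C\<close>.\<close>
    proof (rule that[of "2 * C"])
      show "2 * C \<ge> 0" using C by simp
      show "norm (T t x) \<le> 2 * C * norm x" if "t \<ge> 0" for t x
        by (rule order_trans[OF bound[OF that] mult_right_mono]) (use C(1) in simp_all)
      fix e :: real assume e: "e > 0"
      define \<tau> where "\<tau> = e / 2"
      have \<tau>: "0 < \<tau>" "\<tau> < e" using e by (auto simp: \<tau>_def)
      define P where "P j \<longleftrightarrow> T (real j * \<tau>) = T s" for j :: nat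
      have "gauss_moment (map (\<lambda>j. T (real j * \<tau>) (w j)) [0..<N]) 0 \<le> ennreal ((2 * C)\<^sup>2) * gauss_moment (map w [0..<N]) 0" for N w
      proof -
        let ?f = "\<lambda>j. T (real j * \<tau>) (w j)" and ?Q = "\<lambda>j. \<not> P j" and ?l = "[0..<N]"
        have "map ?f ?l = map (\<lambda>j. (if P j then ?f j else 0) + (if ?Q j then ?f j else 0)) ?l" by auto
        then have "gauss_moment (map ?f ?l) 0 \<le> 2 * gauss_moment (map ?f (filter P ?l)) 0 + 2 * gauss_moment (map ?f (filter ?Q ?l)) 0"
          using gauss_moment_add_le[of "\<lambda>j. if P j then ?f j else 0" "\<lambda>j. if ?Q j then ?f j else 0" ?l 0 0]
          by (simp only: gauss_moment_filter add_0)
        also have "\<dots> \<le> 2 * (ennreal (C\<^sup>2) * gauss_moment (map w ?l) 0) + 2 * (ennreal (C\<^sup>2) * gauss_moment (map w ?l) 0)"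
        proof (intro add_mono mult_left_mono)
          have eq: "map ?f (filter P ?l) = map (\<lambda>j. T s (w j)) (filter P ?l)" by (auto simp: P_def)
          have "T s 0 = 0"
            using bl[OF s(1)] by (simp add: bounded_clinear_def linear_0 bounded_linear.linear)
          then have "gauss_moment (map ?f (filter P ?l)) 0 \<le> ennreal (C\<^sup>2) * gauss_moment (map w (filter P ?l)) 0"
            unfolding eq using gauss_moment_bounded_clinear[OF bl[OF s(1)] bound[OF s(1)], of w "filter P ?l" 0] by simp
          also have "\<dots> \<le> ennreal (C\<^sup>2) * gauss_moment (map w ?l) 0"
            by (intro mult_left_mono gauss_moment_filter_le) simp
          finally show "gauss_moment (map ?f (filter P ?l)) 0 \<le> ennreal (C\<^sup>2) * gauss_moment (map w ?l) 0" .
          have "inj_on (\<lambda>j. T (real j * \<tau>)) (set (filter ?Q ?l))"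
          proof (rule linorder_inj_onI')
            fix i j assume *: "i \<in> set (filter ?Q ?l)" "j \<in> set (filter ?Q ?l)" "i < j"
            show "T (real i * \<tau>) \<noteq> T (real j * \<tau>)"
            proof
              assume "T (real i * \<tau>) = T (real j * \<tau>)"
              then have "T (real i * \<tau> + (real j - real i) * \<tau>) = T (real i * \<tau>)" by (simp add: algebra_simps)
              then have "T (real i * \<tau>) = T s" by (rule inj) (use * \<tau> in auto)
              with * show False by (simp add: P_def)
            qed
          qed
          then have "gauss_moment (map ?f (filter ?Q ?l)) 0 \<le> ennreal (C\<^sup>2) * gauss_moment (map w (filter ?Q ?l)) 0"
            using \<tau> by (intro C(2)[of _ "\<lambda>j. T (real j * \<tau>)"]) auto
          also have "\<dots> \<le> ennreal (C\<^sup>2) * gauss_moment (map w ?l) 0"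
            by (intro mult_left_mono gauss_moment_filter_le) simp
          finally show "gauss_moment (map ?f (filter ?Q ?l)) 0 \<le> ennreal (C\<^sup>2) * gauss_moment (map w ?l) 0" .
        qed auto
        also have "\<dots> = ennreal ((2 * C)\<^sup>2) * gauss_moment (map w ?l) 0"
        proof -
          have "2 * a + 2 * a = (2 + 2) * a" for a :: ennreal by (rule distrib_right[symmetric])
          moreover have "ennreal ((2 * C)\<^sup>2) = (2 + 2) * ennreal (C\<^sup>2)" by (simp add: power_mult_distrib ennreal_mult)
          ultimately show ?thesis by (simp only: mult.assoc)
        qed
        finally show ?thesis .
      qed
      with \<tau> show "\<exists>\<tau>. 0 < \<tau> \<and> \<tau> < e \<and> (\<forall>N w. gauss_moment (map (\<lambda>j. T (real j * \<tau>) (w j)) [0..<N]) 0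
        \<le> ennreal ((2 * C)\<^sup>2) * gauss_moment (map w [0..<N]) 0)" by blast
    qed
  qed
qed

subsection \<open>Functionals continuous under bounded pointwise convergence\<close>

text \<open>The common frame for integrals against complex measures, absolutely convergent series of
  point evaluations and their convolutions. The third clause is dominated convergence in abstract
  form; approximation by polynomials in \<open>exp (- t)\<close> calls for it, since on the
  half-line that approximation is in general not uniform.\<close>

definition bc_functional :: "((real \<Rightarrow> 'b::cbanach) \<Rightarrow> 'a::cbanach) \<Rightarrow> bool" where
  "bc_functional L \<longleftrightarrow>
     (\<forall>\<phi>\<in>bcont. \<forall>\<psi>\<in>bcont. L (\<lambda>t. \<phi> t + \<psi> t) = L \<phi> + L \<psi>) \<and>
     (\<exists>M\<ge>0. \<forall>\<phi>\<in>bcont. \<forall>B. (\<forall>t\<ge>0. norm (\<phi> t) \<le> B) \<longrightarrow> norm (L \<phi>) \<le> M * B) \<and>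
     (\<forall>\<Phi>. \<forall>\<phi>\<in>bcont. \<forall>B. (\<forall>n::nat. \<Phi> n \<in> bcont) \<longrightarrow> (\<forall>n. \<forall>t\<ge>0. norm (\<Phi> n t) \<le> B) \<longrightarrow>
        (\<forall>t\<ge>0. (\<lambda>n. \<Phi> n t) \<longlonglongrightarrow> \<phi> t) \<longrightarrow> (\<lambda>n. L (\<Phi> n)) \<longlonglongrightarrow> L \<phi>)"

lemma bc_functional_add:
  "bc_functional L \<Longrightarrow> \<phi> \<in> bcont \<Longrightarrow> \<psi> \<in> bcont \<Longrightarrow> L (\<lambda>t. \<phi> t + \<psi> t) = L \<phi> + L \<psi>"
  by (simp add: bc_functional_def)

lemma bc_functional_bound:
  assumes "bc_functional L"
  obtains M where "M \<ge> 0" "\<And>\<phi> B. \<phi> \<in> bcont \<Longrightarrow> (\<And>t. t \<ge> 0 \<Longrightarrow> norm (\<phi> t) \<le> B) \<Longrightarrow> norm (L \<phi>) \<le> M * B"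
  using assms unfolding bc_functional_def by blast

lemma bc_functional_tendsto:
  assumes "bc_functional L" "\<phi> \<in> bcont" "\<And>n::nat. \<Phi> n \<in> bcont"
    "\<And>n t. t \<ge> 0 \<Longrightarrow> norm (\<Phi> n t) \<le> B" "\<And>t. t \<ge> 0 \<Longrightarrow> (\<lambda>n. \<Phi> n t) \<longlonglongrightarrow> \<phi> t"
  shows "(\<lambda>n. L (\<Phi> n)) \<longlonglongrightarrow> L \<phi>"
  using assms unfolding bc_functional_def by blast

lemma bcontI:
  assumes "continuous_on {0..} \<phi>" "\<And>t. t \<ge> 0 \<Longrightarrow> norm (\<phi> t) \<le> B"
  shows "\<phi> \<in> bcont"
  using assms by (auto simp: bcont_def bounded_iff)

lemma bcontE:
  assumes "\<phi> \<in> bcont"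
  obtains B where "B \<ge> 0" "\<And>t. t \<ge> 0 \<Longrightarrow> norm (\<phi> t) \<le> B"
proof -
  from assms obtain B where B: "\<And>t. t \<ge> 0 \<Longrightarrow> norm (\<phi> t) \<le> B"
    by (auto simp: bcont_def bounded_iff)
  moreover have "B \<ge> 0" using order_trans[OF norm_ge_zero B[of 0]] by simp
  ultimately show ?thesis using that by blast
qed

lemma bcont_continuous: "\<phi> \<in> bcont \<Longrightarrow> continuous_on {0..} \<phi>"
  by (simp add: bcont_def)

lemma bcont_add: "\<phi> \<in> bcont \<Longrightarrow> \<psi> \<in> bcont \<Longrightarrow> (\<lambda>t. \<phi> t + \<psi> t) \<in> bcont"
  by (auto simp: bcont_def intro!: continuous_intros bounded_plus_comp)

lemma bcont_const: "(\<lambda>t. c) \<in> bcont"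
  by (rule bcontI[of _ "norm c"]) auto

lemma bcont_sum: "(\<And>i. i \<in> I \<Longrightarrow> \<phi> i \<in> bcont) \<Longrightarrow> (\<lambda>t. \<Sum>i\<in>I. \<phi> i t) \<in> bcont"
  by (induction I rule: infinite_finite_induct) (simp_all add: bcont_const bcont_add)

lemma bcont_scaleR:
  fixes v :: "'a::real_normed_vector"
  assumes "continuous_on {0..} a" "\<And>t. t \<ge> 0 \<Longrightarrow> \<bar>a t\<bar> \<le> (1::real)"
  shows "(\<lambda>t. a t *\<^sub>R v) \<in> bcont"
  by (rule bcontI[of _ "norm v"]) (use assms in \<open>auto intro!: continuous_intros mult_left_le_one_le\<close>)

lemma bcont_shift:
  assumes "\<phi> \<in> bcont" "s \<ge> 0"
  shows "(\<lambda>t. \<phi> (s + t)) \<in> bcont"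
proof -
  obtain B where "B \<ge> 0" "\<And>t. t \<ge> 0 \<Longrightarrow> norm (\<phi> t) \<le> B" using bcontE[OF assms(1)] by blast
  moreover have "continuous_on {0..} (\<lambda>t. \<phi> (s + t))"
    by (rule continuous_on_compose2[OF bcont_continuous[OF assms(1)]])
       (use assms(2) in \<open>auto intro!: continuous_intros\<close>)
  ultimately show ?thesis using assms(2) by (intro bcontI[of _ B]) auto
qed

lemma bc_functional_zero:
  assumes "bc_functional L"
  shows "L (\<lambda>t. 0) = 0"
  using bc_functional_add[OF assms bcont_const[of 0] bcont_const[of 0]] by simp

lemma bc_functional_sum:
  assumes "bc_functional L" "\<And>i. i \<in> I \<Longrightarrow> \<phi> i \<in> bcont"
  shows "L (\<lambda>t. \<Sum>i\<in>I. \<phi> i t) = (\<Sum>i\<in>I. L (\<phi> i))"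
  using assms(2)
  by (induction I rule: infinite_finite_induct)
     (simp_all add: bc_functional_zero[OF assms(1)] bc_functional_add[OF assms(1)] bcont_sum)

section \<open>Bernstein approximation and determination of functionals\<close>

lemma Bernstein_variance:
  "(\<Sum>k\<le>n. (real k - real n * x)\<^sup>2 * Bernstein n k x) = real n * x * (1 - x)"
proof -
  have "(real k - real n * x)\<^sup>2 * Bernstein n k x
     = real k * (real k - 1) * Bernstein n k x + (1 - 2 * real n * x) * (real k * Bernstein n k x)
       + (real n * x)\<^sup>2 * Bernstein n k x" for k
    by (simp add: algebra_simps power2_eq_square)
  then have "(\<Sum>k\<le>n. (real k - real n * x)\<^sup>2 * Bernstein n k x)
    = (\<Sum>k\<le>n. real k * (real k - 1) * Bernstein n k x) + (1 - 2 * real n * x) * (\<Sum>k\<le>n. real k * Bernstein n k x)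
      + (real n * x)\<^sup>2 * (\<Sum>k\<le>n. Bernstein n k x)"
    by (simp only: sum.distrib sum_distrib_left)
  also have "\<dots> = real n * x * (1 - x)"
    by (simp only: sum_kk_Bernstein sum_k_Bernstein sum_Bernstein) (simp add: algebra_simps power2_eq_square)
  finally show ?thesis .
qed

text \<open>The estimate is Chebyshev's inequality for the binomial distribution. Continuity is
  asked at the point \<open>u\<close> alone because the function to be approximated, a bounded
  continuous function of \<open>t\<close> in the variable \<open>exp (- t)\<close>, may oscillate at
  the endpoint 0.\<close>

lemma Bernstein_tendsto:
  fixes f :: "real \<Rightarrow> 'a::real_normed_vector"
  assumes u: "u \<in> {0..1}" and B: "\<And>x. x \<in> {0..1} \<Longrightarrow> norm (f x) \<le> B"
    and cont: "continuous (at u within {0..1}) f"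
  shows "(\<lambda>n. \<Sum>k\<le>n. Bernstein n k u *\<^sub>R f (real k / real n)) \<longlonglongrightarrow> f u"
proof (rule LIMSEQ_I)
  fix e :: real assume e: "e > 0"
  have B0: "B \<ge> 0" using B[OF u] norm_ge_zero[of "f u"] by linarith
  from cont e obtain d where d: "d > 0" "\<And>x. x \<in> {0..1} \<Longrightarrow> dist x u < d \<Longrightarrow> dist (f x) (f u) < e/2"
    unfolding continuous_within_eps_delta by (meson half_gt_zero)
  obtain N :: nat where N: "4 * B / d\<^sup>2 / e < N" using reals_Archimedean2 by blast
  have "norm ((\<Sum>k\<le>n. Bernstein n k u *\<^sub>R f (real k / real n)) - f u) < e" if n: "n \<ge> Suc N" for n
  proof -
    have n0: "n > 0" using n by simp
    have pos: "0 \<le> Bernstein n k u" for k using u by (simp add: Bernstein_nonneg)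
    \<comment> \<open>Near \<open>u\<close> the first term suffices by continuity. Otherwise
      \<open>k / n\<close> is at distance at least \<open>d\<close> from \<open>u\<close>, and the
      crude bound \<open>2 * B\<close> is absorbed by the quadratic term, whose mean is the binomial
      variance.\<close>
    have bound: "norm (f (real k / real n) - f u) \<le> e/2 + 2 * B / d\<^sup>2 / (real n)\<^sup>2 * (real k - real n * u)\<^sup>2"
      if "k \<le> n" for k
    proof (cases "dist (real k / real n) u < d")
      case True
      have "norm (f (real k / real n) - f u) \<le> e/2"
        using d(2)[OF _ True] that n0 by (auto simp: dist_norm)
      moreover have "0 \<le> 2 * B / d\<^sup>2 / (real n)\<^sup>2 * (real k - real n * u)\<^sup>2" using B0 by simp
      ultimately show ?thesis by linarith
    next
      case False
      have "norm (f (real k / real n) - f u) \<le> 2 * B"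
        using norm_triangle_ineq4[of "f (real k / real n)" "f u"] B[of "real k / real n"] B[OF u] that n0 by simp
      also have "\<dots> \<le> 2 * B * ((real k / real n - u)\<^sup>2 / d\<^sup>2)"
      proof -
        have "d\<^sup>2 \<le> \<bar>real k / real n - u\<bar>\<^sup>2"
          using False d(1) by (intro power_mono) (auto simp: dist_real_def)
        then have "1 \<le> (real k / real n - u)\<^sup>2 / d\<^sup>2" using d(1) by simp
        from mult_left_mono[OF this, of "2 * B"] show ?thesis using B0 by simp
      qed
      also have "(real k / real n - u)\<^sup>2 = (real k - real n * u)\<^sup>2 / (real n)\<^sup>2"
        using n0 by (simp add: power_divide[symmetric] diff_divide_distrib)
      finally show ?thesis using e by (simp add: mult.commute)
    qed
    have "(\<Sum>k\<le>n. Bernstein n k u *\<^sub>R f (real k / real n)) - f u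
        = (\<Sum>k\<le>n. Bernstein n k u *\<^sub>R (f (real k / real n) - f u))"
      by (simp add: scaleR_diff_right sum_subtractf scaleR_sum_left[symmetric])
    also have "norm \<dots> \<le> (\<Sum>k\<le>n. Bernstein n k u * norm (f (real k / real n) - f u))"
      by (rule order_trans[OF norm_sum]) (simp add: pos)
    also have "\<dots> \<le> (\<Sum>k\<le>n. Bernstein n k u * (e/2 + 2 * B / d\<^sup>2 / (real n)\<^sup>2 * (real k - real n * u)\<^sup>2))"
      by (intro sum_mono mult_left_mono bound pos) auto
    also have "\<dots> = e/2 * (\<Sum>k\<le>n. Bernstein n k u) + 2 * B / d\<^sup>2 / (real n)\<^sup>2 * (\<Sum>k\<le>n. (real k - real n * u)\<^sup>2 * Bernstein n k u)"
      unfolding sum_distrib_left sum.distrib[symmetric] by (rule sum.cong) (auto simp: algebra_simps)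
    also have "\<dots> = e/2 + 2 * B / d\<^sup>2 / (real n)\<^sup>2 * (real n * u * (1 - u))"
      by (simp add: Bernstein_variance)
    also have "\<dots> \<le> e/2 + 2 * B / d\<^sup>2 / (real n)\<^sup>2 * real n"
    proof -
      have "u * (1 - u) \<le> 1 * 1" using u by (intro mult_mono) auto
      then have "real n * (u * (1 - u)) \<le> real n * 1" by (intro mult_left_mono) auto
      then show ?thesis using B0 by (intro add_left_mono mult_left_mono) (auto simp: mult.assoc)
    qed
    also have "2 * B / d\<^sup>2 / (real n)\<^sup>2 * real n = 2 * B / d\<^sup>2 / real n"
      using n0 by (simp add: power2_eq_square)
    also have "\<dots> < e / 2"
    proof -
      have "4 * B / d\<^sup>2 / e < real n" using N n by simp
      then have *: "4 * B / d\<^sup>2 < real n * e" by (subst (asm) pos_divide_less_eq[OF e])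
      have "2 * B / d\<^sup>2 / real n = (4 * B / d\<^sup>2) / real n / 2" by simp
      also have "\<dots> < e / 2" using * n0 by (simp only: pos_divide_less_eq[of "real n"] of_nat_0_less_iff divide_strict_right_mono zero_less_numeral mult.commute)
      finally show ?thesis .
    qed
    finally show ?thesis by simp
  qed
  then show "\<exists>no. \<forall>n\<ge>no. norm ((\<Sum>k\<le>n. Bernstein n k u *\<^sub>R f (real k / real n)) - f u) < e"
    by blast
qed

theorem bc_functional_eqI:
  fixes L L' :: "(real \<Rightarrow> 'b::cbanach) \<Rightarrow> 'a::cbanach"
  assumes L: "bc_functional L" and L': "bc_functional L'"
    and eq: "\<And>n v. n \<ge> 1 \<Longrightarrow> L (\<lambda>t. exp (- t) ^ n *\<^sub>R v) = L' (\<lambda>t. exp (- t) ^ n *\<^sub>R v)"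
    and \<phi>: "\<phi> \<in> bcont"
  shows "L \<phi> = L' \<phi>"
proof -
  have mem: "(\<lambda>t. (exp (- t) ^ k * (1 - exp (- t)) ^ m) *\<^sub>R v) \<in> bcont" for k m and v :: 'b
    by (rule bcont_scaleR)
       (auto simp: abs_mult power_abs intro!: continuous_intros mult_le_one power_le_one)
  \<comment> \<open>Expanding one factor \<open>1 - exp (- t)\<close> leads to the exponents
    \<open>k\<close> and \<open>k + 1\<close>, so \<open>k \<ge> 1\<close> is preserved. The sign is
    moved into the vector, where additivity of the functionals can deal with it.\<close>
  have 1: "L (\<lambda>t. (exp (- t) ^ k * (1 - exp (- t)) ^ m) *\<^sub>R v) = L' (\<lambda>t. (exp (- t) ^ k * (1 - exp (- t)) ^ m) *\<^sub>R v)"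
    if "k \<ge> 1" for k m v
    using that
  proof (induction m arbitrary: k v)
    case 0
    then show ?case using eq by simp
  next
    case (Suc m)
    have "(\<lambda>t. (exp (- t) ^ k * (1 - exp (- t)) ^ Suc m) *\<^sub>R v)
       = (\<lambda>t. (exp (- t) ^ k * (1 - exp (- t)) ^ m) *\<^sub>R v + (exp (- t) ^ Suc k * (1 - exp (- t)) ^ m) *\<^sub>R (- v))"
      by (rule ext) (simp add: algebra_simps)
    then show ?case
      using bc_functional_add[OF L mem[of k m v] mem[of "Suc k" m "- v"]]
        bc_functional_add[OF L' mem[of k m v] mem[of "Suc k" m "- v"]] Suc.IH[of k v] Suc.IH[of "Suc k" "- v"] Suc.prems
      by simp
  qed
  \<comment> \<open>The value 0 at 0 removes the term \<open>k = 0\<close> of the Bernstein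
    polynomial, the only one in which a constant occurs after expansion; the functionals are
    compared at positive powers of \<open>exp (- t)\<close>.\<close>
  define f where "f x = (if x = 0 then 0 else \<phi> (- ln x))" for x
  define p where "p n t = (\<Sum>k\<le>n. Bernstein n k (exp (- t)) *\<^sub>R f (real k / real n))" for n t
  obtain B where B: "B \<ge> 0" "\<And>t. t \<ge> 0 \<Longrightarrow> norm (\<phi> t) \<le> B" using bcontE[OF \<phi>] by blast
  have fB: "norm (f x) \<le> B" if "x \<in> {0..1}" for x
    using that B by (auto simp: f_def)
  have p_eq: "p n t = (\<Sum>k\<le>n. (exp (- t) ^ k * (1 - exp (- t)) ^ (n - k)) *\<^sub>R (real (n choose k) *\<^sub>R f (real k / real n)))" for n t
    by (simp add: p_def Bernstein_def mult_ac)
  have p_mem: "p n \<in> bcont" for n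
    unfolding p_eq[abs_def] by (intro bcont_sum mem)
  have "L (p n) = L' (p n)" for n
  proof -
    have "L (\<lambda>t. (exp (- t) ^ k * (1 - exp (- t)) ^ (n - k)) *\<^sub>R (real (n choose k) *\<^sub>R f (real k / real n)))
       = L' (\<lambda>t. (exp (- t) ^ k * (1 - exp (- t)) ^ (n - k)) *\<^sub>R (real (n choose k) *\<^sub>R f (real k / real n)))" for k
    proof (cases "k = 0")
      case True
      then show ?thesis by (simp add: f_def bc_functional_zero[OF L] bc_functional_zero[OF L'])
    next
      case False
      then show ?thesis by (intro 1) simp
    qed
    then show ?thesis
      unfolding p_eq[abs_def] by (simp add: bc_functional_sum[OF L mem] bc_functional_sum[OF L' mem] del: scaleR_scaleR)
  qed
  moreover have pB: "norm (p n t) \<le> B" if "t \<ge> 0" for n t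
  proof -
    have u: "0 \<le> exp (- t)" "exp (- t) \<le> 1" using that by auto
    have "norm (p n t) \<le> (\<Sum>k\<le>n. Bernstein n k (exp (- t)) * norm (f (real k / real n)))"
      unfolding p_def by (rule order_trans[OF norm_sum]) (simp add: abs_of_nonneg[OF Bernstein_nonneg[OF u]])
    also have "\<dots> \<le> (\<Sum>k\<le>n. Bernstein n k (exp (- t)) * B)"
      by (intro sum_mono mult_left_mono fB Bernstein_nonneg u) (auto simp: divide_le_eq_1)
    also have "\<dots> = B" by (simp flip: sum_distrib_right)
    finally show ?thesis .
  qed
  moreover have plim: "(\<lambda>n. p n t) \<longlonglongrightarrow> \<phi> t" if "t \<ge> 0" for t
  proof -
    have "continuous (at (exp (- t)) within {0..1}) f"
    proof -
      have "continuous_on {0<..1} (\<lambda>x. \<phi> (- ln x))"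
        by (rule continuous_on_compose2[OF bcont_continuous[OF \<phi>]]) (auto intro!: continuous_intros)
      then have "continuous (at (exp (- t)) within {0<..1}) (\<lambda>x. \<phi> (- ln x))"
        using that by (simp add: continuous_on_eq_continuous_within)
      moreover have "at (exp (- t)) within {0..1} = at (exp (- t)) within {0<..1::real}"
        by (rule at_within_nhd[of _ "{0<..}"]) auto
      moreover have "eventually (\<lambda>x. f x = \<phi> (- ln x)) (at (exp (- t)) within {0<..1})"
        by (auto simp: eventually_at_filter f_def intro!: always_eventually)
      ultimately show ?thesis
        by (simp add: continuous_within f_def tendsto_cong[OF \<open>eventually _ _\<close>])
    qed
    then have "(\<lambda>n. p n t) \<longlonglongrightarrow> f (exp (- t))"
      unfolding p_def using that by (intro Bernstein_tendsto[OF _ fB]) auto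
    then show ?thesis by (simp add: f_def)
  qed
  ultimately show ?thesis
    using bc_functional_tendsto[OF L \<phi> p_mem pB plim] bc_functional_tendsto[OF L' \<phi> p_mem pB plim]
    by (simp add: LIMSEQ_unique)
qed

section \<open>Convolution of functionals; series and integrals\<close>

lemma bc_functional_shift_mem:
  assumes L: "bc_functional L" and \<phi>: "\<phi> \<in> bcont"
  shows "(\<lambda>s. L (\<lambda>t. \<phi> (s + t))) \<in> bcont"
proof -
  obtain B where B: "B \<ge> 0" "\<And>t. t \<ge> 0 \<Longrightarrow> norm (\<phi> t) \<le> B" using bcontE[OF \<phi>] by blast
  obtain M where M: "M \<ge> 0" "\<And>\<phi> B. \<phi> \<in> bcont \<Longrightarrow> (\<And>t. t \<ge> 0 \<Longrightarrow> norm (\<phi> t) \<le> B) \<Longrightarrow> norm (L \<phi>) \<le> M * B"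
    using bc_functional_bound[OF L] by blast
  show ?thesis
  proof (rule bcontI[of _ "M * B"])
    show "norm (L (\<lambda>t. \<phi> (s + t))) \<le> M * B" if "s \<ge> 0" for s
      using that B(2) by (intro M(2) bcont_shift \<phi>) auto
    show "continuous_on {0..} (\<lambda>s. L (\<lambda>t. \<phi> (s + t)))"
      unfolding continuous_on_sequentially o_def
    proof (intro allI ballI impI)
      fix x :: "nat \<Rightarrow> real" and s assume s: "s \<in> {0..}" and x: "(\<forall>n. x n \<in> {0..}) \<and> x \<longlonglongrightarrow> s"
      show "(\<lambda>n. L (\<lambda>t. \<phi> (x n + t))) \<longlonglongrightarrow> L (\<lambda>t. \<phi> (s + t))"
      proof (rule bc_functional_tendsto[OF L, where B=B])
        show "(\<lambda>t. \<phi> (s + t)) \<in> bcont" "\<And>n. (\<lambda>t. \<phi> (x n + t)) \<in> bcont"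
          using s x by (auto intro!: bcont_shift[OF \<phi>])
        show "norm (\<phi> (x n + t)) \<le> B" if "t \<ge> 0" for n t
          using that x by (intro B) auto
        show "(\<lambda>n. \<phi> (x n + t)) \<longlonglongrightarrow> \<phi> (s + t)" if "t \<ge> 0" for t
          using that x s
          by (intro continuous_on_tendsto_compose[OF bcont_continuous[OF \<phi>]]) (auto intro!: tendsto_intros)
      qed
    qed
  qed
qed

text \<open>This is convolution: for integrals against two measures the composite is the integral
  against their convolution product.\<close>

lemma bc_functional_compose:
  fixes K L :: "(real \<Rightarrow> 'a::cbanach) \<Rightarrow> 'a"
  assumes L: "bc_functional L" and K: "bc_functional K"
  shows "bc_functional (\<lambda>\<phi>. L (\<lambda>s. K (\<lambda>t. \<phi> (s + t))))"
proof -
  obtain M where M: "M \<ge> 0" "\<And>\<phi> B. \<phi> \<in> bcont \<Longrightarrow> (\<And>t. t \<ge> 0 \<Longrightarrow> norm (\<phi> t) \<le> B) \<Longrightarrow> norm (L \<phi>) \<le> M * B"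
    using bc_functional_bound[OF L] by blast
  obtain N where N: "N \<ge> 0" "\<And>\<phi> B. \<phi> \<in> bcont \<Longrightarrow> (\<And>t. t \<ge> 0 \<Longrightarrow> norm (\<phi> t) \<le> B) \<Longrightarrow> norm (K \<phi>) \<le> N * B"
    using bc_functional_bound[OF K] by blast
  \<comment> \<open>Applied to a constant sequence, the continuity clause shows that a functional
    ignores the values at negative times.\<close>
  have ext: "L \<phi> = L \<psi>" if a: "\<phi> \<in> bcont" "\<psi> \<in> bcont" "\<And>t. t \<ge> 0 \<Longrightarrow> \<phi> t = \<psi> t" for \<phi> \<psi>
  proof -
    have "(\<lambda>n. L \<phi>) \<longlonglongrightarrow> L \<psi>"
    proof -
      obtain B where "\<And>t. t \<ge> 0 \<Longrightarrow> norm (\<phi> t) \<le> B" using bcontE[OF a(1)] by blast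
      with a show ?thesis by (intro bc_functional_tendsto[OF L]) auto
    qed
    then show ?thesis by (simp add: LIMSEQ_const_iff)
  qed
  show ?thesis
    unfolding bc_functional_def
  proof (intro conjI ballI allI impI)
    fix \<phi> \<psi> :: "real \<Rightarrow> 'a" assume \<phi>: "\<phi> \<in> bcont" and \<psi>: "\<psi> \<in> bcont"
    have "L (\<lambda>s. K (\<lambda>t. \<phi> (s + t) + \<psi> (s + t))) = L (\<lambda>s. K (\<lambda>t. \<phi> (s + t)) + K (\<lambda>t. \<psi> (s + t)))"
    proof (rule ext)
      show "(\<lambda>s. K (\<lambda>t. \<phi> (s + t) + \<psi> (s + t))) \<in> bcont"
        using bc_functional_shift_mem[OF K bcont_add[OF \<phi> \<psi>]] .
      show "(\<lambda>s. K (\<lambda>t. \<phi> (s + t)) + K (\<lambda>t. \<psi> (s + t))) \<in> bcont"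
        by (intro bcont_add bc_functional_shift_mem K \<phi> \<psi>)
    qed (rule bc_functional_add[OF K bcont_shift[OF \<phi>] bcont_shift[OF \<psi>]])
    also have "\<dots> = L (\<lambda>s. K (\<lambda>t. \<phi> (s + t))) + L (\<lambda>s. K (\<lambda>t. \<psi> (s + t)))"
      by (intro bc_functional_add L bc_functional_shift_mem K \<phi> \<psi>)
    finally show "L (\<lambda>s. K (\<lambda>t. \<phi> (s + t) + \<psi> (s + t))) = \<dots>" .
  next
    show "\<exists>M\<ge>0. \<forall>\<phi>\<in>bcont. \<forall>B. (\<forall>t\<ge>0. norm (\<phi> t) \<le> B) \<longrightarrow> norm (L (\<lambda>s. K (\<lambda>t. \<phi> (s + t)))) \<le> M * B"
    proof (intro exI[of _ "M * N"] conjI ballI allI impI)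
      fix \<phi> :: "real \<Rightarrow> 'a" and B assume \<phi>: "\<phi> \<in> bcont" and B: "\<forall>t\<ge>0. norm (\<phi> t) \<le> B"
      have "norm (L (\<lambda>s. K (\<lambda>t. \<phi> (s + t)))) \<le> M * (N * B)"
      proof (rule M(2)[OF bc_functional_shift_mem[OF K \<phi>]])
        show "norm (K (\<lambda>t. \<phi> (s + t))) \<le> N * B" if "s \<ge> 0" for s
          using that B by (intro N(2) bcont_shift \<phi>) auto
      qed
      then show "norm (L (\<lambda>s. K (\<lambda>t. \<phi> (s + t)))) \<le> M * N * B" by (simp add: mult.assoc)
    qed (use M(1) N(1) in simp)
  next
    fix \<Phi> :: "nat \<Rightarrow> real \<Rightarrow> 'a" and \<phi> B
    assume \<phi>: "\<phi> \<in> bcont" and \<Phi>: "\<forall>n. \<Phi> n \<in> bcont" "\<forall>n. \<forall>t\<ge>0. norm (\<Phi> n t) \<le> B"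
      and lim: "\<forall>t\<ge>0. (\<lambda>n. \<Phi> n t) \<longlonglongrightarrow> \<phi> t"
    show "(\<lambda>n. L (\<lambda>s. K (\<lambda>t. \<Phi> n (s + t)))) \<longlonglongrightarrow> L (\<lambda>s. K (\<lambda>t. \<phi> (s + t)))"
    proof (rule bc_functional_tendsto[OF L, where B="N * B"])
      show "(\<lambda>s. K (\<lambda>t. \<phi> (s + t))) \<in> bcont" "\<And>n. (\<lambda>s. K (\<lambda>t. \<Phi> n (s + t))) \<in> bcont"
        using \<phi> \<Phi> by (auto intro: bc_functional_shift_mem[OF K])
      show "norm (K (\<lambda>t. \<Phi> n (s + t))) \<le> N * B" if "s \<ge> 0" for n s
        using that \<Phi> by (intro N(2) bcont_shift) auto
      show "(\<lambda>n. K (\<lambda>t. \<Phi> n (s + t))) \<longlonglongrightarrow> K (\<lambda>t. \<phi> (s + t))" if "s \<ge> 0" for s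
        using that \<phi> \<Phi> lim by (intro bc_functional_tendsto[OF K, where B=B] bcont_shift) auto
    qed
  qed
qed

lemma bc_functional_eval: "bc_functional (\<lambda>\<phi>. \<phi> 0)"
  unfolding bc_functional_def by (auto intro!: exI[of _ 1])

lemma bc_functional_series:
  fixes b :: "nat \<Rightarrow> complex"
  assumes b: "summable (\<lambda>k. cmod (b k))" and \<tau>: "\<tau> \<ge> 0"
  shows "bc_functional (\<lambda>\<phi>. \<Sum>k. b k *\<^sub>C (\<phi> (real k * \<tau>) :: 'a::cbanach))"
proof -
  have nB: "norm (b k *\<^sub>C \<phi> (real k * \<tau>)) \<le> cmod (b k) * B" if "\<And>t. t \<ge> 0 \<Longrightarrow> norm (\<phi> t) \<le> B"
    for \<phi> :: "real \<Rightarrow> 'a" and B k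
    using that \<tau> by (auto simp: norm_scaleC intro!: mult_left_mono)
  have sB: "summable (\<lambda>k. cmod (b k) * B)" for B using b by (rule summable_mult2)
  have sm: "summable (\<lambda>k. b k *\<^sub>C \<phi> (real k * \<tau>))" if "\<phi> \<in> bcont" for \<phi> :: "real \<Rightarrow> 'a"
  proof -
    obtain B where "\<And>t. t \<ge> 0 \<Longrightarrow> norm (\<phi> t) \<le> B" using bcontE[OF \<open>\<phi> \<in> bcont\<close>] by blast
    then show ?thesis by (intro summable_comparison_test'[OF sB] nB) auto
  qed
  show ?thesis
    unfolding bc_functional_def
  proof (intro conjI ballI allI impI)
    fix \<phi> \<psi> :: "real \<Rightarrow> 'a" assume \<phi>: "\<phi> \<in> bcont" and \<psi>: "\<psi> \<in> bcont"
    show "(\<Sum>k. b k *\<^sub>C (\<phi> (real k * \<tau>) + \<psi> (real k * \<tau>))) = (\<Sum>k. b k *\<^sub>C \<phi> (real k * \<tau>)) + (\<Sum>k. b k *\<^sub>C \<psi> (real k * \<tau>))"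
      by (simp add: scaleC_add_right suminf_add sm \<phi> \<psi>)
  next
    show "\<exists>M\<ge>0. \<forall>\<phi>::real \<Rightarrow> 'a\<in>bcont. \<forall>B. (\<forall>t\<ge>0. norm (\<phi> t) \<le> B) \<longrightarrow> norm (\<Sum>k. b k *\<^sub>C \<phi> (real k * \<tau>)) \<le> M * B"
    proof (intro exI[of _ "\<Sum>k. cmod (b k)"] conjI ballI allI impI)
      show "0 \<le> (\<Sum>k. cmod (b k))" by (rule suminf_nonneg[OF b]) simp
      fix \<phi> :: "real \<Rightarrow> 'a" and B assume \<phi>: "\<phi> \<in> bcont" and B: "\<forall>t\<ge>0. norm (\<phi> t) \<le> B"
      have "norm (\<Sum>k. b k *\<^sub>C \<phi> (real k * \<tau>)) \<le> (\<Sum>k. cmod (b k) * B)"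
        using B by (intro norm_suminf_le nB sB) auto
      then show "norm (\<Sum>k. b k *\<^sub>C \<phi> (real k * \<tau>)) \<le> (\<Sum>k. cmod (b k)) * B"
        by (simp add: suminf_mult2[OF b])
    qed
  next
    fix \<Phi> :: "nat \<Rightarrow> real \<Rightarrow> 'a" and \<phi> B
    assume \<phi>: "\<phi> \<in> bcont" and \<Phi>: "\<forall>n. \<Phi> n \<in> bcont" "\<forall>n. \<forall>t\<ge>0. norm (\<Phi> n t) \<le> B"
      and lim: "\<forall>t\<ge>0. (\<lambda>n. \<Phi> n t) \<longlonglongrightarrow> \<phi> t"
    show "(\<lambda>n. \<Sum>k. b k *\<^sub>C \<Phi> n (real k * \<tau>)) \<longlonglongrightarrow> (\<Sum>k. b k *\<^sub>C \<phi> (real k * \<tau>))"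
    proof (rule LIM_zero_cancel, rule Lim_null_comparison)
      have phiB: "norm (\<phi> t) \<le> B" if "t \<ge> 0" for t
      proof (rule LIMSEQ_le_const2)
        show "(\<lambda>n. norm (\<Phi> n t)) \<longlonglongrightarrow> norm (\<phi> t)" using lim that by (intro tendsto_norm) auto
        show "\<exists>N. \<forall>n\<ge>N. norm (\<Phi> n t) \<le> B" using \<Phi>(2) that by blast
      qed
      have D: "cmod (b k) * norm (\<Phi> n (real k * \<tau>) - \<phi> (real k * \<tau>)) \<le> cmod (b k) * (2 * B)" for k n
      proof (rule mult_left_mono)
        have "real k * \<tau> \<ge> 0" using \<tau> by simp
        then show "norm (\<Phi> n (real k * \<tau>) - \<phi> (real k * \<tau>)) \<le> 2 * B"
          using norm_triangle_ineq4[of "\<Phi> n (real k * \<tau>)" "\<phi> (real k * \<tau>)"] phiB \<Phi>(2) by (smt (verit))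
      qed simp
      have sD: "summable (\<lambda>k. cmod (b k) * norm (\<Phi> n (real k * \<tau>) - \<phi> (real k * \<tau>)))" for n
        by (rule summable_comparison_test'[OF sB[of "2 * B"], of 0]) (use D in simp)
      show "\<forall>\<^sub>F n in sequentially. norm ((\<Sum>k. b k *\<^sub>C \<Phi> n (real k * \<tau>)) - (\<Sum>k. b k *\<^sub>C \<phi> (real k * \<tau>)))
          \<le> (\<Sum>k. cmod (b k) * norm (\<Phi> n (real k * \<tau>) - \<phi> (real k * \<tau>)))"
      proof (intro always_eventually allI)
        fix n
        have "(\<Sum>k. b k *\<^sub>C \<Phi> n (real k * \<tau>)) - (\<Sum>k. b k *\<^sub>C \<phi> (real k * \<tau>))
          = (\<Sum>k. b k *\<^sub>C \<Phi> n (real k * \<tau>) - b k *\<^sub>C \<phi> (real k * \<tau>))"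
          using \<phi> \<Phi>(1) by (intro suminf_diff sm) auto
        also have "norm \<dots> \<le> (\<Sum>k. cmod (b k) * norm (\<Phi> n (real k * \<tau>) - \<phi> (real k * \<tau>)))"
          by (rule norm_suminf_le[OF _ sD]) (simp flip: scaleC.diff_right add: norm_scaleC)
        finally show "norm ((\<Sum>k. b k *\<^sub>C \<Phi> n (real k * \<tau>)) - (\<Sum>k. b k *\<^sub>C \<phi> (real k * \<tau>))) \<le> \<dots>" .
      qed
      have "(\<lambda>n. \<Sum>k. cmod (b k) * norm (\<Phi> n (real k * \<tau>) - \<phi> (real k * \<tau>))) \<longlonglongrightarrow> (\<Sum>k. 0)"
      proof (rule conjunct2[OF conjunct2[OF tannerys_theorem[where M="\<lambda>k. cmod (b k) * (2 * B)"]]])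
        show "(\<lambda>n. cmod (b k) * norm (\<Phi> n (real k * \<tau>) - \<phi> (real k * \<tau>))) \<longlonglongrightarrow> 0" for k
        proof -
          have "(\<lambda>n. cmod (b k) * norm (\<Phi> n (real k * \<tau>) - \<phi> (real k * \<tau>)))
             \<longlonglongrightarrow> cmod (b k) * norm (\<phi> (real k * \<tau>) - \<phi> (real k * \<tau>))"
            using lim \<tau> by (intro tendsto_mult tendsto_const tendsto_norm tendsto_diff) auto
          then show ?thesis by simp
        qed
        show "\<forall>\<^sub>F (k, n) in sequentially \<times>\<^sub>F sequentially.
            norm (cmod (b k) * norm (\<Phi> n (real k * \<tau>) - \<phi> (real k * \<tau>))) \<le> cmod (b k) * (2 * B)"
          using D by (intro always_eventually) auto
      qed (use sB in auto)
      then show "(\<lambda>n. \<Sum>k. cmod (b k) * norm (\<Phi> n (real k * \<tau>) - \<phi> (real k * \<tau>))) \<longlonglongrightarrow> 0"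
        by simp
    qed
  qed
qed

lemma bc_functional_cm_integral:
  assumes \<nu>: "sets \<nu> = sets borel_halfline" and h: "integrable \<nu> h"
  shows "bc_functional (cm_integral (density_cm \<nu> h) :: (real \<Rightarrow> 'a::cbanach) \<Rightarrow> 'a)"
proof -
  let ?L = "cm_integral (density_cm \<nu> h) :: (real \<Rightarrow> 'a::cbanach) \<Rightarrow> 'a"
  note hb = has_bochner_cm_integral[OF \<nu> h]
  have [simp]: "space \<nu> = {0..}" using \<nu> by (rule space_halfline)
  have hm[measurable]: "h \<in> borel_measurable \<nu>" using h by auto
  have diff: "ennreal (norm (?L \<phi> - ?L \<psi>)) \<le> (\<integral>\<^sup>+t. ennreal (cmod (h t) * norm (\<phi> t - \<psi> t)) \<partial>\<nu>)"
    and [measurable]: "(\<lambda>t. norm (\<phi> t - \<psi> t)) \<in> borel_measurable \<nu>"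
    if "\<phi> \<in> bcont" "\<psi> \<in> bcont" for \<phi> \<psi> :: "real \<Rightarrow> 'a"
  proof -
    show nm[measurable]: "(\<lambda>t. norm (\<phi> t - \<psi> t)) \<in> borel_measurable \<nu>"
      by (intro strongly_measurable_norm strongly_measurable_diff strongly_measurable_continuous \<nu> bcont_continuous that)
    show "ennreal (norm (?L \<phi> - ?L \<psi>)) \<le> (\<integral>\<^sup>+t. ennreal (cmod (h t) * norm (\<phi> t - \<psi> t)) \<partial>\<nu>)"
      by (rule has_bochner_diff_le[OF hb(1)[OF that(1)] hb(1)[OF that(2)]])
         (simp_all flip: scaleC.diff_right add: norm_scaleC)
  qed
  show ?thesis
    unfolding bc_functional_def
  proof (intro conjI ballI allI impI)
    fix \<phi> \<psi> :: "real \<Rightarrow> 'a" assume \<phi>: "\<phi> \<in> bcont" and \<psi>: "\<psi> \<in> bcont"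
    have "stieltjes_sum (density_cm \<nu> h) (\<lambda>t. \<phi> t + \<psi> t) = (\<lambda>n. stieltjes_sum (density_cm \<nu> h) \<phi> n + stieltjes_sum (density_cm \<nu> h) \<psi> n)"
      by (rule ext) (simp add: stieltjes_sum_def scaleC_add_right sum.distrib)
    then have "(\<lambda>n. stieltjes_sum (density_cm \<nu> h) \<phi> n + stieltjes_sum (density_cm \<nu> h) \<psi> n) \<longlonglongrightarrow> ?L (\<lambda>t. \<phi> t + \<psi> t)"
      using hb(2)[OF bcont_add[OF \<phi> \<psi>]] by simp
    moreover have "(\<lambda>n. stieltjes_sum (density_cm \<nu> h) \<phi> n + stieltjes_sum (density_cm \<nu> h) \<psi> n) \<longlonglongrightarrow> ?L \<phi> + ?L \<psi>"
      by (intro tendsto_add hb(2) \<phi> \<psi>)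
    ultimately show "?L (\<lambda>t. \<phi> t + \<psi> t) = ?L \<phi> + ?L \<psi>" by (rule LIMSEQ_unique)
  next
    have L0: "?L (\<lambda>t. 0) = 0"
      by (simp add: cm_integral_def stieltjes_sum_def[abs_def] scaleC.zero_right)
    have hint: "(\<integral>\<^sup>+t. ennreal (cmod (h t)) \<partial>\<nu>) = ennreal (\<integral>t. cmod (h t) \<partial>\<nu>)"
      using h by (intro nn_integral_eq_integral) auto
    show "\<exists>M\<ge>0. \<forall>\<phi>\<in>bcont. \<forall>B. (\<forall>t\<ge>0. norm (\<phi> t) \<le> B) \<longrightarrow> norm (?L \<phi>) \<le> M * B"
    proof (intro exI[of _ "\<integral>t. cmod (h t) \<partial>\<nu>"] conjI ballI allI impI)
      show "0 \<le> (\<integral>t. cmod (h t) \<partial>\<nu>)" by simp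
      fix \<phi> :: "real \<Rightarrow> 'a" and B assume \<phi>: "\<phi> \<in> bcont" and B: "\<forall>t\<ge>0. norm (\<phi> t) \<le> B"
      have B0: "B \<ge> 0" using order_trans[OF norm_ge_zero, of "\<phi> 0" B] B by simp
      have "ennreal (norm (?L \<phi>)) \<le> (\<integral>\<^sup>+t. ennreal (cmod (h t) * norm (\<phi> t)) \<partial>\<nu>)"
        using diff[OF \<phi> bcont_const[of 0]] by (simp add: L0)
      also have "\<dots> \<le> (\<integral>\<^sup>+t. ennreal (cmod (h t)) * ennreal B \<partial>\<nu>)"
        using B B0 by (intro nn_integral_mono) (auto simp flip: ennreal_mult intro!: ennreal_leI mult_left_mono)
      also have "\<dots> = ennreal ((\<integral>t. cmod (h t) \<partial>\<nu>) * B)"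
        using B0 by (simp add: nn_integral_multc hint ennreal_mult)
      finally show "norm (?L \<phi>) \<le> (\<integral>t. cmod (h t) \<partial>\<nu>) * B"
        using B0 by (subst (asm) ennreal_le_iff) auto
    qed
  next
    fix \<Phi> :: "nat \<Rightarrow> real \<Rightarrow> 'a" and \<phi> B
    assume \<phi>: "\<phi> \<in> bcont" and \<Phi>: "\<forall>n. \<Phi> n \<in> bcont" "\<forall>n. \<forall>t\<ge>0. norm (\<Phi> n t) \<le> B"
      and lim: "\<forall>t\<ge>0. (\<lambda>n. \<Phi> n t) \<longlonglongrightarrow> \<phi> t"
    have nm[measurable]: "(\<lambda>t. norm (\<Phi> n t - \<phi> t)) \<in> borel_measurable \<nu>" for n
      using \<phi> \<Phi>(1) by (intro strongly_measurable_norm strongly_measurable_diff strongly_measurable_continuous \<nu> bcont_continuous) auto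
    have phiB: "norm (\<phi> t) \<le> B" if "t \<ge> 0" for t
    proof (rule LIMSEQ_le_const2)
      show "(\<lambda>n. norm (\<Phi> n t)) \<longlonglongrightarrow> norm (\<phi> t)" using lim that by (intro tendsto_norm) auto
      show "\<exists>N. \<forall>n\<ge>N. norm (\<Phi> n t) \<le> B" using \<Phi>(2) that by blast
    qed
    have B0: "B \<ge> 0" using order_trans[OF norm_ge_zero phiB[of 0]] by simp
    have "(\<lambda>n. \<integral>\<^sup>+t. ennreal (cmod (h t) * norm (\<Phi> n t - \<phi> t)) \<partial>\<nu>) \<longlonglongrightarrow> (\<integral>\<^sup>+t. 0 \<partial>\<nu>)"
    proof (rule nn_integral_dominated_convergence[where w="\<lambda>t. ennreal (cmod (h t) * (2 * B))"])
      have "norm (\<Phi> n t - \<phi> t) \<le> 2 * B" if "t \<ge> 0" for n t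
        using norm_triangle_ineq4[of "\<Phi> n t" "\<phi> t"] phiB[OF that] \<Phi>(2)[rule_format, OF that, of n] by simp
      then show "AE t in \<nu>. ennreal (cmod (h t) * norm (\<Phi> n t - \<phi> t)) \<le> ennreal (cmod (h t) * (2 * B))" for n
        by (intro AE_I2 ennreal_leI mult_left_mono) auto
      have "integrable \<nu> (\<lambda>t. cmod (h t) * (2 * B))" using h by auto
      then show "(\<integral>\<^sup>+t. ennreal (cmod (h t) * (2 * B)) \<partial>\<nu>) < \<infinity>"
        using B0 by (subst nn_integral_eq_integral) auto
      show "AE t in \<nu>. (\<lambda>n. ennreal (cmod (h t) * norm (\<Phi> n t - \<phi> t))) \<longlonglongrightarrow> 0"
      proof (rule AE_I2)
        fix t assume "t \<in> space \<nu>"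
        then have "(\<lambda>n. cmod (h t) * norm (\<Phi> n t - \<phi> t)) \<longlonglongrightarrow> cmod (h t) * norm (\<phi> t - \<phi> t)"
          using lim by (intro tendsto_intros) auto
        then have "(\<lambda>n. ennreal (cmod (h t) * norm (\<Phi> n t - \<phi> t))) \<longlonglongrightarrow> ennreal (cmod (h t) * norm (\<phi> t - \<phi> t))"
          by (rule tendsto_ennrealI)
        then show "(\<lambda>n. ennreal (cmod (h t) * norm (\<Phi> n t - \<phi> t))) \<longlonglongrightarrow> 0" by simp
      qed
    qed measurable
    then have "(\<lambda>n. \<integral>\<^sup>+t. ennreal (cmod (h t) * norm (\<Phi> n t - \<phi> t)) \<partial>\<nu>) \<longlonglongrightarrow> 0" by simp
    then have "(\<lambda>n. ennreal (norm (?L (\<Phi> n) - ?L \<phi>))) \<longlonglongrightarrow> 0"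
      by (rule ennreal_tendsto_0_le) (use diff \<phi> \<Phi>(1) in auto)
    then have "(\<lambda>n. norm (?L (\<Phi> n) - ?L \<phi>)) \<longlonglongrightarrow> 0"
      by (subst (asm) ennreal_0[symmetric], subst (asm) tendsto_ennreal_iff) auto
    then show "(\<lambda>n. ?L (\<Phi> n)) \<longlonglongrightarrow> ?L \<phi>"
      by (simp add: tendsto_norm_zero_iff LIM_zero_iff)
  qed
qed

lemma cm_integral_scaleC:
  fixes v :: "'a::cbanach"
  assumes \<nu>: "sets \<nu> = sets borel_halfline" and h: "integrable \<nu> h" and p: "p \<in> bcont"
  shows "cm_integral (density_cm \<nu> h) (\<lambda>t. p t *\<^sub>C v) = (\<integral>t. h t * p t \<partial>\<nu>) *\<^sub>C v"
proof -
  obtain B where B: "B \<ge> 0" "\<And>t. t \<ge> 0 \<Longrightarrow> norm (p t) \<le> B" using bcontE[OF p] by blast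
  have "(\<lambda>t. p t *\<^sub>C v) \<in> bcont"
    using B bcont_continuous[OF p] by (intro bcontI[of _ "B * norm v"])
      (auto intro!: scaleC.continuous_on continuous_intros mult_right_mono simp: norm_scaleC)
  from has_bochner_cm_integral(1)[OF \<nu> h this]
  have "has_bochner \<nu> (\<lambda>t. (h t * p t) *\<^sub>C v) (cm_integral (density_cm \<nu> h) (\<lambda>t. p t *\<^sub>C v))"
    by (simp add: scaleC_scaleC)
  moreover have "integrable \<nu> (\<lambda>t. h t * p t)"
  proof (rule Bochner_Integration.integrable_bound)
    show "integrable \<nu> (\<lambda>t. B * norm (h t))" using h by auto
    show "(\<lambda>t. h t * p t) \<in> borel_measurable \<nu>"
      using h strongly_measurable_borel[OF strongly_measurable_continuous[OF \<nu> bcont_continuous[OF p]]] by auto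
    show "AE t in \<nu>. norm (h t * p t) \<le> norm (B * norm (h t))"
      using B space_halfline[OF \<nu>] mult_left_mono[OF B(2)]
      by (intro AE_I2) (auto simp: norm_mult mult.commute[of B])
  qed
  ultimately show ?thesis
    using has_bochner_unique has_bochner_scaleC_left by blast
qed

lemma cm_integral_cong:
  assumes "\<And>t. t \<ge> 0 \<Longrightarrow> \<phi> t = \<psi> t"
  shows "cm_integral \<mu> \<phi> = cm_integral \<mu> \<psi>"
  using assms by (simp add: cm_integral_def stieltjes_sum_def[abs_def])

lemma represents_cm_integral:
  assumes "represents \<nu> h \<mu>"
  shows "sets \<nu> = sets borel_halfline" "integrable \<nu> h" 
    "cm_integral \<mu> = (cm_integral (density_cm \<nu> h) :: (real \<Rightarrow> 'a::cbanach) \<Rightarrow> 'a)"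
    "(stieltjes_sum \<mu> :: (real \<Rightarrow> 'a) \<Rightarrow> _) = stieltjes_sum (density_cm \<nu> h)"
proof -
  have "\<mu> (mesh n k) = density_cm \<nu> h (mesh n k)" for n k
    using assms mesh_sets[of n k] by (simp add: represents_def density_cm_def)
  then show "(stieltjes_sum \<mu> :: (real \<Rightarrow> 'a) \<Rightarrow> _) = stieltjes_sum (density_cm \<nu> h)"
    by (simp add: stieltjes_sum_def[abs_def])
  then show "cm_integral \<mu> = (cm_integral (density_cm \<nu> h) :: (real \<Rightarrow> 'a) \<Rightarrow> 'a)"
    by (simp add: cm_integral_def[abs_def])
  show "sets \<nu> = sets borel_halfline" "integrable \<nu> h" using assms by (auto simp: represents_def)
qed

text \<open>Any two representations of \<mu> by densities share their Stieltjes sums, so for bounded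
  continuous integrands the existential in \<open>has_cm_integral\<close> has a single
  value.\<close>

lemma has_cm_integral_iff:
  assumes "represents \<nu> h \<mu>" "\<phi> \<in> bcont"
  shows "has_cm_integral \<mu> \<phi> y \<longleftrightarrow> y = cm_integral \<mu> \<phi>"
proof
  assume "has_cm_integral \<mu> \<phi> y"
  then obtain \<nu>' h' where *: "represents \<nu>' h' \<mu>" "has_bochner \<nu>' (\<lambda>t. h' t *\<^sub>C \<phi> t) y"
    by (auto simp: has_cm_integral_def)
  note r = represents_cm_integral[OF *(1)]
  show "y = cm_integral \<mu> \<phi>"
    using has_bochner_unique[OF *(2) has_bochner_cm_integral(1)[OF r(1,2) assms(2)]] by (simp add: r(3))
next
  assume "y = cm_integral \<mu> \<phi>"
  then show "has_cm_integral \<mu> \<phi> y"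
    using has_bochner_cm_integral(1)[OF represents_cm_integral(1,2)[OF assms(1)] assms(2)] assms(1)
    by (auto simp: has_cm_integral_def represents_cm_integral(3)[OF assms(1)])
qed

lemma has_cm_integral_cong:
  assumes "\<And>t. t \<ge> 0 \<Longrightarrow> \<phi> t = \<psi> t"
  shows "has_cm_integral \<mu> \<phi> y \<longleftrightarrow> has_cm_integral \<mu> \<psi> y"
proof -
  have "has_bochner \<nu> (\<lambda>t. h t *\<^sub>C \<phi> t) y \<longleftrightarrow> has_bochner \<nu> (\<lambda>t. h t *\<^sub>C \<psi> t) y" if "represents \<nu> h \<mu>" for \<nu> h
    by (rule has_bochner_cong) (use assms represents_cm_integral(1)[OF that] in \<open>auto dest: space_halfline\<close>)
  then show ?thesis unfolding has_cm_integral_def by blast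
qed

subsection \<open>Inversion of the Laplace transform\<close>

abbreviation "halfline \<equiv> restrict_space lborel {0::real..}"

text \<open>The three moments serve, in this order, for exponential majorants, for the kernel of the
  squared resolvent, and for the rate at which the rescaled kernel concentrates at 0.\<close>

lemma halfline_power_exp:
  fixes r :: real
  assumes r: "r > 0"
  shows "has_bochner_integral halfline (\<lambda>t. exp (- r * t)) (1 / r)"
    and "has_bochner_integral halfline (\<lambda>t. t * exp (- r * t)) (1 / r\<^sup>2)"
    and "has_bochner_integral halfline (\<lambda>t. t\<^sup>2 * exp (- r * t)) (2 / r ^ 3)"
proof -
  have main: "has_bochner_integral halfline f I"
    if f: "f \<in> borel_measurable borel" and F: "\<And>t. 0 \<le> t \<Longrightarrow> DERIV F t :> f t"
      and nn: "\<And>t. 0 \<le> t \<Longrightarrow> 0 \<le> f t" and lim: "(F \<longlongrightarrow> 0) at_top" and I: "I = - F 0" "0 \<le> I" for f F I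
  proof (rule has_bochner_integral_nn_integral)
    show "f \<in> borel_measurable halfline" using f by (intro measurable_restrict_space1) simp
    show "AE x in halfline. 0 \<le> f x" using nn by (intro AE_I2) (simp add: space_restrict_space)
    show "0 \<le> I" by (rule I(2))
    have "(\<integral>\<^sup>+x. ennreal (f x) \<partial>halfline) = (\<integral>\<^sup>+x. ennreal (f x) * indicator {0..} x \<partial>lborel)"
      by (subst nn_integral_restrict_space) auto
    also have "\<dots> = ennreal (0 - F 0)"
      by (rule nn_integral_FTC_atLeast[OF f F nn lim])
    finally show "(\<integral>\<^sup>+x. ennreal (f x) \<partial>halfline) = ennreal I" using I by simp
  qed
  show "has_bochner_integral halfline (\<lambda>t. exp (- r * t)) (1 / r)"
  proof (rule main[where F="\<lambda>t. - exp (- r * t) / r"])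
    show "DERIV (\<lambda>t. - exp (- r * t) / r) t :> exp (- r * t)" for t
      using r by (auto intro!: derivative_eq_intros)
    show "((\<lambda>t. - exp (- r * t) / r) \<longlongrightarrow> 0) at_top" using r by real_asymp
  qed (use r in auto)
  show "has_bochner_integral halfline (\<lambda>t. t * exp (- r * t)) (1 / r\<^sup>2)"
  proof (rule main[where F="\<lambda>t. - (t / r + 1 / r\<^sup>2) * exp (- r * t)"])
    show "DERIV (\<lambda>t. - (t / r + 1 / r\<^sup>2) * exp (- r * t)) t :> t * exp (- r * t)" for t
      using r by (auto intro!: derivative_eq_intros simp: field_simps power2_eq_square)
    show "((\<lambda>t. - (t / r + 1 / r\<^sup>2) * exp (- r * t)) \<longlongrightarrow> 0) at_top" using r by real_asymp
  qed (use r in auto)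
  show "has_bochner_integral halfline (\<lambda>t. t\<^sup>2 * exp (- r * t)) (2 / r ^ 3)"
  proof (rule main[where F="\<lambda>t. - (t\<^sup>2 / r + 2 * t / r\<^sup>2 + 2 / r ^ 3) * exp (- r * t)"])
    show "DERIV (\<lambda>t. - (t\<^sup>2 / r + 2 * t / r\<^sup>2 + 2 / r ^ 3) * exp (- r * t)) t :> t\<^sup>2 * exp (- r * t)" for t
      using r by (auto intro!: derivative_eq_intros simp: field_simps power2_eq_square power3_eq_cube)
    show "((\<lambda>t. - (t\<^sup>2 / r + 2 * t / r\<^sup>2 + 2 / r ^ 3) * exp (- r * t)) \<longlongrightarrow> 0) at_top" using r by real_asymp
  qed (use r in auto)
qed

lemma halfline_exp:
  fixes c :: complex
  assumes c: "Re c > 0"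
  shows "integrable halfline (\<lambda>t. exp (- c * of_real t))"
    and "(\<integral>t. exp (- c * of_real t) \<partial>halfline) = 1 / c"
proof -
  have m [measurable]: "(\<lambda>t. exp (- c * of_real t)) \<in> borel_measurable M" if [measurable]: "(\<lambda>t. t) \<in> borel_measurable M" for M :: "real measure"
    by measurable
  have mh: "(\<lambda>t. exp (- c * of_real t)) \<in> borel_measurable halfline"
    by (rule measurable_restrict_space1) measurable
  have r: "integrable halfline (\<lambda>t. exp (- Re c * t))"
    using halfline_power_exp(1)[OF c] by (simp add: has_bochner_integral_iff)
  show "integrable halfline (\<lambda>t. exp (- c * of_real t))"
    by (rule Bochner_Integration.integrable_bound[OF r mh]) (auto simp: norm_exp_eq_Re)
  have F: "((\<lambda>t. - exp (- c * of_real t) / c) has_vector_derivative exp (- c * of_real t)) (at t within A)" for t :: real and A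
  proof -
    have "c \<noteq> 0" using c by auto
    then show ?thesis
      by (auto intro!: derivative_eq_intros has_vector_derivative_real_field)
  qed
  have "(\<lambda>n. \<integral>t. indicator {0..real n} t *\<^sub>R exp (- c * of_real t) \<partial>lborel) \<longlonglongrightarrow> (\<integral>t. indicator {0..} t *\<^sub>R exp (- c * of_real t) \<partial>lborel)"
  proof (rule integral_dominated_convergence[where w="\<lambda>t. indicator {0..} t *\<^sub>R exp (- Re c * t)"])
    show "integrable lborel (\<lambda>t. indicator {0..} t *\<^sub>R exp (- Re c * t))"
      using r by (subst (asm) integrable_restrict_space) auto
    show "AE t in lborel. (\<lambda>n. indicator {0..real n} t *\<^sub>R exp (- c * of_real t)) \<longlonglongrightarrow> indicator {0..} t *\<^sub>R exp (- c * of_real t)"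
    proof (rule AE_I2)
      fix t :: real
      obtain N :: nat where "t \<le> real N" using real_arch_simple by blast
      then have "eventually (\<lambda>n. indicator {0..real n} t *\<^sub>R exp (- c * of_real t) = indicator {0..} t *\<^sub>R exp (- c * of_real t)) sequentially"
        by (intro eventually_mono[OF eventually_ge_at_top[of N]]) (auto simp: indicator_def)
      then show "(\<lambda>n. indicator {0..real n} t *\<^sub>R exp (- c * of_real t)) \<longlonglongrightarrow> indicator {0..} t *\<^sub>R exp (- c * of_real t)"
        by (rule tendsto_eventually)
    qed
    show "AE t in lborel. norm (indicator {0..real n} t *\<^sub>R exp (- c * of_real t)) \<le> indicator {0..} t *\<^sub>R exp (- Re c * t)" for n
      by (intro AE_I2) (auto simp: indicator_def norm_exp_eq_Re)
  qed measurable
  moreover have "(\<integral>t. indicator {0..real n} t *\<^sub>R exp (- c * of_real t) \<partial>lborel) = - exp (- c * of_real (real n)) / c - - exp (- c * of_real 0) / c" for n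
    by (rule integral_FTC_Icc[where F="\<lambda>t. - exp (- c * of_real t) / c"]) (simp, rule F, intro continuous_intros)
  moreover have "(\<lambda>n. - exp (- c * of_real (real n)) / c - - exp (- c * of_real 0) / c) \<longlonglongrightarrow> - 0 / c - - exp (- c * of_real 0) / c"
  proof (intro tendsto_intros)
    have "(\<lambda>n. exp (- Re c * real n)) \<longlonglongrightarrow> 0" using c by real_asymp
    then have "(\<lambda>n. cmod (exp (- c * of_real (real n)))) \<longlonglongrightarrow> 0" by (simp add: norm_exp_eq_Re)
    then show "(\<lambda>n. exp (- c * of_real (real n))) \<longlonglongrightarrow> 0" by (rule tendsto_norm_zero_cancel)
  qed (use c in auto)
  ultimately have "(\<integral>t. indicator {0..} t *\<^sub>R exp (- c * of_real t) \<partial>lborel) = 1 / c"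
    using LIMSEQ_unique by fastforce
  then show "(\<integral>t. exp (- c * of_real t) \<partial>halfline) = 1 / c"
    by (subst integral_restrict_space) auto
qed

section \<open>Inversion along a vertical line\<close>

lemma integrable_inverse_square_shift:
  fixes c :: real
  assumes "c > 0"
  shows "integrable lborel (\<lambda>s. 1 / (c\<^sup>2 + s\<^sup>2))"
proof (rule Bochner_Integration.integrable_bound)
  have "integrable lborel (\<lambda>s::real. inverse (1 + s\<^sup>2))"
    using integrable_inverse_1_plus_square by (simp add: set_integrable_def)
  then show "integrable lborel (\<lambda>s::real. max 1 (1 / c\<^sup>2) * inverse (1 + s\<^sup>2))" by simp
  show "AE s in lborel. norm (1 / (c\<^sup>2 + s\<^sup>2)) \<le> norm (max 1 (1 / c\<^sup>2) * inverse (1 + s\<^sup>2))"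
  proof (rule AE_I2)
    fix s :: real
    let ?m = "max 1 (1 / c\<^sup>2)"
    have "1 \<le> ?m * c\<^sup>2"
    proof -
      have "1 / c\<^sup>2 * c\<^sup>2 \<le> ?m * c\<^sup>2" by (intro mult_right_mono) auto
      then show ?thesis using assms by simp
    qed
    moreover have "1 * s\<^sup>2 \<le> ?m * s\<^sup>2" by (intro mult_right_mono) auto
    ultimately have "1 + s\<^sup>2 \<le> ?m * (c\<^sup>2 + s\<^sup>2)" by (simp add: distrib_left)
    moreover have "0 < c\<^sup>2 + s\<^sup>2" using assms by (simp add: add_pos_nonneg)
    moreover have "0 < 1 + s\<^sup>2" by (simp add: add_pos_nonneg)
    ultimately have "1 / (c\<^sup>2 + s\<^sup>2) \<le> ?m / (1 + s\<^sup>2)"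
      by (simp add: divide_le_eq pos_le_divide_eq mult.commute)
    moreover have "0 \<le> 1 / (c\<^sup>2 + s\<^sup>2)" "0 \<le> ?m / (1 + s\<^sup>2)" by (auto simp: add_nonneg_nonneg)
    ultimately show "norm (1 / (c\<^sup>2 + s\<^sup>2)) \<le> norm (?m * inverse (1 + s\<^sup>2))"
      by (simp add: divide_inverse abs_of_nonneg del: max_mult_distrib_right)
  qed
qed measurable

text \<open>Inverse Laplace transform along the line \<open>Re z = a\<close>; the factor \<i> of
  \<open>dz = \<i> ds\<close> has cancelled the one in \<open>2 * pi * \<i>\<close>.\<close>

definition bromwich :: "(complex \<Rightarrow> complex) \<Rightarrow> real \<Rightarrow> real \<Rightarrow> complex" where
  "bromwich Q a t = (\<integral>s. Q (Complex a s) * exp (Complex a s * of_real t) \<partial>lborel) / (2 * pi)"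

text \<open>Quadratic decay makes the inversion integral absolutely convergent, with a majorant
  depending only on \<open>a\<close>, \<open>lam\<close> and \<open>M\<close>. The line lies inside
  the domain of \<open>Q\<close>, to the right of the possible pole \<open>- lam\<close>, and to the
  left of the imaginary axis, whence the inverse transform decays exponentially.\<close>

locale decaying_symbol =
  fixes Q :: "complex \<Rightarrow> complex" and b a lam M :: real
  assumes holo: "Q holomorphic_on {z. Re z > b}" and ba: "b < a" and a0: "a < 0" and lam: "0 < a + lam"
    and M: "0 \<le> M" and bound: "\<And>z. Re z \<ge> a \<Longrightarrow> cmod (Q z) \<le> M / (cmod (z + of_real lam))\<^sup>2"
begin

definition majorant :: "real \<Rightarrow> real" where
  "majorant s = M * (1 / ((a + lam)\<^sup>2 + s\<^sup>2))"

lemma majorant_integrable: "integrable lborel majorant"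
  unfolding majorant_def[abs_def] by (intro integrable_mult_right integrable_inverse_square_shift lam)

lemma majorant_nonneg: "0 \<le> majorant s"
  by (simp add: majorant_def M)

lemma line_bound: "cmod (Q (Complex a s)) \<le> majorant s"
  using bound[of "Complex a s"] by (simp add: majorant_def cmod_power2)

lemma line_measurable [measurable]: "(\<lambda>s. Q (Complex a s)) \<in> borel_measurable borel"
proof (rule borel_measurable_continuous_onI)
  have "continuous_on UNIV (\<lambda>s. Complex a s)"
    unfolding Complex_eq by (intro continuous_intros)
  then show "continuous_on UNIV (\<lambda>s. Q (Complex a s))"
    by (rule continuous_on_compose2[OF holomorphic_on_imp_continuous_on[OF holo]]) (use ba in auto)
qed

lemma Complex_measurable [measurable]: "(\<lambda>s. Complex a s) \<in> borel_measurable borel"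
  unfolding Complex_eq by measurable

lemma integrand_bound: "cmod (Q (Complex a s) * exp (Complex a s * of_real t)) \<le> majorant s * exp (a * t)"
  by (simp add: norm_mult norm_exp_eq_Re mult_right_mono line_bound)

lemma integrand_integrable: "integrable lborel (\<lambda>s. Q (Complex a s) * exp (Complex a s * of_real t))"
proof (rule Bochner_Integration.integrable_bound)
  show "integrable lborel (\<lambda>s. majorant s * exp (a * t))" using majorant_integrable by simp
  show "AE s in lborel. norm (Q (Complex a s) * exp (Complex a s * of_real t)) \<le> norm (majorant s * exp (a * t))"
    using integrand_bound by (intro AE_I2) (simp add: majorant_nonneg abs_of_nonneg)
qed measurable

lemma bromwich_bound: "cmod (bromwich Q a t) \<le> (\<integral>s. majorant s \<partial>lborel) * exp (a * t)"
proof -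
  have "cmod (\<integral>s. Q (Complex a s) * exp (Complex a s * of_real t) \<partial>lborel)
      \<le> (\<integral>s. majorant s * exp (a * t) \<partial>lborel)"
    by (rule Bochner_Integration.integral_norm_bound_integral[OF integrand_integrable _ integrand_bound])
       (use majorant_integrable in simp)
  also have "\<dots> = (\<integral>s. majorant s \<partial>lborel) * exp (a * t)" by simp
  finally have 1: "cmod (\<integral>s. Q (Complex a s) * exp (Complex a s * of_real t) \<partial>lborel) \<le> \<dots>" .
  have "cmod (bromwich Q a t) \<le> cmod (\<integral>s. Q (Complex a s) * exp (Complex a s * of_real t) \<partial>lborel) / 1"
    unfolding bromwich_def norm_divide using pi_ge_two by (intro divide_left_mono) auto
  with 1 show ?thesis by simp
qed

text \<open>Cauchy's formula on the rectangle with opposite corners \<open>a - \<i> R\<close> and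
  \<open>a + R + \<i> R\<close>: on the three sides off the line \<open>Re w = a\<close> the
  integrand is of order \<open>1 / R\<^sup>2\<close> and the total length is \<open>4 * R\<close>,
  so only the left side survives as \<open>R\<close> grows.\<close>

lemma cauchy_line:
  assumes z: "Re z > a"
  shows "(\<integral>s. Q (Complex a s) / (z - Complex a s) \<partial>lborel) = 2 * pi * Q z"
    and "integrable lborel (\<lambda>s. Q (Complex a s) / (z - Complex a s))"
proof -
  let ?g = "\<lambda>s. Q (Complex a s) / (z - Complex a s)"
  have dist: "Re z - a \<le> cmod (z - Complex a s)" for s
    using abs_Re_le_cmod[of "z - Complex a s"] by simp
  have gb: "cmod (?g s) \<le> majorant s / (Re z - a)" for s
    unfolding norm_divide using z dist[of s] line_bound majorant_nonneg by (intro frac_le) auto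
  have maj: "integrable lborel (\<lambda>s. majorant s / (Re z - a))" using majorant_integrable by simp
  have gm: "?g \<in> borel_measurable borel" by measurable
  show gint: "integrable lborel ?g"
    by (rule Bochner_Integration.integrable_bound[OF maj])
       (use gm gb z in \<open>auto intro!: AE_I2 simp: majorant_nonneg abs_of_nonneg\<close>)
  have lim1: "(\<lambda>n. \<integral>s. indicator {- real n..real n} s *\<^sub>R ?g s \<partial>lborel) \<longlonglongrightarrow> (\<integral>s. ?g s \<partial>lborel)"
  proof (rule integral_dominated_convergence[OF _ _ maj])
    show "AE s in lborel. (\<lambda>n. indicator {- real n..real n} s *\<^sub>R ?g s) \<longlonglongrightarrow> ?g s"
    proof (rule AE_I2)
      fix s :: real
      obtain N :: nat where "\<bar>s\<bar> \<le> real N" using real_arch_simple by blast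
      then have "eventually (\<lambda>n. indicator {- real n..real n} s *\<^sub>R ?g s = ?g s) sequentially"
        by (intro eventually_mono[OF eventually_ge_at_top[of N]]) (auto simp: indicator_def)
      then show "(\<lambda>n. indicator {- real n..real n} s *\<^sub>R ?g s) \<longlonglongrightarrow> ?g s"
        by (rule tendsto_eventually)
    qed
    show "AE s in lborel. norm (indicator {- real n..real n} s *\<^sub>R ?g s) \<le> majorant s / (Re z - a)" for n
      using gb z majorant_nonneg by (intro AE_I2) (auto simp: indicator_def simp del: norm_divide)
  qed (use gm in measurable)
  \<comment> \<open>From this size on the rectangle contains \<open>z\<close>, and its three outer
    sides keep distance at least 1 from \<open>z\<close>.\<close>
  obtain N0 :: nat where N0: "cmod z + \<bar>a\<bar> + 1 \<le> real N0" using real_arch_simple by blast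
  have err: "cmod ((\<integral>s. indicator {- real n..real n} s *\<^sub>R ?g s \<partial>lborel) - 2 * pi * Q z) \<le> 6 * M / real n"
    if n: "n \<ge> N0" for n
  proof -
    define R where "R = real n"
    have R: "cmod z + \<bar>a\<bar> + 1 \<le> R" using n N0 by (simp add: R_def)
    then have R1: "R \<ge> 1" using norm_ge_zero[of z] by linarith
    define S where "S = {w. Re w > b}"
    define k where "k w = Q w / (w - z)" for w
    define a1 a2 a3 a4 where "a1 = Complex a (- R)" and "a2 = Complex (a + R) (- R)"
      and "a3 = Complex (a + R) R" and "a4 = Complex a R"
    have S: "convex S" "open S"
      unfolding S_def by (simp_all add: convex_halfspace_Re_gt open_halfspace_Re_gt)
    have zb: "z \<in> box a1 a3"
      using z R abs_Re_le_cmod[of z] abs_Im_le_cmod[of z] by (auto simp: in_box_complex_iff a1_def a3_def)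
    have zS: "z \<in> S" using z ba by (simp add: S_def)
    have img: "path_image (rectpath a1 a3) \<subseteq> S - {z}"
    proof -
      have "path_image (rectpath a1 a3) = cbox a1 a3 - box a1 a3"
        using R1 by (intro path_image_rectpath_cbox_minus_box) (auto simp: a1_def a3_def)
      moreover have "w \<in> S - {z}" if w: "w \<in> cbox a1 a3 - box a1 a3" for w
      proof -
        have "w \<noteq> z" using w zb by blast
        moreover have "a \<le> Re w" using w by (simp add: in_cbox_complex_iff a1_def)
        ultimately show ?thesis using ba by (simp add: S_def)
      qed
      ultimately show ?thesis by blast
    qed
    have "z \<in> interior S" using zS S(2) by (simp add: interior_open)
    then have "(k has_contour_integral (2 * pi * \<i> * winding_number (rectpath a1 a3) z * Q z)) (rectpath a1 a3)"
      unfolding k_def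
      by (rule Cauchy_integral_formula_convex_simple[OF S(1) holo[folded S_def] _ _ img])
         (simp_all add: valid_path_rectpath)
    then have full: "(k has_contour_integral (2 * pi * \<i> * Q z)) (rectpath a1 a3)"
      by (simp add: winding_number_rectpath[OF zb])
    have rp: "rectpath a1 a3 = linepath a1 a2 +++ linepath a2 a3 +++ linepath a3 a4 +++ linepath a4 a1"
      by (simp add: rectpath_def Let_def a1_def a2_def a3_def a4_def)
    have segs: "closed_segment a1 a2 \<union> closed_segment a2 a3 \<union> closed_segment a3 a4 \<union> closed_segment a4 a1 \<subseteq> S - {z}"
      using img by (simp add: rp path_image_join)
    have kcont: "continuous_on (S - {z}) k"
      unfolding k_def using holomorphic_on_imp_continuous_on[OF holo]
      by (intro continuous_intros) (auto simp: S_def intro: continuous_on_subset)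
    have ci: "k contour_integrable_on (linepath u v)" if "closed_segment u v \<subseteq> S - {z}" for u v
      by (rule contour_integrable_continuous_linepath[OF continuous_on_subset[OF kcont that]])
    define I1 I2 I3 I4 where "I1 = contour_integral (linepath a1 a2) k" and "I2 = contour_integral (linepath a2 a3) k"
      and "I3 = contour_integral (linepath a3 a4) k" and "I4 = contour_integral (linepath a4 a1) k"
    have hI: "(k has_contour_integral I1) (linepath a1 a2)" "(k has_contour_integral I2) (linepath a2 a3)"
      "(k has_contour_integral I3) (linepath a3 a4)" "(k has_contour_integral I4) (linepath a4 a1)"
      using segs by (auto simp: I1_def I2_def I3_def I4_def intro!: has_contour_integral_integral ci)
    have "(k has_contour_integral (I1 + (I2 + (I3 + I4)))) (rectpath a1 a3)"
      unfolding rp by (intro has_contour_integral_join hI valid_path_join) simp_all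
    then have sum: "I1 + (I2 + (I3 + I4)) = 2 * pi * \<i> * Q z"
      using full has_contour_integral_unique by blast
    have kb: "cmod (k w) \<le> M / R\<^sup>2" if w: "Re w \<ge> a" "\<bar>Im w\<bar> = R \<or> Re w = a + R" for w
    proof -
      have far: "R \<le> cmod (w + of_real lam)"
        using w abs_Re_le_cmod[of "w + of_real lam"] abs_Im_le_cmod[of "w + of_real lam"] lam R1 by auto
      have near: "1 \<le> cmod (w - z)"
        using w abs_Re_le_cmod[of "w - z"] abs_Im_le_cmod[of "w - z"] abs_Re_le_cmod[of z] abs_Im_le_cmod[of z] R
        by auto
      have "cmod (k w) \<le> (M / (cmod (w + of_real lam))\<^sup>2) / 1"
        unfolding k_def norm_divide using near bound[OF w(1)] M by (intro frac_le) auto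
      also have "\<dots> \<le> M / R\<^sup>2" unfolding div_by_1
        using far R1 M by (intro divide_left_mono power_mono) (auto intro!: mult_pos_pos zero_less_power)
      finally show ?thesis .
    qed
    have B0: "0 \<le> M / R\<^sup>2" using M by simp
    have seg: "Re w \<ge> a \<and> (\<bar>Im w\<bar> = R \<or> Re w = a + R)"
      if "w \<in> closed_segment a1 a2 \<or> w \<in> closed_segment a2 a3 \<or> w \<in> closed_segment a3 a4" for w
      using that R1
      by (auto simp: closed_segment_same_Re closed_segment_same_Im closed_segment_eq_real_ivl a1_def a2_def a3_def a4_def)
    have n1: "cmod I1 \<le> M / R\<^sup>2 * cmod (a2 - a1)"
      by (rule has_contour_integral_bound_linepath[OF hI(1) B0]) (use seg kb in blast)
    have n2: "cmod I2 \<le> M / R\<^sup>2 * cmod (a3 - a2)"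
      by (rule has_contour_integral_bound_linepath[OF hI(2) B0]) (use seg kb in blast)
    have n3: "cmod I3 \<le> M / R\<^sup>2 * cmod (a4 - a3)"
      by (rule has_contour_integral_bound_linepath[OF hI(3) B0]) (use seg kb in blast)
    have l: "cmod (a2 - a1) = R" "cmod (a3 - a2) = 2 * R" "cmod (a4 - a3) = R"
      using R1 by (simp_all add: a1_def a2_def a3_def a4_def cmod_def real_sqrt_mult)
    have "cmod (I1 + I2 + I3) \<le> M / R\<^sup>2 * R + M / R\<^sup>2 * (2 * R) + M / R\<^sup>2 * R"
      using n1 n2 n3 unfolding l by (intro order_trans[OF norm_triangle_ineq] add_mono) auto
    also have "\<dots> = 4 * M / R" using R1 by (simp add: power2_eq_square field_simps)
    finally have small: "cmod (I1 + I2 + I3) \<le> 4 * M / R" .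
    \<comment> \<open>The rectangle is run through counterclockwise, so its left side is traversed
      downwards.\<close>
    have "(k has_contour_integral (- I4)) (linepath a1 a4)"
      using has_contour_integral_reverse_linepath[OF hI(4)] .
    then have "((\<lambda>s. k (Complex a s)) has_integral (- \<i> * (- I4))) {- R..R}"
      using R1 by (subst (asm) has_contour_integral_linepath_same_Re_iff[where c=a and a="-R" and b=R])
        (auto simp: a1_def a4_def)
    then have "((\<lambda>s. - k (Complex a s)) has_integral (- (- \<i> * (- I4)))) {- R..R}"
      by (rule has_integral_neg)
    moreover have "- k (Complex a s) = ?g s" for s
      by (simp add: k_def minus_divide_right)
    ultimately have h4: "(?g has_integral (- \<i> * I4)) {- R..R}" by simp
    have "(?g has_integral (\<integral>s. indicator {- R..R} s *\<^sub>R ?g s \<partial>lborel)) {- R..R}"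
    proof -
      have "integrable lborel (\<lambda>s. indicator {- R..R} s *\<^sub>R ?g s)"
        by (rule integrable_mult_indicator[OF _ gint]) simp
      then have "set_integrable lborel {- R..R} ?g" by (simp add: set_integrable_def)
      from set_borel_integral_eq_integral[OF this] show ?thesis
        by (simp add: has_integral_integrable_integral set_lebesgue_integral_def)
    qed
    then have I: "(\<integral>s. indicator {- R..R} s *\<^sub>R ?g s \<partial>lborel) = - \<i> * I4"
      using h4 has_integral_unique by blast
    have "- \<i> * I4 - 2 * pi * Q z = \<i> * (I1 + I2 + I3)"
    proof -
      have e: "I4 = 2 * pi * \<i> * Q z - (I1 + I2 + I3)" using sum by (simp add: algebra_simps)
      show ?thesis unfolding e by (simp add: algebra_simps)
    qed
    then have "cmod ((\<integral>s. indicator {- R..R} s *\<^sub>R ?g s \<partial>lborel) - 2 * pi * Q z) \<le> 4 * M / R"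
      unfolding I using small by (simp add: norm_mult)
    also have "\<dots> \<le> 6 * M / R" using M R1 by (intro divide_right_mono) auto
    finally show ?thesis by (simp add: R_def)
  qed
  have "(\<lambda>n. (\<integral>s. indicator {- real n..real n} s *\<^sub>R ?g s \<partial>lborel) - 2 * pi * Q z) \<longlonglongrightarrow> 0"
  proof (rule Lim_null_comparison)
    show "\<forall>\<^sub>F n in sequentially. norm ((\<integral>s. indicator {- real n..real n} s *\<^sub>R ?g s \<partial>lborel) - 2 * pi * Q z) \<le> 6 * M / real n"
      using err by (intro eventually_mono[OF eventually_ge_at_top[of N0]])
    show "(\<lambda>n. 6 * M / real n) \<longlonglongrightarrow> 0" by (rule lim_const_over_n)
  qed
  then have "(\<lambda>n. \<integral>s. indicator {- real n..real n} s *\<^sub>R ?g s \<partial>lborel) \<longlonglongrightarrow> 2 * pi * Q z"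
    by (rule LIM_zero_cancel)
  then show "(\<integral>s. ?g s \<partial>lborel) = 2 * pi * Q z" using lim1 LIMSEQ_unique by blast
qed

text \<open>Interchanging the integrals turns the transform in \<open>t\<close> into the factor
  \<open>1 / (z - w)\<close> on the line, and Cauchy's formula for the line returns
  \<open>Q z\<close>.\<close>

theorem laplace_bromwich:
  assumes z: "Re z > a"
  shows "(\<integral>t. bromwich Q a t * exp (- z * of_real t) \<partial>halfline) = Q z"
    and "integrable halfline (\<lambda>t. bromwich Q a t * exp (- z * of_real t))"
proof -
  define f where "f t s = Q (Complex a s) * exp (- (z - Complex a s) * of_real t)" for t s
  interpret hl: sigma_finite_measure halfline
    by (rule sigma_finite_measure_restrict_space) (auto simp: lborel.sigma_finite_measure_axioms)
  interpret P: pair_sigma_finite halfline lborel ..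
  have idm [measurable]: "(\<lambda>t. t) \<in> borel_measurable halfline"
    by (rule measurable_restrict_space1) simp
  have fm: "case_prod f \<in> borel_measurable (halfline \<Otimes>\<^sub>M lborel)"
    unfolding f_def split_beta' by measurable
  have fb: "cmod (f t s) = cmod (Q (Complex a s)) * exp (- (Re z - a) * t)" for t s
    by (simp add: f_def norm_mult norm_exp_eq_Re)
  have rpos: "Re z - a > 0" using z by simp
  have eint: "integrable halfline (\<lambda>t. exp (- (Re z - a) * t))"
    using halfline_power_exp(1)[OF rpos] by (simp add: has_bochner_integral_iff)
  have int: "integrable (halfline \<Otimes>\<^sub>M lborel) (case_prod f)"
  proof (rule P.Fubini_integrable[OF fm])
    show "integrable halfline (\<lambda>t. \<integral>s. norm (case (t, s) of (t, s) \<Rightarrow> f t s) \<partial>lborel)"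
      using eint by (simp add: fb)
    show "AE t in halfline. integrable lborel (\<lambda>s. case (t, s) of (t, s) \<Rightarrow> f t s)"
    proof (rule AE_I2)
      fix t
      have "f t s = exp (- z * of_real t) * (Q (Complex a s) * exp (Complex a s * of_real t))" for s
        by (simp add: f_def algebra_simps exp_add exp_minus exp_diff) (simp add: field_simps)
      then show "integrable lborel (\<lambda>s. case (t, s) of (t, s) \<Rightarrow> f t s)"
        using integrand_integrable[of t] by simp
    qed
  qed
  have inner: "(\<integral>s. f t s \<partial>lborel) = 2 * pi * (bromwich Q a t * exp (- z * of_real t))" for t
  proof -
    have "f t s = (Q (Complex a s) * exp (Complex a s * of_real t)) * exp (- z * of_real t)" for s
      by (simp add: f_def algebra_simps exp_add exp_minus exp_diff) (simp add: field_simps)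
    then show ?thesis by (simp add: bromwich_def)
  qed
  have "(\<integral>t. \<integral>s. f t s \<partial>lborel \<partial>halfline) = (\<integral>s. \<integral>t. f t s \<partial>halfline \<partial>lborel)"
    using P.Fubini_integral[OF int] by simp
  also have "\<dots> = (\<integral>s. Q (Complex a s) / (z - Complex a s) \<partial>lborel)"
  proof (rule Bochner_Integration.integral_cong[OF refl])
    fix s
    have "Re (z - Complex a s) > 0" using z by simp
    from halfline_exp(2)[OF this] show "(\<integral>t. f t s \<partial>halfline) = Q (Complex a s) / (z - Complex a s)"
      by (simp add: f_def)
  qed
  also have "\<dots> = 2 * pi * Q z" by (rule cauchy_line(1)[OF z])
  finally show "(\<integral>t. bromwich Q a t * exp (- z * of_real t) \<partial>halfline) = Q z"
    by (simp add: inner)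
  have "integrable halfline (\<lambda>t. \<integral>s. f t s \<partial>lborel)"
    using P.integrable_fst[OF int] by simp
  then have "integrable halfline (\<lambda>t. complex_of_real (1 / (2 * pi)) * (\<integral>s. f t s \<partial>lborel))"
    by (intro integrable_mult_right)
  then show "integrable halfline (\<lambda>t. bromwich Q a t * exp (- z * of_real t))"
    unfolding inner by simp
qed

end

text \<open>All symbols share the parameters \<open>a\<close>, \<open>lam\<close> and
  \<open>M\<close>, hence a single integrable majorant.\<close>

lemma bromwich_tendsto:
  assumes Q: "\<And>n::nat. decaying_symbol (Qn n) b a lam M" and P: "decaying_symbol Q b a lam M"
    and lim: "\<And>s. (\<lambda>n. Qn n (Complex a s)) \<longlonglongrightarrow> Q (Complex a s)"
  shows "(\<lambda>n. bromwich (Qn n) a t) \<longlonglongrightarrow> bromwich Q a t"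
proof -
  interpret P: decaying_symbol Q b a lam M by fact
  have "(\<lambda>n. \<integral>s. Qn n (Complex a s) * exp (Complex a s * of_real t) \<partial>lborel)
      \<longlonglongrightarrow> (\<integral>s. Q (Complex a s) * exp (Complex a s * of_real t) \<partial>lborel)"
  proof (rule integral_dominated_convergence[where w="\<lambda>s. P.majorant s * exp (a * t)"])
    show "integrable lborel (\<lambda>s. P.majorant s * exp (a * t))" using P.majorant_integrable by simp
    show "(\<lambda>s. Q (Complex a s) * exp (Complex a s * of_real t)) \<in> borel_measurable lborel"
      using P.integrand_integrable by auto
    show "(\<lambda>s. Qn n (Complex a s) * exp (Complex a s * of_real t)) \<in> borel_measurable lborel" for n
      using decaying_symbol.integrand_integrable[OF Q] by auto
    show "AE s in lborel. (\<lambda>n. Qn n (Complex a s) * exp (Complex a s * of_real t)) \<longlonglongrightarrow> Q (Complex a s) * exp (Complex a s * of_real t)"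
      by (intro AE_I2 tendsto_intros lim)
    show "AE s in lborel. norm (Qn n (Complex a s) * exp (Complex a s * of_real t)) \<le> P.majorant s * exp (a * t)" for n
      using decaying_symbol.integrand_bound[OF Q] decaying_symbol.majorant_def[OF Q] P.majorant_def
      by (intro AE_I2) simp
  qed
  then show ?thesis unfolding bromwich_def by (intro tendsto_intros) auto
qed

subsection \<open>Uniqueness of the generated semigroup\<close>

text \<open>Sampling each cell at its right endpoint makes the sample times approach
  \<open>t\<close> strictly from the right. This serves for orbits of a semigroup for which no
  uniform bound, and hence no left continuity, has been established.\<close>

lemma strongly_measurable_right_continuous:
  fixes \<phi> :: "real \<Rightarrow> 'a::cbanach"
  assumes \<nu>: "sets \<nu> = sets borel_halfline" and rc: "\<And>t. t \<ge> 0 \<Longrightarrow> ((\<lambda>h. \<phi> (t + h)) \<longlongrightarrow> \<phi> t) (at_right 0)"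
  shows "strongly_measurable \<nu> \<phi>"
  unfolding strongly_measurable_def
proof (intro exI[of _ "\<lambda>n. step n (\<lambda>t. \<phi> (t + 1 / real n))"] conjI allI ballI)
  show "simple_function \<nu> (step n (\<lambda>t. \<phi> (t + 1 / real n)))" for n
    by (rule simple_function_step[OF \<nu>])
  fix t assume "t \<in> space \<nu>"
  then have t: "t \<ge> 0" using space_halfline[OF \<nu>] by simp
  define h where "h n = real (nat \<lfloor>real n * t\<rfloor>) / real n + 1 / real n - t" for n
  have h: "0 < h n \<and> h n \<le> 1 / real n" if "n > 0" for n
  proof -
    have "real n * t < real (nat \<lfloor>real n * t\<rfloor>) + 1" "real (nat \<lfloor>real n * t\<rfloor>) \<le> real n * t"
      using t by (linarith, simp)
    then have "t < (real (nat \<lfloor>real n * t\<rfloor>) + 1) / real n" "real (nat \<lfloor>real n * t\<rfloor>) / real n \<le> t"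
      using that by (simp_all add: pos_less_divide_eq pos_divide_le_eq mult.commute)
    then show ?thesis by (simp add: h_def add_divide_distrib)
  qed
  have "filterlim h (at_right 0) sequentially"
    unfolding filterlim_at
  proof
    show "eventually (\<lambda>n. h n \<in> {0<..} \<and> h n \<noteq> 0) sequentially"
    proof (rule eventually_mono[OF eventually_gt_at_top[of 0]])
      fix n :: nat assume "0 < n"
      from h[OF this] show "h n \<in> {0<..} \<and> h n \<noteq> 0" by auto
    qed
    show "h \<longlonglongrightarrow> 0"
    proof (rule Lim_null_comparison[OF _ lim_1_over_n])
      show "eventually (\<lambda>n. norm (h n) \<le> 1 / real n) sequentially"
        using h by (intro eventually_mono[OF eventually_gt_at_top[of 0]]) (simp add: abs_of_pos)
    qed
  qed
  then have "(\<lambda>n. \<phi> (t + h n)) \<longlonglongrightarrow> \<phi> t"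
    by (rule filterlim_compose[OF rc[OF t]])
  moreover obtain N :: nat where N: "t < real N" using reals_Archimedean2 by blast
  have "eventually (\<lambda>n. \<phi> (t + h n) = step n (\<lambda>t. \<phi> (t + 1 / real n)) t) sequentially"
    using N t by (intro eventually_mono[OF eventually_ge_at_top[of N]]) (auto simp: step_eq h_def)
  ultimately show "(\<lambda>n. step n (\<lambda>t. \<phi> (t + 1 / real n)) t) \<longlonglongrightarrow> \<phi> t"
    by (rule Lim_transform_eventually)
qed

lemma sets_halfline: "sets halfline = sets borel_halfline"
  by (intro sets_restrict_space_cong) simp

lemma space_halfline' [simp]: "space halfline = {0..}"
  by (rule space_halfline[OF sets_halfline])

text \<open>The integral against a fixed Bochner integrable \<open>D\<close> is a functional on scalar functions that
  is determined by the Laplace transform of \<open>D\<close>.\<close>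

lemma laplace_zero_imp_zero:
  fixes D :: "real \<Rightarrow> 'a::cbanach"
  assumes rc: "\<And>t. t \<ge> 0 \<Longrightarrow> ((\<lambda>h. D (t + h)) \<longlongrightarrow> D t) (at_right 0)"
    and fin: "(\<integral>\<^sup>+t. ennreal (norm (D t)) \<partial>halfline) < \<infinity>"
    and zero: "\<And>n. n \<ge> 1 \<Longrightarrow> has_bochner halfline (\<lambda>t. exp (- t) ^ n *\<^sub>R D t) 0"
    and t0: "t0 \<ge> 0"
  shows "D t0 = 0"
proof -
  have sD: "strongly_measurable halfline D"
    by (rule strongly_measurable_right_continuous[OF sets_halfline rc])
  have nD [measurable]: "(\<lambda>t. norm (D t)) \<in> borel_measurable halfline" by (rule strongly_measurable_norm[OF sD])
  have pm: "p \<in> borel_measurable halfline" if "p \<in> bcont" for p :: "real \<Rightarrow> complex"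
    by (intro strongly_measurable_borel strongly_measurable_continuous sets_halfline bcont_continuous that)
  have sp: "strongly_measurable halfline (\<lambda>t. p t *\<^sub>C D t)" if "p \<in> bcont" for p :: "real \<Rightarrow> complex"
    by (intro strongly_measurable_scaleC pm that sD)
  define L where "L p = (THE y. has_bochner halfline (\<lambda>t. p t *\<^sub>C D t) y)" for p
  have L: "has_bochner halfline (\<lambda>t. p t *\<^sub>C D t) (L p)" if p: "p \<in> bcont" for p
  proof -
    obtain B where B: "B \<ge> 0" "\<And>t. t \<ge> 0 \<Longrightarrow> cmod (p t) \<le> B" using bcontE[OF p] by blast
    have "(\<integral>\<^sup>+t. ennreal (norm (p t *\<^sub>C D t)) \<partial>halfline) \<le> (\<integral>\<^sup>+t. ennreal B * ennreal (norm (D t)) \<partial>halfline)"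
      using B by (intro nn_integral_mono) (auto simp: norm_scaleC simp flip: ennreal_mult intro!: ennreal_leI mult_right_mono)
    also have "\<dots> < \<infinity>" using fin by (simp add: nn_integral_cmult ennreal_mult_less_top)
    finally obtain y where y: "has_bochner halfline (\<lambda>t. p t *\<^sub>C D t) y"
      using has_bochner_exists[OF sp[OF p]] by blast
    then have "L p = y" unfolding L_def by (rule the_equality) (rule has_bochner_unique[OF _ y])
    with y show ?thesis by simp
  qed
  have diff: "ennreal (norm (L p - L q)) \<le> (\<integral>\<^sup>+t. ennreal (cmod (p t - q t) * norm (D t)) \<partial>halfline)"
    if "p \<in> bcont" "q \<in> bcont" for p q
  proof -
    have [measurable]: "p \<in> borel_measurable halfline" "q \<in> borel_measurable halfline" using pm that by auto
    show ?thesis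
      by (rule has_bochner_diff_le[OF L[OF that(1)] L[OF that(2)]])
         (simp_all flip: scaleC.diff_left add: norm_scaleC)
  qed
  have L0: "L (\<lambda>t. 0) = 0"
    using has_bochner_unique[OF L[OF bcont_const[of 0]], of 0] has_bochner_scaleC_left[of halfline "\<lambda>_. 0" "0::'a"]
    by (simp add: scaleC.zero_left)
  have "bc_functional L"
    unfolding bc_functional_def
  proof (intro conjI ballI allI impI)
    fix p q :: "real \<Rightarrow> complex" assume p: "p \<in> bcont" and q: "q \<in> bcont"
    have "has_bochner halfline (\<lambda>t. p t *\<^sub>C D t + q t *\<^sub>C D t) (L p + L q)"
      by (intro has_bochner_add L sp p q)
    then have "has_bochner halfline (\<lambda>t. (p t + q t) *\<^sub>C D t) (L p + L q)"
      by (simp add: scaleC_add_left)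
    then show "L (\<lambda>t. p t + q t) = L p + L q"
      using has_bochner_unique[OF L[OF bcont_add[OF p q]]] by simp
  next
    define J where "J = enn2real (\<integral>\<^sup>+t. ennreal (norm (D t)) \<partial>halfline)"
    have J: "(\<integral>\<^sup>+t. ennreal (norm (D t)) \<partial>halfline) = ennreal J" "J \<ge> 0" using fin by (simp_all add: J_def)
    show "\<exists>M\<ge>0. \<forall>p\<in>bcont. \<forall>B. (\<forall>t\<ge>0. norm (p t) \<le> B) \<longrightarrow> norm (L p) \<le> M * B"
    proof (intro exI[of _ J] conjI ballI allI impI)
      fix p :: "real \<Rightarrow> complex" and B assume p: "p \<in> bcont" and B: "\<forall>t\<ge>0. norm (p t) \<le> B"
      have B0: "B \<ge> 0" using order_trans[OF norm_ge_zero, of "p 0" B] B by simp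
      have "ennreal (norm (L p)) \<le> (\<integral>\<^sup>+t. ennreal (cmod (p t) * norm (D t)) \<partial>halfline)"
        using diff[OF p bcont_const[of 0]] by (simp add: L0)
      also have "\<dots> \<le> (\<integral>\<^sup>+t. ennreal B * ennreal (norm (D t)) \<partial>halfline)"
        using B B0 by (intro nn_integral_mono) (auto simp flip: ennreal_mult intro!: ennreal_leI mult_right_mono)
      also have "\<dots> = ennreal (J * B)" using B0 J by (simp add: nn_integral_cmult ennreal_mult mult.commute)
      finally show "norm (L p) \<le> J * B" using B0 J by (subst (asm) ennreal_le_iff) auto
    qed (rule J)
  next
    fix P :: "nat \<Rightarrow> real \<Rightarrow> complex" and p B
    assume p: "p \<in> bcont" and P: "\<forall>n. P n \<in> bcont" "\<forall>n. \<forall>t\<ge>0. norm (P n t) \<le> B"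
      and lim: "\<forall>t\<ge>0. (\<lambda>n. P n t) \<longlonglongrightarrow> p t"
    have [measurable]: "p \<in> borel_measurable halfline" "P n \<in> borel_measurable halfline" for n using pm p P(1) by auto
    have pB: "cmod (p t) \<le> B" if "t \<ge> 0" for t
    proof (rule LIMSEQ_le_const2)
      show "(\<lambda>n. cmod (P n t)) \<longlonglongrightarrow> cmod (p t)" using lim that by (intro tendsto_norm) auto
      show "\<exists>N. \<forall>n\<ge>N. cmod (P n t) \<le> B" using P(2) that by blast
    qed
    have B0: "B \<ge> 0" using order_trans[OF norm_ge_zero pB[of 0]] by simp
    have "(\<lambda>n. \<integral>\<^sup>+t. ennreal (cmod (P n t - p t) * norm (D t)) \<partial>halfline) \<longlonglongrightarrow> (\<integral>\<^sup>+t. 0 \<partial>halfline)"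
    proof (rule nn_integral_dominated_convergence[where w="\<lambda>t. ennreal (2 * B) * ennreal (norm (D t))"])
      show "(\<integral>\<^sup>+t. ennreal (2 * B) * ennreal (norm (D t)) \<partial>halfline) < \<infinity>"
        using fin by (simp add: nn_integral_cmult ennreal_mult_less_top)
      show "AE t in halfline. ennreal (cmod (P n t - p t) * norm (D t)) \<le> ennreal (2 * B) * ennreal (norm (D t))" for n
      proof (rule AE_I2)
        fix t assume "t \<in> space halfline"
        then have "cmod (P n t - p t) \<le> 2 * B"
          using norm_triangle_ineq4[of "P n t" "p t"] pB[of t] P(2)[rule_format, of t n] by simp
        then have "cmod (P n t - p t) * norm (D t) \<le> 2 * B * norm (D t)" by (rule mult_right_mono) simp
        then show "ennreal (cmod (P n t - p t) * norm (D t)) \<le> ennreal (2 * B) * ennreal (norm (D t))"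
          using B0 by (simp add: ennreal_leI flip: ennreal_mult)
      qed
      show "AE t in halfline. (\<lambda>n. ennreal (cmod (P n t - p t) * norm (D t))) \<longlonglongrightarrow> 0"
      proof (rule AE_I2)
        fix t assume "t \<in> space halfline"
        then have "(\<lambda>n. cmod (P n t - p t) * norm (D t)) \<longlonglongrightarrow> cmod (p t - p t) * norm (D t)"
          using lim by (intro tendsto_mult tendsto_const tendsto_norm tendsto_diff) auto
        then have "(\<lambda>n. ennreal (cmod (P n t - p t) * norm (D t))) \<longlonglongrightarrow> ennreal (cmod (p t - p t) * norm (D t))"
          by (rule tendsto_ennrealI)
        then show "(\<lambda>n. ennreal (cmod (P n t - p t) * norm (D t))) \<longlonglongrightarrow> 0" by simp
      qed
    qed measurable
    then have "(\<lambda>n. \<integral>\<^sup>+t. ennreal (cmod (P n t - p t) * norm (D t)) \<partial>halfline) \<longlonglongrightarrow> 0" by simp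
    then have "(\<lambda>n. ennreal (norm (L (P n) - L p))) \<longlonglongrightarrow> 0"
      by (rule ennreal_tendsto_0_le) (use diff p P(1) in auto)
    then have "(\<lambda>n. norm (L (P n) - L p)) \<longlonglongrightarrow> 0"
      by (subst (asm) ennreal_0[symmetric], subst (asm) tendsto_ennreal_iff) auto
    then show "(\<lambda>n. L (P n)) \<longlonglongrightarrow> L p" by (simp add: tendsto_norm_zero_iff LIM_zero_iff)
  qed
  moreover have "bc_functional (\<lambda>p::real \<Rightarrow> complex. 0::'a)"
    unfolding bc_functional_def by (auto intro!: exI[of _ 0])
  moreover have "L (\<lambda>t. exp (- t) ^ n *\<^sub>R v) = 0" if "n \<ge> 1" for n and v :: complex
  proof -
    have mem: "(\<lambda>t. exp (- t) ^ n *\<^sub>R v) \<in> bcont"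
      by (rule bcont_scaleR) (auto intro!: continuous_intros power_le_one)
    have "has_bochner halfline (\<lambda>t. v *\<^sub>C (exp (- t) ^ n *\<^sub>R D t)) (v *\<^sub>C 0)"
      by (rule has_bochner_bounded_linear[OF zero[OF that] scaleC.bounded_linear_right])
    then have "has_bochner halfline (\<lambda>t. (exp (- t) ^ n *\<^sub>R v) *\<^sub>C D t) 0"
      by (simp add: scaleC.scaleR_left scaleC.scaleR_right scaleC.zero_right)
    then show ?thesis using has_bochner_unique[OF L[OF mem]] by simp
  qed
  ultimately have Lz: "L p = 0" if "p \<in> bcont" for p
    using bc_functional_eqI[of L "\<lambda>_. 0" p] that by simp
  show ?thesis
  proof (rule ccontr)
    assume "D t0 \<noteq> 0"
    then have n0: "norm (D t0) / 2 > 0" by simp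
    from tendstoD[OF rc[OF t0] this] obtain d where d: "d > 0"
      "\<And>h. 0 < h \<Longrightarrow> h < d \<Longrightarrow> dist (D (t0 + h)) (D t0) < norm (D t0) / 2"
      unfolding eventually_at_right_field by auto
    \<comment> \<open>A tent of height 1 over \<open>(t0, t0 + d)\<close>, to the right of
      \<open>t0\<close> because \<open>D\<close> is only right continuous. Its integral against
      \<open>D\<close> vanishes, although on its support \<open>D\<close> stays within half of
      \<open>norm (D t0)\<close> of \<open>D t0\<close>.\<close>
    define p where "p t = max 0 (1 - \<bar>t - (t0 + d/2)\<bar> * (2/d))" for t :: real
    have p0: "0 \<le> p t" "p t \<le> 1" for t using d(1) by (auto simp: p_def)
    have psupp: "t0 < t \<and> t < t0 + d" if "p t \<noteq> 0" for t
    proof -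
      have "\<bar>t - (t0 + d/2)\<bar> * (2/d) < 1"
      proof (rule ccontr)
        assume "\<not> \<bar>t - (t0 + d/2)\<bar> * (2/d) < 1"
        then have "p t = 0" unfolding p_def by (intro max_absorb1) linarith
        with that show False by simp
      qed
      then have "\<bar>t - (t0 + d/2)\<bar> < d/2" using d(1) by (simp add: field_simps)
      then show ?thesis unfolding abs_less_iff by linarith
    qed
    have pcont: "continuous_on UNIV p" unfolding p_def by (intro continuous_intros)
    have [measurable]: "p \<in> borel_measurable borel" using pcont by (rule borel_measurable_continuous_onI)
    have pb: "(\<lambda>t. complex_of_real (p t)) \<in> bcont"
      by (rule bcontI[of _ 1]) (use p0 in \<open>auto intro!: continuous_intros continuous_on_subset[OF pcont]\<close>)
    have pint: "integrable halfline p"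
    proof (rule Bochner_Integration.integrable_bound[of _ "indicator {t0..t0 + d}"])
      have "{t0..t0 + d} \<in> sets halfline" using t0 by (simp add: sets_restrict_space_iff)
      moreover have "emeasure halfline {t0..t0 + d} < \<infinity>"
        using t0 d(1) by (subst emeasure_restrict_space) auto
      ultimately show "integrable halfline (indicator {t0..t0 + d} :: real \<Rightarrow> real)" by simp
      show "AE t in halfline. norm (p t) \<le> norm (indicator {t0..t0 + d} t :: real)"
      proof (rule AE_I2)
        fix t
        show "norm (p t) \<le> norm (indicator {t0..t0 + d} t :: real)"
          using p0[of t] psupp[of t] by (cases "p t = 0") (auto simp: indicator_def)
      qed
    qed (auto intro: measurable_restrict_space1)
    define I where "I = (\<integral>t. p t \<partial>halfline)"
    have Ipos: "I > 0"
    proof -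
      have "(\<integral>t. (1/2) * indicator {t0 + d/4..t0 + 3*d/4} t \<partial>halfline) \<le> I"
        unfolding I_def
      proof (rule Bochner_Integration.integral_mono[OF _ pint])
        have "{t0 + d/4..t0 + 3*d/4} \<in> sets halfline" using t0 d(1) by (simp add: sets_restrict_space_iff)
        moreover have "emeasure halfline {t0 + d/4..t0 + 3*d/4} < \<infinity>"
          using t0 d(1) by (subst emeasure_restrict_space) auto
        ultimately show "integrable halfline (\<lambda>t. (1/2) * indicator {t0 + d/4..t0 + 3*d/4} t :: real)" by simp
        fix t
        show "(1/2) * indicator {t0 + d/4..t0 + 3*d/4} t \<le> p t"
        proof (cases "t \<in> {t0 + d/4..t0 + 3*d/4}")
          case True
          then have "t0 + d/4 \<le> t" "t \<le> t0 + 3*d/4" by auto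
          then have "\<bar>t - (t0 + d/2)\<bar> \<le> d/4" unfolding abs_le_iff by linarith
          then have "\<bar>t - (t0 + d/2)\<bar> * (2/d) \<le> d/4 * (2/d)" using d(1) by (intro mult_right_mono) auto
          also have "\<dots> = 1/2" using d(1) by simp
          finally have "1/2 \<le> p t" unfolding p_def by linarith
          with True show ?thesis by simp
        qed (use p0 in simp)
      qed
      moreover have "(\<integral>t. (1/2) * indicator {t0 + d/4..t0 + 3*d/4} t \<partial>halfline) = (1/2) * (d/2)"
      proof -
        have "measure halfline {t0 + d/4..t0 + 3*d/4} = d/2"
          using t0 d(1) by (subst measure_restrict_space) auto
        moreover have "max (t0 + d/4) 0 = t0 + d/4" using t0 d(1) by simp
        ultimately show ?thesis by simp
      qed
      ultimately show ?thesis using d(1) by simp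
    qed
    have "has_bochner halfline (\<lambda>t. complex_of_real (p t) *\<^sub>C D t0) ((\<integral>t. complex_of_real (p t) \<partial>halfline) *\<^sub>C D t0)"
      using pint by (intro has_bochner_scaleC_left) simp
    then have h: "has_bochner halfline (\<lambda>t. complex_of_real (p t) *\<^sub>C D t0) (I *\<^sub>R D t0)"
      by (simp add: I_def scaleC_of_real)
    have "ennreal (norm (L (\<lambda>t. complex_of_real (p t)) - I *\<^sub>R D t0)) \<le> (\<integral>\<^sup>+t. ennreal (p t * (norm (D t0) / 2)) \<partial>halfline)"
    proof (rule has_bochner_diff_le[OF L[OF pb] h])
      show "(\<lambda>t. ennreal (p t * (norm (D t0) / 2))) \<in> borel_measurable halfline"
        by (rule measurable_restrict_space1) measurable
      fix t
      have "p t * norm (D t - D t0) \<le> p t * (norm (D t0) / 2)"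
      proof (cases "p t = 0")
        case False
        then have "norm (D (t0 + (t - t0)) - D t0) < norm (D t0) / 2"
          unfolding dist_norm[symmetric] using psupp[of t] by (intro d(2)) auto
        then show ?thesis using p0 by (intro mult_left_mono) auto
      qed simp
      then show "ennreal (norm (complex_of_real (p t) *\<^sub>C D t - complex_of_real (p t) *\<^sub>C D t0)) \<le> ennreal (p t * (norm (D t0) / 2))"
        using p0(1)[of t] by (simp flip: scaleC.diff_right add: norm_scaleC ennreal_leI)
    qed
    also have "\<dots> = ennreal (I * (norm (D t0) / 2))"
      using pint p0 by (subst nn_integral_eq_integral) (auto simp: I_def)
    finally have "I * norm (D t0) \<le> I * (norm (D t0) / 2)"
      using Ipos by (subst (asm) ennreal_le_iff) (auto simp: Lz[OF pb])
    then have "norm (D t0) \<le> norm (D t0) / 2" using Ipos by (simp only: mult_le_cancel_left_pos)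
    with n0 show False by simp
  qed
qed

lemma C0_semigroup_right_continuous:
  assumes T: "C0_semigroup T" and t: "t \<ge> 0"
  shows "((\<lambda>h. T (t + h) x) \<longlongrightarrow> T t x) (at_right 0)"
proof -
  have "((\<lambda>h. T h (T t x)) \<longlongrightarrow> T t x) (at_right 0)" using T by (simp add: C0_semigroup_def)
  moreover have "eventually (\<lambda>h. T h (T t x) = T (t + h) x) (at_right 0)"
    unfolding eventually_at_right_field
    using T t by (intro exI[of _ 1]) (auto simp: C0_semigroup_def add.commute[of t])
  ultimately show ?thesis by (rule Lim_transform_eventually)
qed

lemma semigroup_bcont:
  assumes T: "C0_semigroup T" and C: "C \<ge> 0" "\<And>t x. t \<ge> 0 \<Longrightarrow> norm (T t x) \<le> C * norm x"
  shows "(\<lambda>t. T t x) \<in> bcont"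
  by (rule bcontI[OF C0_semigroup_continuous[OF T C] C(2)])

text \<open>Needed because \<open>hille_phillips\<close> quantifies over every generated semigroup.
  The Laplace transforms of both semigroups are the same resolvent, so their difference has
  vanishing transform at \<open>m + n\<close> for all \<open>n\<close>; the weight
  \<open>exp (- m * t)\<close> turns this into vanishing against the powers of
  \<open>exp (- t)\<close>.\<close>

lemma minus_generates_unique:
  fixes T T' :: "real \<Rightarrow> 'a::cbanach \<Rightarrow> 'a"
  assumes gen: "minus_generates A T" "minus_generates A T'"
    and C: "C \<ge> 0" "\<And>t x. t \<ge> 0 \<Longrightarrow> norm (T t x) \<le> C * norm x" and t: "t \<ge> 0"
  shows "T' t x = T t x"
proof -
  have T: "C0_semigroup T" "C0_semigroup T'" using gen by (simp_all add: minus_generates_def)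
  obtain w w' where w: "\<And>\<mu>. Re \<mu> > w \<Longrightarrow> (shifted \<mu> A)\<inverse> = {(x, y). has_bochner halfline (\<lambda>t. exp (- \<mu> * complex_of_real t) *\<^sub>C T t x) y}"
    and w': "\<And>\<mu>. Re \<mu> > w' \<Longrightarrow> (shifted \<mu> A)\<inverse> = {(x, y). has_bochner halfline (\<lambda>t. exp (- \<mu> * complex_of_real t) *\<^sub>C T' t x) y}"
    using gen unfolding minus_generates_def by blast
  define m where "m = max 1 (max (w + 1) (w' + 1))"
  have m: "m > 0" "m > w" "m > w'" by (auto simp: m_def)
  define D where "D t = exp (- m * t) *\<^sub>R (T' t x - T t x)" for t
  have rc: "((\<lambda>h. D (t + h)) \<longlongrightarrow> D t) (at_right 0)" if "t \<ge> 0" for t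
    unfolding D_def
  proof (intro tendsto_intros C0_semigroup_right_continuous T that)
    show "((\<lambda>h. t + h) \<longlongrightarrow> t) (at_right 0)"
      using tendsto_add[OF tendsto_const tendsto_ident_at, of t 0 "{0<..}"] by simp
  qed
  have ex: "\<exists>y. has_bochner halfline (\<lambda>t. exp (- (m + real n) * t) *\<^sub>R T t x) y
      \<and> has_bochner halfline (\<lambda>t. exp (- (m + real n) * t) *\<^sub>R T' t x) y" for n
  proof -
    define \<mu> where "\<mu> = complex_of_real (m + real n)"
    have e: "exp (- \<mu> * complex_of_real t) *\<^sub>C v = exp (- (m + real n) * t) *\<^sub>R v" for t and v :: 'a
    proof -
      have "exp (- \<mu> * complex_of_real t) = complex_of_real (exp (- (m + real n) * t))"
        by (simp add: \<mu>_def exp_of_real[symmetric])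
      then show ?thesis by (simp only: scaleC_of_real)
    qed
    have mu: "Re \<mu> > w" "Re \<mu> > w'" "Re \<mu> > 0" using m by (auto simp: \<mu>_def)
    obtain y where y: "has_bochner halfline (\<lambda>t. exp (- \<mu> * complex_of_real t) *\<^sub>C T t x) y"
      using has_bochner_cm_integral(1)[OF sets_halfline halfline_exp(1)[OF mu(3)] semigroup_bcont[OF T(1) C]] by blast
    \<comment> \<open>No growth bound for \<open>T'\<close> is at hand. That its Laplace integral
      exists is read off from the equality of graphs.\<close>
    then have "(x, y) \<in> (shifted \<mu> A)\<inverse>" unfolding w[OF mu(1)] by simp
    then have "has_bochner halfline (\<lambda>t. exp (- \<mu> * complex_of_real t) *\<^sub>C T' t x) y"
      unfolding w'[OF mu(2)] by simp
    with y show ?thesis unfolding e by blast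
  qed
  have sT: "strongly_measurable halfline (\<lambda>t. exp (- (m + real n) * t) *\<^sub>R U t x)" if "C0_semigroup U" for n and U :: "real \<Rightarrow> 'a \<Rightarrow> 'a"
  proof (rule strongly_measurable_right_continuous[OF sets_halfline])
    fix t :: real assume "t \<ge> 0"
    then show "((\<lambda>h. exp (- (m + real n) * (t + h)) *\<^sub>R U (t + h) x) \<longlongrightarrow> exp (- (m + real n) * t) *\<^sub>R U t x) (at_right 0)"
    proof (intro tendsto_intros C0_semigroup_right_continuous that)
      show "((\<lambda>h. t + h) \<longlongrightarrow> t) (at_right 0)"
        using tendsto_add[OF tendsto_const tendsto_ident_at, of t 0 "{0<..}"] by simp
    qed
  qed
  have sD: "strongly_measurable halfline D"
    by (rule strongly_measurable_right_continuous[OF sets_halfline rc])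
  have fin: "(\<integral>\<^sup>+t. ennreal (norm (exp (- t) ^ n *\<^sub>R D t)) \<partial>halfline) < \<infinity>" for n
  proof -
    obtain y where y: "has_bochner halfline (\<lambda>t. exp (- (m + real n) * t) *\<^sub>R T t x) y"
      "has_bochner halfline (\<lambda>t. exp (- (m + real n) * t) *\<^sub>R T' t x) y" using ex by blast
    have [measurable]: "(\<lambda>t. norm (exp (- (m + real n) * t) *\<^sub>R U t x)) \<in> borel_measurable halfline"
      if "C0_semigroup U" for U :: "real \<Rightarrow> 'a \<Rightarrow> 'a"
      by (rule strongly_measurable_norm[OF sT[OF that]])
    note mm = this[OF T(1)] this[OF T(2)]
    have "(\<integral>\<^sup>+t. ennreal (norm (exp (- t) ^ n *\<^sub>R D t)) \<partial>halfline)
      \<le> (\<integral>\<^sup>+t. ennreal (norm (exp (- (m + real n) * t) *\<^sub>R T' t x)) + ennreal (norm (exp (- (m + real n) * t) *\<^sub>R T t x)) \<partial>halfline)"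
    proof (rule nn_integral_mono)
      fix t
      have "exp (- t) ^ n *\<^sub>R D t = exp (- (m + real n) * t) *\<^sub>R T' t x - exp (- (m + real n) * t) *\<^sub>R T t x"
        by (simp add: D_def exp_of_nat_mult[symmetric] scaleR_diff_right exp_add[symmetric] algebra_simps)
      then have "norm (exp (- t) ^ n *\<^sub>R D t) \<le> norm (exp (- (m + real n) * t) *\<^sub>R T' t x) + norm (exp (- (m + real n) * t) *\<^sub>R T t x)"
        by (simp only: norm_triangle_ineq4)
      then show "ennreal (norm (exp (- t) ^ n *\<^sub>R D t)) \<le> ennreal (norm (exp (- (m + real n) * t) *\<^sub>R T' t x)) + ennreal (norm (exp (- (m + real n) * t) *\<^sub>R T t x))"
        by (simp only: ennreal_leI ennreal_plus[symmetric] norm_ge_zero)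
    qed
    also have "\<dots> = (\<integral>\<^sup>+t. ennreal (norm (exp (- (m + real n) * t) *\<^sub>R T' t x)) \<partial>halfline)
        + (\<integral>\<^sup>+t. ennreal (norm (exp (- (m + real n) * t) *\<^sub>R T t x)) \<partial>halfline)"
      by (rule nn_integral_add) (rule measurable_compose[OF mm(2) measurable_ennreal], rule measurable_compose[OF mm(1) measurable_ennreal])
    also have "\<dots> < \<infinity>" using has_bochner_finite[OF y(1)] has_bochner_finite[OF y(2)] by simp
    finally show ?thesis .
  qed
  have "D t = 0"
  proof (rule laplace_zero_imp_zero[OF rc _ _ t])
    show "(\<integral>\<^sup>+t. ennreal (norm (D t)) \<partial>halfline) < \<infinity>" using fin[of 0] by simp
    fix n :: nat
    have e: "exp (- t) ^ n *\<^sub>R D t = complex_of_real (exp (- t) ^ n) *\<^sub>C D t" for t by (simp only: scaleC_of_real)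
    have sm: "strongly_measurable halfline (\<lambda>t. exp (- t) ^ n *\<^sub>R D t)"
      unfolding e by (intro strongly_measurable_scaleC sD measurable_restrict_space1) measurable
    obtain z where z: "has_bochner halfline (\<lambda>t. exp (- t) ^ n *\<^sub>R D t) z"
      using has_bochner_exists[OF sm fin] by blast
    obtain y where y: "has_bochner halfline (\<lambda>t. exp (- (m + real n) * t) *\<^sub>R T t x) y"
      "has_bochner halfline (\<lambda>t. exp (- (m + real n) * t) *\<^sub>R T' t x) y" using ex by blast
    have "has_bochner halfline (\<lambda>t. exp (- t) ^ n *\<^sub>R D t + exp (- (m + real n) * t) *\<^sub>R T t x) (z + y)"
      by (intro has_bochner_add z sm y sT T)
    moreover have "exp (- t) ^ n *\<^sub>R D t + exp (- (m + real n) * t) *\<^sub>R T t x = exp (- (m + real n) * t) *\<^sub>R T' t x" for t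
      by (simp add: D_def exp_of_nat_mult[symmetric] scaleR_diff_right exp_add[symmetric] algebra_simps)
    ultimately have "z + y = y" using y(2) has_bochner_unique by fastforce
    with z show "has_bochner halfline (\<lambda>t. exp (- t) ^ n *\<^sub>R D t) 0" by simp
  qed
  then show ?thesis by (simp add: D_def)
qed

subsection \<open>Bounded holomorphic functions on half-planes\<close>

lemma H_infinity_le_norm:
  assumes "f \<in> H_infinity \<Omega>" "z \<in> \<Omega>"
  shows "cmod (f z) \<le> H_infinity_norm \<Omega> f"
proof -
  obtain B where B: "\<And>z. z \<in> \<Omega> \<Longrightarrow> cmod (f z) \<le> B"
    using assms(1) by (auto simp: H_infinity_def bounded_iff)
  have "bdd_above ((\<lambda>z. cmod (f z)) ` \<Omega>)"
    by (rule bdd_aboveI[of _ B]) (use B in auto)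
  then show ?thesis unfolding H_infinity_norm_def using assms(2) by (intro cSUP_upper) auto
qed

lemma H_infinity_norm_nonneg:
  assumes "f \<in> H_infinity (right_half_plane \<omega>)"
  shows "0 \<le> H_infinity_norm (right_half_plane \<omega>) f"
proof -
  have "of_real (\<omega> + 1) \<in> right_half_plane \<omega>" by (simp add: right_half_plane_def)
  from H_infinity_le_norm[OF assms this] show ?thesis using norm_ge_zero order_trans by blast
qed

lemma open_right_half_plane: "open (right_half_plane \<omega>)"
  by (simp add: right_half_plane_def open_halfspace_Re_gt)

lemma right_half_plane_Cauchy:
  assumes f: "f \<in> H_infinity (right_half_plane \<omega>)" and r: "r > 0" and z: "Re z > \<omega> + r"
  shows "cmod ((deriv ^^ n) f z) \<le> fact n * H_infinity_norm (right_half_plane \<omega>) f / r ^ n"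
proof -
  have sub: "w \<in> right_half_plane \<omega>" if "cmod (z - w) \<le> r" for w
    using that z abs_Re_le_cmod[of "z - w"] by (auto simp: right_half_plane_def)
  have holo: "f holomorphic_on right_half_plane \<omega>" using f by (simp add: H_infinity_def)
  have ball: "ball z r \<subseteq> right_half_plane \<omega>" "cball z r \<subseteq> right_half_plane \<omega>"
    using sub by (auto simp: dist_norm)
  show ?thesis
  proof (rule Cauchy_inequality[OF holomorphic_on_subset[OF holo ball(1)] _ r])
    show "continuous_on (cball z r) f"
      by (rule continuous_on_subset[OF holomorphic_on_imp_continuous_on[OF holo] ball(2)])
  qed (use sub f H_infinity_le_norm in auto)
qed

text \<open>Discs of radius \<open>\<bar>\<omega>\<bar> / 2\<close> around points of the smaller
  half-plane stay in the larger one; this radius is the source of the factor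
  \<open>2 ^ n\<close>.\<close>

lemma H_infinity_deriv:
  assumes f: "f \<in> H_infinity (right_half_plane \<omega>)" and \<omega>: "\<omega> < 0"
  shows "(deriv ^^ n) f \<in> H_infinity (right_half_plane (\<omega> / 2))"
    and "H_infinity_norm (right_half_plane (\<omega> / 2)) ((deriv ^^ n) f)
      \<le> fact n * 2 ^ n * H_infinity_norm (right_half_plane \<omega>) f / \<bar>\<omega>\<bar> ^ n"
proof -
  let ?B = "fact n * H_infinity_norm (right_half_plane \<omega>) f / (- \<omega> / 2) ^ n"
  have B: "cmod ((deriv ^^ n) f z) \<le> ?B" if "z \<in> right_half_plane (\<omega> / 2)" for z
    using that \<omega> by (intro right_half_plane_Cauchy[OF f]) (auto simp: right_half_plane_def)
  have holo: "f holomorphic_on right_half_plane \<omega>" using f by (simp add: H_infinity_def)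
  have "(deriv ^^ n) f holomorphic_on right_half_plane \<omega>"
    by (rule holomorphic_higher_deriv[OF holo open_right_half_plane])
  moreover have "right_half_plane (\<omega> / 2) \<subseteq> right_half_plane \<omega>" using \<omega> by (auto simp: right_half_plane_def)
  ultimately have "(deriv ^^ n) f holomorphic_on right_half_plane (\<omega> / 2)" by (rule holomorphic_on_subset)
  then show "(deriv ^^ n) f \<in> H_infinity (right_half_plane (\<omega> / 2))"
    using B by (auto simp: H_infinity_def bounded_iff)
  have eq: "fact n * 2 ^ n * H_infinity_norm (right_half_plane \<omega>) f / \<bar>\<omega>\<bar> ^ n = ?B"
  proof -
    have e: "- \<omega> / 2 = \<bar>\<omega>\<bar> / 2" using \<omega> by simp
    show ?thesis unfolding e power_divide by simp
  qed
  show "H_infinity_norm (right_half_plane (\<omega> / 2)) ((deriv ^^ n) f)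
      \<le> fact n * 2 ^ n * H_infinity_norm (right_half_plane \<omega>) f / \<bar>\<omega>\<bar> ^ n"
    unfolding eq unfolding H_infinity_norm_def[of "right_half_plane (\<omega> / 2)"]
  proof (rule cSUP_least)
    have "of_real (\<omega> / 2 + 1) \<in> right_half_plane (\<omega> / 2)" by (simp add: right_half_plane_def)
    then show "right_half_plane (\<omega> / 2) \<noteq> {}" by blast
  qed (rule B)
qed

subsection \<open>Discretized symbols\<close>

text \<open>After the substitution \<open>u = exp (- \<tau> z)\<close> the discretized function is
  the series with these coefficients, and the powers of \<open>u\<close> become the operators
  \<open>T (k \<tau>)\<close>.\<close>

definition coef :: "(complex \<Rightarrow> complex) \<Rightarrow> real \<Rightarrow> nat \<Rightarrow> complex" where
  "coef f \<tau> k = (deriv ^^ k) (\<lambda>u. f ((1 - u) / of_real \<tau>)) 0 / fact k"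

text \<open>By the chain rule this is the derivative in \<open>z\<close> of the discretized function
  \<open>f ((1 - exp (- \<tau> z)) / \<tau>)\<close>.\<close>

definition dsym :: "(complex \<Rightarrow> complex) \<Rightarrow> real \<Rightarrow> complex \<Rightarrow> complex" where
  "dsym f \<tau> z = deriv f ((1 - exp (- of_real \<tau> * z)) / of_real \<tau>) * exp (- of_real \<tau> * z)"

text \<open>Replacing \<open>z\<close> by \<open>(1 - e\<^sup>-\<^sup>\<tau>\<^sup>z) / \<tau>\<close> turns \<open>f\<close> into a power series in \<open>e\<^sup>-\<^sup>\<tau>\<^sup>z\<close> without
  increasing its supremum.\<close>

locale discretized =
  fixes f :: "complex \<Rightarrow> complex" and \<omega> \<tau> :: real
  assumes f: "f \<in> H_infinity (right_half_plane \<omega>)" and \<omega>: "\<omega> < 0" and \<tau>: "\<tau> > 0"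
begin

text \<open>The map \<open>u \<mapsto> (1 - u) / \<tau>\<close> sends the disc of this radius around
  0 into the half-plane, and the point \<rho> itself to the boundary point \<omega>. The excess of
  the radius over 1 is the room for the weights in the transference.\<close>

abbreviation "\<rho> \<equiv> 1 - \<tau> * \<omega>"

lemma rho: "\<rho> > 1" using \<omega> \<tau> by (simp add: mult_pos_neg)

lemma arg_mem: "cmod u < \<rho> \<Longrightarrow> (1 - u) / of_real \<tau> \<in> right_half_plane \<omega>"
  using complex_Re_le_cmod[of u] \<tau> by (simp add: right_half_plane_def pos_less_divide_eq mult.commute)

lemma f_holo: "f holomorphic_on right_half_plane \<omega>" using f by (simp add: H_infinity_def)

lemma comp_holo: "(\<lambda>u. f ((1 - u) / of_real \<tau>)) holomorphic_on ball 0 \<rho>"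
proof -
  have "f \<circ> (\<lambda>u. (1 - u) / of_real \<tau>) holomorphic_on ball 0 \<rho>"
    by (rule holomorphic_on_compose_gen[OF _ f_holo])
       (use \<tau> arg_mem in \<open>auto intro!: holomorphic_intros\<close>)
  then show ?thesis by (simp add: o_def)
qed

lemma coef_sums: "cmod u < \<rho> \<Longrightarrow> (\<lambda>k. coef f \<tau> k * u ^ k) sums f ((1 - u) / of_real \<tau>)"
  using holomorphic_power_series[OF comp_holo, of u] by (simp add: coef_def)

lemma coef_summable: "cmod u < \<rho> \<Longrightarrow> summable (\<lambda>k. coef f \<tau> k * u ^ k)"
  using coef_sums sums_summable by blast

lemma mid_rho: "r < \<rho> \<Longrightarrow> 0 \<le> r \<Longrightarrow> \<exists>x::complex. r < cmod x \<and> cmod x < \<rho>"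
proof -
  assume "r < \<rho>" "0 \<le> r"
  then obtain y where "r < y" "y < \<rho>" "0 \<le> y" using dense[of r \<rho>] by auto
  then show ?thesis by (intro exI[of _ "of_real y"]) simp
qed

lemma coef_abs_summable:
  assumes "0 \<le> r" "r < \<rho>"
  shows "summable (\<lambda>k. cmod (coef f \<tau> k) * r ^ k)"
proof -
  obtain x :: complex where x: "r < cmod x" "cmod x < \<rho>" using mid_rho assms by blast
  have "summable (\<lambda>k. norm (coef f \<tau> k * of_real r ^ k))"
    by (rule powser_insidea[OF coef_summable[OF x(2)]]) (use assms x in simp)
  then show ?thesis using assms by (simp add: norm_mult norm_power)
qed

text \<open>Two expressions for \<open>u\<close> times the derivative in \<open>u\<close> are
  equated: termwise differentiation of the series, and the chain rule, whose inner derivative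
  \<open>-1 / \<tau>\<close> gives the sign and the factor.\<close>

lemma diffs_sums:
  assumes u: "cmod u < \<rho>"
  shows "(\<lambda>k. of_nat k * coef f \<tau> k * u ^ k) sums (- u / of_real \<tau> * deriv f ((1 - u) / of_real \<tau>))"
proof -
  have sd: "summable (\<lambda>k. diffs (coef f \<tau>) k * u ^ k)"
    by (rule termdiff_converges[OF u coef_summable])
  have D1: "((\<lambda>u. \<Sum>k. coef f \<tau> k * u ^ k) has_field_derivative (\<Sum>k. diffs (coef f \<tau>) k * u ^ k)) (at u)"
    by (rule termdiffs_strong'[OF coef_summable u])
  have "(f has_field_derivative deriv f ((1 - u) / of_real \<tau>)) (at ((1 - u) / of_real \<tau>))"
    by (rule holomorphic_derivI[OF f_holo open_right_half_plane arg_mem[OF u]])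
  moreover have "((\<lambda>u. (1 - u) / of_real \<tau>) has_field_derivative (- 1 / of_real \<tau>)) (at u)"
    using \<tau> by (auto intro!: derivative_eq_intros)
  ultimately have D2: "((\<lambda>u. f ((1 - u) / of_real \<tau>)) has_field_derivative (deriv f ((1 - u) / of_real \<tau>) * (- 1 / of_real \<tau>))) (at u)"
    by (rule DERIV_chain2)
  have "((\<lambda>u. \<Sum>k. coef f \<tau> k * u ^ k) has_field_derivative (deriv f ((1 - u) / of_real \<tau>) * (- 1 / of_real \<tau>))) (at u)"
  proof (rule has_field_derivative_transform_within_open[OF D2, of "ball 0 \<rho>"])
    show "f ((1 - v) / of_real \<tau>) = (\<Sum>k. coef f \<tau> k * v ^ k)" if "v \<in> ball 0 \<rho>" for v
      using coef_sums[of v] that by (simp add: sums_iff)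
  qed (use u in auto)
  with D1 have "(\<Sum>k. diffs (coef f \<tau>) k * u ^ k) = deriv f ((1 - u) / of_real \<tau>) * (- 1 / of_real \<tau>)"
    by (rule DERIV_unique)
  with sd have "(\<lambda>k. diffs (coef f \<tau>) k * u ^ k) sums (deriv f ((1 - u) / of_real \<tau>) * (- 1 / of_real \<tau>))"
    by (simp add: sums_iff)
  then have "(\<lambda>k. u * (diffs (coef f \<tau>) k * u ^ k)) sums (u * (deriv f ((1 - u) / of_real \<tau>) * (- 1 / of_real \<tau>)))"
    by (rule sums_mult)
  then have "(\<lambda>k. of_nat (Suc k) * coef f \<tau> (Suc k) * u ^ Suc k) sums (- u / of_real \<tau> * deriv f ((1 - u) / of_real \<tau>))"
    by (simp add: diffs_def mult_ac)
  then show ?thesis by (subst (asm) sums_Suc_iff) simp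
qed

lemma diffs_abs_summable: "summable (\<lambda>k. cmod (of_nat k * coef f \<tau> k))"
proof -
  obtain x :: complex where x: "1 < cmod x" "cmod x < \<rho>" using mid_rho[OF rho] by auto
  have "summable (\<lambda>k. norm (of_nat k * coef f \<tau> k * 1 ^ k))"
    by (rule powser_insidea[OF sums_summable[OF diffs_sums[OF x(2)]]]) (use x in simp)
  then show ?thesis by simp
qed

lemma sym_sums:
  assumes "Re z \<ge> 0"
  shows "(\<lambda>k. - (of_nat k * of_real \<tau> * coef f \<tau> k) * exp (- of_real \<tau> * z) ^ k) sums dsym f \<tau> z"
proof -
  have "cmod (exp (- of_real \<tau> * z)) \<le> 1" using assms \<tau> by (simp add: norm_exp_eq_Re)
  then have "cmod (exp (- of_real \<tau> * z)) < \<rho>" using rho by linarith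
  from sums_mult[OF diffs_sums[OF this], of "- of_real \<tau>"] show ?thesis
    using \<tau> by (simp add: dsym_def mult_ac)
qed

end

text \<open>The elementary inequality \<open>e\<^sup>x \<le> 1 + x + x\<^sup>2\<close> keeps the argument of the symbol inside the
  domain of \<open>f\<close>, with a uniform distance to its boundary.\<close>

locale discretized_small = discretized +
  assumes small: "\<tau> * \<bar>\<omega>\<bar> \<le> 1"
begin

lemma exp_half: "exp (- \<tau> * \<omega> / 2) \<le> 1 - (3/4) * \<tau> * \<omega>" "exp (- \<tau> * \<omega> / 2) \<le> 2"
proof -
  \<comment> \<open>Since \<open>0 \<le> x \<le> 1/2\<close>, the quadratic term is at most
    \<open>x / 2\<close>; the resulting slope \<open>3/2\<close> in \<open>x\<close> is the slope
    \<open>3/4\<close> in \<open>\<tau> * \<bar>\<omega>\<bar>\<close>.\<close>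
  define x where "x = - \<tau> * \<omega> / 2"
  have x: "0 \<le> x" "x \<le> 1/2" using small \<tau> \<omega> by (simp_all add: x_def mult_nonneg_nonpos)
  have "exp x \<le> 1 + x + x\<^sup>2" using x by (intro exp_bound) auto
  also have "x\<^sup>2 \<le> x * (1/2)" unfolding power2_eq_square using x by (intro mult_left_mono) auto
  finally have "exp x \<le> 1 + (3/2) * x" by simp
  then show "exp (- \<tau> * \<omega> / 2) \<le> 1 - (3/4) * \<tau> * \<omega>" by (simp add: x_def)
  from \<open>exp x \<le> 1 + (3/2) * x\<close> show "exp (- \<tau> * \<omega> / 2) \<le> 2" using x by (simp add: x_def)
qed

lemma exp_le: "Re z \<ge> \<omega> / 2 \<Longrightarrow> cmod (exp (- of_real \<tau> * z)) \<le> exp (- \<tau> * \<omega> / 2)"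
  using \<tau> mult_left_mono[of "\<omega> / 2" "Re z" \<tau>] by (simp add: norm_exp_eq_Re)

lemma arg_far:
  assumes "Re z \<ge> \<omega> / 2"
  shows "Re ((1 - exp (- of_real \<tau> * z)) / of_real \<tau>) \<ge> (3/4) * \<omega>"
proof -
  have "Re (exp (- of_real \<tau> * z)) \<le> 1 - (3/4) * \<tau> * \<omega>"
    using complex_Re_le_cmod[of "exp (- of_real \<tau> * z)"] exp_le[OF assms] exp_half(1) by linarith
  then have "(3/4) * \<omega> * \<tau> \<le> 1 - Re (exp (- of_real \<tau> * z))" by (simp add: mult_ac)
  then show ?thesis using \<tau> by (simp add: pos_le_divide_eq)
qed

lemma sym_bound:
  assumes "Re z \<ge> \<omega> / 2"
  shows "cmod (dsym f \<tau> z) \<le> 16 * H_infinity_norm (right_half_plane \<omega>) f / \<bar>\<omega>\<bar>"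
proof -
  let ?N = "H_infinity_norm (right_half_plane \<omega>) f"
  \<comment> \<open>The argument keeps a distance of at least
    \<open>\<bar>\<omega>\<bar> / 4\<close> from the boundary, so discs of half that radius fit. The
    factor 8 from here and 2 from the exponential make up 16.\<close>
  have "\<omega> + (- \<omega> / 8) < Re ((1 - exp (- of_real \<tau> * z)) / of_real \<tau>)"
    using arg_far[OF assms] \<omega> by linarith
  then have "cmod ((deriv ^^ 1) f ((1 - exp (- of_real \<tau> * z)) / of_real \<tau>)) \<le> fact 1 * ?N / (- \<omega> / 8) ^ 1"
    using \<omega> by (intro right_half_plane_Cauchy[OF f]) auto
  then have "cmod (deriv f ((1 - exp (- of_real \<tau> * z)) / of_real \<tau>)) \<le> 8 * ?N / \<bar>\<omega>\<bar>"
    using \<omega> by (simp add: field_simps)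
  moreover have "cmod (exp (- of_real \<tau> * z)) \<le> 2" using exp_le[OF assms] exp_half(2) by linarith
  ultimately have "cmod (dsym f \<tau> z) \<le> 8 * ?N / \<bar>\<omega>\<bar> * 2"
    unfolding dsym_def norm_mult using H_infinity_norm_nonneg[OF f] by (intro mult_mono) auto
  then show ?thesis by simp
qed

lemma sym_holo: "dsym f \<tau> holomorphic_on {z. Re z > \<omega> / 2}"
proof -
  have d: "deriv f holomorphic_on right_half_plane \<omega>"
    by (rule holomorphic_deriv[OF f_holo open_right_half_plane])
  have "deriv f \<circ> (\<lambda>z. (1 - exp (- of_real \<tau> * z)) / of_real \<tau>) holomorphic_on {z. Re z > \<omega> / 2}"
  proof (rule holomorphic_on_compose_gen[OF _ d])
    show "(\<lambda>z. (1 - exp (- of_real \<tau> * z)) / of_real \<tau>) holomorphic_on {z. Re z > \<omega> / 2}"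
      using \<tau> by (auto intro!: holomorphic_intros)
    show "(\<lambda>z. (1 - exp (- of_real \<tau> * z)) / of_real \<tau>) ` {z. Re z > \<omega> / 2} \<subseteq> right_half_plane \<omega>"
    proof (rule image_subsetI)
      fix z assume "z \<in> {z. Re z > \<omega> / 2}"
      then have "(3/4) * \<omega> \<le> Re ((1 - exp (- of_real \<tau> * z)) / of_real \<tau>)" by (intro arg_far) simp
      then have "\<omega> < Re ((1 - exp (- of_real \<tau> * z)) / of_real \<tau>)" using \<omega> by linarith
      then show "(1 - exp (- of_real \<tau> * z)) / of_real \<tau> \<in> right_half_plane \<omega>"
        unfolding right_half_plane_def by simp
    qed
  qed
  then show ?thesis unfolding dsym_def[abs_def] o_def by (intro holomorphic_intros)
qed

text \<open>Division by \<open>(z + lam)\<^sup>2\<close> buys the quadratic decay and corresponds to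
  applying \<open>(lam + A)\<^sup>-\<^sup>2\<close> first. The constant does not depend on \<tau>,
  as the passage to the limit requires.\<close>

lemma sym_decaying:
  assumes lam: "lam > \<bar>\<omega>\<bar>"
  shows "decaying_symbol (\<lambda>z. dsym f \<tau> z / (z + of_real lam)\<^sup>2) (\<omega> / 2) (\<omega> / 4) lam (16 * H_infinity_norm (right_half_plane \<omega>) f / \<bar>\<omega>\<bar>)"
proof
  have "z + of_real lam \<noteq> 0" if "Re z > \<omega> / 2" for z
  proof
    assume "z + of_real lam = 0"
    then have "Re z + lam = 0" by (simp add: complex_eq_iff)
    with that lam \<omega> show False by linarith
  qed
  then show "(\<lambda>z. dsym f \<tau> z / (z + of_real lam)\<^sup>2) holomorphic_on {z. Re z > \<omega> / 2}"
    by (intro holomorphic_intros sym_holo) auto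
  show "0 \<le> 16 * H_infinity_norm (right_half_plane \<omega>) f / \<bar>\<omega>\<bar>" using H_infinity_norm_nonneg[OF f] by simp
  show "cmod (dsym f \<tau> z / (z + of_real lam)\<^sup>2) \<le> 16 * H_infinity_norm (right_half_plane \<omega>) f / \<bar>\<omega>\<bar> / (cmod (z + of_real lam))\<^sup>2"
    if "Re z \<ge> \<omega> / 4" for z
    unfolding norm_divide norm_power using that \<omega> by (intro divide_right_mono sym_bound) auto
qed (use \<omega> lam in auto)

end

text \<open>The inner argument is the difference quotient at 0 of \<open>1 - exp (- t * z)\<close>,
  whose derivative there is \<open>z\<close>; the exponential factor tends to 1.\<close>

lemma sym_tendsto:
  assumes f: "f \<in> H_infinity (right_half_plane \<omega>)" and z: "Re z > \<omega>"
    and \<tau>: "\<And>n::nat. \<tau> n > 0" "\<tau> \<longlonglongrightarrow> 0"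
  shows "(\<lambda>n. dsym f (\<tau> n) z) \<longlonglongrightarrow> deriv f z"
proof -
  have \<tau>': "filterlim \<tau> (at 0) sequentially"
    unfolding filterlim_at using \<tau> by (auto intro!: always_eventually simp: less_imp_neq[symmetric])
  have "((\<lambda>t::complex. (1 - exp (- t * z)) / t) \<longlongrightarrow> z) (at 0)"
  proof -
    have "((\<lambda>t. 1 - exp (- t * z)) has_field_derivative z) (at 0)"
      by (auto intro!: derivative_eq_intros)
    then show ?thesis by (simp add: has_field_derivative_iff)
  qed
  moreover have "filterlim (\<lambda>n. complex_of_real (\<tau> n)) (at 0) sequentially"
    unfolding filterlim_at using \<tau> by (auto intro!: always_eventually tendsto_of_real_iff[THEN iffD2, of _ 0, simplified] simp: less_imp_neq[symmetric])
  ultimately have arg: "(\<lambda>n. (1 - exp (- of_real (\<tau> n) * z)) / of_real (\<tau> n)) \<longlonglongrightarrow> z"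
    by (rule filterlim_compose)
  have holo: "f holomorphic_on right_half_plane \<omega>" using f by (simp add: H_infinity_def)
  have "z \<in> right_half_plane \<omega>" using z by (simp add: right_half_plane_def)
  then have "isCont (deriv f) z"
    using holomorphic_on_imp_continuous_on[OF holomorphic_deriv[OF holo open_right_half_plane]]
    by (simp only: continuous_on_eq_continuous_at[OF open_right_half_plane])
  from isCont_tendsto_compose[OF this arg]
  have "(\<lambda>n. deriv f ((1 - exp (- of_real (\<tau> n) * z)) / of_real (\<tau> n))) \<longlonglongrightarrow> deriv f z" .
  moreover have "(\<lambda>n. exp (- of_real (\<tau> n) * z)) \<longlonglongrightarrow> exp (- of_real 0 * z)"
    by (intro tendsto_intros \<tau>)
  ultimately have "(\<lambda>n. deriv f ((1 - exp (- of_real (\<tau> n) * z)) / of_real (\<tau> n)) * exp (- of_real (\<tau> n) * z)) \<longlonglongrightarrow> deriv f z * exp (- of_real 0 * z)"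
    by (rule tendsto_mult)
  moreover have "dsym f (\<tau> n) z = deriv f ((1 - exp (- of_real (\<tau> n) * z)) / of_real (\<tau> n)) * exp (- of_real (\<tau> n) * z)" for n
    by (rule dsym_def)
  ultimately show ?thesis by simp
qed

subsection \<open>Functionals with a symbol\<close>

text \<open>For integrals against a measure the symbol is the Laplace transform. Recording it at the
  positive integers suffices to determine the functional on bounded continuous functions.\<close>

definition multiplier :: "((real \<Rightarrow> 'a::cbanach) \<Rightarrow> 'a) \<Rightarrow> (complex \<Rightarrow> complex) \<Rightarrow> bool" where
  "multiplier L l \<longleftrightarrow> bc_functional L \<and> (\<forall>n\<ge>1. \<forall>v. L (\<lambda>t. exp (- t) ^ n *\<^sub>R v) = l (of_nat n) *\<^sub>C v)"

lemma multiplier_unique: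
  assumes "multiplier L l" "multiplier K k" "\<And>n. n \<ge> 1 \<Longrightarrow> l (of_nat n) = k (of_nat n)" "\<phi> \<in> bcont"
  shows "L \<phi> = K \<phi>"
proof (rule bc_functional_eqI[OF _ _ _ assms(4)])
  show "bc_functional L" "bc_functional K" using assms(1,2) by (simp_all add: multiplier_def)
  show "L (\<lambda>t. exp (- t) ^ n *\<^sub>R v) = K (\<lambda>t. exp (- t) ^ n *\<^sub>R v)" if "n \<ge> 1" for n v
    using assms(1,2) assms(3)[OF that] that by (simp add: multiplier_def)
qed

text \<open>The exponentials are characters of the half-line, so a shift by \<open>s\<close> only
  contributes a scalar factor and convolution multiplies symbols.\<close>

lemma multiplier_compose:
  fixes L K :: "(real \<Rightarrow> 'a::cbanach) \<Rightarrow> 'a"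
  assumes L: "multiplier L l" and K: "multiplier K k"
  shows "multiplier (\<lambda>\<phi>. L (\<lambda>s. K (\<lambda>t. \<phi> (s + t)))) (\<lambda>z. l z * k z)"
  unfolding multiplier_def
proof (intro conjI allI impI)
  show "bc_functional (\<lambda>\<phi>. L (\<lambda>s. K (\<lambda>t. \<phi> (s + t))))"
    using L K by (intro bc_functional_compose) (auto simp: multiplier_def)
  fix n :: nat and v :: 'a assume n: "1 \<le> n"
  have "(\<lambda>t. exp (- (s + t)) ^ n *\<^sub>R v) = (\<lambda>t. exp (- t) ^ n *\<^sub>R (exp (- s) ^ n *\<^sub>R v))" for s
    by (rule ext) (simp only: minus_add_distrib exp_add power_mult_distrib scaleR_scaleR mult.commute)
  then have "K (\<lambda>t. exp (- (s + t)) ^ n *\<^sub>R v) = exp (- s) ^ n *\<^sub>R (k (of_nat n) *\<^sub>C v)" for s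
    using K n by (simp add: multiplier_def scaleC.scaleR_right del: scaleR_scaleR)
  then show "L (\<lambda>s. K (\<lambda>t. exp (- (s + t)) ^ n *\<^sub>R v)) = (l (of_nat n) * k (of_nat n)) *\<^sub>C v"
    using L n by (simp add: multiplier_def scaleC_scaleC)
qed

lemma exp_bcont: "(\<lambda>t. complex_of_real (exp (- t) ^ n)) \<in> bcont"
  by (rule bcontI[of _ 1]) (auto simp: norm_power intro!: continuous_intros power_le_one)

lemma multiplier_density:
  assumes \<nu>: "sets \<nu> = sets borel_halfline" and h: "integrable \<nu> h"
    and l: "\<And>n. n \<ge> 1 \<Longrightarrow> (\<integral>t. h t * complex_of_real (exp (- t) ^ n) \<partial>\<nu>) = l (of_nat n)"
  shows "multiplier (cm_integral (density_cm \<nu> h) :: (real \<Rightarrow> 'a::cbanach) \<Rightarrow> 'a) l"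
  unfolding multiplier_def
proof (intro conjI allI impI bc_functional_cm_integral \<nu> h)
  fix n :: nat and v :: 'a assume "1 \<le> n"
  then show "cm_integral (density_cm \<nu> h) (\<lambda>t. exp (- t) ^ n *\<^sub>R v) = l (of_nat n) *\<^sub>C v"
    using cm_integral_scaleC[OF \<nu> h exp_bcont, of n v] l by (simp only: scaleC_of_real)
qed

lemma multiplier_laplace:
  assumes "is_laplace_transform \<mu> e"
  obtains \<nu> h where "represents \<nu> h \<mu>" "multiplier (cm_integral \<mu> :: (real \<Rightarrow> 'a::cbanach) \<Rightarrow> 'a) e"
proof -
  have has: "has_cm_integral \<mu> (\<lambda>s. exp (- z * complex_of_real s)) (e z)" if "z \<in> right_half_plane 0" for z
    using assms that by (simp add: is_laplace_transform_def)
  have "1 \<in> right_half_plane 0" by (simp add: right_half_plane_def)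
  from has[OF this] obtain \<nu> h where r: "represents \<nu> h \<mu>" by (auto simp: has_cm_integral_def)
  note r' = represents_cm_integral[OF r]
  have "(\<integral>t. h t * complex_of_real (exp (- t) ^ n) \<partial>\<nu>) = e (of_nat n)" if n: "n \<ge> 1" for n
  proof -
    have "(of_nat n :: complex) \<in> right_half_plane 0" using n by (simp add: right_half_plane_def)
    from has[OF this] have "has_cm_integral \<mu> (\<lambda>s. complex_of_real (exp (- s) ^ n)) (e (of_nat n))"
      by (simp add: exp_of_nat_mult[symmetric] exp_of_real[symmetric])
    then have "e (of_nat n) = cm_integral \<mu> (\<lambda>s. complex_of_real (exp (- s) ^ n))"
      using has_cm_integral_iff[OF r exp_bcont] by blast
    also have "\<dots> = (\<integral>t. h t * complex_of_real (exp (- t) ^ n) \<partial>\<nu>)"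
      using cm_integral_scaleC[OF r'(1,2) exp_bcont, of n "1::complex"] by (simp add: r'(3) scaleC_complex_def)
    finally show ?thesis by simp
  qed
  then have "multiplier (cm_integral \<mu> :: (real \<Rightarrow> 'a) \<Rightarrow> 'a) e"
    unfolding represents_cm_integral(3)[OF r] by (intro multiplier_density r'(1,2)) 
  with r show ?thesis using that by blast
qed

lemma multiplier_series:
  assumes b: "summable (\<lambda>k. cmod (b k))" and \<tau>: "\<tau> \<ge> 0"
    and l: "\<And>n. n \<ge> 1 \<Longrightarrow> (\<lambda>k. b k * exp (- of_real \<tau> * of_nat n) ^ k) sums l (of_nat n)"
  shows "multiplier (\<lambda>\<phi>. \<Sum>k. b k *\<^sub>C (\<phi> (real k * \<tau>) :: 'a::cbanach)) l"
  unfolding multiplier_def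
proof (intro conjI allI impI bc_functional_series b \<tau>)
  fix n :: nat and v :: 'a assume n: "1 \<le> n"
  have e: "b k *\<^sub>C (exp (- (real k * \<tau>)) ^ n *\<^sub>R v) = (b k * exp (- of_real \<tau> * of_nat n) ^ k) *\<^sub>C v" for k
  proof -
    have "exp (- of_real \<tau> * of_nat n) ^ k = complex_of_real (exp (- (real k * \<tau>)) ^ n)"
      by (simp add: exp_of_nat_mult[symmetric] exp_of_real[symmetric] mult_ac)
    then show ?thesis by (simp only: scaleC_scaleC[symmetric] scaleC_of_real)
  qed
  have "(\<lambda>k. (b k * exp (- of_real \<tau> * of_nat n) ^ k) *\<^sub>C v) sums (l (of_nat n) *\<^sub>C v)"
    by (rule bounded_linear.sums[OF scaleC.bounded_linear_left l[OF n]])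
  then show "(\<Sum>k. b k *\<^sub>C (exp (- (real k * \<tau>)) ^ n *\<^sub>R v)) = l (of_nat n) *\<^sub>C v"
    unfolding e by (simp add: sums_iff)
qed

section \<open>Measures given by inverse Laplace transforms\<close>

lemma represents_complex_borel_measure:
  assumes "represents \<nu> h \<mu>"
  shows "complex_borel_measure \<mu>"
  unfolding complex_borel_measure_def
proof (intro allI impI)
  fix E :: "nat \<Rightarrow> real set" assume E: "range E \<subseteq> sets borel_halfline" "disjoint_family E"
  have \<nu>: "sets \<nu> = sets borel_halfline" and h: "integrable \<nu> h"
    and \<mu>: "\<And>E. E \<in> sets borel_halfline \<Longrightarrow> \<mu> E = (LINT t:E|\<nu>. h t)"
    using assms by (auto simp: represents_def)
  have Em: "E n \<in> sets \<nu>" for n using E(1) \<nu> by auto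
  have U: "(\<Union>n. E n) \<in> sets \<nu>" using Em by auto
  have si: "set_integrable \<nu> (\<Union>n. E n) h"
    unfolding set_integrable_def by (rule integrable_mult_indicator[OF U h])
  have "(\<lambda>n. LINT t:E n|\<nu>. h t) sums (LINT t:(\<Union>n. E n)|\<nu>. h t)"
  proof -
    let ?f = "\<lambda>n t. indicator (E n) t *\<^sub>R h t"
    have fi: "integrable \<nu> (?f n)" for n by (rule integrable_mult_indicator[OF Em h])
    have one: "(\<lambda>n. indicator (E n) t :: real) sums indicator (\<Union>n. E n) t" for t
    proof (cases "t \<in> (\<Union>n. E n)")
      case True
      then obtain i where i: "t \<in> E i" by blast
      then have "n \<noteq> i \<Longrightarrow> t \<notin> E n" for n using E(2) by (auto simp: disjoint_family_on_def)
      then have "(\<lambda>n. indicator (E n) t :: real) = (\<lambda>n. if n = i then 1 else 0)" using i by (auto simp: indicator_def)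
      then show ?thesis using sums_single[of i "\<lambda>_. 1::real"] True by simp
    qed (auto simp: indicator_def)
    have "(\<lambda>n. \<integral>t. (\<Sum>i<n. ?f i t) \<partial>\<nu>) \<longlonglongrightarrow> (\<integral>t. indicator (\<Union>n. E n) t *\<^sub>R h t \<partial>\<nu>)"
    proof (rule integral_dominated_convergence[where w="\<lambda>t. cmod (h t)"])
      show "integrable \<nu> (\<lambda>t. cmod (h t))" using h by simp
      show "(\<lambda>t. indicator (\<Union>n. E n) t *\<^sub>R h t) \<in> borel_measurable \<nu>"
        using si by (auto simp: set_integrable_def)
      show "(\<lambda>t. \<Sum>i<n. ?f i t) \<in> borel_measurable \<nu>" for n
        using fi by (intro borel_measurable_sum) auto
      show "AE t in \<nu>. (\<lambda>n. \<Sum>i<n. ?f i t) \<longlonglongrightarrow> indicator (\<Union>n. E n) t *\<^sub>R h t"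
        using bounded_linear.sums[OF bounded_linear_scaleR_left one] unfolding sums_def by (intro AE_I2)
      show "AE t in \<nu>. norm (\<Sum>i<n. ?f i t) \<le> cmod (h t)" for n
      proof (rule AE_I2)
        fix t
        have "(\<Sum>i<n. indicator (E i) t :: real) \<le> (\<Sum>i. indicator (E i) t)"
          by (rule sum_le_suminf[OF sums_summable[OF one]]) auto
        also have "\<dots> \<le> 1" using one[of t] by (simp add: sums_iff indicator_def)
        finally have "(\<Sum>i<n. indicator (E i) t :: real) \<le> 1" .
        moreover have "0 \<le> (\<Sum>i<n. indicator (E i) t :: real)" by (rule sum_nonneg) simp
        ultimately show "norm (\<Sum>i<n. ?f i t) \<le> cmod (h t)"
          by (simp flip: scaleR_sum_left add: mult_left_le_one_le)
      qed
    qed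
    moreover have "(\<integral>t. (\<Sum>i<n. ?f i t) \<partial>\<nu>) = (\<Sum>i<n. \<integral>t. ?f i t \<partial>\<nu>)" for n
      by (rule Bochner_Integration.integral_sum) (rule fi)
    ultimately show ?thesis
      unfolding sums_def set_lebesgue_integral_def by (simp only:)
  qed
  then show "(\<lambda>n. \<mu> (E n)) sums \<mu> (\<Union>n. E n)"
    using E(1) \<mu>[OF U[unfolded \<nu>]] by (simp add: \<mu> image_subset_iff)
qed

context decaying_symbol
begin

lemma bromwich_integrable: "integrable halfline (bromwich Q a)"
  using laplace_bromwich(2)[of 0] a0 by simp

text \<open>\<open>represents\<close> asks for a finite reference measure, which Lebesgue measure is
  not. The exponential decay is split off as the finite measure \<open>exp (a * t) dt\<close>, and
  the density is multiplied by \<open>exp (- a * t)\<close> in compensation.\<close>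

lemma represents_bromwich: "\<exists>\<nu> h. represents \<nu> h (density_cm halfline (bromwich Q a))"
proof (intro exI)
  let ?w = "\<lambda>t. exp (a * t)"
  let ?\<nu> = "density halfline (\<lambda>t. ennreal (?w t))"
  let ?h = "\<lambda>t. bromwich Q a t * complex_of_real (exp (- a * t))"
  have wm [measurable]: "?w \<in> borel_measurable halfline" by (rule measurable_restrict_space1) measurable
  have bm [measurable]: "bromwich Q a \<in> borel_measurable halfline"
    using bromwich_integrable by auto
  have hm [measurable]: "?h \<in> borel_measurable halfline"
    by (intro borel_measurable_times bm measurable_restrict_space1) measurable
  have "has_bochner_integral halfline ?w (1 / (- a))"
    using halfline_power_exp(1)[of "- a"] a0 by simp
  then have "integrable halfline ?w" by (simp add: has_bochner_integral_iff)
  then have "(\<integral>\<^sup>+t. ennreal (?w t) \<partial>halfline) < \<infinity>"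
    by (subst nn_integral_eq_integral) auto
  moreover have "emeasure ?\<nu> (space ?\<nu>) = (\<integral>\<^sup>+t. ennreal (?w t) \<partial>halfline)"
    using sets.top[of halfline] by (subst emeasure_density) (auto intro!: nn_integral_cong simp: indicator_def)
  ultimately have fin: "finite_measure ?\<nu>"
    by (intro finite_measureI) simp
  have sets: "sets ?\<nu> = sets borel_halfline" by (simp add: sets_halfline)
  have w_h: "?w t *\<^sub>R ?h t = bromwich Q a t" for t
  proof -
    have "?w t *\<^sub>R ?h t = bromwich Q a t * complex_of_real (exp (a * t) * exp (- a * t))"
      by (simp add: scaleR_conv_of_real mult_ac)
    then show ?thesis by (simp flip: exp_add)
  qed
  have int: "integrable ?\<nu> ?h"
    by (subst integrable_density) (use bromwich_integrable in \<open>auto simp only: w_h exp_ge_zero intro!: hm wm AE_I2\<close>)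
  have "density_cm halfline (bromwich Q a) E = (LINT t:E|?\<nu>. ?h t)" if E: "E \<in> sets borel_halfline" for E
  proof -
    have Em: "E \<in> sets halfline" using E by (simp add: sets_halfline)
    have fm: "(\<lambda>t. indicator E t *\<^sub>R ?h t) \<in> borel_measurable halfline"
      by (intro borel_measurable_scaleR borel_measurable_indicator Em hm)
    have "(LINT t:E|?\<nu>. ?h t) = (\<integral>t. ?w t *\<^sub>R (indicator E t *\<^sub>R ?h t) \<partial>halfline)"
      unfolding set_lebesgue_integral_def by (rule integral_density[OF fm wm]) simp
    also have "\<dots> = (\<integral>t. indicator E t *\<^sub>R (?w t *\<^sub>R ?h t) \<partial>halfline)"
      by (rule Bochner_Integration.integral_cong) (simp_all add: mult.commute)
    finally show ?thesis by (simp only: w_h density_cm_def set_lebesgue_integral_def)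
  qed
  with fin sets int show "represents ?\<nu> ?h (density_cm halfline (bromwich Q a))"
    by (simp only: represents_def) blast
qed

lemma laplace_transform_bromwich: "is_laplace_transform (density_cm halfline (bromwich Q a)) Q"
proof -
  obtain \<nu> h where r: "represents \<nu> h (density_cm halfline (bromwich Q a))" using represents_bromwich by blast
  have "has_cm_integral (density_cm halfline (bromwich Q a)) (\<lambda>s. exp (- z * complex_of_real s)) (Q z)"
    if z: "z \<in> right_half_plane 0" for z
  proof -
    have zr: "Re z > 0" using z by (simp add: right_half_plane_def)
    have mem: "(\<lambda>s. exp (- z * complex_of_real s)) \<in> bcont"
      by (rule bcontI[of _ 1]) (use zr in \<open>auto simp: norm_exp_eq_Re intro!: continuous_intros\<close>)
    have "cm_integral (density_cm halfline (bromwich Q a)) (\<lambda>s. exp (- z * complex_of_real s)) = Q z"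
      using cm_integral_scaleC[OF sets_halfline bromwich_integrable mem, of "1::complex"] laplace_bromwich(1)[of z] zr a0
      by (simp add: scaleC_complex_def)
    then show ?thesis using has_cm_integral_iff[OF r mem] by simp
  qed
  then show ?thesis
    using represents_complex_borel_measure[OF r] by (simp add: is_laplace_transform_def)
qed

end

lemma cm_integral_density_tendsto:
  fixes \<phi> :: "real \<Rightarrow> 'a::cbanach"
  assumes g: "\<And>n::nat. integrable halfline (g n)" and g0: "integrable halfline g0" and w: "integrable halfline w"
    and le: "\<And>n t. t \<ge> 0 \<Longrightarrow> cmod (g n t) \<le> w t" "\<And>t. t \<ge> 0 \<Longrightarrow> cmod (g0 t) \<le> w t"
    and lim: "\<And>t. t \<ge> 0 \<Longrightarrow> (\<lambda>n. g n t) \<longlonglongrightarrow> g0 t" and \<phi>: "\<phi> \<in> bcont"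
  shows "(\<lambda>n. cm_integral (density_cm halfline (g n)) \<phi>) \<longlonglongrightarrow> cm_integral (density_cm halfline g0) \<phi>"
proof -
  obtain B where B: "B \<ge> 0" "\<And>t. t \<ge> 0 \<Longrightarrow> norm (\<phi> t) \<le> B" using bcontE[OF \<phi>] by blast
  have [measurable]: "g n \<in> borel_measurable halfline" "g0 \<in> borel_measurable halfline" "w \<in> borel_measurable halfline" for n
    using g g0 w by auto
  have w0: "0 \<le> w t" if "t \<ge> 0" for t using order_trans[OF norm_ge_zero le(2)[OF that]] .
  have diff: "ennreal (norm (cm_integral (density_cm halfline (g n)) \<phi> - cm_integral (density_cm halfline g0) \<phi>))
      \<le> (\<integral>\<^sup>+t. ennreal (cmod (g n t - g0 t) * B) \<partial>halfline)" for n
    by (rule has_bochner_diff_le[OF has_bochner_cm_integral(1)[OF sets_halfline g \<phi>] has_bochner_cm_integral(1)[OF sets_halfline g0 \<phi>]])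
       (use B in \<open>auto simp flip: scaleC.diff_left simp: norm_scaleC intro!: ennreal_leI mult_left_mono\<close>)
  have "(\<lambda>n. \<integral>\<^sup>+t. ennreal (cmod (g n t - g0 t) * B) \<partial>halfline) \<longlonglongrightarrow> (\<integral>\<^sup>+t. 0 \<partial>halfline)"
  proof (rule nn_integral_dominated_convergence[where w="\<lambda>t. ennreal (2 * w t * B)"])
    have "integrable halfline (\<lambda>t. 2 * w t * B)" using w by simp
    then show "(\<integral>\<^sup>+t. ennreal (2 * w t * B) \<partial>halfline) < \<infinity>"
      using w0 B by (subst nn_integral_eq_integral) auto
    show "AE t in halfline. ennreal (cmod (g n t - g0 t) * B) \<le> ennreal (2 * w t * B)" for n
    proof (rule AE_I2)
      fix t assume "t \<in> space halfline"
      then have "cmod (g n t - g0 t) \<le> 2 * w t"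
        using norm_triangle_ineq4[of "g n t" "g0 t"] le(1)[of t n] le(2)[of t] by simp
      then show "ennreal (cmod (g n t - g0 t) * B) \<le> ennreal (2 * w t * B)"
        using B by (intro ennreal_leI mult_right_mono)
    qed
    show "AE t in halfline. (\<lambda>n. ennreal (cmod (g n t - g0 t) * B)) \<longlonglongrightarrow> 0"
    proof (rule AE_I2)
      fix t assume "t \<in> space halfline"
      then have "(\<lambda>n. cmod (g n t - g0 t) * B) \<longlonglongrightarrow> cmod (g0 t - g0 t) * B"
        by (intro tendsto_mult tendsto_norm tendsto_diff tendsto_const lim) simp
      then have "(\<lambda>n. ennreal (cmod (g n t - g0 t) * B)) \<longlonglongrightarrow> ennreal (cmod (g0 t - g0 t) * B)"
        by (rule tendsto_ennrealI)
      then show "(\<lambda>n. ennreal (cmod (g n t - g0 t) * B)) \<longlonglongrightarrow> 0" by simp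
    qed
  qed measurable
  then have "(\<lambda>n. \<integral>\<^sup>+t. ennreal (cmod (g n t - g0 t) * B) \<partial>halfline) \<longlonglongrightarrow> 0" by simp
  from ennreal_tendsto_0_le[OF this diff]
  have "(\<lambda>n. norm (cm_integral (density_cm halfline (g n)) \<phi> - cm_integral (density_cm halfline g0) \<phi>)) \<longlonglongrightarrow> 0"
    by (subst (asm) ennreal_0[symmetric], subst (asm) tendsto_ennreal_iff) auto
  then show ?thesis by (simp add: tendsto_norm_zero_iff LIM_zero_iff)
qed

subsection \<open>Bounded semigroups\<close>

locale bounded_semigroup =
  fixes T :: "real \<Rightarrow> 'a::cbanach \<Rightarrow> 'a" and C :: real
  assumes T: "C0_semigroup T" and C: "C \<ge> 0" and bound: "\<And>t x. t \<ge> 0 \<Longrightarrow> norm (T t x) \<le> C * norm x"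
begin

lemma orbit_mem: "(\<lambda>t. T t x) \<in> bcont"
  by (rule semigroup_bcont[OF T C bound])

lemma T_clinear: "t \<ge> 0 \<Longrightarrow> bounded_clinear (T t)"
  using T by (simp add: C0_semigroup_def)

lemma T_add: "t \<ge> 0 \<Longrightarrow> T t (x + y) = T t x + T t y"
  using T_clinear[of t] by (simp add: bounded_clinear_def linear_add bounded_linear.linear)

lemma T_scaleR: "t \<ge> 0 \<Longrightarrow> T t (r *\<^sub>R x) = r *\<^sub>R T t x"
  using T_clinear[of t] by (simp add: bounded_clinear_def linear_scale bounded_linear.linear)

lemma T_semigroup: "s \<ge> 0 \<Longrightarrow> t \<ge> 0 \<Longrightarrow> T (s + t) x = T s (T t x)"
  using T by (simp add: C0_semigroup_def)

text \<open>For \<open>L = cm_integral \<mu>\<close> this is the Hille-Phillips operator of \<mu>,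
  for evaluation at 0 it is the identity.\<close>

definition op :: "((real \<Rightarrow> 'a) \<Rightarrow> 'a) \<Rightarrow> 'a \<Rightarrow> 'a" where
  "op L x = L (\<lambda>t. T t x)"

lemma bc_functional_cong:
  assumes L: "bc_functional L" and "\<phi> \<in> bcont" "\<psi> \<in> bcont" "\<And>t. t \<ge> 0 \<Longrightarrow> \<phi> t = (\<psi> t :: 'a)"
  shows "L \<phi> = L \<psi>"
proof -
  obtain B where "\<And>t. t \<ge> 0 \<Longrightarrow> norm (\<phi> t) \<le> B" using bcontE[OF assms(2)] by blast
  with assms have "(\<lambda>n::nat. L \<phi>) \<longlonglongrightarrow> L \<psi>" by (intro bc_functional_tendsto[OF L]) auto
  then show ?thesis by (simp add: LIMSEQ_const_iff)
qed

lemma op_add: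
  assumes "bc_functional L"
  shows "op L (x + y) = op L x + op L y"
proof -
  have "L (\<lambda>t. T t (x + y)) = L (\<lambda>t. T t x + T t y)"
    by (rule bc_functional_cong[OF assms]) (auto intro: orbit_mem bcont_add simp: T_add)
  then show ?thesis by (simp add: op_def bc_functional_add[OF assms orbit_mem orbit_mem])
qed

lemma op_tendsto:
  assumes L: "bc_functional L" and x: "x \<longlonglongrightarrow> x0"
  shows "(\<lambda>n::nat. op L (x n)) \<longlonglongrightarrow> op L x0"
proof -
  obtain M where M: "M \<ge> 0" "\<And>\<phi> B. \<phi> \<in> bcont \<Longrightarrow> (\<And>t. t \<ge> 0 \<Longrightarrow> norm (\<phi> t) \<le> B) \<Longrightarrow> norm (L \<phi>) \<le> M * B"
    using bc_functional_bound[OF L] by blast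
  have le: "norm (op L (x n) - op L x0) \<le> M * (C * norm (x n - x0))" for n
  proof -
    have "op L (x n) = op L (x n - x0) + op L x0" using op_add[OF L, of "x n - x0" x0] by simp
    moreover have "norm (op L (x n - x0)) \<le> M * (C * norm (x n - x0))"
      unfolding op_def by (rule M(2)[OF orbit_mem bound])
    ultimately show ?thesis by simp
  qed
  have "(\<lambda>n. M * (C * norm (x n - x0))) \<longlonglongrightarrow> M * (C * norm (x0 - x0))"
    by (intro tendsto_intros x)
  then have "(\<lambda>n. M * (C * norm (x n - x0))) \<longlonglongrightarrow> 0" by simp
  then have "(\<lambda>n. op L (x n) - op L x0) \<longlonglongrightarrow> 0"
    by (rule Lim_null_comparison[rotated]) (use le in \<open>auto intro: always_eventually\<close>)
  then show ?thesis by (rule LIM_zero_cancel)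
qed

lemma cm_integral_density_clinear:
  assumes h: "integrable halfline h" and \<phi>: "\<phi> \<in> bcont" and S: "bounded_clinear S"
  shows "cm_integral (density_cm halfline h) (\<lambda>t. S (\<phi> t)) = S (cm_integral (density_cm halfline h) \<phi>)"
proof -
  have bl: "bounded_linear S" using S by (simp add: bounded_clinear_def)
  have "stieltjes_sum (density_cm halfline h) (\<lambda>t. S (\<phi> t)) = (\<lambda>n. S (stieltjes_sum (density_cm halfline h) \<phi> n))"
    using S by (intro ext) (simp add: stieltjes_sum_def linear_sum[OF bounded_linear.linear[OF bl]] bounded_clinear_def)
  moreover have "(\<lambda>n. S (stieltjes_sum (density_cm halfline h) \<phi> n)) \<longlonglongrightarrow> S (cm_integral (density_cm halfline h) \<phi>)"
    by (intro bounded_linear.tendsto[OF bl] has_bochner_cm_integral(2) sets_halfline h \<phi>)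
  ultimately show ?thesis by (simp add: cm_integral_def[of _ "\<lambda>t. S (\<phi> t)"] limI)
qed

text \<open>The semigroup law turns convolution of functionals into composition of operators;
  \<open>T s\<close> can be taken out of the inner integral because bounded operators commute with
  integration.\<close>

lemma op_compose:
  assumes L: "bc_functional L" and h: "integrable halfline h"
  shows "L (\<lambda>s. cm_integral (density_cm halfline h) (\<lambda>t. T (s + t) x)) = op L (op (cm_integral (density_cm halfline h)) x)"
  unfolding op_def[of L]
proof (rule bc_functional_cong[OF L _ orbit_mem])
  let ?K = "cm_integral (density_cm halfline h)"
  show "(\<lambda>s. ?K (\<lambda>t. T (s + t) x)) \<in> bcont"
    by (rule bc_functional_shift_mem[OF bc_functional_cm_integral[OF sets_halfline h] orbit_mem])
  fix s :: real assume s: "s \<ge> 0"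
  have "?K (\<lambda>t. T (s + t) x) = ?K (\<lambda>t. T s (T t x))"
    by (rule cm_integral_cong) (simp add: T_semigroup s)
  also have "\<dots> = T s (op ?K x)"
    unfolding op_def by (rule cm_integral_density_clinear[OF h orbit_mem T_clinear[OF s]])
  finally show "?K (\<lambda>t. T (s + t) x) = T s (op ?K x)" .
qed

text \<open>Since the values at the positive integers determine a functional, operators may be composed
  by multiplying symbols.\<close>

lemma op_eq_compose:
  assumes L: "multiplier L l" "integrable halfline h" "multiplier (cm_integral (density_cm halfline h) :: (real \<Rightarrow> 'a) \<Rightarrow> 'a) k"
    and L': "multiplier L' l'" "integrable halfline h'" "multiplier (cm_integral (density_cm halfline h') :: (real \<Rightarrow> 'a) \<Rightarrow> 'a) k'"
    and eq: "\<And>n. n \<ge> 1 \<Longrightarrow> l (of_nat n) * k (of_nat n) = l' (of_nat n) * k' (of_nat n)"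
  shows "op L (op (cm_integral (density_cm halfline h)) x) = op L' (op (cm_integral (density_cm halfline h')) x)"
proof -
  have "L (\<lambda>s. cm_integral (density_cm halfline h) (\<lambda>t. T (s + t) x))
      = L' (\<lambda>s. cm_integral (density_cm halfline h') (\<lambda>t. T (s + t) x))"
    using multiplier_unique[OF multiplier_compose[OF L(1,3)] multiplier_compose[OF L'(1,3)] eq orbit_mem] .
  moreover have "bc_functional L" "bc_functional L'" using L(1) L'(1) by (simp_all add: multiplier_def)
  ultimately show ?thesis by (simp add: op_compose L(2) L'(2))
qed

section \<open>Regularizers and strong limits\<close>

definition kernel :: "real \<Rightarrow> real \<Rightarrow> complex" where
  "kernel lam t = complex_of_real (t * exp (- lam * t))"

text \<open>If \<open>-A\<close> generates \<open>T\<close>, then \<open>reg lam\<close> is \<open>(lam + A)\<^sup>-\<^sup>2\<close>.\<close>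

definition reg :: "real \<Rightarrow> 'a \<Rightarrow> 'a" where
  "reg lam = op (cm_integral (density_cm halfline (kernel lam)))"

lemma exp_power: "exp (- lam * t) * exp (- t) ^ n = exp (- (lam + real n) * t)" for lam t :: real
  by (simp add: exp_of_nat_mult[symmetric] exp_add[symmetric] algebra_simps)

lemma kernel_integrable: "lam > 0 \<Longrightarrow> integrable halfline (kernel lam)"
  unfolding kernel_def[abs_def]
  by (rule integrable_of_real) (use halfline_power_exp(2)[of lam] in \<open>simp only: has_bochner_integral_iff\<close>)

lemma kernel_multiplier:
  assumes lam: "lam > 0"
  shows "multiplier (cm_integral (density_cm halfline (kernel lam)) :: (real \<Rightarrow> 'a) \<Rightarrow> 'a) (\<lambda>z. 1 / (z + of_real lam)\<^sup>2)"
proof (rule multiplier_density[OF sets_halfline kernel_integrable[OF lam]])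
  fix n :: nat
  have p: "lam + real n > 0" using lam by simp
  have "kernel lam t * complex_of_real (exp (- t) ^ n) = complex_of_real (t * exp (- (lam + real n) * t))" for t
    unfolding exp_power[symmetric] by (simp add: kernel_def mult.assoc)
  then have "(\<integral>t. kernel lam t * complex_of_real (exp (- t) ^ n) \<partial>halfline) = complex_of_real (\<integral>t. t * exp (- (lam + real n) * t) \<partial>halfline)"
    by (simp only: integral_complex_of_real)
  also have "(\<integral>t. t * exp (- (lam + real n) * t) \<partial>halfline) = 1 / (lam + real n)\<^sup>2"
    using halfline_power_exp(2)[OF p] by (simp only: has_bochner_integral_iff)
  finally show "(\<integral>t. kernel lam t * complex_of_real (exp (- t) ^ n) \<partial>halfline) = 1 / (of_nat n + of_real lam)\<^sup>2"
    by (simp add: add.commute)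
qed

text \<open>The kernel \<open>j\<^sup>2 t exp (- j t)\<close> is a probability density with mean
  \<open>2 / j\<close>, so it concentrates at 0, where the orbit is continuous. The ranges of the
  regularizers thus approximate every vector.\<close>

lemma reg_tendsto: "(\<lambda>j. reg (real j) ((real j)\<^sup>2 *\<^sub>R x)) \<longlonglongrightarrow> x"
proof (rule LIMSEQ_I)
  fix e :: real assume e: "e > 0"
  have "((\<lambda>t. T t x) \<longlongrightarrow> x) (at_right 0)" using T by (simp add: C0_semigroup_def)
  from tendstoD[OF this, of "e/2"] e obtain d where d: "d > 0" "\<And>t. 0 < t \<Longrightarrow> t < d \<Longrightarrow> dist (T t x) x < e/2"
    unfolding eventually_at_right_field by auto
  \<comment> \<open>Chosen so that \<open>K * t\<close> dominates \<open>norm (T t x - x)\<close>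
    for \<open>t \<ge> d\<close>; a majorant linear in \<open>t\<close> is convenient because the
    mean of the kernel is explicit.\<close>
  define K where "K = (C + 1) * norm x / d"
  have K: "K \<ge> 0" using C d(1) by (simp add: K_def)
  have near: "norm (T t x - x) \<le> e/2 + K * t" if t: "t \<ge> 0" for t
  proof -
    consider "t = 0" | "0 < t" "t < d" | "d \<le> t" using t by linarith
    then show ?thesis
    proof cases
      case 1
      then show ?thesis using T e by (simp add: C0_semigroup_def)
    next
      case 2
      then have "norm (T t x - x) < e/2" using d(2) by (simp add: dist_norm)
      moreover have "0 \<le> K * t" using K t by simp
      ultimately show ?thesis by linarith
    next
      case 3
      have "norm (T t x - x) \<le> (C + 1) * norm x"
        using norm_triangle_ineq4[of "T t x" x] bound[OF t, of x] by (simp add: algebra_simps)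
      also have "\<dots> = K * d" using d(1) by (simp add: K_def)
      also have "\<dots> \<le> K * t" using K 3 by (intro mult_left_mono)
      finally show ?thesis using e by linarith
    qed
  qed
  obtain N :: nat where N: "4 * K / e < real N" using reals_Archimedean2 by blast
  have "norm (reg (real j) ((real j)\<^sup>2 *\<^sub>R x) - x) < e" if j: "j \<ge> Suc N" for j
  proof -
    define r where "r = real j"
    have r: "r > 0" "4 * K / e < r" using j N by (auto simp: r_def)
    have h1: "has_bochner halfline (\<lambda>t. kernel r t *\<^sub>C T t (r\<^sup>2 *\<^sub>R x)) (reg r (r\<^sup>2 *\<^sub>R x))"
      unfolding reg_def op_def by (rule has_bochner_cm_integral(1)[OF sets_halfline kernel_integrable[OF r(1)] orbit_mem])
    have ki: "(\<integral>t. kernel r t \<partial>halfline) = complex_of_real (1 / r\<^sup>2)"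
      using halfline_power_exp(2)[OF r(1)] unfolding kernel_def integral_complex_of_real
      by (simp only: has_bochner_integral_iff)
    have h2: "has_bochner halfline (\<lambda>t. kernel r t *\<^sub>C (r\<^sup>2 *\<^sub>R x)) x"
      using has_bochner_scaleC_left[OF kernel_integrable[OF r(1)], of "r\<^sup>2 *\<^sub>R x"] r(1)
      unfolding ki scaleC_of_real by simp
    let ?w = "\<lambda>t. r\<^sup>2 * (e/2) * (t * exp (- r * t)) + r\<^sup>2 * K * (t\<^sup>2 * exp (- r * t))"
    have wb: "has_bochner_integral halfline ?w (r\<^sup>2 * (e/2) * (1 / r\<^sup>2) + r\<^sup>2 * K * (2 / r ^ 3))"
      by (intro has_bochner_integral_add has_bochner_integral_mult_right halfline_power_exp r)
    have "ennreal (norm (reg r (r\<^sup>2 *\<^sub>R x) - x)) \<le> (\<integral>\<^sup>+t. ennreal (?w t) \<partial>halfline)"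
    proof (rule has_bochner_diff_le[OF h1 h2])
      show "(\<lambda>t. ennreal (?w t)) \<in> borel_measurable halfline" by (rule measurable_restrict_space1) measurable
      fix t assume "t \<in> space halfline"
      then have t: "t \<ge> 0" by simp
      have "kernel r t *\<^sub>C T t (r\<^sup>2 *\<^sub>R x) - kernel r t *\<^sub>C (r\<^sup>2 *\<^sub>R x) = kernel r t *\<^sub>C (r\<^sup>2 *\<^sub>R (T t x - x))"
        by (simp add: T_scaleR t scaleC.diff_right scaleR_diff_right)
      then have "norm (kernel r t *\<^sub>C T t (r\<^sup>2 *\<^sub>R x) - kernel r t *\<^sub>C (r\<^sup>2 *\<^sub>R x)) = (t * exp (- r * t)) * (r\<^sup>2 * norm (T t x - x))"
        using t by (simp add: norm_scaleC kernel_def norm_mult)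
      also have "\<dots> \<le> (t * exp (- r * t)) * (r\<^sup>2 * (e/2 + K * t))"
        using t by (intro mult_left_mono near) auto
      also have "\<dots> = ?w t" by (simp add: algebra_simps power2_eq_square)
      finally show "ennreal (norm (kernel r t *\<^sub>C T t (r\<^sup>2 *\<^sub>R x) - kernel r t *\<^sub>C (r\<^sup>2 *\<^sub>R x))) \<le> ennreal (?w t)"
        by (rule ennreal_leI)
    qed
    also have "\<dots> = ennreal (r\<^sup>2 * (e/2) * (1 / r\<^sup>2) + r\<^sup>2 * K * (2 / r ^ 3))"
    proof -
      have "(\<integral>\<^sup>+t. ennreal (?w t) \<partial>halfline) = ennreal (\<integral>t. ?w t \<partial>halfline)"
        using wb e K by (intro nn_integral_eq_integral AE_I2) (auto simp: has_bochner_integral_iff)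
      then show ?thesis using wb by (simp only: has_bochner_integral_iff)
    qed
    finally have "norm (reg r (r\<^sup>2 *\<^sub>R x) - x) \<le> r\<^sup>2 * (e/2) * (1 / r\<^sup>2) + r\<^sup>2 * K * (2 / r ^ 3)"
      using r e K by (subst (asm) ennreal_le_iff) auto
    also have "\<dots> = e/2 + 2 * K / r" using r by (simp add: power2_eq_square power3_eq_cube)
    also have "2 * K / r < e / 2"
    proof -
      have "4 * K < r * e" using r(2) by (subst (asm) pos_divide_less_eq[OF e])
      then show ?thesis using r(1) by (simp add: pos_divide_less_eq mult.commute)
    qed
    finally show ?thesis by (simp add: r_def)
  qed
  then show "\<exists>no. \<forall>n\<ge>no. norm (reg (real n) ((real n)\<^sup>2 *\<^sub>R x) - x) < e" by blast
qed

text \<open>Uniform boundedness extends convergence from an approximating set to all vectors. The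
  approximants \<open>reg j (j\<^sup>2 x)\<close> vary with \<open>j\<close>, which is why
  convergence is asked on the range of every \<open>reg j\<close> from some index on.\<close>

lemma strong_limit_exists:
  fixes S :: "nat \<Rightarrow> 'a \<Rightarrow> 'a"
  assumes S: "\<And>n. bounded_clinear (S n)" and B: "B \<ge> 0" "\<And>n x. norm (S n x) \<le> B * norm x"
    and conv: "\<And>j y. j \<ge> j0 \<Longrightarrow> convergent (\<lambda>n. S n (reg (real j) y))"
  obtains R where "bounded_clinear R" "\<And>x. norm (R x) \<le> B * norm x" "\<And>x. (\<lambda>n. S n x) \<longlonglongrightarrow> R x"
proof -
  have lin: "S n (x - y) = S n x - S n y" "S n (x + y) = S n x + S n y" "S n (c *\<^sub>C x) = c *\<^sub>C S n x" for n x y c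
    using S[of n] by (simp_all add: bounded_clinear_def linear_diff linear_add bounded_linear.linear)
  have "convergent (\<lambda>n. S n x)" for x
  proof (rule Cauchy_convergent, rule CauchyI)
    fix e :: real assume e: "e > 0"
    have "eventually (\<lambda>j. dist (reg (real j) ((real j)\<^sup>2 *\<^sub>R x)) x < e / (3 * (B + 1))) sequentially"
      using e B by (intro tendstoD[OF reg_tendsto]) auto
    then obtain j where j: "j \<ge> j0" "dist (reg (real j) ((real j)\<^sup>2 *\<^sub>R x)) x < e / (3 * (B + 1))"
      unfolding eventually_sequentially by (meson nat_le_linear order_refl order_trans)
    define y where "y = reg (real j) ((real j)\<^sup>2 *\<^sub>R x)"
    have close: "norm (S n x - S n y) < e / 3" for n
    proof -
      have "norm (S n x - S n y) \<le> B * norm (x - y)" using B(2)[of n "x - y"] by (simp add: lin)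
      also have "\<dots> \<le> (B + 1) * norm (x - y)" by (intro mult_right_mono) auto
      also have "\<dots> < (B + 1) * (e / (3 * (B + 1)))"
        using j(2) B(1) by (intro mult_strict_left_mono) (auto simp: dist_norm y_def norm_minus_commute)
      also have "\<dots> = e / 3"
      proof -
        have "B + 1 \<noteq> 0" using B(1) by simp
        then have "(B + 1) * e / ((B + 1) * 3) = e / 3" by (rule nonzero_mult_divide_mult_cancel_left)
        then show ?thesis by (simp only: times_divide_eq_right mult.commute[of 3])
      qed
      finally show ?thesis .
    qed
    have "Cauchy (\<lambda>n. S n y)" using conv[OF j(1)] by (simp add: y_def convergent_Cauchy)
    then obtain N where N: "\<And>m n. m \<ge> N \<Longrightarrow> n \<ge> N \<Longrightarrow> norm (S m y - S n y) < e / 3"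
      using CauchyD[of _ "e/3"] e by (metis divide_pos_pos zero_less_numeral)
    have "norm (S m x - S n x) < e" if "m \<ge> N" "n \<ge> N" for m n
    proof -
      have "norm (S m x - S n x) = norm ((S m x - S m y) + (S m y - S n y) - (S n x - S n y))" by simp
      also have "\<dots> \<le> norm ((S m x - S m y) + (S m y - S n y)) + norm (S n x - S n y)"
        by (rule norm_triangle_ineq4)
      also have "\<dots> \<le> norm (S m x - S m y) + norm (S m y - S n y) + norm (S n x - S n y)"
        by (intro add_right_mono norm_triangle_ineq)
      finally show ?thesis using close[of m] close[of n] N[OF that] by linarith
    qed
    then show "\<exists>M. \<forall>m\<ge>M. \<forall>n\<ge>M. norm (S m x - S n x) < e" by blast
  qed
  then have "\<exists>R. \<forall>x. (\<lambda>n. S n x) \<longlonglongrightarrow> R x"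
    by (intro choice) (simp add: convergent_def)
  then obtain R where R: "\<And>x. (\<lambda>n. S n x) \<longlonglongrightarrow> R x" by blast
  have add: "R (x + y) = R x + R y" for x y
    using LIMSEQ_unique[OF R[of "x + y"]] tendsto_add[OF R R, of x y] by (simp add: lin)
  have scl: "R (c *\<^sub>C x) = c *\<^sub>C R x" for c x
    using LIMSEQ_unique[OF R[of "c *\<^sub>C x"]] scaleC.tendsto[OF tendsto_const R, of c x] by (simp add: lin)
  have bd: "norm (R x) \<le> B * norm x" for x
    by (rule LIMSEQ_le_const2[OF tendsto_norm[OF R]]) (use B(2) in blast)
  have "bounded_linear R"
    by (rule bounded_linear_intro[where K=B])
       (use add scl bd in \<open>auto simp: scaleR_scaleC mult.commute\<close>)
  then have "bounded_clinear R" using scl by (simp add: bounded_clinear_def)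
  then show ?thesis using bd R by (rule that)
qed

end

section \<open>Symbols of the limit operator and of the regularizers\<close>

lemma (in decaying_symbol) bromwich_multiplier:
  "multiplier (cm_integral (density_cm halfline (bromwich Q a)) :: (real \<Rightarrow> 'a::cbanach) \<Rightarrow> 'a) Q"
  using multiplier_laplace[OF laplace_transform_bromwich] by blast

lemma deriv_decaying:
  assumes f: "f \<in> H_infinity (right_half_plane \<omega>)" and \<omega>: "\<omega> < 0" and lam: "lam > \<bar>\<omega>\<bar>"
  shows "decaying_symbol (\<lambda>z. deriv f z / (z + of_real lam)\<^sup>2) (\<omega> / 2) (\<omega> / 4) lam (16 * H_infinity_norm (right_half_plane \<omega>) f / \<bar>\<omega>\<bar>)"
proof
  have nz: "z + of_real lam \<noteq> 0" if "Re z > \<omega> / 2" for z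
  proof
    assume "z + of_real lam = 0"
    then have "Re z + lam = 0" by (simp add: complex_eq_iff)
    with that lam \<omega> show False by linarith
  qed
  have "deriv f holomorphic_on right_half_plane \<omega>"
    using f by (intro holomorphic_deriv open_right_half_plane) (simp add: H_infinity_def)
  then have "deriv f holomorphic_on {z. Re z > \<omega> / 2}"
    by (rule holomorphic_on_subset) (use \<omega> in \<open>auto simp: right_half_plane_def\<close>)
  moreover have "(\<lambda>z. (z + of_real lam)\<^sup>2) holomorphic_on {z. Re z > \<omega> / 2}"
    by (intro holomorphic_intros)
  ultimately show "(\<lambda>z. deriv f z / (z + of_real lam)\<^sup>2) holomorphic_on {z. Re z > \<omega> / 2}"
    by (rule holomorphic_on_divide) (use nz in simp)
  show "0 \<le> 16 * H_infinity_norm (right_half_plane \<omega>) f / \<bar>\<omega>\<bar>" using H_infinity_norm_nonneg[OF f] by simp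
  show "cmod (deriv f z / (z + of_real lam)\<^sup>2) \<le> 16 * H_infinity_norm (right_half_plane \<omega>) f / \<bar>\<omega>\<bar> / (cmod (z + of_real lam))\<^sup>2"
    if "Re z \<ge> \<omega> / 4" for z
  proof -
    \<comment> \<open>Larger discs would fit; the radius \<open>\<bar>\<omega>\<bar> / 16\<close>
      yields the constant 16 of the discretized symbols, so that all of them obey one
      \<open>decaying_symbol\<close> bound together with the limit.\<close>
    have "cmod ((deriv ^^ 1) f z) \<le> fact 1 * H_infinity_norm (right_half_plane \<omega>) f / (- \<omega> / 16) ^ 1"
      using that \<omega> by (intro right_half_plane_Cauchy[OF f]) auto
    then have "cmod (deriv f z) \<le> 16 * H_infinity_norm (right_half_plane \<omega>) f / \<bar>\<omega>\<bar>"
      using \<omega> by (simp add: field_simps)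
    then show ?thesis unfolding norm_divide norm_power by (intro divide_right_mono) auto
  qed
qed (use \<omega> lam in auto)

lemma const_decaying:
  assumes "b < a" "a < 0" "lam > \<bar>b\<bar>"
  shows "decaying_symbol (\<lambda>z. 1 / (z + of_real lam)\<^sup>2) b a lam 1"
proof
  have "z + of_real lam \<noteq> 0" if "Re z > b" for z
  proof
    assume "z + of_real lam = 0"
    then have "Re z + lam = 0" by (simp add: complex_eq_iff)
    with that assms show False by linarith
  qed
  then show "(\<lambda>z. 1 / (z + of_real lam)\<^sup>2) holomorphic_on {z. Re z > b}"
    by (intro holomorphic_intros) auto
qed (use assms in \<open>auto simp: norm_divide norm_power\<close>)

section \<open>The derivative calculus of a gamma-bounded semigroup\<close>

locale discrete_gamma_semigroup = bounded_semigroup +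
  assumes discrete: "\<And>e. e > 0 \<Longrightarrow> \<exists>\<tau>. 0 < \<tau> \<and> \<tau> < e \<and>
    (\<forall>N w. gauss_moment (map (\<lambda>j. T (real j * \<tau>) (w j)) [0..<N]) 0 \<le> ennreal (C\<^sup>2) * gauss_moment (map w [0..<N]) 0)"
begin

text \<open>Transference is applied to the partial sums of the series. They may exceed the supremum
  of the function, but on a circle strictly inside the disc of convergence only by a tail that tends
  to 0.\<close>

lemma discretized_bound:
  assumes f: "f \<in> H_infinity (right_half_plane \<omega>)" and \<omega>: "\<omega> < 0" and \<tau>: "\<tau> > 0" and small: "\<tau> * \<bar>\<omega>\<bar> \<le> 1"
    and gm: "\<And>N w. gauss_moment (map (\<lambda>j. T (real j * \<tau>) (w j)) [0..<N]) 0 \<le> ennreal (C\<^sup>2) * gauss_moment (map w [0..<N]) 0"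
  shows "norm (\<Sum>k. (- (of_nat k * of_real \<tau> * coef f \<tau> k)) *\<^sub>C T (real k * \<tau>) x)
     \<le> 4 * C\<^sup>2 / \<bar>\<omega>\<bar> * H_infinity_norm (right_half_plane \<omega>) f * norm x"
proof -
  interpret discretized f \<omega> \<tau> using f \<omega> \<tau> by unfold_locales
  define N where "N = H_infinity_norm (right_half_plane \<omega>) f"
  have N0: "N \<ge> 0" unfolding N_def by (rule H_infinity_norm_nonneg[OF f])
  \<comment> \<open>Half of the room \<open>\<rho> - 1\<close>: the circle of radius
    \<open>1 + \<delta> = 1 / r\<close> lies strictly inside the disc on which the series converges
    absolutely.\<close>
  define \<delta> where "\<delta> = \<tau> * \<bar>\<omega>\<bar> / 2"
  have "0 < \<tau> * \<bar>\<omega>\<bar>" using \<tau> \<omega> by (intro mult_pos_pos) auto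
  then have \<delta>: "0 < \<delta>" "\<delta> \<le> 1" using small unfolding \<delta>_def by linarith+
  define r where "r = 1 / (1 + \<delta>)"
  have r: "0 < r" "r < 1" "1 / r = 1 + \<delta>" using \<delta> by (auto simp: r_def)
  have \<delta>\<rho>: "1 + \<delta> < \<rho>" using \<tau> \<omega> by (simp add: \<delta>_def mult_pos_neg)
  let ?c = "coef f \<tau>"
  let ?t = "\<lambda>k. (of_nat k * ?c k) *\<^sub>C T (real k * \<tau>) x"
  have tb: "norm (?t k) \<le> cmod (of_nat k * ?c k) * (C * norm x)" for k
    unfolding norm_scaleC using \<tau> by (intro mult_left_mono bound) auto
  have tsum: "summable ?t"
    by (rule summable_comparison_test'[OF summable_mult2[OF diffs_abs_summable] tb])
  have asum: "summable (\<lambda>k. cmod (?c k) * (1 + \<delta>) ^ k)"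
    using \<delta>(1) \<delta>\<rho> by (intro coef_abs_summable) auto
  have "norm (suminf ?t) \<le> C\<^sup>2 * (N + \<eta>) / (1 - r\<^sup>2) * norm x" if \<eta>: "\<eta> > 0" for \<eta>
  proof (rule LIMSEQ_le_const2)
    show "(\<lambda>n. norm (\<Sum>k<Suc n. ?t k)) \<longlonglongrightarrow> norm (suminf ?t)"
      by (intro tendsto_norm LIMSEQ_Suc[OF summable_LIMSEQ[OF tsum]])
    have "(\<lambda>n. \<Sum>k<Suc n. cmod (?c k) * (1 + \<delta>) ^ k) \<longlonglongrightarrow> (\<Sum>k. cmod (?c k) * (1 + \<delta>) ^ k)"
      by (rule LIMSEQ_Suc[OF summable_LIMSEQ[OF asum]])
    then have "eventually (\<lambda>n. (\<Sum>k. cmod (?c k) * (1 + \<delta>) ^ k) - \<eta> < (\<Sum>k<Suc n. cmod (?c k) * (1 + \<delta>) ^ k)) sequentially"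
      by (rule order_tendstoD(1)) (use \<eta> in simp)
    then obtain n0 where n0: "\<And>n. n \<ge> n0 \<Longrightarrow> (\<Sum>k. cmod (?c k) * (1 + \<delta>) ^ k) - \<eta> < (\<Sum>k<Suc n. cmod (?c k) * (1 + \<delta>) ^ k)"
      unfolding eventually_sequentially by blast
    have "norm (\<Sum>k<Suc n. ?t k) \<le> C\<^sup>2 * (N + \<eta>) / (1 - r\<^sup>2) * norm x" if n: "n \<ge> n0" for n
    proof -
      have sup: "cmod (\<Sum>k\<le>n. ?c k * z ^ k) \<le> N + \<eta>" if z: "cmod z = 1 / r" for z
      proof -
        have zd: "cmod z = 1 + \<delta>" using z r(3) by simp
        then have z\<rho>: "cmod z < \<rho>" using \<delta>\<rho> by simp
        have sm: "summable (\<lambda>k. ?c k * z ^ k)" by (rule coef_summable[OF z\<rho>])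
        have full: "cmod (\<Sum>k. ?c k * z ^ k) \<le> N"
          using coef_sums[OF z\<rho>] H_infinity_le_norm[OF f arg_mem[OF z\<rho>]] by (simp add: sums_iff N_def)
        have tail: "cmod (\<Sum>k. ?c (k + Suc n) * z ^ (k + Suc n)) \<le> (\<Sum>k. cmod (?c (k + Suc n)) * (1 + \<delta>) ^ (k + Suc n))"
          using summable_ignore_initial_segment[OF asum, of "Suc n"]
          by (intro norm_suminf_le) (simp_all only: norm_mult norm_power zd order_refl)
        have "(\<Sum>k\<le>n. ?c k * z ^ k) = (\<Sum>k. ?c k * z ^ k) - (\<Sum>k. ?c (k + Suc n) * z ^ (k + Suc n))"
          using suminf_split_initial_segment[OF sm, of "Suc n"] by (simp add: lessThan_Suc_atMost)
        then have "cmod (\<Sum>k\<le>n. ?c k * z ^ k) \<le> cmod (\<Sum>k. ?c k * z ^ k) + cmod (\<Sum>k. ?c (k + Suc n) * z ^ (k + Suc n))"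
          by (simp only: norm_triangle_ineq4)
        also have "\<dots> \<le> N + (\<Sum>k. cmod (?c (k + Suc n)) * (1 + \<delta>) ^ (k + Suc n))"
          by (rule add_mono[OF full tail])
        also have "(\<Sum>k. cmod (?c (k + Suc n)) * (1 + \<delta>) ^ (k + Suc n)) \<le> \<eta>"
          using suminf_split_initial_segment[OF asum, of "Suc n"] n0[OF n] by linarith
        finally show ?thesis by simp
      qed
      have "norm (\<Sum>k\<le>n. (of_nat k * ?c k) *\<^sub>C T (real k * \<tau>) x) \<le> C\<^sup>2 * (N + \<eta>) / (1 - r\<^sup>2) * norm x"
      proof (rule discrete_transference[where B="\<lambda>j. T (real j * \<tau>)"])
        show "bounded_clinear (T (real j * \<tau>))" for j using \<tau> by (intro T_clinear) simp
        show "T (real j * \<tau>) (T (real i * \<tau>) y) = T (real (i + j) * \<tau>) y" for i j y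
          using T_semigroup[of "real j * \<tau>" "real i * \<tau>" y] \<tau> by (simp add: algebra_simps)
      qed (use C gm r(1,2) sup N0 \<eta> in auto)
      then show ?thesis by (simp only: lessThan_Suc_atMost)
    qed
    then show "\<exists>n0. \<forall>n\<ge>n0. norm (\<Sum>k<Suc n. ?t k) \<le> C\<^sup>2 * (N + \<eta>) / (1 - r\<^sup>2) * norm x" by blast
  qed
  then have eta: "norm (suminf ?t) \<le> C\<^sup>2 / (1 - r\<^sup>2) * norm x * (N + \<eta>)" if "\<eta> > 0" for \<eta>
    using that by (simp add: mult_ac)
  have "(\<lambda>j. C\<^sup>2 / (1 - r\<^sup>2) * norm x * (N + inverse (real (Suc j)))) \<longlonglongrightarrow> C\<^sup>2 / (1 - r\<^sup>2) * norm x * (N + 0)"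
    by (intro tendsto_intros LIMSEQ_inverse_real_of_nat)
  then have lim: "norm (suminf ?t) \<le> C\<^sup>2 / (1 - r\<^sup>2) * norm x * (N + 0)"
    by (rule LIMSEQ_le_const) (use eta in \<open>auto intro!: exI[of _ 0]\<close>)
  have "(\<lambda>k. (- (of_nat k * of_real \<tau> * ?c k)) *\<^sub>C T (real k * \<tau>) x) = (\<lambda>k. (- of_real \<tau>) *\<^sub>C ?t k)"
    by (rule ext) (simp add: scaleC_scaleC mult_ac)
  then have "(\<Sum>k. (- (of_nat k * of_real \<tau> * ?c k)) *\<^sub>C T (real k * \<tau>) x) = (- of_real \<tau>) *\<^sub>C suminf ?t"
    by (simp only: bounded_linear.suminf[OF scaleC.bounded_linear_right tsum])
  then have "norm (\<Sum>k. (- (of_nat k * of_real \<tau> * ?c k)) *\<^sub>C T (real k * \<tau>) x) = \<tau> * norm (suminf ?t)"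
    using \<tau> by (simp add: norm_scaleC)
  also have "\<dots> \<le> \<tau> * (C\<^sup>2 / (1 - r\<^sup>2) * norm x * N)"
    using lim \<tau> by (intro mult_left_mono) auto
  also have "\<dots> = \<tau> / (1 - r\<^sup>2) * (C\<^sup>2 * norm x * N)" by simp
  also have "\<dots> \<le> 4 / \<bar>\<omega>\<bar> * (C\<^sup>2 * norm x * N)"
  proof (rule mult_right_mono)
    \<comment> \<open>With \<open>\<delta> \<le> 1\<close> this leads to
      \<open>1 - r\<^sup>2 \<ge> \<delta> / 2\<close>. The factor \<tau> of the symbol then cancels
      against \<delta>, which is proportional to it:
      \<open>2 * \<tau> / \<delta> = 4 / \<bar>\<omega>\<bar>\<close>.\<close>
    have "\<delta> / 2 \<le> \<delta> / (1 + \<delta>)" using \<delta> by (intro divide_left_mono) auto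
    also have "\<dots> = 1 - r" using \<delta> by (simp add: r_def field_simps)
    also have "\<dots> \<le> 1 - r\<^sup>2" using r by (simp add: power2_eq_square mult_left_le)
    finally have "\<tau> / (1 - r\<^sup>2) \<le> \<tau> / (\<delta> / 2)" using \<tau> \<delta> by (intro divide_left_mono) auto
    also have "\<dots> = 4 / \<bar>\<omega>\<bar>" using \<tau> \<omega> by (simp add: \<delta>_def)
    finally show "\<tau> / (1 - r\<^sup>2) \<le> 4 / \<bar>\<omega>\<bar>" .
  qed (use N0 in simp)
  finally show ?thesis by (simp add: N_def mult_ac)
qed

text \<open>The bounded operator \<open>f'(A)\<close>, obtained as a strong limit of discretizations.\<close>

lemma derivative_operator:
  assumes f: "f \<in> H_infinity (right_half_plane \<omega>)" and \<omega>: "\<omega> < 0"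
  obtains S where "bounded_clinear S"
    "\<And>x. norm (S x) \<le> 4 * C\<^sup>2 / \<bar>\<omega>\<bar> * H_infinity_norm (right_half_plane \<omega>) f * norm x"
    "\<And>j::nat. \<And>y. real j > \<bar>\<omega>\<bar> \<Longrightarrow> S (reg (real j) y)
       = op (cm_integral (density_cm halfline (bromwich (\<lambda>z. deriv f z / (z + of_real (real j))\<^sup>2) (\<omega> / 4)))) y"
proof -
  define N where "N = H_infinity_norm (right_half_plane \<omega>) f"
  have N0: "N \<ge> 0" unfolding N_def by (rule H_infinity_norm_nonneg[OF f])
  \<comment> \<open>One upper bound for the \<open>n\<close>-th step serves twice: it gives
    \<open>\<tau> n * \<bar>\<omega>\<bar> \<le> 1\<close> and convergence to 0.\<close>
  have "\<forall>n::nat. \<exists>\<tau>. 0 < \<tau> \<and> \<tau> < inverse (real (Suc n)) / \<bar>\<omega>\<bar> \<and>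
    (\<forall>N w. gauss_moment (map (\<lambda>j. T (real j * \<tau>) (w j)) [0..<N]) 0 \<le> ennreal (C\<^sup>2) * gauss_moment (map w [0..<N]) 0)"
    using \<omega> by (intro allI discrete divide_pos_pos) simp_all
  from choice[OF this] obtain \<tau> where \<tau>: "\<And>n::nat. 0 < \<tau> n" "\<And>n. \<tau> n < inverse (real (Suc n)) / \<bar>\<omega>\<bar>"
    and gm: "\<And>n N w. gauss_moment (map (\<lambda>j. T (real j * \<tau> n) (w j)) [0..<N]) 0 \<le> ennreal (C\<^sup>2) * gauss_moment (map w [0..<N]) 0"
    by blast
  have small: "\<tau> n * \<bar>\<omega>\<bar> \<le> 1" for n
  proof -
    have "\<tau> n * \<bar>\<omega>\<bar> < inverse (real (Suc n))" using \<tau>(2)[of n] \<omega> by (subst (asm) pos_less_divide_eq) auto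
    also have "\<dots> \<le> 1" by (simp add: inverse_le_1_iff)
    finally show ?thesis by simp
  qed
  have \<tau>0: "\<tau> \<longlonglongrightarrow> 0"
  proof (rule Lim_null_comparison)
    show "\<forall>\<^sub>F n in sequentially. norm (\<tau> n) \<le> inverse (real (Suc n)) / \<bar>\<omega>\<bar>"
      using \<tau> by (intro always_eventually allI) (simp add: less_imp_le abs_of_pos)
    have "(\<lambda>n. inverse (real (Suc n)) / \<bar>\<omega>\<bar>) \<longlonglongrightarrow> 0 / \<bar>\<omega>\<bar>"
      by (rule tendsto_divide[OF LIMSEQ_inverse_real_of_nat tendsto_const]) (use \<omega> in simp)
    then show "(\<lambda>n. inverse (real (Suc n)) / \<bar>\<omega>\<bar>) \<longlonglongrightarrow> 0" by simp
  qed
  have dl: "discretized f \<omega> (\<tau> n)" "discretized_small f \<omega> (\<tau> n)" for n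
    using f \<omega> \<tau>(1) small by unfold_locales auto
  define b where "b n k = - (of_nat k * of_real (\<tau> n) * coef f (\<tau> n) k)" for n k
  have bsum: "summable (\<lambda>k. cmod (b n k))" for n
  proof -
    have "(\<lambda>k. cmod (b n k)) = (\<lambda>k. \<tau> n * cmod (of_nat k * coef f (\<tau> n) k))"
      using \<tau>(1)[of n] by (intro ext) (simp add: b_def norm_mult)
    then show ?thesis using summable_mult[OF discretized.diffs_abs_summable[OF dl(1)]] by simp
  qed
  define L where "L n \<phi> = (\<Sum>k. b n k *\<^sub>C (\<phi> (real k * \<tau> n) :: 'a))" for n \<phi>
  have Lmult: "multiplier (L n) (dsym f (\<tau> n))" for n
    unfolding L_def[abs_def] b_def using \<tau>(1)[of n] bsum[unfolded b_def]
    by (intro multiplier_series discretized.sym_sums[OF dl(1)]) auto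
  then have Lbc: "bc_functional (L n)" for n by (simp add: multiplier_def)
  have Sb: "norm (op (L n) x) \<le> 4 * C\<^sup>2 / \<bar>\<omega>\<bar> * N * norm x" for n x
    unfolding op_def L_def b_def N_def by (rule discretized_bound[OF f \<omega> \<tau>(1) small gm])
  have Ssc: "op (L n) (c *\<^sub>C x) = c *\<^sub>C op (L n) x" for n c x
  proof -
    have s: "summable (\<lambda>k. b n k *\<^sub>C T (real k * \<tau> n) x)"
    proof (rule summable_comparison_test'[OF summable_mult2[OF bsum[of n], of "C * norm x"], of 0])
      show "norm (b n k *\<^sub>C T (real k * \<tau> n) x) \<le> cmod (b n k) * (C * norm x)" for k
        unfolding norm_scaleC using \<tau>(1)[of n] by (intro mult_left_mono bound) auto
    qed
    have "(\<lambda>k. b n k *\<^sub>C T (real k * \<tau> n) (c *\<^sub>C x)) = (\<lambda>k. c *\<^sub>C (b n k *\<^sub>C T (real k * \<tau> n) x))"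
      using T_clinear[of "real _ * \<tau> n"] \<tau>(1)[of n]
      by (intro ext) (simp add: bounded_clinear_def scaleC_scaleC mult.commute)
    then show ?thesis
      by (simp only: op_def L_def bounded_linear.suminf[OF scaleC.bounded_linear_right s])
  qed
  have Scl: "bounded_clinear (op (L n))" for n
    unfolding bounded_clinear_def
  proof (intro conjI allI Ssc)
    show "bounded_linear (op (L n))"
      by (rule bounded_linear_intro[where K="4 * C\<^sup>2 / \<bar>\<omega>\<bar> * N"])
         (use op_add[OF Lbc] Ssc Sb in \<open>auto simp: scaleR_scaleC mult.commute\<close>)
  qed
  define M where "M = 16 * N / \<bar>\<omega>\<bar>"
  let ?Q = "\<lambda>j z. deriv f z / (z + of_real (real j))\<^sup>2"
  let ?Qn = "\<lambda>j n z. dsym f (\<tau> n) z / (z + of_real (real j))\<^sup>2"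
  have lim: "(\<lambda>n. op (L n) (reg (real j) y)) \<longlonglongrightarrow> op (cm_integral (density_cm halfline (bromwich (?Q j) (\<omega> / 4)))) y"
    if j: "real j > \<bar>\<omega>\<bar>" for j :: nat and y
  proof -
    have Qn: "decaying_symbol (?Qn j n) (\<omega> / 2) (\<omega> / 4) (real j) M" for n
      unfolding M_def N_def by (rule discretized_small.sym_decaying[OF dl(2) j])
    have Q: "decaying_symbol (?Q j) (\<omega> / 2) (\<omega> / 4) (real j) M"
      unfolding M_def N_def by (rule deriv_decaying[OF f \<omega> j])
    interpret Q: decaying_symbol "?Q j" "\<omega> / 2" "\<omega> / 4" "real j" M by (rule Q)
    have j0: "real j > 0" using j by linarith
    \<comment> \<open>The left side is a composition of two operators, the right side a single one.
      Composing the latter with evaluation at 0, whose symbol is 1 and whose operator is the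
      identity, brings both sides into the same form.\<close>
    have eq: "op (L n) (reg (real j) y) = op (cm_integral (density_cm halfline (bromwich (?Qn j n) (\<omega> / 4)))) y" for n
    proof -
      have ev: "multiplier (\<lambda>\<phi>. \<phi> 0 :: 'a) (\<lambda>z. 1)"
        by (simp add: multiplier_def bc_functional_eval scaleC_one)
      have "op (L n) (reg (real j) y) = op (\<lambda>\<phi>. \<phi> 0) (op (cm_integral (density_cm halfline (bromwich (?Qn j n) (\<omega> / 4)))) y)"
        unfolding reg_def
        by (rule op_eq_compose[OF Lmult kernel_integrable[OF j0] kernel_multiplier[OF j0] ev
              decaying_symbol.bromwich_integrable[OF Qn] decaying_symbol.bromwich_multiplier[OF Qn]]) simp
      then show ?thesis using T by (simp add: op_def C0_semigroup_def)
    qed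
    define J where "J = (\<integral>s. Q.majorant s \<partial>lborel)"
    have "(\<lambda>n. cm_integral (density_cm halfline (bromwich (?Qn j n) (\<omega> / 4))) (\<lambda>t. T t y))
        \<longlonglongrightarrow> cm_integral (density_cm halfline (bromwich (?Q j) (\<omega> / 4))) (\<lambda>t. T t y)"
    proof (rule cm_integral_density_tendsto[OF decaying_symbol.bromwich_integrable[OF Qn] Q.bromwich_integrable])
      have "has_bochner_integral halfline (\<lambda>t. exp (\<omega> / 4 * t)) (1 / (- \<omega> / 4))"
        using halfline_power_exp(1)[of "- \<omega> / 4"] \<omega> by simp
      then have "integrable halfline (\<lambda>t. exp (\<omega> / 4 * t))" by (simp only: has_bochner_integral_iff)
      then show "integrable halfline (\<lambda>t. J * exp (\<omega> / 4 * t))" by (rule integrable_mult_right)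
      show "cmod (bromwich (?Qn j n) (\<omega> / 4) t) \<le> J * exp (\<omega> / 4 * t)" for n t
        using decaying_symbol.bromwich_bound[OF Qn]
        unfolding J_def Q.majorant_def[abs_def] decaying_symbol.majorant_def[OF Qn, abs_def] by simp
      show "cmod (bromwich (?Q j) (\<omega> / 4) t) \<le> J * exp (\<omega> / 4 * t)" for t
        unfolding J_def by (rule Q.bromwich_bound)
      show "(\<lambda>n. bromwich (?Qn j n) (\<omega> / 4) t) \<longlonglongrightarrow> bromwich (?Q j) (\<omega> / 4) t" for t
      proof (rule bromwich_tendsto[OF Qn Q])
        fix s
        have "\<omega> / 4 + real j \<noteq> 0" using j \<omega> by linarith
        then have "Complex (\<omega> / 4) s + of_real (real j) \<noteq> 0" by (simp add: complex_eq_iff)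
        then have ne: "(Complex (\<omega> / 4) s + of_real (real j))\<^sup>2 \<noteq> 0" by simp
        show "(\<lambda>n. ?Qn j n (Complex (\<omega> / 4) s)) \<longlonglongrightarrow> ?Q j (Complex (\<omega> / 4) s)"
          by (rule tendsto_divide[OF sym_tendsto[OF f _ \<tau>(1) \<tau>0] tendsto_const ne]) (use \<omega> in simp)
      qed
    qed (rule orbit_mem)
    then show ?thesis unfolding eq by (simp only: op_def)
  qed
  obtain j0 :: nat where j0: "\<bar>\<omega>\<bar> < real j0" using reals_Archimedean2 by blast
  have conv: "convergent (\<lambda>n. op (L n) (reg (real j) y))" if "j \<ge> j0" for j y
  proof -
    have "\<bar>\<omega>\<bar> < real j" using j0 that by (meson of_nat_le_iff order_less_le_trans)
    from lim[OF this] show ?thesis unfolding convergent_def by blast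
  qed
  have "0 \<le> 4 * C\<^sup>2 / \<bar>\<omega>\<bar> * N" using N0 by simp
  then obtain S where S: "bounded_clinear S" "\<And>x. norm (S x) \<le> 4 * C\<^sup>2 / \<bar>\<omega>\<bar> * N * norm x"
    "\<And>x. (\<lambda>n. op (L n) x) \<longlonglongrightarrow> S x"
    using strong_limit_exists[OF Scl _ Sb conv] by blast
  show ?thesis
  proof (rule that[OF S(1) S(2)[unfolded N_def]])
    fix j :: nat and y assume "\<bar>\<omega>\<bar> < real j"
    from lim[OF this] S(3) show "S (reg (real j) y) = op (cm_integral (density_cm halfline (bromwich (?Q j) (\<omega> / 4)))) y"
      using LIMSEQ_unique by blast
  qed
qed

text \<open>For any regularizer \<open>e\<close> the operator of \<open>e f'\<close> and the
  composition of \<open>e(A)\<close> with \<open>S\<close> agree on the approximating vectors in the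
  ranges of the \<open>reg j\<close>, hence everywhere; injectivity of \<open>e(A)\<close> then
  leaves \<open>S\<close> as the only choice. The opposite inclusion needs one regularizer, for
  which \<open>(z + j)\<^sup>-\<^sup>2\<close> is taken.\<close>

theorem fun_calc_derivative:
  assumes gen: "minus_generates A T" and f: "f \<in> H_infinity (right_half_plane \<omega>)" and \<omega>: "\<omega> < 0"
  shows "\<exists>S. bounded_clinear S \<and> fun_calc A (deriv f) = graph_of S
    \<and> onorm S \<le> 4 * C\<^sup>2 / \<bar>\<omega>\<bar> * H_infinity_norm (right_half_plane \<omega>) f"
proof -
  obtain S where S: "bounded_clinear S"
    "\<And>x. norm (S x) \<le> 4 * C\<^sup>2 / \<bar>\<omega>\<bar> * H_infinity_norm (right_half_plane \<omega>) f * norm x"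
    "\<And>j::nat. \<And>y. real j > \<bar>\<omega>\<bar> \<Longrightarrow> S (reg (real j) y)
       = op (cm_integral (density_cm halfline (bromwich (\<lambda>z. deriv f z / (z + of_real (real j))\<^sup>2) (\<omega> / 4)))) y"
    using derivative_operator[OF f \<omega>] by blast
  \<comment> \<open>Both existentials in \<open>hille_phillips\<close>, over the semigroup and over
    the representation of \<mu>, collapse, and the relation becomes the graph of an
    operator.\<close>
  have hp: "(x, y) \<in> hille_phillips A \<mu> \<longleftrightarrow> y = op (cm_integral \<mu>) x" if r: "represents \<nu> h \<mu>" for \<nu> h \<mu> x y
  proof -
    have "has_cm_integral \<mu> (\<lambda>t. T' t x) y \<longleftrightarrow> has_cm_integral \<mu> (\<lambda>t. T t x) y" if "minus_generates A T'" for T'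
      by (rule has_cm_integral_cong) (rule minus_generates_unique[OF gen that C bound])
    then have "(x, y) \<in> hille_phillips A \<mu> \<longleftrightarrow> has_cm_integral \<mu> (\<lambda>t. T t x) y"
      unfolding hille_phillips_def using gen by blast
    then show ?thesis using has_cm_integral_iff[OF r orbit_mem] by (simp add: op_def)
  qed
  have reg_eq: "op (cm_integral \<nu>) x = op (cm_integral \<mu>) (S x)"
    if \<mu>: "is_laplace_transform \<mu> e" and \<nu>: "is_laplace_transform \<nu> (\<lambda>z. e z * deriv f z)" for \<mu> \<nu> e x
  proof -
    obtain M: "multiplier (cm_integral \<mu> :: (real \<Rightarrow> 'a) \<Rightarrow> 'a) e" using multiplier_laplace[OF \<mu>] by blast
    obtain N: "multiplier (cm_integral \<nu> :: (real \<Rightarrow> 'a) \<Rightarrow> 'a) (\<lambda>z. e z * deriv f z)" using multiplier_laplace[OF \<nu>] by blast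
    have bc: "bc_functional (cm_integral \<mu> :: (real \<Rightarrow> 'a) \<Rightarrow> 'a)" "bc_functional (cm_integral \<nu> :: (real \<Rightarrow> 'a) \<Rightarrow> 'a)"
      using M N by (simp_all add: multiplier_def)
    let ?x = "\<lambda>j. reg (real j) ((real j)\<^sup>2 *\<^sub>R x)"
    have eq: "op (cm_integral \<nu>) (?x j) = op (cm_integral \<mu>) (S (?x j))" if j: "real j > \<bar>\<omega>\<bar>" for j
    proof -
      interpret Q: decaying_symbol "\<lambda>z. deriv f z / (z + of_real (real j))\<^sup>2" "\<omega> / 2" "\<omega> / 4" "real j"
        "16 * H_infinity_norm (right_half_plane \<omega>) f / \<bar>\<omega>\<bar>"
        by (rule deriv_decaying[OF f \<omega> j])
      have j0: "real j > 0" using j by linarith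
      show ?thesis
        unfolding S(3)[OF j] unfolding reg_def
        by (rule op_eq_compose[OF N kernel_integrable[OF j0] kernel_multiplier[OF j0] M Q.bromwich_integrable Q.bromwich_multiplier]) simp
    qed
    obtain j0 :: nat where j0: "\<bar>\<omega>\<bar> < real j0" using reals_Archimedean2 by blast
    have "eventually (\<lambda>j. op (cm_integral \<mu>) (S (?x j)) = op (cm_integral \<nu>) (?x j)) sequentially"
      using j0 eq by (intro eventually_mono[OF eventually_ge_at_top[of j0]]) auto
    moreover have "(\<lambda>j. op (cm_integral \<mu>) (S (?x j))) \<longlonglongrightarrow> op (cm_integral \<mu>) (S x)"
      using S(1) by (intro op_tendsto bc bounded_linear.tendsto[OF _ reg_tendsto]) (simp add: bounded_clinear_def)
    ultimately have "(\<lambda>j. op (cm_integral \<nu>) (?x j)) \<longlonglongrightarrow> op (cm_integral \<mu>) (S x)"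
      by (rule Lim_transform_eventually[rotated])
    moreover have "(\<lambda>j. op (cm_integral \<nu>) (?x j)) \<longlonglongrightarrow> op (cm_integral \<nu>) x"
      by (intro op_tendsto bc reg_tendsto)
    ultimately show ?thesis using LIMSEQ_unique by blast
  qed
  have "fun_calc A (deriv f) = graph_of S"
  proof (intro equalityI subsetI)
    fix p assume "p \<in> fun_calc A (deriv f)"
    then obtain \<mu> \<nu> e where e: "is_laplace_transform \<mu> e" "is_laplace_transform \<nu> (\<lambda>z. e z * deriv f z)"
      "single_valued ((hille_phillips A \<mu>)\<inverse>)" "p \<in> hille_phillips A \<nu> O (hille_phillips A \<mu>)\<inverse>"
      unfolding fun_calc_def by blast
    then obtain x y z where p: "p = (x, y)" "(x, z) \<in> hille_phillips A \<nu>" "(y, z) \<in> hille_phillips A \<mu>" by blast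
    obtain \<nu>1 h1 where r1: "represents \<nu>1 h1 \<mu>" using multiplier_laplace[OF e(1)] by blast
    obtain \<nu>2 h2 where r2: "represents \<nu>2 h2 \<nu>" using multiplier_laplace[OF e(2)] by blast
    have "z = op (cm_integral \<mu>) (S x)" using p(2) reg_eq[OF e(1,2)] by (simp add: hp[OF r2])
    then have "(S x, z) \<in> hille_phillips A \<mu>" by (simp add: hp[OF r1])
    with p(3) e(3) have "y = S x" unfolding single_valued_def by blast
    then show "p \<in> graph_of S" by (simp add: p(1) graph_of_def)
  next
    fix p assume "p \<in> graph_of S"
    then obtain x where p: "p = (x, S x)" by (auto simp: graph_of_def)
    obtain w where w: "\<And>\<mu>. Re \<mu> > w \<Longrightarrow> (shifted \<mu> A)\<inverse> = {(x, y). has_bochner halfline (\<lambda>t. exp (- \<mu> * complex_of_real t) *\<^sub>C T t x) y}"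
      using gen unfolding minus_generates_def by blast
    \<comment> \<open>The bound \<open>\<bar>\<omega>\<bar>\<close> puts the double pole at
      \<open>- j\<close> to the left of the domain; \<open>w\<close> is the threshold beyond which
      the Laplace integral inverts \<open>j + A\<close>.\<close>
    obtain j :: nat where "max \<bar>\<omega>\<bar> w < real j" using reals_Archimedean2 by blast
    then have j: "\<bar>\<omega>\<bar> < real j" "w < real j" "0 < real j" by auto
    interpret E: decaying_symbol "\<lambda>z. 1 / (z + of_real (real j))\<^sup>2" "\<omega> / 2" "\<omega> / 4" "real j" 1
      by (rule const_decaying) (use \<omega> j in auto)
    interpret Q: decaying_symbol "\<lambda>z. deriv f z / (z + of_real (real j))\<^sup>2" "\<omega> / 2" "\<omega> / 4" "real j"
      "16 * H_infinity_norm (right_half_plane \<omega>) f / \<bar>\<omega>\<bar>"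
      by (rule deriv_decaying[OF f \<omega> j(1)])
    define \<mu> where "\<mu> = density_cm halfline (bromwich (\<lambda>z. 1 / (z + of_real (real j))\<^sup>2) (\<omega> / 4))"
    define \<nu> where "\<nu> = density_cm halfline (bromwich (\<lambda>z. deriv f z / (z + of_real (real j))\<^sup>2) (\<omega> / 4))"
    have e: "is_laplace_transform \<mu> (\<lambda>z. 1 / (z + of_real (real j))\<^sup>2)"
      "is_laplace_transform \<nu> (\<lambda>z. 1 / (z + of_real (real j))\<^sup>2 * deriv f z)"
      using E.laplace_transform_bromwich Q.laplace_transform_bromwich by (simp_all add: \<mu>_def \<nu>_def)
    obtain \<nu>1 h1 where r1: "represents \<nu>1 h1 \<mu>" using multiplier_laplace[OF e(1)] by blast
    obtain \<nu>2 h2 where r2: "represents \<nu>2 h2 \<nu>" using multiplier_laplace[OF e(2)] by blast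
    have \<mu>reg: "op (cm_integral \<mu>) y = reg (real j) y" for y
      unfolding op_def reg_def \<mu>_def
      by (rule multiplier_unique[OF E.bromwich_multiplier kernel_multiplier[OF j(3)] refl orbit_mem])
    let ?r = "\<lambda>t. exp (- complex_of_real (real j) * complex_of_real t)"
    have ri: "integrable halfline ?r" using j(3) by (intro halfline_exp(1)) simp
    let ?R = "op (cm_integral (density_cm halfline ?r))"
    have Rm: "multiplier (cm_integral (density_cm halfline ?r) :: (real \<Rightarrow> 'a) \<Rightarrow> 'a) (\<lambda>z. 1 / (z + of_real (real j)))"
    proof (rule multiplier_density[OF sets_halfline ri])
      fix n :: nat
      have "?r t * complex_of_real (exp (- t) ^ n) = exp (- complex_of_real (real j + real n) * complex_of_real t)" for t
      proof -
        have "?r t = complex_of_real (exp (- real j * t))" by (simp add: exp_of_real[symmetric])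
        moreover have "exp (- complex_of_real (real j + real n) * complex_of_real t) = complex_of_real (exp (- (real j + real n) * t))"
          by (simp add: exp_of_real[symmetric])
        ultimately show ?thesis by (simp only: exp_power[symmetric] of_real_mult)
      qed
      then show "(\<integral>t. ?r t * complex_of_real (exp (- t) ^ n) \<partial>halfline) = 1 / (of_nat n + of_real (real j))"
        using halfline_exp(2)[of "complex_of_real (real j + real n)"] j(3) by (simp add: add.commute)
    qed
    \<comment> \<open>\<open>?R\<close> is the inverse of \<open>j + A\<close>. If it maps
      \<open>y\<close> to 0, then \<open>(0, y)\<close> lies in the graph of \<open>A\<close>, and
      \<open>A\<close> is single-valued. The square of \<open>?R\<close> is \<open>reg j\<close>,
      which is thereby injective as well.\<close>
    have R_inj: "y = 0" if "?R y = 0" for y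
    proof -
      have "has_bochner halfline (\<lambda>t. ?r t *\<^sub>C T t y) (?R y)"
        unfolding op_def by (rule has_bochner_cm_integral(1)[OF sets_halfline ri orbit_mem])
      then have "(y, 0) \<in> (shifted (complex_of_real (real j)) A)\<inverse>"
        using w[of "complex_of_real (real j)"] j(2) that by simp
      then obtain v where v: "(0, v) \<in> A" "y = complex_of_real (real j) *\<^sub>C 0 + v"
        unfolding shifted_def by auto
      have "single_valued A" "(0, 0) \<in> A" using gen by (auto simp: minus_generates_def clinear_operator_def)
      with v(1) have "v = 0" unfolding single_valued_def by blast
      with v(2) show ?thesis by (simp add: scaleC.zero_right)
    qed
    have reg_inj: "y = 0" if "reg (real j) y = 0" for y
    proof -
      have ev: "multiplier (\<lambda>\<phi>. \<phi> 0 :: 'a) (\<lambda>z. 1)"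
        by (simp add: multiplier_def bc_functional_eval scaleC_one)
      have "?R (?R y) = op (\<lambda>\<phi>. \<phi> 0) (reg (real j) y)"
        unfolding reg_def
        by (rule op_eq_compose[OF Rm ri Rm ev kernel_integrable[OF j(3)] kernel_multiplier[OF j(3)]])
           (simp add: power2_eq_square)
      also have "\<dots> = 0" using T that by (simp add: op_def C0_semigroup_def)
      finally show ?thesis by (rule R_inj[OF R_inj])
    qed
    have "single_valued ((hille_phillips A \<mu>)\<inverse>)"
    proof (rule single_valuedI)
      fix z y y' assume "(z, y) \<in> (hille_phillips A \<mu>)\<inverse>" "(z, y') \<in> (hille_phillips A \<mu>)\<inverse>"
      then have "reg (real j) y = reg (real j) y'" by (simp add: hp[OF r1] \<mu>reg)
      moreover have "reg (real j) y = reg (real j) (y - y') + reg (real j) y'"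
        using op_add[OF bc_functional_cm_integral[OF sets_halfline kernel_integrable[OF j(3)]], of "y - y'" y']
        by (simp add: reg_def)
      ultimately have "reg (real j) (y - y') = 0" by simp
      from reg_inj[OF this] show "y = y'" by simp
    qed
    moreover have "p \<in> hille_phillips A \<nu> O (hille_phillips A \<mu>)\<inverse>"
      unfolding p
    proof (rule relcompI)
      show "(x, op (cm_integral \<nu>) x) \<in> hille_phillips A \<nu>" by (simp add: hp[OF r2])
      show "(op (cm_integral \<nu>) x, S x) \<in> (hille_phillips A \<mu>)\<inverse>" by (simp add: hp[OF r1] reg_eq[OF e])
    qed
    ultimately show "p \<in> fun_calc A (deriv f)" unfolding fun_calc_def using e by blast
  qed
  moreover have "onorm S \<le> 4 * C\<^sup>2 / \<bar>\<omega>\<bar> * H_infinity_norm (right_half_plane \<omega>) f"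
    by (rule onorm_bound) (use S(2) H_infinity_norm_nonneg[OF f] in auto)
  ultimately show ?thesis using S(1) by blast
qed

end

theorem theorem6p4:
  fixes A :: "('a::cbanach \<times> 'a) set"
    and T :: "real \<Rightarrow> 'a \<Rightarrow> 'a"
  assumes "minus_generates A T"
    and "gamma_bounded_semigroup T"
  shows "\<forall>m::nat. 1 \<le> m \<longrightarrow> strong_bounded_calculus m A"
proof (intro allI impI)
  fix m :: nat assume m: "1 \<le> m"
  have T: "C0_semigroup T" using assms(1) by (simp add: minus_generates_def)
  obtain C where C: "C \<ge> 0" "\<And>t x. t \<ge> 0 \<Longrightarrow> norm (T t x) \<le> C * norm x"
    "\<And>e. e > 0 \<Longrightarrow> \<exists>\<tau>. 0 < \<tau> \<and> \<tau> < e \<and> (\<forall>N w. gauss_moment (map (\<lambda>j. T (real j * \<tau>) (w j)) [0..<N]) 0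
        \<le> ennreal (C\<^sup>2) * gauss_moment (map w [0..<N]) 0)"
    using gamma_bounded_semigroup_discrete[OF T assms(2)] by blast
  interpret discrete_gamma_semigroup T C
    using T C by unfold_locales
  \<comment> \<open>The derivative bound is applied on the half-plane of abscissa
    \<open>\<omega> / 2\<close>, which doubles 4 to 8; the other \<open>m - 1\<close> derivatives
    are taken by Cauchy's estimate and contribute \<open>fact (m - 1) * 2 ^ (m - 1)\<close>.\<close>
  define D where "D = 8 * C\<^sup>2 * (fact (m - 1) * 2 ^ (m - 1))"
  show "strong_bounded_calculus m A"
    unfolding strong_bounded_calculus_def
  proof (intro exI[of _ D] conjI allI impI ballI)
    show "0 \<le> D" by (simp add: D_def)
    fix \<omega> :: real and f assume \<omega>: "\<omega> < 0" and f: "f \<in> H_infinity (right_half_plane \<omega>)"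
    define g where "g = (deriv ^^ (m - 1)) f"
    have g: "g \<in> H_infinity (right_half_plane (\<omega> / 2))"
      "H_infinity_norm (right_half_plane (\<omega> / 2)) g \<le> fact (m - 1) * 2 ^ (m - 1) * H_infinity_norm (right_half_plane \<omega>) f / \<bar>\<omega>\<bar> ^ (m - 1)"
      unfolding g_def by (rule H_infinity_deriv[OF f \<omega>])+
    have dm: "deriv g = (deriv ^^ m) f" using m by (cases m) (simp_all add: g_def)
    obtain S where S: "bounded_clinear S" "fun_calc A (deriv g) = graph_of S"
      "onorm S \<le> 4 * C\<^sup>2 / \<bar>\<omega> / 2\<bar> * H_infinity_norm (right_half_plane (\<omega> / 2)) g"
      using fun_calc_derivative[OF assms(1) g(1)] \<omega> by auto
    have "onorm S \<le> 4 * C\<^sup>2 / \<bar>\<omega> / 2\<bar> * (fact (m - 1) * 2 ^ (m - 1) * H_infinity_norm (right_half_plane \<omega>) f / \<bar>\<omega>\<bar> ^ (m - 1))"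
      by (rule order_trans[OF S(3)]) (intro mult_left_mono g(2), simp)
    also have "\<dots> = D / \<bar>\<omega>\<bar> ^ m * H_infinity_norm (right_half_plane \<omega>) f"
    proof -
      have "\<bar>\<omega>\<bar> ^ m = \<bar>\<omega>\<bar> * \<bar>\<omega>\<bar> ^ (m - 1)" using m by (cases m) simp_all
      then show ?thesis by (simp add: D_def)
    qed
    finally show "\<exists>S. bounded_clinear S \<and> fun_calc A ((deriv ^^ m) f) = graph_of S
          \<and> onorm S \<le> D / \<bar>\<omega>\<bar> ^ m * H_infinity_norm (right_half_plane \<omega>) f"
      using S(1,2) dm by auto
  qed
qed

end
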